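(* Let $\xi_{(1)},\dots,\xi_{(\nu)}:[0,T]\times D([0,T],U)\to\mathbb R^d$ be admissible functional integrands. For $X\in C([0,T],U)$ with continuous quadratic variation $[X]$, define $Y=(Y_1,\dots,Y_\nu)\in C([0,T],\mathbb R^\nu)$ through $$Y_\ell(t):=\int_0^t\xi_{(\ell)}(s,X)\,dX(s),\qquad \ell=1,\dots,\nu.$$ Then there exist $q\in\mathbb N$, an open set $\widetilde S\subset\mathbb R^q$, $\widetilde A\in\mathrm{CBV}([0,T],\widetilde S)$, and $\widetilde F_1,\dots,\widetilde F_\nu\in\mathbb C^{1,2}_c(U,\widetilde S)$ such that the following assertions hold. (a) For all $t\in[0,T]$, $$Y(t)=\widetilde F(t,X,\widetilde A):=\big(\widetilde F_1(t,X,\widetilde A),\dots,\widetilde F_\nu(t,X,\widetilde A)\big).$$ (b) If $\eta:[0,T]\times D([0,T],\mathbb R^\nu)\to\mathbb R^\nu$ is an admissible functional integrand, then $\zeta:[0,T]\times D([0,T],U)\to\mathbb R^d$, defined through $$\zeta(t,\widetilde X):=\sum_{\ell=1}^\nu\eta_\ell\big(t,\widetilde F(\cdot,\widetilde X,\widetilde A)\big)\,\xi_{(\ell)}(t,\widetilde X),\qquad \widetilde X\in D([0,T],U),$$ is well defined and an admissible functional integrand. (c) If $Y$ admits the continuous quadratic variation $$[Y_k,Y_\ell](t)=\sum_{i,j=1}^d\int_0^t\xi_{(k),i}(s,X)\,\xi_{(\ell),j}(s,X)\,d[X_i,X_j](s),\qquad k,\ell=1,\dots,\nu,\ t\in[0,T],$$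 and $\eta$ and $\zeta$ are as in (b), then the following associativity formula holds: $$\int_0^T\eta(s,Y)\,dY(s)=\int_0^T\zeta(t,X)\,dX(t)=\int_0^T\sum_{\ell=1}^\nu\eta_\ell(s,Y)\,\xi_{(\ell)}(s,X)\,dX(s),$$ where the last integral is the It\^o integral of the functional integrand $\zeta$, written using $\widetilde F(\cdot,X,\widetilde A)=Y$.
   Context: Fix $T>0$ and an open set $U\subset\mathbb R^d$. For an open set $S\subset\mathbb R^m$, $\mathrm{CBV}([0,T],S)$ is the set of continuous $S$-valued functions on $[0,T]$ whose components are of bounded variation. $D([0,T],U)$ is the space of c\`adl\`ag functions $X:[0,T]\to U$ whose left limits $X(t-)$ also lie in $U$, with the norm $\|X\|_\infty=\sup_{u\in[0,T]}|X(u)|$. For a path $X$, $X^t:=(X(t\wedge s))_{s\in[0,T]}$ is the path stopped at $t$, and $X^{t-}:=\lim_{r\uparrow t}X^r$ for $t>0$ (equal to $X(u)$ for $u<t$ and to $X(t-)$ for $u\ge t$). A functional $F:[0,T]\times D([0,T],U)\times \mathrm{CBV}([0,T],S)\to\mathbb R$ is non-anticipative if $F(t,X,A)=F(t,X^t,A^t)$ for all $(t,X,A)$. A non-anticipative $F$ is called: - boundedness-preserving if for every $A\in\mathrm{CBV}([0,T],S)$ and compact $K\subset U$ there is a constant $C$ with $|F(t,X,A)|\le C$ for all $t\in[0,T]$, $X\in D([0,T],K)$; - continuous at fixed times if for all $\varepsilon>0$, $t\in[0,T]$, $X\in D([0,T],U)$, $A\in\mathrm{CBV}([0,T],S)$ there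 is $\eta>0$ such that $|F(t,X,A)-F(t,Y,A)|<\varepsilon$ for all $Y\in D([0,T],U)$ with $\|X^t-Y^t\|_\infty<\eta$; - left-continuous if for all $t\in(0,T]$, $\varepsilon>0$, $X\in D([0,T],U)$, $A\in \mathrm{CBV}([0,T],S)$ there is $\eta>0$ such that $|F(t,X,A)-F(t-h,Y,A)|<\varepsilon$ for all $h\in[0,\eta)$ and $Y\in D([0,T],U)$ with $\|X^t-Y^{t-h}\|_\infty<\eta$; - continuous in $X$ locally uniformly in $t$ if for all $\varepsilon>0$ and $(t,X,A)$ there is $\eta>0$ such that $|F(u,X,A)-F(u,Y,A)|<\varepsilon$ for all $(u,Y)\in[0,T]\times D([0,T],U)$ with $\|X-Y\|_\infty<\eta$ and $|t-u|<\eta$. For vector-valued functionals these notions are understood componentwise. Horizontal derivative: $F$ is horizontally differentiable if there are non-anticipative, boundedness-preserving functionals $\mathscr D_0F,\dots,\mathscr D_mF$ on $[0,T]\times D([0,T],U)\times\mathrm{CBV}([0,T],S)$ such that for all $0\le s<t\le T$ and all $(X,A)$ the functions $[s,t]\ni r\mapsto\mathscr D_iF(r,X^s,A)$ are Borel measurable and $F(t,X^s,A)-F(s,X^s,A)=\sum_{i=0}^m\int_s^t\mathscr D_iF(r,X^s,A)\,A_i(dr)$, where $A_0(r):=r$. Then $\mathscr DF=(\mathscr D_0F,\dots,\mathscr D_mF)$ is the horizontal derivative. Vertical derivative: $F$ is vertically differentiable at $(t,X,A)$ if $v\mapsto F(t,X+v\mathbf 1_{[t,T]},A)$ ($v\in\mathbb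 R^d$ near $0$) is differentiable at $0$; its gradient at $v=0$ is $\nabla_XF(t,X,A)=(\partial_iF(t,X,A))_{i=1,\dots,d}$. Iterating, $\partial_{ij}F:=\partial_i(\partial_jF)$ and $\nabla_X^2F=(\partial_{ij}F)_{i,j}$. $\mathbb C^{1,2}_b(U,S)$ is the set of non-anticipative functionals $F$ such that: (i) $F$ is left-continuous, horizontally differentiable and twice vertically differentiable; (ii) $\mathscr DF$ is continuous at fixed times; (iii) $\nabla_XF$ and $\nabla_X^2F$ are left-continuous and boundedness-preserving. $\mathbb C^{1,2}_c(U,S)$ is the set of all $F\in\mathbb C^{1,2}_b(U,S)$ that are continuous in $X$ locally uniformly in $t$ and boundedness-preserving. Partitions and quadratic variation: $(\mathbb T_n)_{n\in\mathbb N}$ is a fixed refining sequence of partitions of $[0,T]$: each $\mathbb T_n$ is a finite subset of $[0,T]$ containing $0$ and $T$, $\mathbb T_1\subset\mathbb T_2\subset\cdots$, and the mesh tends to $0$. For $t\in\mathbb T_n$, $t'$ is the successor of $t$ in $\mathbb T_n$ if $t<T$, and $t'=T$ if $t=T$. A real-valued continuous path $X$ admits the continuous quadratic variation $[X]$ (along $(\mathbb T_n)$) if for all $t\in(0,T]$ the sums $\sum_{s\in\mathbb T_n,\,s\le t}(X(s')-X(s))^2$ converge to a finite limit $[X](t)$ and $t\mapsto[X](t)$ is continuous with $[X](0):=0$. A path $X\in C([0,T],\mathbb R^d)$, $d>1$, admits the continuous quadratic variation if all $X_i+X_j$, $i,j=1,\dots,d$, do; then $[X_i,X_j]:=\frac12([X_i+X_j]-[X_i]-[X_j])$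 and $[X]:=([X_i,X_j])_{i,j}$. Admissible integrands and It\^o integral: $\xi:[0,T]\times D([0,T],U)\to\mathbb R^d$ is an admissible functional integrand if there are $m\in\mathbb N$, an open set $S\subset\mathbb R^m$, $A\in\mathrm{CBV}([0,T],S)$ and $F\in\mathbb C^{1,2}_c(U,S)$ such that $\xi(t,\widetilde X)=\nabla_XF(t,\widetilde X,A)$ for all $(t,\widetilde X)\in[0,T]\times D([0,T],U)$ (and likewise with $\mathbb R^\nu$ in place of $U$). If $X\in C([0,T],U)$ has continuous quadratic variation, the pathwise It\^o integral is $$\int_0^t\xi(s,X)\,dX(s):=\lim_{n\uparrow\infty}\sum_{s\in\mathbb T_n,\,s\le t}\xi(s,X^{n,s-})\cdot(X(s')-X(s)),$$ where $X^n(t):=\sum_{s\in\mathbb T_n}X(s')\mathbf 1_{[s,s')}(t)+X(T)\mathbf 1_{\{T\}}(t)$, $X^{n,s-}:=\lim_{r\uparrow s}X^{n,r}$ with $X^{n,r}$ the path $X^n$ stopped at $r$, and $X^{n,0-}$ is the constant path $X(0)$. This limit exists and is continuous in $t$. $\xi_{(k),i}$ denotes the $i$-th component of $\xi_{(k)}$. *)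

theory Defs
  imports "HOL-Analysis.Analysis"
begin

text \<open>
  A path on \<open>[0,T]\<close> is a function on all of \<open>real\<close> of which only the restriction to
  \<open>{0..T}\<close> is relevant. Vectors in \<open>R^m\<close>, for a dimension \<open>m\<close> that is quantified inside the
  statement, are the points of \<open>topspace (Euclidean_space m)\<close>: functions \<open>nat \<Rightarrow> real\<close>
  vanishing at all indices \<open>\<ge> m\<close>, with components \<open>0, \<dots>, m - 1\<close>.
\<close>

type_synonym 'd path = "real \<Rightarrow> real ^ 'd"
type_synonym 'd functional = "real \<Rightarrow> 'd path \<Rightarrow> (real \<Rightarrow> nat \<Rightarrow> real) \<Rightarrow> real"
type_synonym 'd integrand = "real \<Rightarrow> 'd path \<Rightarrow> real ^ 'd"

definition variation_sums :: "(real \<Rightarrow> real) \<Rightarrow> real \<Rightarrow> real \<Rightarrow> real set" where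
  "variation_sums g a b =
     {\<Sum>i<n. \<bar>g (p (Suc i)) - g (p i)\<bar> | n p. mono_on {..n} p \<and> p ` {..n} \<subseteq> {a..b}}"

definition bounded_variation_on :: "real \<Rightarrow> real \<Rightarrow> (real \<Rightarrow> real) \<Rightarrow> bool" where
  "bounded_variation_on a b g \<longleftrightarrow> bdd_above (variation_sums g a b)"

definition total_variation :: "(real \<Rightarrow> real) \<Rightarrow> real \<Rightarrow> real \<Rightarrow> real" where
  "total_variation g a b = Sup (variation_sums g a b)"

text \<open>
  The integral \<open>\<integral>\<^sub>s\<^sup>t f(r) g(dr)\<close> for continuous \<open>g\<close> of bounded variation on \<open>[s,t]\<close>: on
  \<open>[s,t]\<close> the integrator is \<open>V - (V - g)\<close>, where \<open>V\<close> is the total variation of \<open>g\<close> from \<open>s\<close>, and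
  both \<open>V\<close> and \<open>V - g\<close> are nondecreasing. They are continued as constants outside \<open>[s,t]\<close>,
  since \<open>interval_measure\<close> requires a function that is nondecreasing on all of \<open>real\<close>.
\<close>

definition stieltjes_integral ::
    "real \<Rightarrow> real \<Rightarrow> (real \<Rightarrow> real) \<Rightarrow> (real \<Rightarrow> real) \<Rightarrow> real" where
  "stieltjes_integral s t f g =
     (let clamp = (\<lambda>r. max s (min t r));
          V = (\<lambda>r. total_variation g s (clamp r));
          W = (\<lambda>r. V r - g (clamp r))
      in set_lebesgue_integral (interval_measure V) {s<..t} f
         - set_lebesgue_integral (interval_measure W) {s<..t} f)"

definition CBV :: "real \<Rightarrow> nat \<Rightarrow> (nat \<Rightarrow> real) set \<Rightarrow> (real \<Rightarrow> nat \<Rightarrow> real) set" where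
  "CBV T m S = {A. (\<forall>t\<in>{0..T}. A t \<in> S) \<and>
     (\<forall>i<m. continuous_on {0..T} (\<lambda>t. A t i) \<and> bounded_variation_on 0 T (\<lambda>t. A t i))}"

definition cadlag_paths :: "real \<Rightarrow> (real ^ 'd::finite) set \<Rightarrow> 'd path set" where
  "cadlag_paths T U = {X. (\<forall>t\<in>{0..T}. X t \<in> U) \<and>
     (\<forall>t\<in>{0..<T}. (X \<longlongrightarrow> X t) (at_right t)) \<and>
     (\<forall>t\<in>{0<..T}. \<exists>l\<in>U. (X \<longlongrightarrow> l) (at_left t))}"

definition sup_norm :: "real \<Rightarrow> 'd::finite path \<Rightarrow> real" where
  "sup_norm T X = (SUP u\<in>{0..T}. norm (X u))"

text \<open>
  Arguments are also clamped at \<open>0\<close>, so that the stopped path depends only on the restriction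
  of the path to \<open>[0,t]\<close>. Hence a non-anticipative functional automatically depends on
  its path arguments only through their restrictions to \<open>[0,T]\<close>.
\<close>

definition stop :: "real \<Rightarrow> (real \<Rightarrow> 'a) \<Rightarrow> real \<Rightarrow> 'a" where
  "stop t X = (\<lambda>s. X (max 0 (min t s)))"

text \<open>This is \<open>X\<^sup>t\<^sup>-\<close>, the limit of \<open>stop r X\<close> as \<open>r\<close> increases to \<open>t\<close>; only used for \<open>t > 0\<close>.\<close>

definition stop_left :: "real \<Rightarrow> 'd::finite path \<Rightarrow> 'd path" where
  "stop_left t X = (\<lambda>u. if u < t then X u else Lim (at_left t) X)"

definition non_anticipative ::
    "real \<Rightarrow> nat \<Rightarrow> (real ^ 'd::finite) set \<Rightarrow> (nat \<Rightarrow> real) set \<Rightarrow> 'd functional \<Rightarrow> bool" where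
  "non_anticipative T m U S F \<longleftrightarrow>
     (\<forall>t\<in>{0..T}. \<forall>X\<in>cadlag_paths T U. \<forall>A\<in>CBV T m S. F t X A = F t (stop t X) (stop t A))"

definition boundedness_preserving ::
    "real \<Rightarrow> nat \<Rightarrow> (real ^ 'd::finite) set \<Rightarrow> (nat \<Rightarrow> real) set \<Rightarrow> 'd functional \<Rightarrow> bool" where
  "boundedness_preserving T m U S F \<longleftrightarrow>
     (\<forall>A\<in>CBV T m S. \<forall>K. compact K \<and> K \<subseteq> U \<longrightarrow>
        (\<exists>C. \<forall>t\<in>{0..T}. \<forall>X\<in>cadlag_paths T K. \<bar>F t X A\<bar> \<le> C))"

definition continuous_at_fixed_times ::
    "real \<Rightarrow> nat \<Rightarrow> (real ^ 'd::finite) set \<Rightarrow> (nat \<Rightarrow> real) set \<Rightarrow> 'd functional \<Rightarrow> bool" where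
  "continuous_at_fixed_times T m U S F \<longleftrightarrow>
     (\<forall>\<epsilon>>0. \<forall>t\<in>{0..T}. \<forall>X\<in>cadlag_paths T U. \<forall>A\<in>CBV T m S. \<exists>\<eta>>0.
        \<forall>Y\<in>cadlag_paths T U.
          sup_norm T (\<lambda>u. stop t X u - stop t Y u) < \<eta> \<longrightarrow> \<bar>F t X A - F t Y A\<bar> < \<epsilon>)"

definition left_continuous ::
    "real \<Rightarrow> nat \<Rightarrow> (real ^ 'd::finite) set \<Rightarrow> (nat \<Rightarrow> real) set \<Rightarrow> 'd functional \<Rightarrow> bool" where
  "left_continuous T m U S F \<longleftrightarrow>
     (\<forall>t\<in>{0<..T}. \<forall>\<epsilon>>0. \<forall>X\<in>cadlag_paths T U. \<forall>A\<in>CBV T m S. \<exists>\<eta>>0.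
        \<forall>h\<in>{0..<\<eta>}. h \<le> t \<longrightarrow> (\<forall>Y\<in>cadlag_paths T U.
          sup_norm T (\<lambda>u. stop t X u - stop (t - h) Y u) < \<eta> \<longrightarrow>
          \<bar>F t X A - F (t - h) Y A\<bar> < \<epsilon>))"

definition continuous_in_X_locally_uniformly ::
    "real \<Rightarrow> nat \<Rightarrow> (real ^ 'd::finite) set \<Rightarrow> (nat \<Rightarrow> real) set \<Rightarrow> 'd functional \<Rightarrow> bool" where
  "continuous_in_X_locally_uniformly T m U S F \<longleftrightarrow>
     (\<forall>\<epsilon>>0. \<forall>t\<in>{0..T}. \<forall>X\<in>cadlag_paths T U. \<forall>A\<in>CBV T m S. \<exists>\<eta>>0.
        \<forall>u\<in>{0..T}. \<forall>Y\<in>cadlag_paths T U.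
          sup_norm T (\<lambda>r. X r - Y r) < \<eta> \<and> \<bar>t - u\<bar> < \<eta> \<longrightarrow> \<bar>F u X A - F u Y A\<bar> < \<epsilon>)"

text \<open>The integrators \<open>A\<^sub>0, A\<^sub>1, \<dots>, A\<^sub>m\<close> with \<open>A\<^sub>0(r) = r\<close>; the components of \<open>A\<close> are
  numbered from \<open>0\<close>, hence the shift by one.\<close>

definition integrator :: "(real \<Rightarrow> nat \<Rightarrow> real) \<Rightarrow> nat \<Rightarrow> real \<Rightarrow> real" where
  "integrator A i r = (case i of 0 \<Rightarrow> r | Suc j \<Rightarrow> A r j)"

definition is_horizontal_derivative ::
    "real \<Rightarrow> nat \<Rightarrow> (real ^ 'd::finite) set \<Rightarrow> (nat \<Rightarrow> real) set \<Rightarrow> 'd functional \<Rightarrow>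
     (nat \<Rightarrow> 'd functional) \<Rightarrow> bool" where
  "is_horizontal_derivative T m U S F DF \<longleftrightarrow>
     (\<forall>i\<le>m. non_anticipative T m U S (DF i) \<and> boundedness_preserving T m U S (DF i)) \<and>
     (\<forall>s t. 0 \<le> s \<and> s < t \<and> t \<le> T \<longrightarrow> (\<forall>X\<in>cadlag_paths T U. \<forall>A\<in>CBV T m S.
        (\<forall>i\<le>m. (\<lambda>r. DF i r (stop s X) A) \<in> borel_measurable (restrict_space borel {s..t})) \<and>
        F t (stop s X) A - F s (stop s X) A =
          (\<Sum>i\<le>m. stieltjes_integral s t (\<lambda>r. DF i r (stop s X) A) (integrator A i))))"

definition bump :: "real \<Rightarrow> real \<Rightarrow> real ^ 'd::finite \<Rightarrow> 'd path \<Rightarrow> 'd path" where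
  "bump T t v X = (\<lambda>s. X s + indicator {t..T} s *\<^sub>R v)"

definition vertically_differentiable ::
    "real \<Rightarrow> nat \<Rightarrow> (real ^ 'd::finite) set \<Rightarrow> (nat \<Rightarrow> real) set \<Rightarrow> 'd functional \<Rightarrow> bool" where
  "vertically_differentiable T m U S F \<longleftrightarrow>
     (\<forall>t\<in>{0..T}. \<forall>X\<in>cadlag_paths T U. \<forall>A\<in>CBV T m S.
        (\<lambda>v. F t (bump T t v X) A) differentiable (at 0))"

definition vertical_partial :: "real \<Rightarrow> 'd \<Rightarrow> 'd::finite functional \<Rightarrow> 'd functional" where
  "vertical_partial T i F =
     (\<lambda>t X A. frechet_derivative (\<lambda>v. F t (bump T t v X) A) (at 0) (axis i 1))"

definition vertical_gradient ::
    "real \<Rightarrow> 'd::finite functional \<Rightarrow> real \<Rightarrow> 'd path \<Rightarrow> (real \<Rightarrow> nat \<Rightarrow> real) \<Rightarrow> real ^ 'd" where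
  "vertical_gradient T F t X A = (\<chi> i. vertical_partial T i F t X A)"

text \<open>
  A horizontal derivative is not unique, since only its integrals are prescribed; \<open>C12b\<close> asks
  for one that is continuous at fixed times. The vertical derivatives inherit
  non-anticipativity from \<open>F\<close>, so it is not required of them separately.
\<close>

definition C12b ::
    "real \<Rightarrow> nat \<Rightarrow> (real ^ 'd::finite) set \<Rightarrow> (nat \<Rightarrow> real) set \<Rightarrow> 'd functional set" where
  "C12b T m U S = {F.
     non_anticipative T m U S F \<and>
     left_continuous T m U S F \<and>
     vertically_differentiable T m U S F \<and>
     (\<forall>j. vertically_differentiable T m U S (vertical_partial T j F)) \<and>
     (\<exists>DF. is_horizontal_derivative T m U S F DF \<and>
        (\<forall>i\<le>m. continuous_at_fixed_times T m U S (DF i))) \<and>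
     (\<forall>i. left_continuous T m U S (vertical_partial T i F) \<and>
          boundedness_preserving T m U S (vertical_partial T i F)) \<and>
     (\<forall>i j. left_continuous T m U S (vertical_partial T i (vertical_partial T j F)) \<and>
            boundedness_preserving T m U S (vertical_partial T i (vertical_partial T j F)))}"

definition C12c ::
    "real \<Rightarrow> nat \<Rightarrow> (real ^ 'd::finite) set \<Rightarrow> (nat \<Rightarrow> real) set \<Rightarrow> 'd functional set" where
  "C12c T m U S = {F \<in> C12b T m U S.
     continuous_in_X_locally_uniformly T m U S F \<and> boundedness_preserving T m U S F}"

definition admissible_integrand ::
    "real \<Rightarrow> (real ^ 'd::finite) set \<Rightarrow> 'd integrand \<Rightarrow> bool" where
  "admissible_integrand T U \<xi> \<longleftrightarrow>
     (\<exists>m\<ge>1. \<exists>S A F. openin (Euclidean_space m) S \<and> A \<in> CBV T m S \<and> F \<in> C12c T m U S \<and>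
        (\<forall>t\<in>{0..T}. \<forall>X\<in>cadlag_paths T U. \<xi> t X = vertical_gradient T F t X A))"

definition successor :: "real \<Rightarrow> real set \<Rightarrow> real \<Rightarrow> real" where
  "successor T P t = (if t < T then Min {u\<in>P. t < u} else T)"

definition refining_partitions :: "real \<Rightarrow> (nat \<Rightarrow> real set) \<Rightarrow> bool" where
  "refining_partitions T P \<longleftrightarrow>
     (\<forall>n. finite (P n) \<and> P n \<subseteq> {0..T} \<and> 0 \<in> P n \<and> T \<in> P n) \<and>
     (\<forall>n. P n \<subseteq> P (Suc n)) \<and>
     (\<lambda>n. Max ((\<lambda>t. successor T (P n) t - t) ` P n)) \<longlonglongrightarrow> 0"

definition qv_sum :: "real \<Rightarrow> (nat \<Rightarrow> real set) \<Rightarrow> (real \<Rightarrow> real) \<Rightarrow> real \<Rightarrow> nat \<Rightarrow> real" where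
  "qv_sum T P x t n = (\<Sum>s\<in>{s\<in>P n. s \<le> t}. (x (successor T (P n) s) - x s)\<^sup>2)"

definition quadratic_variation ::
    "real \<Rightarrow> (nat \<Rightarrow> real set) \<Rightarrow> (real \<Rightarrow> real) \<Rightarrow> real \<Rightarrow> real" where
  "quadratic_variation T P x t = (if t = 0 then 0 else lim (qv_sum T P x t))"

definition admits_qv_real :: "real \<Rightarrow> (nat \<Rightarrow> real set) \<Rightarrow> (real \<Rightarrow> real) \<Rightarrow> bool" where
  "admits_qv_real T P x \<longleftrightarrow> continuous_on {0..T} x \<and>
     (\<forall>t\<in>{0<..T}. convergent (qv_sum T P x t)) \<and>
     continuous_on {0..T} (quadratic_variation T P x)"

text \<open>In dimension one this is the condition on \<open>2 X\<close>, which is equivalent to that on \<open>X\<close>.\<close>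

definition admits_qv :: "real \<Rightarrow> (nat \<Rightarrow> real set) \<Rightarrow> 'd::finite path \<Rightarrow> bool" where
  "admits_qv T P X \<longleftrightarrow> (\<forall>i j. admits_qv_real T P (\<lambda>t. X t $ i + X t $ j))"

definition covariation :: "real \<Rightarrow> (nat \<Rightarrow> real set) \<Rightarrow> 'd::finite path \<Rightarrow> 'd \<Rightarrow> 'd \<Rightarrow> real \<Rightarrow> real" where
  "covariation T P X i j t =
     (quadratic_variation T P (\<lambda>s. X s $ i + X s $ j) t
      - quadratic_variation T P (\<lambda>s. X s $ i) t
      - quadratic_variation T P (\<lambda>s. X s $ j) t) / 2"

definition step_path :: "real \<Rightarrow> real set \<Rightarrow> 'd::finite path \<Rightarrow> 'd path" where
  "step_path T P X = (\<lambda>t.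
     (\<Sum>s\<in>P. indicator {s..<successor T P s} t *\<^sub>R X (successor T P s)) + indicator {T} t *\<^sub>R X T)"

definition step_path_before :: "real \<Rightarrow> real set \<Rightarrow> 'd::finite path \<Rightarrow> real \<Rightarrow> 'd path" where
  "step_path_before T P X s = (if s = 0 then (\<lambda>_. X 0) else stop_left s (step_path T P X))"

definition ito_sum ::
    "real \<Rightarrow> (nat \<Rightarrow> real set) \<Rightarrow> 'd::finite integrand \<Rightarrow> 'd path \<Rightarrow> real \<Rightarrow> nat \<Rightarrow> real" where
  "ito_sum T P \<xi> X t n =
     (\<Sum>s\<in>{s\<in>P n. s \<le> t}. \<xi> s (step_path_before T (P n) X s) \<bullet> (X (successor T (P n) s) - X s))"

definition ito_integrable ::
    "real \<Rightarrow> (nat \<Rightarrow> real set) \<Rightarrow> 'd::finite integrand \<Rightarrow> 'd path \<Rightarrow> real \<Rightarrow> bool" where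
  "ito_integrable T P \<xi> X t \<longleftrightarrow> convergent (ito_sum T P \<xi> X t)"

definition ito_integral ::
    "real \<Rightarrow> (nat \<Rightarrow> real set) \<Rightarrow> 'd::finite integrand \<Rightarrow> 'd path \<Rightarrow> real \<Rightarrow> real" where
  "ito_integral T P \<xi> X t = lim (ito_sum T P \<xi> X t)"

definition functional_path ::
    "('n::finite \<Rightarrow> 'd functional) \<Rightarrow> 'd path \<Rightarrow> (real \<Rightarrow> nat \<Rightarrow> real) \<Rightarrow> 'n path" where
  "functional_path F X A = (\<lambda>t. \<chi> l. F l t X A)"

definition composed_integrand ::
    "('n::finite \<Rightarrow> 'd::finite functional) \<Rightarrow> (real \<Rightarrow> nat \<Rightarrow> real) \<Rightarrow> 'n integrand \<Rightarrow>
     ('n \<Rightarrow> 'd integrand) \<Rightarrow> 'd integrand" where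
  "composed_integrand F A \<eta> \<xi> =
     (\<lambda>t X. \<Sum>l\<in>UNIV. (\<eta> t (functional_path F X A) $ l) *\<^sub>R \<xi> l t X)"

end

theory Submission
  imports Defs
begin

text \<open>
  The integrand \<open>\<xi>\<^sub>l\<close> is the vertical gradient of a functional. Subtracting from that functional
  the Stieltjes integrals of the functional Ito formula, after adjoining the covariations of \<open>X\<close> to
  the controls, does not change the vertical gradient, and by the Ito formula the new functional
  \<open>F\<^sub>l\<close> represents \<open>Y\<^sub>l\<close>. If \<open>\<eta>\<close> is the vertical gradient of \<open>G\<close>, then by the chain rule \<open>\<zeta>\<close> is the
  vertical gradient of \<open>K(t,X,A) = G(t, F(\<cdot>,X,A), A)\<close>; the horizontal part of the chain rule is a
  change of variables along paths of bounded variation. Finally the Ito formulas for \<open>G\<close> along \<open>Y\<close>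
  and for \<open>K\<close> along \<open>X\<close> are compared: the second vertical derivatives of \<open>F\<close> cancel against its
  horizontal derivative, and those of \<open>G\<close> match by the formula for the covariations of \<open>Y\<close>.
\<close>

section \<open>Functions of bounded variation and Stieltjes integrals\<close>

text \<open>Two weak points of the assumptions shape the argument. Gradients are only
  left-continuous, which says nothing at time 0; wherever one of them becomes part of a horizontal
  derivative it is set to 0 there, a change that integrals over \<open>{s<..t}\<close> do not see.
  And the second-order term is a sum of derivatives at uncontrolled intermediate points, weighted by
  squared increments, whose limit is known only through the distribution function
  \<open>[X]\<close>. Passing to the limit against a merely left-continuous integrand uses that
  \<open>[X]\<close> is continuous and hence has no atoms. For the composition, the path of values
  of \<open>F\<close> has to be cadlag, to depend uniformly on \<open>X\<close>, and to transport
  the convergence of stopped paths that occurs in left-continuity. Continuity in \<open>X\<close>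
  locally uniformly in \<open>t\<close> provides this. The control of \<eta> is unknown when
  \<open>F\<close> is chosen. So \<open>F\<close> uses only the controls of the \<xi>_l and the
  covariations, and for each \<eta> it is lifted to a larger space of controls, where its values,
  its gradients and the cancellation along \<open>X\<close> persist.\<close>

lemma variation_sums_mono:
  "a \<le> c \<Longrightarrow> d \<le> b \<Longrightarrow> variation_sums g c d \<subseteq> variation_sums g a b"
  unfolding variation_sums_def by fastforce

lemma bounded_variation_on_subset:
  "bounded_variation_on a b g \<Longrightarrow> a \<le> c \<Longrightarrow> d \<le> b \<Longrightarrow> bounded_variation_on c d g"
  unfolding bounded_variation_on_def by (metis variation_sums_mono bdd_above_mono)

lemma variation_sums_memI:
  "mono_on {..n} p \<Longrightarrow> p ` {..n} \<subseteq> {a..b} \<Longrightarrow>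
    (\<Sum>i<n. \<bar>g (p (Suc i)) - g (p i)\<bar>) \<in> variation_sums g a b"
  unfolding variation_sums_def by blast

lemma variation_sum_le_total_variation:
  assumes "bounded_variation_on a b g" "mono_on {..n} p" "p ` {..n} \<subseteq> {a..b}"
  shows "(\<Sum>i<n. \<bar>g (p (Suc i)) - g (p i)\<bar>) \<le> total_variation g a b"
  unfolding total_variation_def
  by (rule cSup_upper) (use assms variation_sums_memI in \<open>auto simp: bounded_variation_on_def\<close>)

lemma variation_sums_nonempty: "a \<le> b \<Longrightarrow> variation_sums g a b \<noteq> {}"
  using variation_sums_memI[of 0 "\<lambda>_. a" a b g] by (auto simp: mono_on_def)

lemma total_variation_least:
  assumes "a \<le> b"
    and "\<And>n p. mono_on {..n} p \<Longrightarrow> p ` {..n} \<subseteq> {a..b} \<Longrightarrow>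
           (\<Sum>i<n. \<bar>g (p (Suc i)) - g (p i)\<bar>) \<le> B"
  shows "total_variation g a b \<le> B"
  unfolding total_variation_def
  by (rule cSup_least) (use assms variation_sums_nonempty in \<open>auto simp: variation_sums_def\<close>)

lemma abs_diff_le_total_variation:
  assumes "bounded_variation_on a b g" "a \<le> x" "x \<le> y" "y \<le> b"
  shows "\<bar>g y - g x\<bar> \<le> total_variation g x y"
proof -
  have "(\<Sum>i<1. \<bar>g ((\<lambda>i. if i = 0 then x else y) (Suc i)) - g ((\<lambda>i. if i = 0 then x else y) i)\<bar>)
      \<le> total_variation g x y"
    by (rule variation_sum_le_total_variation[OF bounded_variation_on_subset[OF assms(1)]])
       (use assms in \<open>auto simp: mono_on_def\<close>)
  then show ?thesis by simp
qed

lemma total_variation_refl: "total_variation g a a = 0"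
proof -
  have "variation_sums g a a = {0}"
  proof
    show "variation_sums g a a \<subseteq> {0}"
    proof
      fix x assume "x \<in> variation_sums g a a"
      then obtain n p where x: "x = (\<Sum>i<n. \<bar>g (p (Suc i)) - g (p i)\<bar>)" and p: "p ` {..n} \<subseteq> {a..a}"
        unfolding variation_sums_def by blast
      have "p i = a" if "i \<le> n" for i using p that by auto
      then show "x \<in> {0}" unfolding x by simp
    qed
    show "{0} \<subseteq> variation_sums g a a"
      using variation_sums_memI[of 0 "\<lambda>_. a" a a g] by (auto simp: mono_on_def)
  qed
  then show ?thesis by (simp add: total_variation_def)
qed

lemma sum_lessThan_add: "(\<Sum>i<m + n. f i) = (\<Sum>i<m. f i) + (\<Sum>i<n. f (m + i :: nat) :: real)"
  by (induction n) (auto simp: algebra_simps)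

text \<open>Clipping a partition with \<open>min c\<close> and \<open>max c\<close> yields
  partitions of the two halves without inserting \<open>c\<close>, and
  \<open>g x = g (min c x) + g (max c x) - g c\<close> bounds each increment. For the converse, a
  partition of \<open>[a,c]\<close> is followed by one of \<open>[c,b]\<close>.\<close>

lemma total_variation_add:
  assumes bv: "bounded_variation_on a b g" and "a \<le> c" "c \<le> b"
  shows "total_variation g a b = total_variation g a c + total_variation g c b"
proof (rule antisym)
  have bv': "bounded_variation_on a c g" "bounded_variation_on c b g"
    using bounded_variation_on_subset[OF bv] assms by auto
  show "total_variation g a b \<le> total_variation g a c + total_variation g c b"
  proof (rule total_variation_least)
    fix n and p :: "nat \<Rightarrow> real" assume p: "mono_on {..n} p" "p ` {..n} \<subseteq> {a..b}"
    have split: "g x = g (min c x) + g (max c x) - g c" for x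
      by (auto simp: min_def max_def)
    have "(\<Sum>i<n. \<bar>g (p (Suc i)) - g (p i)\<bar>) \<le>
        (\<Sum>i<n. \<bar>g (min c (p (Suc i))) - g (min c (p i))\<bar> + \<bar>g (max c (p (Suc i))) - g (max c (p i))\<bar>)"
    proof (rule sum_mono)
      fix i show "\<bar>g (p (Suc i)) - g (p i)\<bar> \<le>
          \<bar>g (min c (p (Suc i))) - g (min c (p i))\<bar> + \<bar>g (max c (p (Suc i))) - g (max c (p i))\<bar>"
        using split[of "p (Suc i)"] split[of "p i"] by linarith
    qed
    also have "\<dots> \<le> total_variation g a c + total_variation g c b"
      unfolding sum.distrib
    proof (rule add_mono)
      show "(\<Sum>i<n. \<bar>g (min c (p (Suc i))) - g (min c (p i))\<bar>) \<le> total_variation g a c"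
        by (intro variation_sum_le_total_variation[OF bv'(1)] mono_onI min.mono order_refl mono_onD[OF p(1)])
           (use p assms in \<open>auto simp: image_subset_iff min_le_iff_disj le_max_iff_disj\<close>)
      show "(\<Sum>i<n. \<bar>g (max c (p (Suc i))) - g (max c (p i))\<bar>) \<le> total_variation g c b"
        by (intro variation_sum_le_total_variation[OF bv'(2)] mono_onI max.mono order_refl mono_onD[OF p(1)])
           (use p assms in \<open>auto simp: image_subset_iff min_le_iff_disj le_max_iff_disj\<close>)
    qed
    finally show "(\<Sum>i<n. \<bar>g (p (Suc i)) - g (p i)\<bar>) \<le> total_variation g a c + total_variation g c b" .
  qed (use assms in auto)
  have "total_variation g a c \<le> total_variation g a b - total_variation g c b"
  proof (rule total_variation_least[OF \<open>a \<le> c\<close>])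
    fix n and p :: "nat \<Rightarrow> real" assume p: "mono_on {..n} p" "p ` {..n} \<subseteq> {a..c}"
    have "total_variation g c b \<le> total_variation g a b - (\<Sum>i<n. \<bar>g (p (Suc i)) - g (p i)\<bar>)"
    proof (rule total_variation_least[OF \<open>c \<le> b\<close>])
      fix k and r :: "nat \<Rightarrow> real" assume r: "mono_on {..k} r" "r ` {..k} \<subseteq> {c..b}"
      define q where "q i = (if i \<le> n then p i else r (i - Suc n))" for i
      have "mono_on {..n + Suc k} q"
      proof (rule mono_onI)
        fix i j assume ij: "i \<in> {..n + Suc k}" "j \<in> {..n + Suc k}" "i \<le> (j::nat)"
        consider "j \<le> n" | "i \<le> n" "\<not> j \<le> n" | "\<not> i \<le> n" "\<not> j \<le> n" by linarith
        then show "q i \<le> q j"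
        proof cases
          case 1 then show ?thesis using ij p by (auto simp: q_def mono_on_def)
        next
          case 2
          have "p i \<le> c" using 2 p by auto
          moreover have "c \<le> r (j - Suc n)" using 2 ij r by (auto simp: image_subset_iff)
          ultimately show ?thesis using 2 by (simp add: q_def)
        next
          case 3
          then have "r (i - Suc n) \<le> r (j - Suc n)" using ij by (intro mono_onD[OF r(1)]) auto
          with 3 show ?thesis by (simp add: q_def)
        qed
      qed
      moreover have "q ` {..n + Suc k} \<subseteq> {a..b}"
        proof (intro image_subsetI)
        fix i assume i: "i \<in> {..n + Suc k}"
        show "q i \<in> {a..b}"
        proof (cases "i \<le> n")
          case True
          then have "p i \<in> {a..c}" using p by auto
          then show ?thesis using True assms by (auto simp: q_def)
        next
          case False
          then have "r (i - Suc n) \<in> {c..b}" using i by (intro subsetD[OF r(2)] imageI) auto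
          then show ?thesis using False assms by (auto simp: q_def)
        qed
      qed
      ultimately have "(\<Sum>i<n + Suc k. \<bar>g (q (Suc i)) - g (q i)\<bar>) \<le> total_variation g a b"
        by (rule variation_sum_le_total_variation[OF bv])
      moreover have "(\<Sum>i<n. \<bar>g (q (Suc i)) - g (q i)\<bar>) = (\<Sum>i<n. \<bar>g (p (Suc i)) - g (p i)\<bar>)"
        by (rule sum.cong) (auto simp: q_def)
      moreover have "(\<Sum>i<k. \<bar>g (q (Suc (n + Suc i))) - g (q (n + Suc i))\<bar>) = (\<Sum>i<k. \<bar>g (r (Suc i)) - g (r i)\<bar>)"
        by (rule sum.cong) (auto simp: q_def)
      \<comment> \<open>The term of index \<open>n\<close>, the increment from the end of
        \<open>p\<close> to the start of \<open>r\<close>, is nonnegative and is dropped.\<close>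
      ultimately show "(\<Sum>i<k. \<bar>g (r (Suc i)) - g (r i)\<bar>) \<le> total_variation g a b - (\<Sum>i<n. \<bar>g (p (Suc i)) - g (p i)\<bar>)"
        unfolding sum_lessThan_add sum.lessThan_Suc_shift by (smt (verit) abs_ge_zero add_Suc_right)
    qed
    then show "(\<Sum>i<n. \<bar>g (p (Suc i)) - g (p i)\<bar>) \<le> total_variation g a b - total_variation g c b"
      by linarith
  qed
  then show "total_variation g a c + total_variation g c b \<le> total_variation g a b" by linarith
qed

text \<open>Truncating a nearly optimal partition at \<open>x\<close> gives a continuous function of \<open>x\<close> that is
  uniformly close to the variation on \<open>[a,x]\<close>.\<close>

lemma continuous_on_total_variation:
  assumes g: "continuous_on {a..b} g" and bv: "bounded_variation_on a b g"
  shows "continuous_on {a..b} (\<lambda>x. total_variation g a x)"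
proof (cases "a \<le> b")
  case True
  have "\<exists>d>0. \<forall>y\<in>{a..b}. dist y x < d \<longrightarrow> dist (total_variation g a y) (total_variation g a x) < e"
    if x: "x \<in> {a..b}" and e: "e > 0" for x e
  proof -
    have "total_variation g a b - e/3 < Sup (variation_sums g a b)"
      using e by (simp add: total_variation_def)
    then obtain n p where p: "mono_on {..n} p" "p ` {..n} \<subseteq> {a..b}"
      and opt: "total_variation g a b - e/3 < (\<Sum>i<n. \<bar>g (p (Suc i)) - g (p i)\<bar>)"
      using less_cSupD[OF variation_sums_nonempty[OF True]] unfolding variation_sums_def by blast
    define S where "S x = (\<Sum>i<n. \<bar>g (min x (p (Suc i))) - g (min x (p i))\<bar>)" for x
    have pi: "a \<le> p i" "p i \<le> b" if "i \<le> n" for i using p that by auto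
    have gm: "continuous_on {a..b} (\<lambda>x. g (min x (p i)))" if "i \<le> n" for i
      by (rule continuous_on_compose2[OF g]) (use pi[OF that] in \<open>auto intro!: continuous_intros\<close>)
    have "continuous_on {a..b} S"
      unfolding S_def by (intro continuous_intros gm) auto
    moreover have "e/3 > 0" using e by simp
    ultimately obtain d where d: "d > 0" "\<And>y. y \<in> {a..b} \<Longrightarrow> dist y x < d \<Longrightarrow> dist (S y) (S x) < e/3"
      using x unfolding continuous_on_iff by blast
    \<comment> \<open>The clipped sum misses no more on \<open>[a,y]\<close> than the full sum
      misses on \<open>[a,b]\<close>, because the part clipped to \<open>[y,b]\<close> cannot exceed
      the variation there.\<close>
    have close: "S y \<le> total_variation g a y \<and> total_variation g a y < S y + e/3" if y: "y \<in> {a..b}" for y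
    proof
      have bv': "bounded_variation_on a y g" "bounded_variation_on y b g"
        using bounded_variation_on_subset[OF bv] y by auto
      show "S y \<le> total_variation g a y"
        unfolding S_def
        by (intro variation_sum_le_total_variation[OF bv'(1)] mono_onI min.mono order_refl mono_onD[OF p(1)])
           (use p y in \<open>auto simp: image_subset_iff min_le_iff_disj le_max_iff_disj\<close>)
      have U: "(\<Sum>i<n. \<bar>g (max y (p (Suc i))) - g (max y (p i))\<bar>) \<le> total_variation g y b"
        by (intro variation_sum_le_total_variation[OF bv'(2)] mono_onI max.mono order_refl mono_onD[OF p(1)])
           (use p y in \<open>auto simp: image_subset_iff min_le_iff_disj le_max_iff_disj\<close>)
      have split: "g x = g (min y x) + g (max y x) - g y" for x
        by (auto simp: min_def max_def)
      have "(\<Sum>i<n. \<bar>g (p (Suc i)) - g (p i)\<bar>) \<le>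
        (\<Sum>i<n. \<bar>g (min y (p (Suc i))) - g (min y (p i))\<bar> + \<bar>g (max y (p (Suc i))) - g (max y (p i))\<bar>)"
      proof (rule sum_mono)
        fix i show "\<bar>g (p (Suc i)) - g (p i)\<bar> \<le>
            \<bar>g (min y (p (Suc i))) - g (min y (p i))\<bar> + \<bar>g (max y (p (Suc i))) - g (max y (p i))\<bar>"
          using split[of "p (Suc i)"] split[of "p i"] by linarith
      qed
      then show "total_variation g a y < S y + e/3"
        using U opt total_variation_add[OF bv, of y] y unfolding sum.distrib S_def by auto
    qed
    show ?thesis
    proof (intro exI conjI ballI impI)
      fix y assume "y \<in> {a..b}" "dist y x < d"
      then show "dist (total_variation g a y) (total_variation g a x) < e"
        using d(2)[of y] close[of y] close[OF x] unfolding dist_real_def by linarith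
    qed (rule d)
  qed
  then show ?thesis unfolding continuous_on_iff by blast
qed auto

section \<open>Jordan decomposition and calculus of Stieltjes integrals\<close>

definition cont_bv :: "real \<Rightarrow> (real \<Rightarrow> real) \<Rightarrow> bool" where
  "cont_bv T g \<longleftrightarrow> continuous_on {0..T} g \<and> bounded_variation_on 0 T g"

text \<open>One Jordan decomposition, based at 0, serves all subintervals of \<open>[0,T]\<close>,
  whereas \<open>stieltjes_integral\<close> decomposes anew from each lower limit, so that
  additivity in the interval would compare different measures. The clamp makes the function monotone
  on the whole line.\<close>

definition jordan_pos :: "real \<Rightarrow> (real \<Rightarrow> real) \<Rightarrow> real \<Rightarrow> real" where
  "jordan_pos T g r = total_variation g 0 (max 0 (min T r))"

definition jordan_neg :: "real \<Rightarrow> (real \<Rightarrow> real) \<Rightarrow> real \<Rightarrow> real" where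
  "jordan_neg T g r = jordan_pos T g r - g (max 0 (min T r))"

lemma continuous_clamp:
  assumes "continuous_on {a..b} h" "a \<le> (b::real)"
  shows "continuous_on UNIV (\<lambda>r. h (max a (min b r)))"
  by (rule continuous_on_compose2[OF assms(1)]) (use assms in \<open>auto intro!: continuous_intros\<close>)

context
  fixes T :: real and g :: "real \<Rightarrow> real"
  assumes T: "0 \<le> T" and g: "cont_bv T g"
begin

lemma continuous_jordan_pos: "continuous_on UNIV (jordan_pos T g)"
  unfolding jordan_pos_def
  by (rule continuous_clamp) (use g T continuous_on_total_variation in \<open>auto simp: cont_bv_def\<close>)

lemma continuous_jordan_neg: "continuous_on UNIV (jordan_neg T g)"
  unfolding jordan_neg_def
  by (intro continuous_intros continuous_jordan_pos continuous_clamp) (use g T in \<open>auto simp: cont_bv_def\<close>)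

lemma jordan_pos_diff:
  assumes "0 \<le> s" "s \<le> t" "t \<le> T"
  shows "jordan_pos T g t - jordan_pos T g s = total_variation g s t"
proof -
  have "total_variation g 0 t = total_variation g 0 s + total_variation g s t"
    by (rule total_variation_add) (use assms g bounded_variation_on_subset in \<open>auto simp: cont_bv_def\<close>)
  then show ?thesis using assms by (simp add: jordan_pos_def)
qed

lemma mono_jordan:
  assumes "x \<le> y"
  shows "jordan_pos T g x \<le> jordan_pos T g y" "jordan_neg T g x \<le> jordan_neg T g y"
proof -
  let ?c = "\<lambda>r. max 0 (min T r)"
  have c: "0 \<le> ?c x" "?c x \<le> ?c y" "?c y \<le> T" using assms T by auto
  have "\<bar>g (?c y) - g (?c x)\<bar> \<le> total_variation g (?c x) (?c y)"
    by (rule abs_diff_le_total_variation) (use c g in \<open>auto simp: cont_bv_def\<close>)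
  moreover have "jordan_pos T g y - jordan_pos T g x = total_variation g (?c x) (?c y)"
    using jordan_pos_diff[OF c] T by (simp add: jordan_pos_def max_def min_def split: if_splits)
  ultimately show "jordan_pos T g x \<le> jordan_pos T g y" "jordan_neg T g x \<le> jordan_neg T g y"
    unfolding jordan_neg_def by linarith+
qed

end

text \<open>Half-open intervals form an intersection-stable generator on which both measures agree:
  \<open>G\<close> grows only while its argument is in \<open>{a<..b}\<close>, and the constant
  \<open>c\<close> drops out of increments.\<close>

lemma interval_measure_clamped:
  assumes F: "\<And>x y. x \<le> y \<Longrightarrow> F x \<le> F y" "continuous_on UNIV F" and "a \<le> b"
    and G: "\<And>x. G x = F (max a (min b x)) - c"
  shows "interval_measure G = density (interval_measure F) (indicator {a<..b})"
proof -
  have Fr: "continuous (at_right x) F" for x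
    using F(2) by (simp add: continuous_on_eq_continuous_at continuous_at_imp_continuous_at_within)
  have Gm: "G x \<le> G y" if "x \<le> y" for x y unfolding G using that by (auto intro!: F(1))
  have "continuous_on UNIV (\<lambda>x. F (max a (min b x)) - c)"
    by (intro continuous_intros continuous_clamp continuous_on_subset[OF F(2)]) (use \<open>a \<le> b\<close> in auto)
  then have Gc: "continuous_on UNIV G" unfolding G[abs_def] .
  have Gr: "continuous (at_right x) G" for x
    using Gc by (simp add: continuous_on_eq_continuous_at continuous_at_imp_continuous_at_within)
  let ?E = "range (\<lambda>(a, b). {a <.. b::real})"
  show ?thesis
  proof (rule measure_eqI_generator_eq[where E = ?E and \<Omega> = UNIV and A = "\<lambda>i::nat. {- real i<..real i}"])
    show "Int_stable ?E"
    proof (rule Int_stableI)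
      fix A B assume "A \<in> ?E" "B \<in> ?E"
      then obtain p q r s where "A = {p<..q}" "B = {r<..s}" by (auto elim!: rangeE)
      then have "A \<inter> B = {max p r<..min q s}" by auto
      then show "A \<inter> B \<in> ?E" by (intro range_eqI[where x = "(max p r, min q s)"]) simp
    qed
    show "emeasure (interval_measure G) X = emeasure (density (interval_measure F) (indicator {a<..b})) X"
      if X: "X \<in> ?E" for X
    proof -
      obtain p q where X: "X = {p<..q}" using X by (auto elim!: rangeE)
      have "emeasure (density (interval_measure F) (indicator {a<..b})) X
          = (\<integral>\<^sup>+x. indicator ({max a p<..min b q}) x \<partial>interval_measure F)"
        unfolding X by (subst emeasure_density) (auto intro!: nn_integral_cong simp: indicator_def simp del: nn_integral_indicator)
      also have "\<dots> = emeasure (interval_measure F) {max a p<..min b q}" by simp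
      also have "\<dots> = emeasure (interval_measure G) X"
        unfolding X using \<open>a \<le> b\<close>
        by (auto simp: emeasure_interval_measure_Ioc_eq F(1) Fr Gm Gr) (auto simp: G max_def min_def)
      finally show ?thesis by simp
    qed
    show "(\<Union>i. {- real i<..real i}) = UNIV"
    proof -
      have "\<exists>i::nat. x \<in> {- real i<..real i}" for x
      proof -
        obtain i :: nat where "\<bar>x\<bar> < real i" using reals_Archimedean2 by blast
        then have "x \<in> {- real i<..real i}" by auto
        then show ?thesis by blast
      qed
      then show ?thesis by blast
    qed
    show "emeasure (interval_measure G) {- real i<..real i} \<noteq> \<infinity>" for i
      by (simp add: emeasure_interval_measure_Ioc_eq[OF Gm Gr])
  qed (auto simp: borel_sigma_sets_Ioc)
qed

text \<open>Multiplication by the indicator makes this a property of \<open>f\<close> on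
  \<open>{s<..t}\<close> alone, the set over which Stieltjes integrals extend. The value at
  \<open>s\<close> is free, so integrands may be redefined at time 0.\<close>

definition bdd_measurable :: "real \<Rightarrow> real \<Rightarrow> (real \<Rightarrow> real) \<Rightarrow> bool" where
  "bdd_measurable s t f \<longleftrightarrow>
     (\<lambda>x. indicator {s<..t} x * f x) \<in> borel_measurable borel \<and> (\<exists>C. \<forall>x\<in>{s<..t}. \<bar>f x\<bar> \<le> C)"

lemma set_lebesgue_integral_density_indicator:
  fixes f :: "real \<Rightarrow> real"
  assumes [measurable_cong]: "sets M = sets borel"
    and f[measurable]: "(\<lambda>x. indicator {s<..t} x * f x) \<in> borel_measurable borel"
  shows "set_lebesgue_integral (density M (indicator {s<..t})) {s<..t} f = set_lebesgue_integral M {s<..t} f"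
proof -
  have "density M (indicator {s<..t}) = density M (\<lambda>x. ennreal (indicator {s<..t} x :: real))"
    by (simp add: ennreal_indicator)
  then show ?thesis
    unfolding set_lebesgue_integral_def
    by (subst \<open>density M _ = _\<close>, subst integral_density)
       (use f in \<open>auto intro!: Bochner_Integration.integral_cong simp: indicator_def
          measurable_cong_sets[OF assms(1) refl]\<close>)
qed

text \<open>Up to an additive constant, the variation counted from \<open>s\<close> is
  \<open>jordan_pos\<close> clamped to \<open>[s,t]\<close>; the two measures of the definition are
  therefore restrictions of the fixed Jordan measures.\<close>

lemma stieltjes_integral_eq:
  assumes g: "cont_bv T g" and st: "0 \<le> s" "s \<le> t" "t \<le> T" and f: "bdd_measurable s t f"
  shows "stieltjes_integral s t f g =
    set_lebesgue_integral (interval_measure (jordan_pos T g)) {s<..t} f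
    - set_lebesgue_integral (interval_measure (jordan_neg T g)) {s<..t} f"
proof -
  have T: "0 \<le> T" using st by simp
  note fm = f[unfolded bdd_measurable_def, THEN conjunct1]
  let ?cl = "\<lambda>r. max s (min t r)"
  have V: "total_variation g s (?cl r) = jordan_pos T g (?cl r) - jordan_pos T g s" for r
    using jordan_pos_diff[OF T g, of s "?cl r"] st by auto
  have W: "total_variation g s (?cl r) - g (?cl r) = jordan_neg T g (?cl r) - jordan_pos T g s" for r
      proof -
    have "max 0 (min T (?cl r)) = ?cl r" using st by auto
    then show ?thesis unfolding V by (simp add: jordan_neg_def)
  qed
  have 1: "interval_measure (\<lambda>r. total_variation g s (?cl r)) = density (interval_measure (jordan_pos T g)) (indicator {s<..t})"
    by (rule interval_measure_clamped[OF mono_jordan(1)[OF T g] continuous_jordan_pos[OF T g]]) (use st V in auto)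
  have 2: "interval_measure (\<lambda>r. total_variation g s (?cl r) - g (?cl r)) = density (interval_measure (jordan_neg T g)) (indicator {s<..t})"
    by (rule interval_measure_clamped[OF mono_jordan(2)[OF T g] continuous_jordan_neg[OF T g]]) (use st W in auto)
  show ?thesis
    unfolding stieltjes_integral_def Let_def 1 2
    by (simp add: set_lebesgue_integral_density_indicator[OF _ fm])
qed

lemma bdd_measurableI:
  assumes "(\<lambda>x. indicator {s<..t} x * f x) \<in> borel_measurable borel"
    and "\<And>x. x \<in> {s<..t} \<Longrightarrow> \<bar>f x\<bar> \<le> C"
  shows "bdd_measurable s t f"
  using assms unfolding bdd_measurable_def by blast

lemma bdd_measurable_cong:
  assumes "\<And>x. x \<in> {s<..t} \<Longrightarrow> f x = f' x"
  shows "bdd_measurable s t f \<longleftrightarrow> bdd_measurable s t f'"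
proof -
  have "(\<lambda>x. indicator {s<..t} x * f x) = (\<lambda>x. indicator {s<..t} x * f' x)"
    using assms by (auto simp: indicator_def)
  then show ?thesis unfolding bdd_measurable_def using assms by auto
qed

lemma bdd_measurable_subset:
  assumes "bdd_measurable s t f" "s \<le> s'" "t' \<le> t"
  shows "bdd_measurable s' t' f"
proof -
  have "(\<lambda>x. indicator {s'<..t'} x * (indicator {s<..t} x * f x)) \<in> borel_measurable borel"
    by (rule borel_measurable_times) (use assms(1) in \<open>auto simp: bdd_measurable_def\<close>)
  also have "(\<lambda>x. indicator {s'<..t'} x * (indicator {s<..t} x * f x)) = (\<lambda>x. indicator {s'<..t'} x * f x)"
    using assms by (auto simp: indicator_def)
  finally show ?thesis using assms unfolding bdd_measurable_def by fastforce
qed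

lemma bdd_measurable_const: "bdd_measurable s t (\<lambda>_. c)"
  by (rule bdd_measurableI) auto

lemma bdd_measurable_add:
  assumes "bdd_measurable s t f" "bdd_measurable s t g"
  shows "bdd_measurable s t (\<lambda>x. f x + g x)"
proof -
  obtain C D where C: "\<And>x. x \<in> {s<..t} \<Longrightarrow> \<bar>f x\<bar> \<le> C" "\<And>x. x \<in> {s<..t} \<Longrightarrow> \<bar>g x\<bar> \<le> D"
    using assms unfolding bdd_measurable_def by blast
  show ?thesis
  proof (rule bdd_measurableI[where C = "C + D"])
    show "(\<lambda>x. indicator {s<..t} x * (f x + g x)) \<in> borel_measurable borel"
      unfolding distrib_left by (rule borel_measurable_add) (use assms in \<open>auto simp: bdd_measurable_def\<close>)
    fix x assume "x \<in> {s<..t}"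
    then show "\<bar>f x + g x\<bar> \<le> C + D" using C[of x] by linarith
  qed
qed

lemma bdd_measurable_mult:
  assumes "bdd_measurable s t f" "bdd_measurable s t g"
  shows "bdd_measurable s t (\<lambda>x. f x * g x)"
proof -
  obtain C D where C: "\<And>x. x \<in> {s<..t} \<Longrightarrow> \<bar>f x\<bar> \<le> C" "\<And>x. x \<in> {s<..t} \<Longrightarrow> \<bar>g x\<bar> \<le> D"
    using assms unfolding bdd_measurable_def by blast
  have eq: "(\<lambda>x. indicator {s<..t} x * (f x * g x)) =
      (\<lambda>x. (indicator {s<..t} x * f x) * (indicator {s<..t} x * g x))"
    by (auto simp: indicator_def)
  show ?thesis
  proof (rule bdd_measurableI[where C = "C * D"])
    show "(\<lambda>x. indicator {s<..t} x * (f x * g x)) \<in> borel_measurable borel"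
      unfolding eq by (rule borel_measurable_times) (use assms in \<open>auto simp: bdd_measurable_def\<close>)
    fix x assume "x \<in> {s<..t}"
    then have "\<bar>f x\<bar> \<le> C" "\<bar>g x\<bar> \<le> D" by (auto intro: C)
    then show "\<bar>f x * g x\<bar> \<le> C * D" unfolding abs_mult by (intro mult_mono) auto
  qed
qed

lemmas bdd_measurable_cmult = bdd_measurable_mult[OF bdd_measurable_const]

lemma bdd_measurable_diff:
  "bdd_measurable s t f \<Longrightarrow> bdd_measurable s t g \<Longrightarrow> bdd_measurable s t (\<lambda>x. f x - g x)"
  using bdd_measurable_add[of s t f "\<lambda>x. - 1 * g x"] bdd_measurable_cmult[of s t g "- 1"] by simp

lemma bdd_measurable_sum:
  "(\<And>i. i \<in> I \<Longrightarrow> bdd_measurable s t (f i)) \<Longrightarrow> bdd_measurable s t (\<lambda>x. \<Sum>i\<in>I. f i x)"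
  by (induction I rule: infinite_finite_induct) (auto intro: bdd_measurable_const bdd_measurable_add)

lemma stieltjes_integral_cong:
  assumes "\<And>x. x \<in> {s<..t} \<Longrightarrow> f x = f' x" "s \<le> t" "\<And>x. x \<in> {s..t} \<Longrightarrow> g x = g' x"
  shows "stieltjes_integral s t f g = stieltjes_integral s t f' g'"
proof -
  let ?cl = "\<lambda>r. max s (min t r)"
  have V: "total_variation g s (?cl r) = total_variation g' s (?cl r)" for r
  proof -
    have "(\<Sum>i<n. \<bar>g (p (Suc i)) - g (p i)\<bar>) = (\<Sum>i<n. \<bar>g' (p (Suc i)) - g' (p i)\<bar>)"
      if "p ` {..n} \<subseteq> {s..?cl r}" for n and p :: "nat \<Rightarrow> real"
    proof (rule sum.cong[OF refl])
      fix i assume "i \<in> {..<n}"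
      then have "p i \<in> p ` {..n}" "p (Suc i) \<in> p ` {..n}" by auto
      then have "p i \<in> {s..?cl r}" "p (Suc i) \<in> {s..?cl r}" using that by blast+
      moreover have "?cl r \<le> t" using assms(2) by auto
      ultimately have "p i \<in> {s..t}" "p (Suc i) \<in> {s..t}" by auto
      then show "\<bar>g (p (Suc i)) - g (p i)\<bar> = \<bar>g' (p (Suc i)) - g' (p i)\<bar>"
        by (simp add: assms(3))
    qed
    then have "variation_sums g s (?cl r) = variation_sums g' s (?cl r)"
      unfolding variation_sums_def by (intro Collect_cong) (metis (no_types, lifting))
    then show ?thesis unfolding total_variation_def by simp
  qed
  have W: "g (?cl r) = g' (?cl r)" for r using assms(2,3) by auto
  have S: "set_lebesgue_integral M {s<..t} f = set_lebesgue_integral M {s<..t} f'" for M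
    unfolding set_lebesgue_integral_def
    by (intro Bochner_Integration.integral_cong refl) (auto simp: indicator_def assms(1))
  show ?thesis unfolding stieltjes_integral_def Let_def V W S ..
qed

lemma stieltjes_integral_refl: "stieltjes_integral s s f g = 0"
  unfolding stieltjes_integral_def Let_def by (simp add: set_lebesgue_integral_def)

lemma set_integrable_bdd_measurable:
  assumes M: "sets M = sets borel" "emeasure M {s<..t} < \<infinity>" and f: "bdd_measurable s t f"
  shows "set_integrable M {s<..t} f"
proof -
  obtain C where C: "\<And>x. x \<in> {s<..t} \<Longrightarrow> \<bar>f x\<bar> \<le> C"
    using f unfolding bdd_measurable_def by blast
  have "integrable M (\<lambda>x. indicator {s<..t} x *\<^sub>R (indicator {s<..t} x * f x))"
    by (rule integrableI_bounded_set_indicator[where B = C])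
       (use M f C in \<open>auto simp: bdd_measurable_def measurable_cong_sets[OF M(1) refl] indicator_def\<close>)
  also have "(\<lambda>x. indicator {s<..t} x *\<^sub>R (indicator {s<..t} x * f x)) = (\<lambda>x. indicator {s<..t} x *\<^sub>R f x)"
    by (auto simp: indicator_def)
  finally show ?thesis unfolding set_integrable_def .
qed

context
  fixes T :: real and g :: "real \<Rightarrow> real" and s t :: real
  assumes g: "cont_bv T g" and st: "0 \<le> s" "s \<le> t" "t \<le> T"
begin

lemma emeasure_jordan_Ioc:
  assumes "0 \<le> a" "a \<le> b" "b \<le> T"
  shows "emeasure (interval_measure (jordan_pos T g)) {a<..b} = ennreal (total_variation g a b)"
    and "emeasure (interval_measure (jordan_neg T g)) {a<..b} = ennreal (total_variation g a b - (g b - g a))"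
proof -
  have T: "0 \<le> T" using st by simp
  have r: "continuous (at_right x) (jordan_pos T g)" "continuous (at_right x) (jordan_neg T g)" for x
    using continuous_jordan_pos[OF T g] continuous_jordan_neg[OF T g]
    by (simp_all add: continuous_on_eq_continuous_at continuous_at_imp_continuous_at_within)
  have "jordan_pos T g b - jordan_pos T g a = total_variation g a b"
    by (rule jordan_pos_diff[OF T g assms])
  then have "jordan_neg T g b - jordan_neg T g a = total_variation g a b - (g b - g a)"
    using assms by (simp add: jordan_neg_def)
  with \<open>jordan_pos T g b - _ = _\<close> show "emeasure (interval_measure (jordan_pos T g)) {a<..b} = ennreal (total_variation g a b)"
    "emeasure (interval_measure (jordan_neg T g)) {a<..b} = ennreal (total_variation g a b - (g b - g a))"
    using assms by (simp_all add: emeasure_interval_measure_Ioc_eq mono_jordan[OF T g] r)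
qed

lemma total_variation_bounds:
  shows "0 \<le> total_variation g s t" "\<bar>g t - g s\<bar> \<le> total_variation g s t"
  using abs_diff_le_total_variation[of 0 T g s t] g st by (auto simp: cont_bv_def)

lemma jordan_set_integrable:
  assumes "bdd_measurable s t f"
  shows "set_integrable (interval_measure (jordan_pos T g)) {s<..t} f"
    and "set_integrable (interval_measure (jordan_neg T g)) {s<..t} f"
  by (rule set_integrable_bdd_measurable; simp add: assms emeasure_jordan_Ioc[OF st])+

lemma stieltjes_integral_add:
  assumes "bdd_measurable s t f" "bdd_measurable s t h"
  shows "stieltjes_integral s t (\<lambda>x. f x + h x) g = stieltjes_integral s t f g + stieltjes_integral s t h g"
  using assms by (simp add: stieltjes_integral_eq[OF g st] bdd_measurable_add jordan_set_integrable)

lemma stieltjes_integral_cmult: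
  assumes "bdd_measurable s t f"
  shows "stieltjes_integral s t (\<lambda>x. c * f x) g = c * stieltjes_integral s t f g"
  using assms by (simp add: stieltjes_integral_eq[OF g st] bdd_measurable_cmult algebra_simps)

lemma stieltjes_integral_diff:
  assumes "bdd_measurable s t f" "bdd_measurable s t h"
  shows "stieltjes_integral s t (\<lambda>x. f x - h x) g = stieltjes_integral s t f g - stieltjes_integral s t h g"
  using assms by (simp add: stieltjes_integral_eq[OF g st] bdd_measurable_diff jordan_set_integrable)

lemma stieltjes_integral_const: "stieltjes_integral s t (\<lambda>_. c) g = c * (g t - g s)"
proof -
  have "stieltjes_integral s t (\<lambda>_. c) g = c * total_variation g s t - c * (total_variation g s t - (g t - g s))"
    using total_variation_bounds emeasure_jordan_Ioc[OF st]
    by (simp add: stieltjes_integral_eq[OF g st] bdd_measurable_const set_integral_const measure_def)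
  then show ?thesis by (simp add: algebra_simps)
qed

lemma stieltjes_integral_sum:
  "(\<And>i. i \<in> I \<Longrightarrow> bdd_measurable s t (f i)) \<Longrightarrow>
    stieltjes_integral s t (\<lambda>x. \<Sum>i\<in>I. f i x) g = (\<Sum>i\<in>I. stieltjes_integral s t (f i) g)"
  by (induction I rule: infinite_finite_induct)
     (auto simp: stieltjes_integral_add bdd_measurable_sum stieltjes_integral_const[of 0, simplified])

text \<open>The factor 3 is crude: the positive Jordan measure of \<open>{s<..t}\<close> is the
  total variation, and the negative one is at most twice that.\<close>

lemma stieltjes_integral_bound:
  assumes f: "bdd_measurable s t f" and C: "\<And>x. x \<in> {s<..t} \<Longrightarrow> \<bar>f x\<bar> \<le> C"
  shows "\<bar>stieltjes_integral s t f g\<bar> \<le> 3 * C * total_variation g s t"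
proof (cases "s < t")
  case True
  then have "\<bar>f t\<bar> \<le> C" using C[of t] by simp
  then have C0: "0 \<le> C" by linarith
  have b: "\<bar>set_lebesgue_integral M {s<..t} f\<bar> \<le> C * measure M {s<..t}"
    if M: "set_integrable M {s<..t} f" "emeasure M {s<..t} < \<infinity>" "sets M = sets borel" for M
  proof -
    have c: "set_integrable M {s<..t} (\<lambda>_. C)"
      by (rule set_integrable_bdd_measurable) (use M bdd_measurable_const in auto)
    have "norm (set_lebesgue_integral M {s<..t} f) \<le> set_lebesgue_integral M {s<..t} (\<lambda>_. C)"
      unfolding set_lebesgue_integral_def
      by (rule Bochner_Integration.integral_norm_bound_integral)
         (use M c C in \<open>auto simp: set_integrable_def indicator_def\<close>)
    also have "\<dots> = C * measure M {s<..t}"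
      using M by (subst set_integral_const) auto
    finally show ?thesis by simp
  qed
  have "\<bar>set_lebesgue_integral (interval_measure (jordan_pos T g)) {s<..t} f\<bar> \<le> C * total_variation g s t"
    using b[OF jordan_set_integrable(1)[OF f]] emeasure_jordan_Ioc[OF st] total_variation_bounds
    by (simp add: measure_def)
  moreover have "\<bar>set_lebesgue_integral (interval_measure (jordan_neg T g)) {s<..t} f\<bar>
      \<le> C * (total_variation g s t - (g t - g s))"
    using b[OF jordan_set_integrable(2)[OF f]] emeasure_jordan_Ioc[OF st] total_variation_bounds
    by (simp add: measure_def)
  moreover have "C * (total_variation g s t - (g t - g s)) \<le> C * (2 * total_variation g s t)"
    using C0 total_variation_bounds by (intro mult_left_mono) auto
  ultimately show ?thesis
    unfolding stieltjes_integral_eq[OF g st f] by (simp add: algebra_simps)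
next
  case False
  then show ?thesis using st by (simp add: stieltjes_integral_refl total_variation_refl)
qed

lemma stieltjes_integral_dominated_convergence:
  assumes f: "\<And>n. bdd_measurable s t (f n)" and h: "bdd_measurable s t h"
    and C: "\<And>n x. x \<in> {s<..t} \<Longrightarrow> \<bar>f n x\<bar> \<le> C"
    and lim: "\<And>x. x \<in> {s<..t} \<Longrightarrow> (\<lambda>n. f n x) \<longlonglongrightarrow> h x"
  shows "(\<lambda>n. stieltjes_integral s t (f n) g) \<longlonglongrightarrow> stieltjes_integral s t h g"
proof -
  have *: "(\<lambda>n. set_lebesgue_integral M {s<..t} (f n)) \<longlonglongrightarrow> set_lebesgue_integral M {s<..t} h"
    if M: "emeasure M {s<..t} < \<infinity>" "sets M = sets borel" for M
    unfolding set_lebesgue_integral_def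
  proof (rule integral_dominated_convergence[where w = "\<lambda>x. indicator {s<..t} x *\<^sub>R C"])
    show "integrable M (\<lambda>x. indicator {s<..t} x *\<^sub>R C)"
      using set_integrable_bdd_measurable[OF M(2,1) bdd_measurable_const] unfolding set_integrable_def .
    show "AE x in M. (\<lambda>n. indicator {s<..t} x *\<^sub>R f n x) \<longlonglongrightarrow> indicator {s<..t} x *\<^sub>R h x"
      using lim by (auto simp: indicator_def)
  qed (use f h C M in \<open>auto simp: bdd_measurable_def measurable_cong_sets[OF M(2) refl] indicator_def\<close>)
  show ?thesis
    unfolding stieltjes_integral_eq[OF g st f] stieltjes_integral_eq[OF g st h]
    by (intro tendsto_diff *) (auto simp: emeasure_jordan_Ioc[OF st])
qed

end

text \<open>All three integrals refer to the same two Jordan measures, so only additivity over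
  \<open>{s<..u} \<union> {u<..t}\<close> is left.\<close>

lemma stieltjes_integral_combine:
  assumes g: "cont_bv T g" and st: "0 \<le> s" "s \<le> u" "u \<le> t" "t \<le> T" and f: "bdd_measurable s t f"
  shows "stieltjes_integral s t f g = stieltjes_integral s u f g + stieltjes_integral u t f g"
proof -
  have un: "{s<..t} = {s<..u} \<union> {u<..t}" using st by auto
  have f1: "bdd_measurable s u f" and f2: "bdd_measurable u t f"
    using bdd_measurable_subset[OF f] st by auto
  have su: "0 \<le> s" "s \<le> u" "u \<le> T" and ut: "0 \<le> u" "u \<le> t" "t \<le> T" and s_t: "0 \<le> s" "s \<le> t" "t \<le> T"
    using st by auto
  show ?thesis
    unfolding stieltjes_integral_eq[OF g su f1] stieltjes_integral_eq[OF g ut f2] stieltjes_integral_eq[OF g s_t f] un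
    using jordan_set_integrable[OF g su f1] jordan_set_integrable[OF g ut f2]
    by (subst (1 2) set_integral_Un) auto
qed

lemma cont_bv_id: "0 \<le> T \<Longrightarrow> cont_bv T (\<lambda>r. r)"
proof -
  assume "0 \<le> T"
  have tel: "(\<Sum>i<n. \<bar>p (Suc i) - p i\<bar>) = p n - p 0" if "mono_on {..n} p" for n and p :: "nat \<Rightarrow> real"
    using that
  proof (induction n)
    case (Suc n)
    have "p n \<le> p (Suc n)" by (rule mono_onD[OF Suc.prems]) auto
    moreover have "mono_on {..n} p" by (rule mono_on_subset[OF Suc.prems]) auto
    ultimately show ?case using Suc.IH by simp
  qed simp
  have "bdd_above (variation_sums (\<lambda>r. r) 0 T)"
  proof (rule bdd_aboveI[where M = T])
    fix x assume "x \<in> variation_sums (\<lambda>r. r) 0 T"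
    then obtain n and p :: "nat \<Rightarrow> real" where x: "x = (\<Sum>i<n. \<bar>p (Suc i) - p i\<bar>)" and p: "mono_on {..n} p" "p ` {..n} \<subseteq> {0..T}"
      unfolding variation_sums_def by blast
    have "p n \<in> p ` {..n}" "p 0 \<in> p ` {..n}" by auto
    then have "p n \<in> {0..T}" "p 0 \<in> {0..T}" using p(2) by blast+
    then show "x \<le> T" unfolding x tel[OF p(1)] by auto
  qed
  then show ?thesis by (auto simp: cont_bv_def bounded_variation_on_def)
qed

section \<open>Subdivisions of an interval\<close>

definition nx :: "real set \<Rightarrow> real \<Rightarrow> real" where "nx Q s = Min {u\<in>Q. s < u}"

text \<open>The strict predecessor, so that \<open>u\<close> lies in the cell
  \<open>{pre Q u<..nx Q (pre Q u)}\<close>; these cells are half-open on the same side as the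
  domains of Stieltjes integrals.\<close>

definition pre :: "real set \<Rightarrow> real \<Rightarrow> real" where "pre Q u = Max {s\<in>Q. s < u}"

definition subdivision :: "real \<Rightarrow> real \<Rightarrow> real set \<Rightarrow> bool" where
  "subdivision a b Q \<longleftrightarrow> finite Q \<and> Q \<subseteq> {a..b} \<and> a \<in> Q \<and> b \<in> Q"

definition fine_subdivisions :: "real \<Rightarrow> real \<Rightarrow> (nat \<Rightarrow> real set) \<Rightarrow> bool" where
  "fine_subdivisions a b Q \<longleftrightarrow> (\<forall>n. subdivision a b (Q n)) \<and>
     (\<forall>\<delta>>0. \<forall>\<^sub>F n in sequentially. \<forall>s\<in>Q n. s < b \<longrightarrow> nx (Q n) s - s < \<delta>)"

lemma fine_subdivisionsD: "fine_subdivisions a b Q \<Longrightarrow> subdivision a b (Q n)"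
  by (simp add: fine_subdivisions_def)

context
  fixes a b :: real and Q :: "real set"
  assumes Q: "subdivision a b Q"
begin

lemma subdivision_finite: "finite Q" and subdivision_ends: "a \<in> Q" "b \<in> Q" "a \<le> b"
  and subdivision_bounds: "s \<in> Q \<Longrightarrow> a \<le> s" "s \<in> Q \<Longrightarrow> s \<le> b"
  using Q unfolding subdivision_def by auto

lemma nx_props:
  assumes "s < b"
  shows "nx Q s \<in> Q" "s < nx Q s" "nx Q s \<le> b"
proof -
  have "nx Q s \<in> {u\<in>Q. s < u}"
    unfolding nx_def by (rule Min_in) (use assms subdivision_finite subdivision_ends in auto)
  then show "nx Q s \<in> Q" "s < nx Q s" "nx Q s \<le> b" using subdivision_bounds by auto
qed

lemma nx_least: "u \<in> Q \<Longrightarrow> s < u \<Longrightarrow> nx Q s \<le> u"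
  unfolding nx_def by (rule Min_le) (use subdivision_finite in auto)

lemma pre_props:
  assumes "a < u"
  shows "pre Q u \<in> Q" "pre Q u < u" "a \<le> pre Q u"
proof -
  have "pre Q u \<in> {s\<in>Q. s < u}"
    unfolding pre_def by (rule Max_in) (use assms subdivision_finite subdivision_ends in auto)
  then show "pre Q u \<in> Q" "pre Q u < u" "a \<le> pre Q u" using subdivision_bounds by auto
qed

lemma pre_greatest: "s \<in> Q \<Longrightarrow> s < u \<Longrightarrow> s \<le> pre Q u"
  unfolding pre_def by (rule Max_ge) (use subdivision_finite in auto)

lemma pre_eq:
  assumes "s \<in> Q" "s < u" "u \<le> nx Q s"
  shows "pre Q u = s"
proof (rule antisym)
  have "a < u" using assms subdivision_bounds by force
  show "pre Q u \<le> s"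
  proof (rule ccontr)
    assume "\<not> pre Q u \<le> s"
    then have "nx Q s \<le> pre Q u" by (intro nx_least pre_props) (use \<open>a < u\<close> in auto)
    then show False using pre_props[OF \<open>a < u\<close>] assms by linarith
  qed
qed (use assms pre_greatest in auto)

lemma le_nx_pre:
  assumes "a < u" "u \<le> b"
  shows "pre Q u < b" "u \<le> nx Q (pre Q u)"
proof -
  show l: "pre Q u < b" using pre_props[OF assms(1)] assms by linarith
  show "u \<le> nx Q (pre Q u)"
  proof (rule ccontr)
    assume "\<not> u \<le> nx Q (pre Q u)"
    then have "nx Q (pre Q u) \<le> pre Q u" by (intro pre_greatest nx_props l) auto
    then show False using nx_props[OF l] by linarith
  qed
qed

lemma nx_pre: "u \<in> Q \<Longrightarrow> a < u \<Longrightarrow> nx Q (pre Q u) = u"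
  by (rule antisym) (use nx_least pre_props le_nx_pre subdivision_bounds in auto)

text \<open>The least point of \<open>Q\<close> that violates \<open>P\<close> is not
  \<open>a\<close>; its predecessor satisfies \<open>P\<close>, and stepping forward from there
  leads back to it.\<close>

lemma subdivision_induct_aux:
  assumes "r \<in> Q" and "P a" and step: "\<And>s. s \<in> Q \<Longrightarrow> s < b \<Longrightarrow> P s \<Longrightarrow> P (nx Q s)"
  shows "P r"
proof (rule ccontr)
  assume "\<not> P r"
  let ?B = "{r\<in>Q. \<not> P r}"
  have B: "Min ?B \<in> ?B" by (rule Min_in) (use subdivision_finite \<open>r \<in> Q\<close> \<open>\<not> P r\<close> in auto)
  then have "a < Min ?B" using subdivision_bounds[of "Min ?B"] \<open>P a\<close> by (cases "Min ?B = a") auto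
  note p = pre_props[OF this]
  have "P (pre Q (Min ?B))"
  proof (rule ccontr)
    assume "\<not> P (pre Q (Min ?B))"
    then have "Min ?B \<le> pre Q (Min ?B)" by (intro Min_le) (use p subdivision_finite in auto)
    then show False using p by linarith
  qed
  moreover have "pre Q (Min ?B) < b" using p B subdivision_bounds(2)[of "Min ?B"] by auto
  ultimately have "P (nx Q (pre Q (Min ?B)))" using p by (intro step) auto
  then show False using B nx_pre[of "Min ?B"] \<open>a < Min ?B\<close> by auto
qed

lemma nx_Collect_less:
  assumes "s \<in> Q" "s < b"
  shows "{r\<in>Q. r < nx Q s} = insert s {r\<in>Q. r < s}"
  using assms nx_props[OF assms(2)] nx_least[of _ s] by force

end

lemma subdivision_induct [consumes 2, case_names base step]:
  assumes "subdivision a b Q" "r \<in> Q" "P a"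
    and "\<And>s. s \<in> Q \<Longrightarrow> s < b \<Longrightarrow> P s \<Longrightarrow> P (nx Q s)"
  shows "P r"
  using subdivision_induct_aux[OF assms(1), of r P] assms(2-) by blast

lemma subdivision_telescope_upto:
  fixes \<phi> :: "real \<Rightarrow> 'b::real_vector"
  assumes Q: "subdivision a b Q" and r: "r \<in> Q"
  shows "(\<Sum>s\<in>{s\<in>Q. s < r}. \<phi> (nx Q s) - \<phi> s) = \<phi> r - \<phi> a"
  using Q r
proof (induction rule: subdivision_induct)
  case base
  have "{s\<in>Q. s < a} = {}" using subdivision_bounds[OF Q] by fastforce
  then show ?case by (metis sum.empty diff_self)
next
  case (step s)
  then show ?case by (simp add: nx_Collect_less[OF Q] subdivision_finite[OF Q])
qed

lemma subdivision_telescope: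
  fixes \<phi> :: "real \<Rightarrow> 'b::real_vector"
  assumes Q: "subdivision a b Q"
  shows "(\<Sum>s\<in>{s\<in>Q. s < b}. \<phi> (nx Q s) - \<phi> s) = \<phi> b - \<phi> a"
  by (rule subdivision_telescope_upto[OF Q subdivision_ends(2)[OF Q]])

lemma bdd_measurable_append:
  assumes "bdd_measurable s u f" "bdd_measurable u t f" "s \<le> u" "u \<le> t"
  shows "bdd_measurable s t f"
proof -
  obtain C D where C: "\<And>x. x \<in> {s<..u} \<Longrightarrow> \<bar>f x\<bar> \<le> C" "\<And>x. x \<in> {u<..t} \<Longrightarrow> \<bar>f x\<bar> \<le> D"
    using assms unfolding bdd_measurable_def by blast
  have eq: "(\<lambda>x. indicator {s<..t} x * f x) = (\<lambda>x. indicator {s<..u} x * f x + indicator {u<..t} x * f x)"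
    using assms(3,4) by (auto simp: indicator_def)
  show ?thesis
  proof (rule bdd_measurableI[where C = "max C D"])
    show "(\<lambda>x. indicator {s<..t} x * f x) \<in> borel_measurable borel"
      unfolding eq by (rule borel_measurable_add) (use assms in \<open>auto simp: bdd_measurable_def\<close>)
    fix x assume "x \<in> {s<..t}"
    then show "\<bar>f x\<bar> \<le> max C D" using C[of x] by fastforce
  qed
qed

lemma bdd_measurable_refl: "bdd_measurable s s f"
  by (rule bdd_measurableI) auto

lemma bdd_measurable_pieces:
  assumes Q: "subdivision a b Q"
    and h: "\<And>s. s \<in> Q \<Longrightarrow> s < b \<Longrightarrow> bdd_measurable s (nx Q s) (h s)"
  shows "bdd_measurable a b (\<lambda>u. h (pre Q u) u)"
proof -
  have "bdd_measurable a r (\<lambda>u. h (pre Q u) u)" if "r \<in> Q" for r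
    using Q that
  proof (induction rule: subdivision_induct)
    case (step s)
    have "bdd_measurable s (nx Q s) (\<lambda>u. h (pre Q u) u) \<longleftrightarrow> bdd_measurable s (nx Q s) (h s)"
      by (rule bdd_measurable_cong) (use pre_eq[OF Q step(1)] in auto)
    then show ?case
      using step h nx_props[OF Q] subdivision_bounds[OF Q]
      by (intro bdd_measurable_append[of a s _ "nx Q s"]) (auto intro: less_imp_le)
  qed (rule bdd_measurable_refl)
  then show ?thesis using subdivision_ends[OF Q] by blast
qed

text \<open>The selector \<open>pre Q u\<close> glues cellwise integrands into a single one. Sums
  over the cells of ever finer subdivisions thereby become integrals over one fixed interval, to
  which dominated convergence applies.\<close>

lemma stieltjes_integral_pieces:
  assumes g: "cont_bv T g" and ab: "0 \<le> a" "b \<le> T" and Q: "subdivision a b Q"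
    and h: "\<And>s. s \<in> Q \<Longrightarrow> s < b \<Longrightarrow> bdd_measurable s (nx Q s) (h s)"
  shows "stieltjes_integral a b (\<lambda>u. h (pre Q u) u) g =
    (\<Sum>s\<in>{s\<in>Q. s < b}. stieltjes_integral s (nx Q s) (h s) g)"
proof -
  let ?\<phi> = "\<lambda>r. stieltjes_integral a r (\<lambda>u. h (pre Q u) u) g"
  have "stieltjes_integral s (nx Q s) (h s) g = ?\<phi> (nx Q s) - ?\<phi> s" if s: "s \<in> Q" "s < b" for s
  proof -
    note n = nx_props[OF Q s(2)] and sb = subdivision_bounds[OF Q s(1)]
    have "bdd_measurable a (nx Q s) (\<lambda>u. h (pre Q u) u)"
      by (rule bdd_measurable_subset[OF bdd_measurable_pieces[OF Q h]]) (use n in auto)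
    then have "?\<phi> (nx Q s) = ?\<phi> s + stieltjes_integral s (nx Q s) (\<lambda>u. h (pre Q u) u) g"
      by (intro stieltjes_integral_combine[OF g]) (use n sb ab in auto)
    also have "stieltjes_integral s (nx Q s) (\<lambda>u. h (pre Q u) u) g = stieltjes_integral s (nx Q s) (h s) g"
      by (rule stieltjes_integral_cong) (use pre_eq[OF Q s(1)] n in auto)
    finally show ?thesis by simp
  qed
  then have "(\<Sum>s\<in>{s\<in>Q. s < b}. stieltjes_integral s (nx Q s) (h s) g) = ?\<phi> b - ?\<phi> a"
    using subdivision_telescope[OF Q, of ?\<phi>] by simp
  then show ?thesis by (simp add: stieltjes_integral_refl)
qed

lemma pre_tendsto:
  assumes Q: "fine_subdivisions a b Q" and u: "a < u" "u \<le> b"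
  shows "(\<lambda>n. pre (Q n) u) \<longlonglongrightarrow> u"
proof (rule tendstoI)
  fix e :: real assume "e > 0"
  note sub = fine_subdivisionsD[OF Q]
  have "\<forall>\<^sub>F n in sequentially. \<forall>s\<in>Q n. s < b \<longrightarrow> nx (Q n) s - s < e"
    using Q \<open>e > 0\<close> by (auto simp: fine_subdivisions_def)
  then show "\<forall>\<^sub>F n in sequentially. dist (pre (Q n) u) u < e"
  proof eventually_elim
    case (elim n)
    then show ?case
      using pre_props[OF sub u(1), of n] le_nx_pre[OF sub u, of n] by (auto simp: dist_real_def)
  qed
qed

lemma fine_subdivisions_exist:
  assumes "a < b"
  obtains Q where "fine_subdivisions a b Q"
proof
  let ?p = "\<lambda>n k. a + (b - a) * real k / real (Suc n)"
  let ?Q = "\<lambda>n. ?p n ` {..Suc n}"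
  have sub: "subdivision a b (?Q n)" for n
    unfolding subdivision_def
  proof (intro conjI)
    show "?Q n \<subseteq> {a..b}"
    proof
      fix x assume "x \<in> ?Q n"
      then obtain k where k: "k \<le> Suc n" "x = ?p n k" by auto
      have "real k / real (Suc n) \<le> 1" "0 \<le> real k / real (Suc n)" using k by (auto simp: divide_le_eq_1)
      then have "0 \<le> (b - a) * (real k / real (Suc n))" "(b - a) * (real k / real (Suc n)) \<le> b - a"
        using assms mult_left_le[of "real k / real (Suc n)" "b - a"] by auto
      then show "x \<in> {a..b}" unfolding k by simp
    qed
    show "a \<in> ?Q n" by (rule image_eqI[where x = 0]) auto
    show "b \<in> ?Q n" by (rule image_eqI[where x = "Suc n"]) auto
  qed auto
  have mesh: "nx (?Q n) s - s \<le> (b - a) / real (Suc n)" if s: "s \<in> ?Q n" "s < b" for n s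
  proof -
    obtain k where k: "k \<le> Suc n" "s = ?p n k" using s by auto
    have "?p n (Suc n) = b" by (simp del: of_nat_Suc)
    have "k \<noteq> Suc n"
    proof
      assume "k = Suc n"
      with k(2) \<open>?p n (Suc n) = b\<close> have "s = b" by (simp only:)
      then show False using s by simp
    qed
    then have "?p n (Suc k) \<in> ?Q n" using k by (intro image_eqI[where x = "Suc k"]) auto
    moreover have diff: "?p n (Suc k) - s = (b - a) / real (Suc n)"
      unfolding k by (simp add: diff_divide_distrib[symmetric] algebra_simps)
    moreover have "0 < (b - a) / real (Suc n)" using assms by simp
    ultimately have "nx (?Q n) s \<le> ?p n (Suc k)" by (intro nx_least[OF sub]) auto
    then show ?thesis using diff by linarith
  qed
  show "fine_subdivisions a b ?Q"
    unfolding fine_subdivisions_def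
  proof (intro conjI allI impI sub)
    fix \<delta> :: real assume "\<delta> > 0"
    have "(\<lambda>n. (b - a) / real (Suc n)) \<longlonglongrightarrow> 0"
      using tendsto_mult_right_zero[OF LIMSEQ_inverse_real_of_nat, of "b - a"] by (simp add: field_simps)
    then have "\<forall>\<^sub>F n in sequentially. (b - a) / real (Suc n) < \<delta>"
      using \<open>\<delta> > 0\<close> by (rule order_tendstoD)
    then show "\<forall>\<^sub>F n in sequentially. \<forall>s\<in>?Q n. s < b \<longrightarrow> nx (?Q n) s - s < \<delta>"
      by eventually_elim (use mesh in fastforce)
  qed
qed

text \<open>For integrals up to a time \<open>t\<close> that need not be a partition point: the cell
  reaching beyond \<open>t\<close> is cut off there, the earlier cells stay as they are.\<close>

lemma fine_subdivisions_truncate: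
  assumes P: "fine_subdivisions 0 T P" and t: "0 \<le> t" "t \<le> T"
    and Q: "Q = (\<lambda>n. insert t (P n \<inter> {0..t}))"
  shows "fine_subdivisions 0 t Q"
    and "\<And>n s. s \<in> P n \<Longrightarrow> s < t \<Longrightarrow> nx (Q n) s = min t (nx (P n) s)"
proof -
  note sub = fine_subdivisionsD[OF P]
  have subQ: "subdivision 0 t (Q n)" for n
    using sub[of n] t by (auto simp: subdivision_def Q)
  show nxQ: "nx (Q n) s = min t (nx (P n) s)" if s: "s \<in> P n" "s < t" for n s
  proof (rule antisym)
    have sT: "s < T" using s t by simp
    note n = nx_props[OF sub sT, of n] and q = nx_props[OF subQ s(2), of n]
    have "0 \<le> s" using s subdivision_bounds[OF sub] by auto
    then show "nx (Q n) s \<le> min t (nx (P n) s)"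
      using n s t nx_least[OF subQ, of "nx (P n) s" n s] nx_least[OF subQ, of t n s]
      by (cases "nx (P n) s \<le> t") (auto simp: Q)
    show "min t (nx (P n) s) \<le> nx (Q n) s"
      using q nx_least[OF sub, of "nx (Q n) s" n s] by (auto simp: Q)
  qed
  show "fine_subdivisions 0 t Q"
    unfolding fine_subdivisions_def
  proof (intro conjI allI impI subQ)
    fix \<delta> :: real assume "\<delta> > 0"
    then have "\<forall>\<^sub>F n in sequentially. \<forall>s\<in>P n. s < T \<longrightarrow> nx (P n) s - s < \<delta>"
      using P by (auto simp: fine_subdivisions_def)
    then show "\<forall>\<^sub>F n in sequentially. \<forall>s\<in>Q n. s < t \<longrightarrow> nx (Q n) s - s < \<delta>"
    proof eventually_elim
      case (elim n)
      show ?case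
      proof (intro ballI impI)
        fix s assume "s \<in> Q n" "s < t"
        then have s: "s \<in> P n" by (auto simp: Q)
        then show "nx (Q n) s - s < \<delta>" using elim nxQ[OF s \<open>s < t\<close>] \<open>s < t\<close> t by fastforce
      qed
    qed
  qed
qed

section \<open>Cadlag paths\<close>

lemma cadlag_pathsD:
  assumes "X \<in> cadlag_paths T U"
  shows "t \<in> {0..T} \<Longrightarrow> X t \<in> U"
    and "t \<in> {0..<T} \<Longrightarrow> (X \<longlongrightarrow> X t) (at_right t)"
    and "t \<in> {0<..T} \<Longrightarrow> \<exists>l\<in>U. (X \<longlongrightarrow> l) (at_left t)"
  using assms unfolding cadlag_paths_def by auto

lemma cadlag_paths_mono: "X \<in> cadlag_paths T K \<Longrightarrow> K \<subseteq> U \<Longrightarrow> X \<in> cadlag_paths T U"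
  unfolding cadlag_paths_def by blast

lemma cadlag_paths_cong:
  assumes "X \<in> cadlag_paths T U" and eq: "\<And>u. u \<in> {0..T} \<Longrightarrow> X u = Y u"
  shows "Y \<in> cadlag_paths T U"
  unfolding cadlag_paths_def
proof (intro CollectI conjI ballI)
  fix t assume "t \<in> {0..T}" then show "Y t \<in> U" using cadlag_pathsD(1)[OF assms(1)] eq by metis
next
  fix t assume t: "t \<in> {0..<T}"
  have "\<forall>\<^sub>F u in at_right t. X u = Y u"
    using t eventually_at_right_real[of t T] by (auto elim!: eventually_mono intro!: eq)
  then show "(Y \<longlongrightarrow> Y t) (at_right t)"
    using cadlag_pathsD(2)[OF assms(1) t] eq[of t] t tendsto_cong by fastforce
next
  fix t assume t: "t \<in> {0<..T}"
  have "\<forall>\<^sub>F u in at_left t. X u = Y u"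
    using t eventually_at_left_real[of 0 t] by (auto elim!: eventually_mono intro!: eq)
  then show "\<exists>l\<in>U. (Y \<longlongrightarrow> l) (at_left t)"
    using cadlag_pathsD(3)[OF assms(1) t] tendsto_cong by fast
qed

lemma cadlag_paths_const: "c \<in> U \<Longrightarrow> (\<lambda>_. c) \<in> cadlag_paths T U"
  unfolding cadlag_paths_def by (auto intro!: bexI[of _ c])

lemma cadlag_paths_continuous:
  assumes X: "continuous_on {0..T} X" "X ` {0..T} \<subseteq> U"
  shows "X \<in> cadlag_paths T U"
  unfolding cadlag_paths_def
proof (intro CollectI conjI ballI)
  fix t assume t: "t \<in> {0..<T}"
  then show "(X \<longlongrightarrow> X t) (at_right t)"
    using X(1) continuous_on_Icc_at_rightD[of t T X] continuous_on_subset[OF X(1), of "{t..T}"] by auto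
next
  fix t assume t: "t \<in> {0<..T}"
  then have "(X \<longlongrightarrow> X t) (at_left t)"
    using X(1) continuous_on_Icc_at_leftD[of 0 t X] continuous_on_subset[OF X(1), of "{0..t}"] by auto
  then show "\<exists>l\<in>U. (X \<longlongrightarrow> l) (at_left t)" using X t by (intro bexI[of _ "X t"]) auto
qed (use X in auto)

lemma cadlag_paths_glue:
  assumes X: "X \<in> cadlag_paths T U" and Y: "Y \<in> cadlag_paths T U"
  shows "(\<lambda>u. if u < a then X u else Y u) \<in> cadlag_paths T U"
  unfolding cadlag_paths_def
proof (intro CollectI conjI ballI)
  fix t assume t: "t \<in> {0..<T}"
  show "((\<lambda>u. if u < a then X u else Y u) \<longlongrightarrow> (if t < a then X t else Y t)) (at_right t)"
  proof (cases "t < a")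
    case True
    then have "\<forall>\<^sub>F u in at_right t. X u = (if u < a then X u else Y u)"
      using eventually_at_right_real[of t a] by (auto elim!: eventually_mono)
    then show ?thesis using cadlag_pathsD(2)[OF X t] True tendsto_cong by fastforce
  next
    case False
    then have "\<forall>\<^sub>F u in at_right t. Y u = (if u < a then X u else Y u)"
      using eventually_at_right_real[of t T] t by (auto elim!: eventually_mono)
    then show ?thesis using cadlag_pathsD(2)[OF Y t] False tendsto_cong by fastforce
  qed
next
  fix t assume t: "t \<in> {0<..T}"
  show "\<exists>l\<in>U. ((\<lambda>u. if u < a then X u else Y u) \<longlongrightarrow> l) (at_left t)"
  proof (cases "t \<le> a")
    case True
    then have "\<forall>\<^sub>F u in at_left t. X u = (if u < a then X u else Y u)"
      using eventually_at_left_real[of 0 t] t by (auto elim!: eventually_mono)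
    then show ?thesis using cadlag_pathsD(3)[OF X t] tendsto_cong by fast
  next
    case False
    then have "\<forall>\<^sub>F u in at_left t. Y u = (if u < a then X u else Y u)"
      using eventually_at_left_real[of a t] t by (auto elim!: eventually_mono)
    then show ?thesis using cadlag_pathsD(3)[OF Y t] tendsto_cong by fast
  qed
qed (use cadlag_pathsD(1)[OF X] cadlag_pathsD(1)[OF Y] in auto)

lemma stop_apply: "u \<in> {0..T} \<Longrightarrow> 0 \<le> t \<Longrightarrow> stop t X u = (if u < t then X u else X t)"
  unfolding stop_def by (auto simp: max_def min_def)

lemma stop_cong: "(\<And>u. u \<in> {0..t} \<Longrightarrow> X u = Y u) \<Longrightarrow> 0 \<le> t \<Longrightarrow> stop t X = stop t Y"
  unfolding stop_def by auto

lemma stop_stop: "0 \<le> s \<Longrightarrow> stop t (stop s X) = stop (min s t) X"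
  unfolding stop_def by (rule ext) (simp add: min_def max_def)

lemma cadlag_paths_stop:
  assumes X: "X \<in> cadlag_paths T U" and t: "0 \<le> t" "t \<le> T"
  shows "stop t X \<in> cadlag_paths T U"
proof (rule cadlag_paths_cong)
  show "(\<lambda>u. if u < t then X u else X t) \<in> cadlag_paths T U"
    by (rule cadlag_paths_glue[OF X cadlag_paths_const]) (use cadlag_pathsD(1)[OF X, of t] t in auto)
qed (use t stop_apply in metis)

text \<open>On either side of \<open>t\<close> the set of points of \<open>Q\<close> still ahead is
  locally constant: from the right it is the set at \<open>t\<close> itself, from the left it also
  contains \<open>t\<close> if \<open>t \<in> Q\<close>. Piecewise constant approximations are built
  in this form.\<close>

lemma cadlag_paths_step:
  assumes Q: "finite Q" and U: "\<And>u. u \<in> {0..T} \<Longrightarrow> \<phi> {x\<in>Q. u < x} \<in> U"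
  shows "(\<lambda>u. \<phi> {x\<in>Q. u < (x::real)}) \<in> cadlag_paths T U"
  unfolding cadlag_paths_def
proof (intro CollectI conjI ballI)
  fix t assume t: "t \<in> {0..<T}"
  have "\<forall>\<^sub>F u in at_right t. \<forall>x\<in>Q. u < x \<longleftrightarrow> t < x"
  proof (rule eventually_ball_finite[OF Q], rule ballI)
    fix x show "\<forall>\<^sub>F u in at_right t. u < x \<longleftrightarrow> t < x"
      using eventually_at_right_real[of t x] eventually_at_right_less[of t]
      by (cases "t < x") (auto elim!: eventually_mono)
  qed
  then have "\<forall>\<^sub>F u in at_right t. \<phi> {x\<in>Q. t < x} = \<phi> {x\<in>Q. u < x}"
    by eventually_elim (metis (mono_tags, lifting) Collect_cong)
  then show "((\<lambda>u. \<phi> {x\<in>Q. u < x}) \<longlongrightarrow> \<phi> {x\<in>Q. t < x}) (at_right t)"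
    using tendsto_cong tendsto_const by fast
next
  fix t assume t: "t \<in> {0<..T}"
  have "\<forall>\<^sub>F u in at_left t. \<forall>x\<in>Q. u < x \<longleftrightarrow> t \<le> x"
  proof (rule eventually_ball_finite[OF Q], rule ballI)
    fix x show "\<forall>\<^sub>F u in at_left t. u < x \<longleftrightarrow> t \<le> x"
    proof (cases "t \<le> x")
      case True
      then show ?thesis using eventually_at_left_real[of 0 t] t by (auto elim!: eventually_mono)
    next
      case False
      then show ?thesis using eventually_at_left_real[of x t] by (auto elim!: eventually_mono)
    qed
  qed
  then have ev: "\<forall>\<^sub>F u in at_left t. \<phi> {x\<in>Q. t \<le> x} = \<phi> {x\<in>Q. u < x}"
    by eventually_elim (metis (mono_tags, lifting) Collect_cong)
  have "\<forall>\<^sub>F u in at_left t. u \<in> {0<..<t}" using eventually_at_left_real[of 0 t] t by auto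
  with ev have "\<forall>\<^sub>F u in at_left t. \<phi> {x\<in>Q. t \<le> x} \<in> U"
    by eventually_elim (use U t in auto)
  \<comment> \<open>This set gives the value of the path just before \<open>t\<close>, which may
    differ from the value at \<open>t\<close> but is attained at earlier times and hence lies in
    \<open>U\<close>.\<close>
  then have "\<phi> {x\<in>Q. t \<le> x} \<in> U" by (simp add: trivial_limit_at_left_real eventually_const_iff)
  with ev show "\<exists>l\<in>U. ((\<lambda>u. \<phi> {x\<in>Q. u < x}) \<longlongrightarrow> l) (at_left t)"
    using tendsto_cong tendsto_const by fast
qed (use U in auto)

lemma cadlag_paths_closed:
  assumes X: "X \<in> cadlag_paths T V" and K: "closed K" "\<And>t. t \<in> {0..T} \<Longrightarrow> X t \<in> K"
  shows "X \<in> cadlag_paths T K"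
  unfolding cadlag_paths_def
proof (intro CollectI conjI ballI)
  fix t assume t: "t \<in> {0<..T}"
  obtain l where l: "(X \<longlongrightarrow> l) (at_left t)" using cadlag_pathsD(3)[OF X t] by blast
  have "\<forall>\<^sub>F u in at_left t. X u \<in> K"
    using eventually_at_left_real[of 0 t] t by (auto elim!: eventually_mono intro!: K)
  then have "l \<in> K" using Lim_in_closed_set[OF K(1) _ _ l] trivial_limit_at_left_real by blast
  then show "\<exists>l\<in>K. (X \<longlongrightarrow> l) (at_left t)" using l by blast
qed (use K cadlag_pathsD[OF X] in auto)

lemma cadlag_paths_add:
  assumes X: "X \<in> cadlag_paths T U" and Y: "Y \<in> cadlag_paths T V"
  shows "(\<lambda>u. X u + Y u) \<in> cadlag_paths T UNIV"
  unfolding cadlag_paths_def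
proof (intro CollectI conjI ballI)
  fix t assume t: "t \<in> {0<..T}"
  obtain l k where "(X \<longlongrightarrow> l) (at_left t)" "(Y \<longlongrightarrow> k) (at_left t)"
    using cadlag_pathsD(3)[OF X t] cadlag_pathsD(3)[OF Y t] by blast
  then show "\<exists>l\<in>UNIV. ((\<lambda>u. X u + Y u) \<longlongrightarrow> l) (at_left t)"
    by (blast intro: tendsto_add)
qed (use cadlag_pathsD(2)[OF X] cadlag_pathsD(2)[OF Y] in \<open>auto intro: tendsto_add\<close>)

lemma cadlag_paths_local:
  assumes X: "X \<in> cadlag_paths T U" and t: "t \<in> {0..T}" and e: "e > 0"
  obtains \<eta> l where "\<eta> > 0" "l \<in> U" "\<And>u. u \<in> {0..T} \<Longrightarrow> t - \<eta> < u \<Longrightarrow> u < t \<Longrightarrow> dist (X u) l < e"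
    "\<And>u. u \<in> {0..T} \<Longrightarrow> t \<le> u \<Longrightarrow> u < t + \<eta> \<Longrightarrow> dist (X u) (X t) < e"
proof -
  have "\<exists>\<eta>>0. \<forall>u\<in>{0..T}. t \<le> u \<longrightarrow> u < t + \<eta> \<longrightarrow> dist (X u) (X t) < e"
  proof (cases "t < T")
    case True
    then have "\<forall>\<^sub>F u in at_right t. dist (X u) (X t) < e"
      using cadlag_pathsD(2)[OF X, of t] t e by (auto dest: tendstoD)
    then obtain b where b: "b > t" "\<And>u. u > t \<Longrightarrow> u < b \<Longrightarrow> dist (X u) (X t) < e"
      unfolding eventually_at_right[OF True] by blast
    then have "dist (X u) (X t) < e" if "t \<le> u" "u < t + (b - t)" for u
      using that e by (cases "u = t") auto
    then show ?thesis using b by (intro exI[of _ "b - t"]) auto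
  next
    case False
    then show ?thesis using t e by (intro exI[of _ 1]) auto
  qed
  then obtain \<eta>1 where 1: "\<eta>1 > 0" "\<And>u. u \<in> {0..T} \<Longrightarrow> t \<le> u \<Longrightarrow> u < t + \<eta>1 \<Longrightarrow> dist (X u) (X t) < e" by blast
  have "\<exists>\<eta>>0. \<exists>l\<in>U. \<forall>u\<in>{0..T}. t - \<eta> < u \<longrightarrow> u < t \<longrightarrow> dist (X u) l < e"
  proof (cases "0 < t")
    case True
    then obtain l where l: "l \<in> U" "(X \<longlongrightarrow> l) (at_left t)" using cadlag_pathsD(3)[OF X, of t] t by auto
    then have "\<forall>\<^sub>F u in at_left t. dist (X u) l < e" using e by (auto dest: tendstoD)
    then obtain b where b: "b < t" "\<And>u. u > b \<Longrightarrow> u < t \<Longrightarrow> dist (X u) l < e"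
      unfolding eventually_at_left[OF True] by blast
    then show ?thesis using l by (intro exI[of _ "t - b"] conjI bexI[of _ l]) auto
  next
    case False
    then show ?thesis using t cadlag_pathsD(1)[OF X t] by (intro exI[of _ 1] conjI bexI[of _ "X t"]) auto
  qed
  then obtain \<eta>2 l where 2: "\<eta>2 > 0" "l \<in> U" "\<And>u. u \<in> {0..T} \<Longrightarrow> t - \<eta>2 < u \<Longrightarrow> u < t \<Longrightarrow> dist (X u) l < e" by blast
  show ?thesis
    by (rule that[of "min \<eta>1 \<eta>2" l]) (use 1 2 in auto)
qed

text \<open>Near each time the path stays in the union of a closed ball around its value and one
  around its left limit, both inside the open set \<open>U\<close>; by compactness of
  \<open>[0,T]\<close> finitely many times suffice. Functionals are assumed bounded only on paths
  with values in a compact set, so bounds along a given path start here.\<close>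

lemma cadlag_paths_compact:
  fixes X :: "'d::finite path"
  assumes X: "X \<in> cadlag_paths T U" and U: "open U"
  obtains K where "compact K" "K \<subseteq> U" "X \<in> cadlag_paths T K"
proof -
  have "\<exists>G K. open G \<and> t \<in> G \<and> compact K \<and> K \<subseteq> U \<and> X ` (G \<inter> {0..T}) \<subseteq> K" if t: "t \<in> {0..T}" for t
  proof -
    obtain e where e: "e > 0" "cball (X t) e \<subseteq> U"
      using open_contains_cball U cadlag_pathsD(1)[OF X t] by blast
    obtain \<eta>' l where l: "l \<in> U" "\<eta>' > 0" "\<And>u. u \<in> {0..T} \<Longrightarrow> t \<le> u \<Longrightarrow> u < t + \<eta>' \<Longrightarrow> dist (X u) (X t) < e"
      and l': "t > 0 \<Longrightarrow> (X \<longlongrightarrow> l) (at_left t)"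
    proof -
      obtain \<eta>' where "\<eta>' > 0" "\<And>u. u \<in> {0..T} \<Longrightarrow> t \<le> u \<Longrightarrow> u < t + \<eta>' \<Longrightarrow> dist (X u) (X t) < e"
        using cadlag_paths_local[OF X t e(1)] by metis
      moreover obtain l where "l \<in> U" "t > 0 \<Longrightarrow> (X \<longlongrightarrow> l) (at_left t)"
        using cadlag_pathsD(1,3)[OF X, of t] t by (cases "t > 0") auto
      ultimately show ?thesis using that by blast
    qed
    obtain e' where e': "e' > 0" "cball l e' \<subseteq> U"
      using open_contains_cball U l(1) by blast
    have "\<exists>\<eta>''>0. \<forall>u\<in>{0..T}. t - \<eta>'' < u \<longrightarrow> u < t \<longrightarrow> dist (X u) l < e'"
    proof (cases "t > 0")
      case True
      then have "\<forall>\<^sub>F u in at_left t. dist (X u) l < e'" using l' e' by (auto dest: tendstoD)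
      then obtain b where "b < t" "\<And>u. u > b \<Longrightarrow> u < t \<Longrightarrow> dist (X u) l < e'"
        unfolding eventually_at_left[OF True] by blast
      then show ?thesis by (intro exI[of _ "t - b"]) auto
    qed (auto intro: exI[of _ 1])
    then obtain \<eta>'' where \<eta>'': "\<eta>'' > 0" "\<And>u. u \<in> {0..T} \<Longrightarrow> t - \<eta>'' < u \<Longrightarrow> u < t \<Longrightarrow> dist (X u) l < e'" by blast
    have "X u \<in> cball (X t) e \<union> cball l e'" if "u \<in> {t - \<eta>''<..<t + \<eta>'} \<inter> {0..T}" for u
      using l(3)[of u] \<eta>''(2)[of u] that by (cases "u < t") (auto simp: dist_commute less_imp_le)
    then have "X ` ({t - \<eta>''<..<t + \<eta>'} \<inter> {0..T}) \<subseteq> cball (X t) e \<union> cball l e'" by blast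
    then show ?thesis
      by (intro exI[of _ "{t - \<eta>''<..<t + \<eta>'}"] exI[of _ "cball (X t) e \<union> cball l e'"] conjI)
         (use e e' l(2) \<eta>''(1) in \<open>auto intro: compact_Un\<close>)
  qed
  then obtain G K where GK: "\<And>t. t \<in> {0..T} \<Longrightarrow> open (G t) \<and> t \<in> G t \<and> compact (K t) \<and> K t \<subseteq> U \<and> X ` (G t \<inter> {0..T}) \<subseteq> K t"
    by metis
  have "{0..T} \<subseteq> (\<Union>t\<in>{0..T}. G t)" using GK by auto
  then obtain D where D: "D \<subseteq> {0..T}" "finite D" "{0..T} \<subseteq> (\<Union>t\<in>D. G t)"
    using compactE_image[OF compact_Icc, of "{0..T}" G 0 T] GK by metis
  have c: "compact (\<Union>t\<in>D. K t)" using D GK by (intro compact_UN) auto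
  moreover have "(\<Union>t\<in>D. K t) \<subseteq> U" using D GK by blast
  moreover have "X \<in> cadlag_paths T (\<Union>t\<in>D. K t)"
  proof (rule cadlag_paths_closed[OF X compact_imp_closed[OF c]])
    fix u assume u: "u \<in> {0..T}"
    then obtain t where t: "t \<in> D" "u \<in> G t" using D by blast
    then have "X u \<in> X ` (G t \<inter> {0..T})" using u by auto
    then show "X u \<in> (\<Union>t\<in>D. K t)" using GK[of t] t D by blast
  qed
  ultimately show ?thesis by (rule that)
qed

text \<open>The compact set of \<open>X\<close> is enlarged by closed balls of one radius, so that a
  single compact set serves all uniformly close paths and bounds become uniform along approximating
  sequences.\<close>

lemma cadlag_paths_neighbourhood:
  fixes X :: "'d::finite path"
  assumes X: "X \<in> cadlag_paths T U" and U: "open U"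
  obtains K \<delta> where "compact K" "K \<subseteq> U" "\<delta> > 0"
    "\<And>V Y. Y \<in> cadlag_paths T V \<Longrightarrow> (\<And>u. u \<in> {0..T} \<Longrightarrow> norm (Y u - X u) \<le> \<delta>) \<Longrightarrow> Y \<in> cadlag_paths T K"
proof -
  obtain K where K: "compact K" "K \<subseteq> U" "X \<in> cadlag_paths T K"
    using cadlag_paths_compact[OF assms] .
  obtain e where e: "e > 0" "(\<Union>x\<in>K. cball x e) \<subseteq> U"
    using compact_subset_open_imp_cball_epsilon_subset[OF K(1) U K(2)] by blast
  let ?K = "\<Union>x\<in>K. cball x e"
  have c: "compact ?K" using K by (intro compact_minkowski_sum_cball)
  show ?thesis
  proof (rule that[OF c e(2,1)])
    fix V Y assume Y: "Y \<in> cadlag_paths T V" "\<And>u. u \<in> {0..T} \<Longrightarrow> norm (Y u - X u) \<le> e"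
    show "Y \<in> cadlag_paths T ?K"
    proof (rule cadlag_paths_closed[OF Y(1) compact_imp_closed[OF c]])
      fix t assume t: "t \<in> {0..T}"
      have "Y t \<in> cball (X t) e" using Y(2)[OF t] by (simp add: dist_norm norm_minus_commute)
      then show "Y t \<in> ?K" using cadlag_pathsD(1)[OF K(3) t] by blast
    qed
  qed
qed

section \<open>Bumps, oscillation and the supremum norm of cadlag paths\<close>

lemma cadlag_paths_bump:
  assumes X: "X \<in> cadlag_paths T U" and t: "0 \<le> t"
  shows "bump T t v X \<in> cadlag_paths T UNIV"
proof (rule cadlag_paths_cong)
  show "(\<lambda>u. if u < t then X u else X u + v) \<in> cadlag_paths T UNIV"
    by (intro cadlag_paths_glue cadlag_paths_add[OF X cadlag_paths_const] cadlag_paths_mono[OF X]) auto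
qed (auto simp: bump_def)

lemma bump_apply: "u \<in> {0..T} \<Longrightarrow> bump T t v X u = (if u < t then X u else X u + v)"
  by (auto simp: bump_def)

text \<open>A path whose values and left limits lie in the open set \<open>U\<close> keeps a
  positive distance from its complement. Vertical derivatives at \<open>X\<close> thus involve only
  admissible paths.\<close>

lemma cadlag_paths_bump_small:
  fixes X :: "'d::finite path"
  assumes X: "X \<in> cadlag_paths T U" and U: "open U" and t: "0 \<le> t"
  shows "\<forall>\<^sub>F v in nhds 0. bump T t v X \<in> cadlag_paths T U"
proof -
  obtain K \<delta> where K: "compact K" "K \<subseteq> U" "\<delta> > 0"
    "\<And>V Y. Y \<in> cadlag_paths T V \<Longrightarrow> (\<And>u. u \<in> {0..T} \<Longrightarrow> norm (Y u - X u) \<le> \<delta>) \<Longrightarrow> Y \<in> cadlag_paths T K"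
    using cadlag_paths_neighbourhood[OF X U] by metis
  have "bump T t v X \<in> cadlag_paths T U" if "dist v 0 < \<delta>" for v
    by (rule cadlag_paths_mono[OF K(4)[OF cadlag_paths_bump[OF X t]] K(2)])
       (use that K(3) in \<open>auto simp: bump_apply\<close>)
  then show ?thesis using K(3) unfolding eventually_nhds_metric by blast
qed

lemma cadlag_paths_bounded:
  assumes X: "X \<in> cadlag_paths T U"
  shows "bounded ((X :: 'd::finite path) ` {0..T})"
proof -
  obtain K where "compact K" "X \<in> cadlag_paths T K"
    using cadlag_paths_compact[OF cadlag_paths_mono[OF X subset_UNIV] open_UNIV] by blast
  then show ?thesis using cadlag_pathsD(1) by (metis bounded_subset compact_imp_bounded image_subsetI)
qed

text \<open>The subdivision collects the centres \<open>t\<close> of a finite cover by intervals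
  \<open>(t - \<eta> t, t + \<eta> t)\<close> together with their right ends. A cell that starts to
  the left of the centre covering its start ends at or before that centre; any other one ends at or
  before the right end, or at \<open>T\<close>. In each case one of the two one-sided estimates with
  \<open>e/2\<close> holds on the whole cell.\<close>

lemma cadlag_paths_finite_oscillation:
  fixes X :: "'d::finite path"
  assumes X: "X \<in> cadlag_paths T U" and T: "0 \<le> T" and e: "e > 0"
  obtains Q where "subdivision 0 T Q"
    "\<And>s u. s \<in> Q \<Longrightarrow> s < T \<Longrightarrow> s \<le> u \<Longrightarrow> u < nx Q s \<Longrightarrow> norm (X u - X s) < e"
proof -
  have "\<exists>\<eta>>0. \<exists>l. (\<forall>u\<in>{0..T}. t - \<eta> < u \<longrightarrow> u < t \<longrightarrow> dist (X u) l < e/2) \<and>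
     (\<forall>u\<in>{0..T}. t \<le> u \<longrightarrow> u < t + \<eta> \<longrightarrow> dist (X u) (X t) < e/2)" if t: "t \<in> {0..T}" for t
    using cadlag_paths_local[OF X t, of "e/2"] e by (metis half_gt_zero)
  then obtain \<eta> l where \<eta>: "\<And>t. t \<in> {0..T} \<Longrightarrow> \<eta> t > 0"
    and left: "\<And>t u. t \<in> {0..T} \<Longrightarrow> u \<in> {0..T} \<Longrightarrow> t - \<eta> t < u \<Longrightarrow> u < t \<Longrightarrow> dist (X u) (l t) < e/2"
    and right: "\<And>t u. t \<in> {0..T} \<Longrightarrow> u \<in> {0..T} \<Longrightarrow> t \<le> u \<Longrightarrow> u < t + \<eta> t \<Longrightarrow> dist (X u) (X t) < e/2"
    by metis
  have "{0..T} \<subseteq> (\<Union>t\<in>{0..T}. {t - \<eta> t<..<t + \<eta> t})" using \<eta> by force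
  then obtain D where D: "D \<subseteq> {0..T}" "finite D" "{0..T} \<subseteq> (\<Union>t\<in>D. {t - \<eta> t<..<t + \<eta> t})"
    using compactE_image[OF compact_Icc, of "{0..T}" "\<lambda>t. {t - \<eta> t<..<t + \<eta> t}" 0 T] by auto
  let ?Q = "{0, T} \<union> (D \<union> (\<lambda>t. t + \<eta> t) ` D) \<inter> {0..T}"
  have Q: "subdivision 0 T ?Q" using D T by (auto simp: subdivision_def)
  show ?thesis
  proof (rule that[OF Q])
    fix s u assume s: "s \<in> ?Q" "s < T" and u: "s \<le> u" "u < nx ?Q s"
    have sI: "s \<in> {0..T}" using subdivision_bounds[OF Q s(1)] by auto
    have uI: "u \<in> {0..T}" using u sI nx_props[OF Q s(2)] by auto
    obtain t where t: "t \<in> D" "t - \<eta> t < s" "s < t + \<eta> t" using D sI by auto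
    have tI: "t \<in> {0..T}" using t D by auto
    show "norm (X u - X s) < e"
    proof (cases "s < t")
      case True
      then have "nx ?Q s \<le> t" using t tI by (intro nx_least[OF Q]) auto
      then have "dist (X u) (l t) < e/2" "dist (X s) (l t) < e/2"
        using left[OF tI uI] left[OF tI sI] u t True by auto
      then show ?thesis by (metis dist_norm dist_triangle_half_l)
    next
      case False
      have "u < t + \<eta> t"
      proof (cases "t + \<eta> t \<le> T")
        case True
        then have "nx ?Q s \<le> t + \<eta> t" using t tI \<eta>[OF tI] by (intro nx_least[OF Q]) auto
        then show ?thesis using u by linarith
      next
        case False
        then show ?thesis using uI by auto
      qed
      then have "dist (X u) (X t) < e/2" "dist (X s) (X t) < e/2"
        using right[OF tI uI] right[OF tI sI] u t False by auto
      then show ?thesis by (metis dist_norm dist_triangle_half_l)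
    qed
  qed
qed

lemma sup_norm_le: "0 \<le> T \<Longrightarrow> (\<And>u. u \<in> {0..T} \<Longrightarrow> norm (X u) \<le> c) \<Longrightarrow> sup_norm T X \<le> c"
  unfolding sup_norm_def by (rule cSUP_least) auto

lemma norm_le_sup_norm:
  assumes "bounded ((X :: 'd::finite path) ` {0..T})" "u \<in> {0..T}"
  shows "norm (X u) \<le> sup_norm T X"
  unfolding sup_norm_def
proof (rule cSUP_upper[OF assms(2)])
  obtain B where "\<And>x. x \<in> X ` {0..T} \<Longrightarrow> norm x \<le> B" using assms(1) unfolding bounded_iff by blast
  then show "bdd_above ((\<lambda>u. norm (X u)) ` {0..T})" by (auto intro!: bdd_aboveI[where M = B])
qed

lemma norm_diff_le_sup_norm:
  fixes X Y :: "'d::finite path"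
  assumes "X \<in> cadlag_paths T U" "Y \<in> cadlag_paths T V" "u \<in> {0..T}"
  shows "norm (X u - Y u) \<le> sup_norm T (\<lambda>u. X u - Y u)"
proof (rule norm_le_sup_norm[OF _ assms(3)])
  show "bounded ((\<lambda>u. X u - Y u) ` {0..T})"
    using bounded_minus_comp[OF cadlag_paths_bounded[OF assms(1)] cadlag_paths_bounded[OF assms(2)]] .
qed

section \<open>Continuity of functionals along sequences\<close>

text \<open>If uniformity failed, then for infinitely many \<open>n\<close> some point would violate
  it; such points, completed arbitrarily for the other \<open>n\<close>, form a sequence that
  contradicts the assumption. Continuity that is locally uniform in time is exploited through such
  moving times.\<close>

lemma uniform_limit_sequences:
  fixes f :: "nat \<Rightarrow> 'a \<Rightarrow> 'b::real_normed_vector"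
  assumes "\<And>u. (\<And>n. u n \<in> S) \<Longrightarrow> (\<lambda>n. f n (u n) - l (u n)) \<longlonglongrightarrow> 0"
  shows "uniform_limit S f l sequentially"
proof (rule ccontr)
  assume "\<not> uniform_limit S f l sequentially"
  then obtain e where e: "e > 0" "\<exists>\<^sub>F n in sequentially. \<exists>x\<in>S. \<not> dist (f n x) (l x) < e"
    unfolding uniform_limit_iff frequently_def by auto
  obtain n0 x0 where "x0 \<in> S" using frequently_ex[OF e(2)] by blast
  define u where "u n = (if \<exists>x\<in>S. \<not> dist (f n x) (l x) < e then SOME x. x \<in> S \<and> \<not> dist (f n x) (l x) < e else x0)" for n
  have u: "u n \<in> S \<and> ((\<exists>x\<in>S. \<not> dist (f n x) (l x) < e) \<longrightarrow> \<not> dist (f n (u n)) (l (u n)) < e)" for n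
  proof (cases "\<exists>x\<in>S. \<not> dist (f n x) (l x) < e")
    case True
    then have "\<exists>x. x \<in> S \<and> \<not> dist (f n x) (l x) < e" by blast
    from someI_ex[OF this] show ?thesis using True by (simp add: u_def)
  qed (auto simp: u_def \<open>x0 \<in> S\<close>)
  have "\<forall>\<^sub>F n in sequentially. dist (f n (u n) - l (u n)) 0 < e"
    using assms[of u] u e(1) by (blast dest: tendstoD)
  then have "\<forall>\<^sub>F n in sequentially. \<not> (\<exists>x\<in>S. \<not> dist (f n x) (l x) < e)"
    by eventually_elim (use u in \<open>simp add: dist_norm, blast\<close>)
  then show False using e(2) unfolding frequently_def by blast
qed

lemma uniform_limit_norm:
  fixes f :: "nat \<Rightarrow> 'a \<Rightarrow> 'b::real_normed_vector"
  shows "uniform_limit S f l F \<longleftrightarrow> (\<forall>e>0. \<forall>\<^sub>F n in F. \<forall>x\<in>S. norm (f n x - l x) < e)"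
  by (simp add: uniform_limit_iff dist_norm)

lemma uniform_limit_normD:
  fixes f :: "nat \<Rightarrow> 'a \<Rightarrow> 'b::real_normed_vector"
  shows "uniform_limit S f l F \<Longrightarrow> e > 0 \<Longrightarrow> \<forall>\<^sub>F n in F. \<forall>x\<in>S. norm (f n x - l x) < e"
  unfolding uniform_limit_norm by blast

lemma uniform_limit_inverse_Suc:
  fixes f :: "nat \<Rightarrow> 'a \<Rightarrow> 'b::real_normed_vector"
  assumes "\<And>n u. u \<in> S \<Longrightarrow> norm (f n u - l u) < inverse (real (Suc n))"
  shows "uniform_limit S f l sequentially"
  unfolding uniform_limit_norm
proof (intro allI impI)
  fix e :: real assume "e > 0"
  then have "\<forall>\<^sub>F n in sequentially. inverse (real (Suc n)) < e"
    using LIMSEQ_inverse_real_of_nat by (rule order_tendstoD(2)[rotated])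
  then show "\<forall>\<^sub>F n in sequentially. \<forall>u\<in>S. norm (f n u - l u) < e"
  proof eventually_elim
    case (elim n)
    show ?case using assms[of _ n] elim by (meson less_trans)
  qed
qed

lemma uniform_limit_stop:
  fixes Y :: "nat \<Rightarrow> real \<Rightarrow> 'b::real_normed_vector"
  assumes Y: "uniform_limit {0..T} Y X sequentially" and s: "\<And>n. s n \<in> {0..T}"
  shows "uniform_limit {0..T} (\<lambda>n u. stop (s n) (Y n) u - stop (s n) X u) (\<lambda>_. 0) sequentially"
  unfolding uniform_limit_norm
proof (intro allI impI)
  fix e :: real assume "e > 0"
  then have "\<forall>\<^sub>F n in sequentially. \<forall>u\<in>{0..T}. norm (Y n u - X u) < e"
    using Y unfolding uniform_limit_norm by blast
  then show "\<forall>\<^sub>F n in sequentially. \<forall>u\<in>{0..T}. norm (stop (s n) (Y n) u - stop (s n) X u - 0) < e"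
    by eventually_elim (use s in \<open>auto simp: stop_def min_def max_def\<close>)
qed

lemma uniform_limit_stop_const:
  fixes Y :: "nat \<Rightarrow> real \<Rightarrow> 'b::real_normed_vector"
  assumes "uniform_limit {0..T} Y X sequentially" "s \<in> {0..T}"
  shows "uniform_limit {0..T} (\<lambda>n. stop s (Y n)) (stop s X) sequentially"
  using uniform_limit_stop[OF assms(1), of "\<lambda>_. s", OF assms(2)] by (simp only: uniform_limit_norm diff_0_right)

lemma ex_eta_sequence:
  assumes "\<And>\<eta>::real. \<eta> > 0 \<Longrightarrow> \<exists>x. P \<eta> x"
  obtains x where "\<And>n::nat. P (inverse (real (Suc n))) (x n)"
proof -
  have "\<forall>n::nat. \<exists>x. P (inverse (real (Suc n))) x" using assms by simp
  then show ?thesis using that by metis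
qed

lemma CBV_stop:
  assumes A: "A \<in> CBV T m S" and t: "t \<in> {0..T}"
  shows "stop t A \<in> CBV T m S"
  unfolding CBV_def
proof (intro CollectI conjI ballI allI impI)
  fix s assume "s \<in> {0..T}"
  then show "stop t A s \<in> S" using A t by (auto simp: CBV_def stop_def)
next
  fix i assume i: "i < m"
  have c: "continuous_on {0..T} (\<lambda>t. A t i)" and b: "bounded_variation_on 0 T (\<lambda>t. A t i)"
    using A i by (auto simp: CBV_def)
  show "continuous_on {0..T} (\<lambda>s. stop t A s i)"
    unfolding stop_def by (rule continuous_on_compose2[OF c]) (use t in \<open>auto intro!: continuous_intros\<close>)
  have "variation_sums (\<lambda>s. stop t A s i) 0 T \<subseteq> variation_sums (\<lambda>s. A s i) 0 T"
  proof
    fix x assume "x \<in> variation_sums (\<lambda>s. stop t A s i) 0 T"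
    then obtain n p where x: "x = (\<Sum>k<n. \<bar>stop t A (p (Suc k)) i - stop t A (p k) i\<bar>)"
      and p: "mono_on {..n} p" "p ` {..n} \<subseteq> {0..T}" unfolding variation_sums_def by blast
    have x': "x = (\<Sum>k<n. \<bar>A (max 0 (min t (p (Suc k)))) i - A (max 0 (min t (p k))) i\<bar>)"
      unfolding x stop_def ..
    show "x \<in> variation_sums (\<lambda>s. A s i) 0 T"
      unfolding x'
      by (rule variation_sums_memI[of n "\<lambda>k. max 0 (min t (p k))" 0 T "\<lambda>s. A s i"])
         (use t in \<open>auto intro!: mono_onI max.mono min.mono mono_onD[OF p(1)]\<close>)
  qed
  then show "bounded_variation_on 0 T (\<lambda>s. stop t A s i)"
    using b unfolding bounded_variation_on_def by (metis bdd_above_mono)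
qed

lemma cont_bv_integrator:
  assumes "A \<in> CBV T m S" "i \<le> m" "0 \<le> T"
  shows "cont_bv T (integrator A i)"
proof (cases i)
  case 0
  then show ?thesis using cont_bv_id[OF assms(3)] by (simp add: integrator_def[abs_def])
next
  case (Suc j)
  then show ?thesis using assms by (auto simp: integrator_def[abs_def] CBV_def cont_bv_def)
qed

text \<open>Increments of the integral are dominated by a multiple of those of the total variation,
  which is continuous.\<close>

lemma continuous_on_stieltjes_integral:
  assumes g: "cont_bv T g" and f: "bdd_measurable 0 T f" and T: "0 \<le> T"
  shows "continuous_on {0..T} (\<lambda>u. stieltjes_integral 0 u f g)"
proof -
  obtain C where C: "\<And>x. x \<in> {0<..T} \<Longrightarrow> \<bar>f x\<bar> \<le> C" using f unfolding bdd_measurable_def by blast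
  define C' where "C' = \<bar>C\<bar>"
  have C': "\<bar>f x\<bar> \<le> C'" if "x \<in> {0<..T}" for x using C[OF that] unfolding C'_def by linarith
  let ?V = "total_variation g 0"
  have V: "continuous_on {0..T} ?V"
    using g continuous_on_total_variation by (simp add: cont_bv_def)
  have inc: "\<bar>stieltjes_integral 0 v f g - stieltjes_integral 0 u f g\<bar> \<le> 3 * C' * \<bar>?V v - ?V u\<bar>"
    if uv: "u \<in> {0..T}" "v \<in> {0..T}" "u \<le> v" for u v
  proof -
    have fv: "bdd_measurable 0 v f" "bdd_measurable u v f" by (rule bdd_measurable_subset[OF f]; use uv in simp)+
    have "stieltjes_integral 0 v f g = stieltjes_integral 0 u f g + stieltjes_integral u v f g"
      by (rule stieltjes_integral_combine[OF g]) (use uv fv in auto)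
    moreover have "\<bar>stieltjes_integral u v f g\<bar> \<le> 3 * C' * total_variation g u v"
      by (rule stieltjes_integral_bound[OF g]) (use uv fv in \<open>auto intro!: C'\<close>)
    moreover have "?V v = ?V u + total_variation g u v"
      by (rule total_variation_add) (use uv g bounded_variation_on_subset in \<open>auto simp: cont_bv_def\<close>)
    moreover have "0 \<le> total_variation g u v"
      by (rule total_variation_bounds[OF g]) (use uv in auto)
    ultimately show ?thesis by simp
  qed
  have inc': "\<bar>stieltjes_integral 0 v f g - stieltjes_integral 0 u f g\<bar> \<le> 3 * C' * \<bar>?V v - ?V u\<bar>"
    if "u \<in> {0..T}" "v \<in> {0..T}" for u v
  proof (cases "u \<le> v")
    case False
    then show ?thesis using inc[of v u] that by (simp add: abs_minus_commute)
  qed (use inc that in auto)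
  show ?thesis
    unfolding continuous_on_sequentially comp_def
  proof (intro allI ballI impI)
    fix x a assume xa: "a \<in> {0..T}" "(\<forall>n. x n \<in> {0..T}) \<and> x \<longlonglongrightarrow> a"
    have "(\<lambda>n. ?V (x n)) \<longlonglongrightarrow> ?V a"
      using V xa unfolding continuous_on_sequentially comp_def by blast
    then have "(\<lambda>n. 3 * C' * \<bar>?V (x n) - ?V a\<bar>) \<longlonglongrightarrow> 3 * C' * \<bar>?V a - ?V a\<bar>"
      by (intro tendsto_intros)
    then have *: "(\<lambda>n. 3 * C' * \<bar>?V (x n) - ?V a\<bar>) \<longlonglongrightarrow> 0" by (simp only: diff_self abs_zero mult_zero_right)
    have "norm (stieltjes_integral 0 (x n) f g - stieltjes_integral 0 a f g) \<le> 3 * C' * \<bar>?V (x n) - ?V a\<bar>" for n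
      using inc'[OF xa(1)] xa(2) by (simp only: real_norm_def)
    then have "(\<lambda>n. stieltjes_integral 0 (x n) f g - stieltjes_integral 0 a f g) \<longlonglongrightarrow> 0"
      by (intro Lim_null_comparison[OF always_eventually *]) blast
    then show "(\<lambda>n. stieltjes_integral 0 (x n) f g) \<longlonglongrightarrow> stieltjes_integral 0 a f g"
      by (simp add: Lim_null[symmetric])
  qed
qed

text \<open>Trades a moving upper limit for a cut-off integrand on the fixed interval
  \<open>[0,T]\<close>, as dominated convergence requires.\<close>

lemma stieltjes_integral_truncate:
  assumes g: "cont_bv T g" and f: "bdd_measurable 0 u f" and u: "u \<in> {0..T}"
  shows "bdd_measurable 0 T (\<lambda>r. if r \<le> u then f r else 0)"
    and "stieltjes_integral 0 T (\<lambda>r. if r \<le> u then f r else 0) g = stieltjes_integral 0 u f g"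
proof -
  let ?f = "\<lambda>r. if r \<le> u then f r else 0"
  have 1: "bdd_measurable 0 u ?f \<longleftrightarrow> bdd_measurable 0 u f" by (rule bdd_measurable_cong) auto
  have 2: "bdd_measurable u T ?f \<longleftrightarrow> bdd_measurable u T (\<lambda>_. 0)" by (rule bdd_measurable_cong) auto
  show m: "bdd_measurable 0 T ?f"
    by (rule bdd_measurable_append[of 0 u]) (use 1 2 f u bdd_measurable_const in auto)
  have "stieltjes_integral 0 T ?f g = stieltjes_integral 0 u ?f g + stieltjes_integral u T ?f g"
    by (rule stieltjes_integral_combine[OF g]) (use m u in auto)
  also have "stieltjes_integral 0 u ?f g = stieltjes_integral 0 u f g"
    by (rule stieltjes_integral_cong) (use u in auto)
  also have "stieltjes_integral u T ?f g = stieltjes_integral u T (\<lambda>_. 0) g"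
    by (rule stieltjes_integral_cong) (use u in auto)
  also have "\<dots> = 0" using stieltjes_integral_const[OF g, of u T 0] u by auto
  finally show "stieltjes_integral 0 T ?f g = stieltjes_integral 0 u f g" by simp
qed

text \<open>Approximating paths lie in \<open>U\<close> and obey the common bound only from some
  index on, so the hypotheses are asked for eventually.\<close>

lemma stieltjes_integral_dominated_convergence':
  assumes g: "cont_bv T g" and st: "0 \<le> s" "s \<le> t" "t \<le> T"
    and f: "\<forall>\<^sub>F n in sequentially. bdd_measurable s t (f n) \<and> (\<forall>x\<in>{s<..t}. \<bar>f n x\<bar> \<le> C)"
    and h: "bdd_measurable s t h"
    and lim: "\<And>x. x \<in> {s<..t} \<Longrightarrow> (\<lambda>n. f n x) \<longlonglongrightarrow> h x"
  shows "(\<lambda>n. stieltjes_integral s t (f n) g) \<longlonglongrightarrow> stieltjes_integral s t h g"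
proof -
  obtain N where N: "\<And>n. n \<ge> N \<Longrightarrow> bdd_measurable s t (f n) \<and> (\<forall>x\<in>{s<..t}. \<bar>f n x\<bar> \<le> C)"
    using f unfolding eventually_sequentially by blast
  have "(\<lambda>n. stieltjes_integral s t (f (n + N)) g) \<longlonglongrightarrow> stieltjes_integral s t h g"
    by (rule stieltjes_integral_dominated_convergence[OF g st _ h, where C = C])
       (use N in \<open>auto intro!: LIMSEQ_ignore_initial_segment lim\<close>)
  then show ?thesis by (rule LIMSEQ_offset)
qed

text \<open>The conditions on a single component of a horizontal derivative, detached from the
  functional it differentiates, so that sums, products and compositions of such components can be
  formed.\<close>

definition horizontal_integrand ::
  "real \<Rightarrow> nat \<Rightarrow> (real ^ 'd::finite) set \<Rightarrow> (nat \<Rightarrow> real) set \<Rightarrow> 'd functional \<Rightarrow> bool" where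
  "horizontal_integrand T m U S E \<longleftrightarrow> non_anticipative T m U S E \<and> boundedness_preserving T m U S E \<and>
     continuous_at_fixed_times T m U S E \<and>
     (\<forall>s t. 0 \<le> s \<and> s < t \<and> t \<le> T \<longrightarrow> (\<forall>X\<in>cadlag_paths T U. \<forall>A\<in>CBV T m S.
        (\<lambda>r. E r (stop s X) A) \<in> borel_measurable (restrict_space borel {s..t})))"

lemma boundedness_preserving_neighbourhood:
  fixes X :: "'d::finite path"
  assumes U: "open U" and X: "X \<in> cadlag_paths T U" and A: "A \<in> CBV T m S"
    and E: "boundedness_preserving T m U S E"
  obtains \<delta> C where "\<delta> > 0" "\<And>Y t. Y \<in> cadlag_paths T U \<Longrightarrow> \<forall>u\<in>{0..T}. norm (Y u - X u) \<le> \<delta> \<Longrightarrow>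
      t \<in> {0..T} \<Longrightarrow> \<bar>E t Y A\<bar> \<le> C"
proof -
  obtain K \<delta> where K: "compact K" "K \<subseteq> U" "\<delta> > 0"
    "\<And>V Y. Y \<in> cadlag_paths T V \<Longrightarrow> (\<And>u. u \<in> {0..T} \<Longrightarrow> norm (Y u - X u) \<le> \<delta>) \<Longrightarrow> Y \<in> cadlag_paths T K"
    using cadlag_paths_neighbourhood[OF X U] by metis
  obtain C where C: "\<And>t Y. t \<in> {0..T} \<Longrightarrow> Y \<in> cadlag_paths T K \<Longrightarrow> \<bar>E t Y A\<bar> \<le> C"
    using E[unfolded boundedness_preserving_def, rule_format, OF A, of K] K(1,2) by blast
  show ?thesis
  proof (rule that[OF K(3)])
    fix Y t assume "Y \<in> cadlag_paths T U" "\<forall>u\<in>{0..T}. norm (Y u - X u) \<le> \<delta>" "t \<in> {0..T}"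
    then show "\<bar>E t Y A\<bar> \<le> C" by (intro C K(4)) auto
  qed
qed

section \<open>Sequential forms of the continuity conditions\<close>

context
  fixes T :: real and m :: nat and U :: "(real ^ 'd::finite) set" and S :: "(nat \<Rightarrow> real) set"
  assumes T: "0 < T" and U: "open U"
begin

lemma non_anticipative_cong:
  assumes F: "non_anticipative T m U S F" and t: "t \<in> {0..T}"
    and X: "X \<in> cadlag_paths T U" "Y \<in> cadlag_paths T U" "\<And>u. u \<in> {0..t} \<Longrightarrow> X u = Y u"
    and A: "A \<in> CBV T m S" "B \<in> CBV T m S" "\<And>u. u \<in> {0..t} \<Longrightarrow> A u = B u"
  shows "F t X A = F t Y B"
proof -
  have "F t X A = F t (stop t X) (stop t A)" "F t Y B = F t (stop t Y) (stop t B)"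
    using F t X A unfolding non_anticipative_def by blast+
  moreover have "stop t X = stop t Y" "stop t A = stop t B"
    using t by (auto intro!: stop_cong X A)
  ultimately show ?thesis by simp
qed

lemma non_anticipative_stop:
  assumes F: "non_anticipative T m U S F" and t: "t \<in> {0..T}" "s \<in> {t..T}"
    and X: "X \<in> cadlag_paths T U" and A: "A \<in> CBV T m S"
  shows "F t (stop s X) A = F t X A"
proof (rule non_anticipative_cong[OF F t(1) _ X _ A A])
  show "stop s X \<in> cadlag_paths T U" by (rule cadlag_paths_stop[OF X]) (use t in auto)
  fix u assume "u \<in> {0..t}"
  then have "max 0 (min s u) = u" using t by auto
  then show "stop s X u = X u" by (simp add: stop_def)
qed auto

text \<open>The gap \<open>t - s n\<close> plays the part of \<open>h\<close>. The paths need to lie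
  in \<open>U\<close> only eventually, as is the case for paths that merely approach
  \<open>X\<close>.\<close>

lemma left_continuousD:
  assumes F: "left_continuous T m U S F" and t: "t \<in> {0<..T}" and X: "X \<in> cadlag_paths T U" and A: "A \<in> CBV T m S"
    and Y: "\<forall>\<^sub>F n in sequentially. Y n \<in> cadlag_paths T U" and s: "\<And>n. s n \<in> {0..t}" "s \<longlonglongrightarrow> t"
    and lim: "uniform_limit {0..T} (\<lambda>n. stop (s n) (Y n)) (stop t X) sequentially"
  shows "(\<lambda>n. F (s n) (Y n) A) \<longlonglongrightarrow> F t X A"
proof (rule tendstoI)
  fix e :: real assume e: "e > 0"
  obtain \<eta> where \<eta>: "\<eta> > 0" "\<And>h Y. h \<in> {0..<\<eta>} \<Longrightarrow> h \<le> t \<Longrightarrow> Y \<in> cadlag_paths T U \<Longrightarrow>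
      sup_norm T (\<lambda>u. stop t X u - stop (t - h) Y u) < \<eta> \<Longrightarrow> \<bar>F t X A - F (t - h) Y A\<bar> < e"
    using F t e X A unfolding left_continuous_def by meson
  have "\<forall>\<^sub>F n in sequentially. dist (s n) t < \<eta>" using s(2) \<eta>(1) by (rule tendstoD)
  moreover have "\<forall>\<^sub>F n in sequentially. \<forall>u\<in>{0..T}. norm (stop (s n) (Y n) u - stop t X u) < \<eta>/2"
    using uniform_limit_normD[OF lim, of "\<eta>/2"] \<eta>(1) by simp
  ultimately show "\<forall>\<^sub>F n in sequentially. dist (F (s n) (Y n) A) (F t X A) < e"
    using Y
  proof eventually_elim
    case (elim n)
    have "sup_norm T (\<lambda>u. stop t X u - stop (t - (t - s n)) (Y n) u) \<le> \<eta>/2"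
      by (rule sup_norm_le) (use elim T in \<open>auto simp: norm_minus_commute less_imp_le\<close>)
    then have "\<bar>F t X A - F (t - (t - s n)) (Y n) A\<bar> < e"
      using elim s(1)[of n] \<eta>(1) by (intro \<eta>(2)) (auto simp: dist_real_def)
    then show ?case by (simp add: dist_real_def abs_minus_commute)
  qed
qed

text \<open>Failure of left-continuity supplies, for \<eta> = 1/(n+1), a counterexample
  \<open>(h n, Y n)\<close>; together these form a sequence to which the assumption applies.\<close>

lemma left_continuousI:
  assumes "\<And>t X A Y s. t \<in> {0<..T} \<Longrightarrow> X \<in> cadlag_paths T U \<Longrightarrow> A \<in> CBV T m S \<Longrightarrow> (\<And>n. Y n \<in> cadlag_paths T U) \<Longrightarrow>
     (\<And>n. s n \<in> {0..t}) \<Longrightarrow> s \<longlonglongrightarrow> t \<Longrightarrow> uniform_limit {0..T} (\<lambda>n. stop (s n) (Y n)) (stop t X) sequentially \<Longrightarrow>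
     (\<lambda>n. F (s n) (Y n) A) \<longlonglongrightarrow> F t X A"
  shows "left_continuous T m U S F"
  unfolding left_continuous_def
proof (intro ballI allI impI, rule ccontr)
  fix t e X A assume *: "t \<in> {0<..T}" "(0::real) < e" "X \<in> cadlag_paths T U" "A \<in> CBV T m S"
    and neg: "\<not> (\<exists>\<eta>>0. \<forall>h\<in>{0..<\<eta>}. h \<le> t \<longrightarrow> (\<forall>Y\<in>cadlag_paths T U.
       sup_norm T (\<lambda>u. stop t X u - stop (t - h) Y u) < \<eta> \<longrightarrow> \<bar>F t X A - F (t - h) Y A\<bar> < e))"
  let ?P = "\<lambda>\<eta> (h, Y). h \<in> {0..<\<eta>} \<and> h \<le> t \<and> Y \<in> cadlag_paths T U \<and>
     sup_norm T (\<lambda>u. stop t X u - stop (t - h) Y u) < \<eta> \<and> \<not> \<bar>F t X A - F (t - h) Y A\<bar> < e"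
  have "\<exists>x. ?P \<eta> x" if \<eta>: "\<eta> > 0" for \<eta>
  proof -
    obtain h Y where "?P \<eta> (h, Y)" using neg \<eta> unfolding prod.case by blast
    then show ?thesis by blast
  qed
  then obtain x where x: "\<And>n::nat. ?P (inverse (real (Suc n))) (x n)"
    using ex_eta_sequence[of ?P] by blast
  define h Y where "h n = fst (x n)" and "Y n = snd (x n)" for n
  have hY: "0 \<le> h n" "h n < inverse (real (Suc n))" "h n \<le> t" "Y n \<in> cadlag_paths T U"
     "sup_norm T (\<lambda>u. stop t X u - stop (t - h n) (Y n) u) < inverse (real (Suc n))"
     "\<not> \<bar>F t X A - F (t - h n) (Y n) A\<bar> < e" for n
    using x[of n] by (auto simp: h_def Y_def case_prod_beta)
  have h0: "h \<longlonglongrightarrow> 0"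
    by (rule tendsto_sandwich[OF _ _ tendsto_const LIMSEQ_inverse_real_of_nat]) (use hY(1,2) in \<open>auto simp del: of_nat_Suc intro: always_eventually less_imp_le\<close>)
  have "(\<lambda>n. t - h n) \<longlonglongrightarrow> t - 0" by (intro tendsto_intros h0)
  moreover have "uniform_limit {0..T} (\<lambda>n. stop (t - h n) (Y n)) (stop t X) sequentially"
  proof (rule uniform_limit_inverse_Suc)
    fix n u assume u: "u \<in> {0..T}"
    have "norm (stop t X u - stop (t - h n) (Y n) u) \<le> sup_norm T (\<lambda>u. stop t X u - stop (t - h n) (Y n) u)"
      by (rule norm_diff_le_sup_norm[OF cadlag_paths_stop[OF *(3)] cadlag_paths_stop[OF hY(4)[of n]] u])
         (use * hY(1,3)[of n] in auto)
    then show "norm (stop (t - h n) (Y n) u - stop t X u) < inverse (real (Suc n))"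
      using hY(5)[of n] by (simp only: norm_minus_commute)
  qed
  ultimately have "(\<lambda>n. F (t - h n) (Y n) A) \<longlonglongrightarrow> F t X A"
    using * hY by (intro assms) auto
  then have "\<forall>\<^sub>F n in sequentially. dist (F (t - h n) (Y n) A) (F t X A) < e" using *(2) by (rule tendstoD)
  then obtain n where "dist (F (t - h n) (Y n) A) (F t X A) < e" using eventually_happens'[OF sequentially_bot] by blast
  then show False using hY(6)[of n] by (simp only: dist_real_def abs_minus_commute)
qed

lemma continuous_at_fixed_timesD:
  assumes F: "continuous_at_fixed_times T m U S F" and t: "t \<in> {0..T}" and X: "X \<in> cadlag_paths T U" and A: "A \<in> CBV T m S"
    and Y: "\<forall>\<^sub>F n in sequentially. Y n \<in> cadlag_paths T U"
    and lim: "uniform_limit {0..T} (\<lambda>n. stop t (Y n)) (stop t X) sequentially"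
  shows "(\<lambda>n. F t (Y n) A) \<longlonglongrightarrow> F t X A"
proof (rule tendstoI)
  fix e :: real assume e: "e > 0"
  obtain \<eta> where \<eta>: "\<eta> > 0" "\<And>Y. Y \<in> cadlag_paths T U \<Longrightarrow>
      sup_norm T (\<lambda>u. stop t X u - stop t Y u) < \<eta> \<Longrightarrow> \<bar>F t X A - F t Y A\<bar> < e"
    using F t e X A unfolding continuous_at_fixed_times_def by meson
  have "\<forall>\<^sub>F n in sequentially. \<forall>u\<in>{0..T}. norm (stop t (Y n) u - stop t X u) < \<eta>/2"
    using uniform_limit_normD[OF lim, of "\<eta>/2"] \<eta>(1) by simp
  then show "\<forall>\<^sub>F n in sequentially. dist (F t (Y n) A) (F t X A) < e"
    using Y
  proof eventually_elim
    case (elim n)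
    have "sup_norm T (\<lambda>u. stop t X u - stop t (Y n) u) \<le> \<eta>/2"
      by (rule sup_norm_le) (use elim T in \<open>auto simp: norm_minus_commute less_imp_le\<close>)
    then have "\<bar>F t X A - F t (Y n) A\<bar> < e"
      using elim \<eta>(1) by (intro \<eta>(2)) auto
    then show ?case by (simp add: dist_real_def abs_minus_commute)
  qed
qed

lemma continuous_at_fixed_timesI:
  assumes "\<And>t X A Y. t \<in> {0..T} \<Longrightarrow> X \<in> cadlag_paths T U \<Longrightarrow> A \<in> CBV T m S \<Longrightarrow> (\<And>n. Y n \<in> cadlag_paths T U) \<Longrightarrow>
     uniform_limit {0..T} (\<lambda>n. stop t (Y n)) (stop t X) sequentially \<Longrightarrow> (\<lambda>n. F t (Y n) A) \<longlonglongrightarrow> F t X A"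
  shows "continuous_at_fixed_times T m U S F"
  unfolding continuous_at_fixed_times_def
proof (intro ballI allI impI, rule ccontr)
  fix e t X A assume *: "(0::real) < e" "t \<in> {0..T}" "X \<in> cadlag_paths T U" "A \<in> CBV T m S"
    and neg: "\<not> (\<exists>\<eta>>0. \<forall>Y\<in>cadlag_paths T U. sup_norm T (\<lambda>u. stop t X u - stop t Y u) < \<eta> \<longrightarrow> \<bar>F t X A - F t Y A\<bar> < e)"
  let ?P = "\<lambda>\<eta> Y. Y \<in> cadlag_paths T U \<and> sup_norm T (\<lambda>u. stop t X u - stop t Y u) < \<eta> \<and> \<not> \<bar>F t X A - F t Y A\<bar> < e"
  have "\<exists>x. ?P \<eta> x" if "\<eta> > 0" for \<eta> using neg that by blast
  then obtain Y where Y: "\<And>n::nat. ?P (inverse (real (Suc n))) (Y n)"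
    using ex_eta_sequence[of ?P] by blast
  have "uniform_limit {0..T} (\<lambda>n. stop t (Y n)) (stop t X) sequentially"
  proof (rule uniform_limit_inverse_Suc)
    fix n u assume u: "u \<in> {0..T}"
    have "norm (stop t X u - stop t (Y n) u) \<le> sup_norm T (\<lambda>u. stop t X u - stop t (Y n) u)"
      by (rule norm_diff_le_sup_norm[OF cadlag_paths_stop[OF *(3)] cadlag_paths_stop[OF Y[THEN conjunct1]] u])
         (use * in auto)
    also have "\<dots> < inverse (real (Suc n))" using Y[of n] by blast
    finally show "norm (stop t (Y n) u - stop t X u) < inverse (real (Suc n))"
      by (simp only: norm_minus_commute)
  qed
  then have "(\<lambda>n. F t (Y n) A) \<longlonglongrightarrow> F t X A" using * Y by (intro assms) blast+
  then have "\<forall>\<^sub>F n in sequentially. dist (F t (Y n) A) (F t X A) < e" using *(1) by (rule tendstoD)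
  then obtain n where "dist (F t (Y n) A) (F t X A) < e" using eventually_happens'[OF sequentially_bot] by blast
  then show False using Y[of n] by (simp only: dist_real_def abs_minus_commute)
qed

text \<open>Compactness of \<open>[0,T]\<close> turns local uniformity in time into uniformity.\<close>

lemma continuous_in_X_locally_uniformlyD:
  assumes F: "continuous_in_X_locally_uniformly T m U S F" and X: "X \<in> cadlag_paths T U" and A: "A \<in> CBV T m S"
    and Y: "\<forall>\<^sub>F n in sequentially. Y n \<in> cadlag_paths T U" and lim: "uniform_limit {0..T} Y X sequentially"
    and u: "\<And>n. u n \<in> {0..T}"
  shows "(\<lambda>n. F (u n) (Y n) A - F (u n) X A) \<longlonglongrightarrow> 0"
proof (rule tendstoI)
  fix e :: real assume e: "e > 0"
  have "\<forall>t\<in>{0..T}. \<exists>\<eta>>0. \<forall>u\<in>{0..T}. \<forall>Y\<in>cadlag_paths T U.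
      sup_norm T (\<lambda>r. X r - Y r) < \<eta> \<and> \<bar>t - u\<bar> < \<eta> \<longrightarrow> \<bar>F u X A - F u Y A\<bar> < e"
    using F e X A unfolding continuous_in_X_locally_uniformly_def by blast
  from bchoice[OF this] obtain \<eta> where \<eta>': "\<forall>t\<in>{0..T}. \<eta> t > 0 \<and> (\<forall>u\<in>{0..T}. \<forall>Y\<in>cadlag_paths T U.
      sup_norm T (\<lambda>r. X r - Y r) < \<eta> t \<and> \<bar>t - u\<bar> < \<eta> t \<longrightarrow> \<bar>F u X A - F u Y A\<bar> < e)" by blast
  then have \<eta>: "\<And>t. t \<in> {0..T} \<Longrightarrow> \<eta> t > 0"
    "\<And>t u Y. t \<in> {0..T} \<Longrightarrow> u \<in> {0..T} \<Longrightarrow> Y \<in> cadlag_paths T U \<Longrightarrow> sup_norm T (\<lambda>r. X r - Y r) < \<eta> t \<Longrightarrow> \<bar>t - u\<bar> < \<eta> t \<Longrightarrow>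
       \<bar>F u X A - F u Y A\<bar> < e"
    by blast+
  have "{0..T} \<subseteq> (\<Union>t\<in>{0..T}. ball t (\<eta> t))" using \<eta>(1) by force
  then obtain D where D: "D \<subseteq> {0..T}" "finite D" "{0..T} \<subseteq> (\<Union>t\<in>D. ball t (\<eta> t))"
    using compactE_image[OF compact_Icc, of "{0..T}" "\<lambda>t. ball t (\<eta> t)" 0 T] by auto
  have "D \<noteq> {}" using D T by auto
  define d where "d = Min (\<eta> ` D)"
  have d: "d > 0" "\<And>t. t \<in> D \<Longrightarrow> d \<le> \<eta> t"
    using D \<eta>(1) \<open>D \<noteq> {}\<close> unfolding d_def by (auto simp: subset_iff)
  have "\<forall>\<^sub>F n in sequentially. \<forall>u\<in>{0..T}. norm (Y n u - X u) < d/2"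
    using uniform_limit_normD[OF lim, of "d/2"] d(1) by simp
  then show "\<forall>\<^sub>F n in sequentially. dist (F (u n) (Y n) A - F (u n) X A) 0 < e"
    using Y
  proof eventually_elim
    case (elim n)
    obtain t where t: "t \<in> D" "\<bar>t - u n\<bar> < \<eta> t" using D u[of n] by (force simp: dist_real_def)
    have "sup_norm T (\<lambda>r. X r - Y n r) \<le> d/2"
      by (rule sup_norm_le) (use elim T in \<open>auto simp: norm_minus_commute less_imp_le\<close>)
    then have "\<bar>F (u n) X A - F (u n) (Y n) A\<bar> < e"
      using elim u t D d(1) d(2)[OF t(1)] by (intro \<eta>(2)[of t]) auto
    then show ?case by (simp add: abs_minus_commute)
  qed
qed

lemma continuous_in_X_locally_uniformlyI:
  assumes "\<And>X A Y u. X \<in> cadlag_paths T U \<Longrightarrow> A \<in> CBV T m S \<Longrightarrow> (\<And>n. Y n \<in> cadlag_paths T U) \<Longrightarrow> uniform_limit {0..T} Y X sequentially \<Longrightarrow>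
     (\<And>n. u n \<in> {0..T}) \<Longrightarrow> (\<lambda>n. F (u n) (Y n) A - F (u n) X A) \<longlonglongrightarrow> 0"
  shows "continuous_in_X_locally_uniformly T m U S F"
  unfolding continuous_in_X_locally_uniformly_def
proof (intro ballI allI impI, rule ccontr)
  fix e t X A assume *: "(0::real) < e" "t \<in> {0..T}" "X \<in> cadlag_paths T U" "A \<in> CBV T m S"
    and neg: "\<not> (\<exists>\<eta>>0. \<forall>u\<in>{0..T}. \<forall>Y\<in>cadlag_paths T U.
          sup_norm T (\<lambda>r. X r - Y r) < \<eta> \<and> \<bar>t - u\<bar> < \<eta> \<longrightarrow> \<bar>F u X A - F u Y A\<bar> < e)"
  let ?P = "\<lambda>\<eta> (u, Y). u \<in> {0..T} \<and> Y \<in> cadlag_paths T U \<and> sup_norm T (\<lambda>r. X r - Y r) < \<eta> \<and> \<not> \<bar>F u X A - F u Y A\<bar> < e"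
  have "\<exists>x. ?P \<eta> x" if \<eta>: "\<eta> > 0" for \<eta>
  proof -
    obtain u Y where "?P \<eta> (u, Y)" using neg \<eta> unfolding prod.case by blast
    then show ?thesis by blast
  qed
  then obtain x where x: "\<And>n::nat. ?P (inverse (real (Suc n))) (x n)"
    using ex_eta_sequence[of ?P] by blast
  define u Y where "u n = fst (x n)" and "Y n = snd (x n)" for n
  have uY: "u n \<in> {0..T}" "Y n \<in> cadlag_paths T U" "sup_norm T (\<lambda>r. X r - Y n r) < inverse (real (Suc n))"
     "\<not> \<bar>F (u n) X A - F (u n) (Y n) A\<bar> < e" for n
    using x[of n] by (auto simp: u_def Y_def case_prod_beta)
  have "uniform_limit {0..T} Y X sequentially"
  proof (rule uniform_limit_inverse_Suc)
    fix n v assume v: "v \<in> {0..T}"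
    have "norm (X v - Y n v) < inverse (real (Suc n))"
      using norm_diff_le_sup_norm[OF *(3) uY(2)[of n] v] uY(3)[of n] by (rule le_less_trans)
    then show "norm (Y n v - X v) < inverse (real (Suc n))" by (simp only: norm_minus_commute)
  qed
  then have "(\<lambda>n. F (u n) (Y n) A - F (u n) X A) \<longlonglongrightarrow> 0" using * uY by (intro assms) auto
  then have "\<forall>\<^sub>F n in sequentially. dist (F (u n) (Y n) A - F (u n) X A) 0 < e" using *(1) by (rule tendstoD)
  then obtain n where "dist (F (u n) (Y n) A - F (u n) X A) 0 < e" using eventually_happens'[OF sequentially_bot] by blast
  then show False using uY(4)[of n] by (simp only: dist_real_def abs_minus_commute diff_0_right)
qed

text \<open>The case \<open>h = 0\<close> of left-continuity is continuity at a fixed positive time.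
  At time 0 nothing is known, hence the value 0 prescribed there.\<close>

lemma left_continuous_imp_fixed_times:
  assumes "left_continuous T m U S F"
  shows "continuous_at_fixed_times T m U S (\<lambda>t X A. if t = 0 then 0 else F t X A)"
proof (rule continuous_at_fixed_timesI)
  fix t X A Y assume *: "t \<in> {0..T}" "X \<in> cadlag_paths T U" "A \<in> CBV T m S" "\<And>n. Y n \<in> cadlag_paths T U"
     "uniform_limit {0..T} (\<lambda>n. stop t (Y n)) (stop t X) sequentially"
  show "(\<lambda>n. if t = 0 then 0 else F t (Y n) A) \<longlonglongrightarrow> (if t = 0 then 0 else F t X A)"
    using left_continuousD[OF assms, of t X A Y "\<lambda>_. t"] * by (cases "t = 0") auto
qed

lemma horizontal_integrandD:
  assumes "horizontal_integrand T m U S E"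
  shows "non_anticipative T m U S E" "boundedness_preserving T m U S E" "continuous_at_fixed_times T m U S E"
    "0 \<le> s \<Longrightarrow> s < t \<Longrightarrow> t \<le> T \<Longrightarrow> X \<in> cadlag_paths T U \<Longrightarrow> A \<in> CBV T m S \<Longrightarrow>
       (\<lambda>r. E r (stop s X) A) \<in> borel_measurable (restrict_space borel {s..t})"
  using assms unfolding horizontal_integrand_def by auto

text \<open>The path is approximated uniformly by piecewise constant paths; on each constancy
  interval the measurability is part of the assumption.\<close>

lemma horizontal_integrand_measurable:
  assumes E: "horizontal_integrand T m U S E" and X: "X \<in> cadlag_paths T U" and A: "A \<in> CBV T m S"
  shows "bdd_measurable 0 T (\<lambda>r. E r X A)"
proof -
  note E' = horizontal_integrandD[OF E]
  have T0: "0 \<le> T" using T by simp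
  have step: "\<exists>Y. Y \<in> cadlag_paths T U \<and> (\<forall>u\<in>{0..T}. norm (Y u - X u) < e) \<and>
      (\<lambda>r. indicator {0<..T} r * E r Y A) \<in> borel_measurable borel" if e: "e > 0" for e
  proof -
    obtain Q where Q: "subdivision 0 T Q"
      and osc: "\<And>s u. s \<in> Q \<Longrightarrow> s < T \<Longrightarrow> s \<le> u \<Longrightarrow> u < nx Q s \<Longrightarrow> norm (X u - X s) < e"
      using cadlag_paths_finite_oscillation[OF X T0 e] by metis
    note fin = subdivision_finite[OF Q] and ends = subdivision_ends[OF Q] and bnds = subdivision_bounds[OF Q]
    \<comment> \<open>The value of \<open>X\<close> at the last point of \<open>Q\<close> that is
      not after \<open>u\<close>.\<close>
    define Y where "Y = (\<lambda>u. X (Max (Q - {x\<in>Q. u < x})))"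
    have mx: "Max (Q - {x\<in>Q. u < x}) \<in> Q \<and> Max (Q - {x\<in>Q. u < x}) \<le> u" if "u \<in> {0..T}" for u
    proof -
      have "Max (Q - {x\<in>Q. u < x}) \<in> Q - {x\<in>Q. u < x}"
        by (rule Max_in) (use fin ends that in auto)
      then show ?thesis by auto
    qed
    have Y: "Y \<in> cadlag_paths T U"
      unfolding Y_def
    proof (rule cadlag_paths_step[OF fin, of T "\<lambda>B. X (Max (Q - B))"])
      fix u assume "u \<in> {0..T}"
      from mx[OF this] show "X (Max (Q - {x \<in> Q. u < x})) \<in> U"
        using bnds by (intro cadlag_pathsD(1)[OF X]) auto
    qed
    have Yeq: "Y u = X s" if s: "s \<in> Q" "s < T" "s \<le> u" "u < nx Q s" for s u
    proof -
      have "Max (Q - {x\<in>Q. u < x}) = s"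
      proof (rule Max_eqI)
        fix y assume y: "y \<in> Q - {x\<in>Q. u < x}"
        show "y \<le> s"
        proof (rule ccontr)
          assume "\<not> y \<le> s"
          then have "nx Q s \<le> y" using y by (intro nx_least[OF Q]) auto
          then show False using y s by auto
        qed
      qed (use fin s in auto)
      then show ?thesis by (simp add: Y_def)
    qed
    have YT: "Y T = X T"
    proof -
      have "Max (Q - {x\<in>Q. T < x}) = T" by (rule Max_eqI) (use fin ends bnds in auto)
      then show ?thesis by (simp add: Y_def)
    qed
    have close: "norm (Y u - X u) < e" if u: "u \<in> {0..T}" for u
    proof (cases "u = T")
      case False
      let ?s = "Max (Q - {x\<in>Q. u < x})"
      have s: "?s \<in> Q" "?s \<le> u" "?s < T" using mx[OF u] u False by auto
      have "u < nx Q ?s"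
      proof (rule ccontr)
        assume "\<not> u < nx Q ?s"
        then have "nx Q ?s \<in> Q - {x\<in>Q. u < x}" using nx_props[OF Q s(3)] by auto
        then have "nx Q ?s \<le> ?s" using fin by (intro Max_ge) auto
        then show False using nx_props[OF Q s(3)] by linarith
      qed
      then show ?thesis using osc[OF s(1,3,2)] by (simp add: Y_def norm_minus_commute)
    qed (use YT e in auto)
    \<comment> \<open>Strictly inside a cell \<open>Y\<close> coincides with
      \<open>stop s Y\<close>, for which measurability is assumed; at the right end \<open>Y\<close>
      may already have jumped, and this single point is added by hand.\<close>
    define h where "h s r = (if r < nx Q s then E r (stop s Y) A else E r Y A)" for s r
    obtain K where K: "compact K" "K \<subseteq> U" "Y \<in> cadlag_paths T K" using cadlag_paths_compact[OF Y U] .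
    obtain C where C: "\<And>t Y. t \<in> {0..T} \<Longrightarrow> Y \<in> cadlag_paths T K \<Longrightarrow> \<bar>E t Y A\<bar> \<le> C"
      using E'(2)[unfolded boundedness_preserving_def, rule_format, OF A, of K] K(1,2) by blast
    have hm: "bdd_measurable s (nx Q s) (h s)" if s: "s \<in> Q" "s < T" for s
    proof (rule bdd_measurableI[where C = C])
      note n = nx_props[OF Q s(2)] and sb = bnds[OF s(1)]
      have "(\<lambda>r. E r (stop s Y) A) \<in> borel_measurable (restrict_space borel {s..nx Q s})"
        using n sb Y A by (intro E'(4)) auto
      then have 1: "(\<lambda>r. indicator {s..nx Q s} r *\<^sub>R E r (stop s Y) A) \<in> borel_measurable borel"
        by (subst (asm) borel_measurable_restrict_space_iff) auto
      have eq: "(\<lambda>r. indicator {s<..nx Q s} r * h s r) =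
         (\<lambda>r. indicator {s<..<nx Q s} r * (indicator {s..nx Q s} r *\<^sub>R E r (stop s Y) A) + indicator {nx Q s} r * E (nx Q s) Y A)"
        using n by (auto simp: h_def indicator_def)
      show "(\<lambda>r. indicator {s<..nx Q s} r * h s r) \<in> borel_measurable borel"
        unfolding eq by (intro borel_measurable_add borel_measurable_times 1) auto
      fix r assume r: "r \<in> {s<..nx Q s}"
      have "stop s Y \<in> cadlag_paths T K" using K(3) s sb by (intro cadlag_paths_stop) auto
      then show "\<bar>h s r\<bar> \<le> C" using r n sb K(3) by (auto simp: h_def intro!: C)
    qed
    have "bdd_measurable 0 T (\<lambda>r. h (pre Q r) r)"
      by (rule bdd_measurable_pieces[OF Q hm])
    also have "?this \<longleftrightarrow> bdd_measurable 0 T (\<lambda>r. E r Y A)"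
    proof (rule bdd_measurable_cong)
      fix r assume r: "r \<in> {0<..T}"
      let ?s = "pre Q r"
      have s: "?s \<in> Q" "?s < r" "0 \<le> ?s" "?s < T" "r \<le> nx Q ?s"
        using pre_props[OF Q, of r] le_nx_pre[OF Q, of r] r by auto
      show "h ?s r = E r Y A"
      proof (cases "r < nx Q ?s")
        case True
        have "E r (stop ?s Y) A = E r Y A"
        proof (rule non_anticipative_cong[OF E'(1)])
          show "stop ?s Y \<in> cadlag_paths T U" using Y s by (intro cadlag_paths_stop) auto
          fix u assume u: "u \<in> {0..r}"
          then show "stop ?s Y u = Y u"
            using Yeq[OF s(1,4), of ?s] Yeq[OF s(1,4), of u] s True nx_props[OF Q s(4)] by (simp add: stop_apply[of u T] r)
        qed (use r Y A in auto)
        then show ?thesis using True by (simp add: h_def)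
      qed (simp add: h_def)
    qed
    finally show ?thesis using Y close unfolding bdd_measurable_def by blast
  qed
  have "\<exists>Y. \<forall>n::nat. Y n \<in> cadlag_paths T U \<and> (\<forall>u\<in>{0..T}. norm (Y n u - X u) < inverse (real (Suc n))) \<and>
      (\<lambda>r. indicator {0<..T} r * E r (Y n) A) \<in> borel_measurable borel"
    using step by (intro choice allI) auto
  then obtain Y where Y: "\<And>n::nat. Y n \<in> cadlag_paths T U" "\<And>n u. u \<in> {0..T} \<Longrightarrow> norm (Y n u - X u) < inverse (real (Suc n))"
     "\<And>n. (\<lambda>r. indicator {0<..T} r * E r (Y n) A) \<in> borel_measurable borel" by blast
  have lim: "uniform_limit {0..T} Y X sequentially"
    by (rule uniform_limit_inverse_Suc) (rule Y(2))
  obtain \<delta> C where "\<delta> > 0" and C: "\<And>Y t. Y \<in> cadlag_paths T U \<Longrightarrow> \<forall>u\<in>{0..T}. norm (Y u - X u) \<le> \<delta> \<Longrightarrow>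
      t \<in> {0..T} \<Longrightarrow> \<bar>E t Y A\<bar> \<le> C"
    using boundedness_preserving_neighbourhood[OF U X A E'(2)] by metis
  show ?thesis
  proof (rule bdd_measurableI[where C = C])
    show "(\<lambda>r. indicator {0<..T} r * E r X A) \<in> borel_measurable borel"
    proof (rule borel_measurable_LIMSEQ_real[OF _ Y(3)])
      fix r :: real
      have "(\<lambda>n. E r (Y n) A) \<longlonglongrightarrow> E r X A" if "r \<in> {0<..T}"
        by (rule continuous_at_fixed_timesD[OF E'(3) _ X A])
           (use that Y(1) in \<open>auto intro!: uniform_limit_stop_const[OF lim]\<close>)
      then show "(\<lambda>n. indicator {0<..T} r * E r (Y n) A) \<longlonglongrightarrow> indicator {0<..T} r * E r X A"
        by (cases "r \<in> {0<..T}") auto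
    qed
    fix x assume "x \<in> {0<..T}"
    then show "\<bar>E x X A\<bar> \<le> C" using \<open>\<delta> > 0\<close> by (intro C X) auto
  qed
qed

text \<open>Pointwise convergence of the integrands comes from continuity at fixed times, domination
  from the compact neighbourhood of \<open>X\<close>. Cutting the integrand at \<open>u n\<close>
  lets the upper limit move arbitrarily with \<open>n\<close>.\<close>

lemma horizontal_integrand_integral_tendsto:
  assumes E: "horizontal_integrand T m U S E" and X: "X \<in> cadlag_paths T U" and A: "A \<in> CBV T m S" and g: "cont_bv T g"
    and Y: "\<forall>\<^sub>F n in sequentially. Y n \<in> cadlag_paths T U" and lim: "uniform_limit {0..T} Y X sequentially"
    and u: "\<And>n. u n \<in> {0..T}"
  shows "(\<lambda>n. stieltjes_integral 0 (u n) (\<lambda>r. E r (Y n) A) g - stieltjes_integral 0 (u n) (\<lambda>r. E r X A) g) \<longlonglongrightarrow> 0"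
proof -
  note E' = horizontal_integrandD[OF E]
  obtain \<delta> C where "\<delta> > 0" and C: "\<And>Y t. Y \<in> cadlag_paths T U \<Longrightarrow> \<forall>u\<in>{0..T}. norm (Y u - X u) \<le> \<delta> \<Longrightarrow>
      t \<in> {0..T} \<Longrightarrow> \<bar>E t Y A\<bar> \<le> C"
    using boundedness_preserving_neighbourhood[OF U X A E'(2)] by metis
  let ?f = "\<lambda>n r. if r \<le> u n then E r (Y n) A - E r X A else 0"
  \<comment> \<open>Yields \<open>0 \<le> C\<close>, which bounds the integrand where it is cut off
    to 0.\<close>
  have C0: "\<bar>E 0 X A\<bar> \<le> C" using T \<open>\<delta> > 0\<close> by (intro C X) auto
  have close: "\<forall>\<^sub>F n in sequentially. \<forall>u\<in>{0..T}. norm (Y n u - X u) < \<delta>"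
    using lim \<open>\<delta> > 0\<close> unfolding uniform_limit_norm by blast
  have ev: "\<forall>\<^sub>F n in sequentially. bdd_measurable 0 (u n) (\<lambda>r. E r (Y n) A - E r X A) \<and> (\<forall>x\<in>{0<..T}. \<bar>?f n x\<bar> \<le> 2 * C)"
    using Y close
  proof eventually_elim
    case (elim n)
    have "\<bar>?f n x\<bar> \<le> 2 * C" if x: "x \<in> {0<..T}" for x
    proof -
      have "\<bar>E x (Y n) A\<bar> \<le> C" "\<bar>E x X A\<bar> \<le> C"
        using elim x X \<open>\<delta> > 0\<close> by (auto intro!: C simp: less_imp_le)
      then show ?thesis using C0 by auto
    qed
    moreover have "bdd_measurable 0 (u n) (\<lambda>r. E r (Y n) A - E r X A)"
      by (rule bdd_measurable_subset[OF bdd_measurable_diff])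
         (use elim u[of n] horizontal_integrand_measurable[OF E _ A] X in auto)
    ultimately show ?case by blast
  qed
  have "(\<lambda>n. stieltjes_integral 0 T (?f n) g) \<longlonglongrightarrow> stieltjes_integral 0 T (\<lambda>_. 0) g"
  proof (rule stieltjes_integral_dominated_convergence'[OF g, where C = "2 * C"])
    show "\<forall>\<^sub>F n in sequentially. bdd_measurable 0 T (?f n) \<and> (\<forall>x\<in>{0<..T}. \<bar>?f n x\<bar> \<le> 2 * C)"
      using ev by eventually_elim (use stieltjes_integral_truncate(1)[OF g _ u] in auto)
    fix x assume x: "x \<in> {0<..T}"
    have "(\<lambda>n. E x (Y n) A) \<longlonglongrightarrow> E x X A"
      by (rule continuous_at_fixed_timesD[OF E'(3) _ X A])
         (use x Y in \<open>auto intro!: uniform_limit_stop_const[OF lim]\<close>)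
    then have "(\<lambda>n. E x (Y n) A - E x X A) \<longlonglongrightarrow> 0" by (simp add: Lim_null[symmetric])
    then show "(\<lambda>n. ?f n x) \<longlonglongrightarrow> 0"
      by (rule Lim_null_comparison[rotated, OF tendsto_norm_zero]) auto
  qed (use T bdd_measurable_const in auto)
  also have "stieltjes_integral 0 T (\<lambda>_. 0) g = 0" using stieltjes_integral_const[OF g, of 0 T 0] T by simp
  finally show ?thesis
  proof (rule Lim_transform_eventually)
    show "\<forall>\<^sub>F n in sequentially. stieltjes_integral 0 T (?f n) g =
       stieltjes_integral 0 (u n) (\<lambda>r. E r (Y n) A) g - stieltjes_integral 0 (u n) (\<lambda>r. E r X A) g"
      using ev Y
    proof eventually_elim
      case (elim n)
      have "stieltjes_integral 0 T (?f n) g = stieltjes_integral 0 (u n) (\<lambda>r. E r (Y n) A - E r X A) g"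
        using elim by (intro stieltjes_integral_truncate(2)[OF g _ u]) auto
      also have "\<dots> = stieltjes_integral 0 (u n) (\<lambda>r. E r (Y n) A) g - stieltjes_integral 0 (u n) (\<lambda>r. E r X A) g"
      proof (rule stieltjes_integral_diff[OF g])
        show "bdd_measurable 0 (u n) (\<lambda>r. E r (Y n) A)" "bdd_measurable 0 (u n) (\<lambda>r. E r X A)"
          by (rule bdd_measurable_subset[OF horizontal_integrand_measurable[OF E _ A]]; use elim X u[of n] in simp)+
      qed (use u[of n] in auto)
      finally show ?case .
    qed
  qed
qed

end

section \<open>Functionals of class C12 and their paths\<close>

text \<open>Since a functional does not determine its horizontal derivative, one is named; the Ito
  formula and the chain rule are statements about that choice.\<close>

definition C12c_via ::
  "real \<Rightarrow> nat \<Rightarrow> (real ^ 'd::finite) set \<Rightarrow> (nat \<Rightarrow> real) set \<Rightarrow> 'd functional \<Rightarrow> (nat \<Rightarrow> 'd functional) \<Rightarrow> bool" where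
  "C12c_via T m U S F DF \<longleftrightarrow> F \<in> C12c T m U S \<and> is_horizontal_derivative T m U S F DF \<and>
     (\<forall>i\<le>m. continuous_at_fixed_times T m U S (DF i))"

lemma C12c_viaE:
  assumes "F \<in> C12c T m U S"
  obtains DF where "C12c_via T m U S F DF"
  using assms unfolding C12c_via_def C12c_def C12b_def by blast

lemma C12c_viaD:
  assumes "C12c_via T m U S F DF"
  shows "F \<in> C12c T m U S" "non_anticipative T m U S F" "left_continuous T m U S F"
    "vertically_differentiable T m U S F" "vertically_differentiable T m U S (vertical_partial T j F)"
    "left_continuous T m U S (vertical_partial T i F)" "boundedness_preserving T m U S (vertical_partial T i F)"
    "left_continuous T m U S (vertical_partial T i (vertical_partial T j F))"
    "boundedness_preserving T m U S (vertical_partial T i (vertical_partial T j F))"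
    "continuous_in_X_locally_uniformly T m U S F" "boundedness_preserving T m U S F"
    "is_horizontal_derivative T m U S F DF"
  using assms unfolding C12c_via_def C12c_def C12b_def by simp_all

lemma C12c_viaI:
  assumes "non_anticipative T m U S F" "left_continuous T m U S F" "vertically_differentiable T m U S F"
    and "\<And>j. vertically_differentiable T m U S (vertical_partial T j F)"
    and "\<And>i. left_continuous T m U S (vertical_partial T i F)" "\<And>i. boundedness_preserving T m U S (vertical_partial T i F)"
    and "\<And>i j. left_continuous T m U S (vertical_partial T i (vertical_partial T j F))"
    and "\<And>i j. boundedness_preserving T m U S (vertical_partial T i (vertical_partial T j F))"
    and "continuous_in_X_locally_uniformly T m U S F" "boundedness_preserving T m U S F"
    and "\<And>i. i \<le> m \<Longrightarrow> horizontal_integrand T m U S (DF i)"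
    and "\<And>s t X A. 0 \<le> s \<Longrightarrow> s < t \<Longrightarrow> t \<le> T \<Longrightarrow> X \<in> cadlag_paths T U \<Longrightarrow> A \<in> CBV T m S \<Longrightarrow>
      F t (stop s X) A - F s (stop s X) A = (\<Sum>i\<le>m. stieltjes_integral s t (\<lambda>r. DF i r (stop s X) A) (integrator A i))"
  shows "C12c_via T m U S F DF"
  unfolding C12c_via_def C12c_def C12b_def is_horizontal_derivative_def
  using assms unfolding horizontal_integrand_def by simp blast

lemma C12c_via_horizontal_integrand:
  assumes "C12c_via T m U S F DF" "i \<le> m"
  shows "horizontal_integrand T m U S (DF i)"
  using assms unfolding C12c_via_def is_horizontal_derivative_def horizontal_integrand_def by simp

lemma borel_measurable_restrict_Icc:
  assumes f: "bdd_measurable 0 T f" and "0 \<le> s" "t \<le> T"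
  shows "f \<in> borel_measurable (restrict_space borel {s..t})"
proof -
  have "(\<lambda>x. indicator {s..t} x *\<^sub>R f x) =
      (\<lambda>x. indicator {s..t} x * (indicator {0<..T} x * f x) + indicator ({s..t} \<inter> {0}) x * f 0)"
    using assms(2,3) by (auto simp: indicator_def)
  also have "\<dots> \<in> borel_measurable borel"
    by (rule borel_measurable_add[OF borel_measurable_times[OF _ f[unfolded bdd_measurable_def, THEN conjunct1]] borel_measurable_times]) auto
  finally show ?thesis by (subst borel_measurable_restrict_space_iff) auto
qed

text \<open>\<open>f\<close> is the pointwise limit of the step functions
  \<open>f (pre (Q n) r)\<close> along finer and finer subdivisions.\<close>

lemma left_continuous_measurable:
  fixes f :: "real \<Rightarrow> real"
  assumes lim: "\<And>u x. u \<in> {s<..t} \<Longrightarrow> (\<And>n. x n \<in> {s..u}) \<Longrightarrow> x \<longlonglongrightarrow> u \<Longrightarrow> (\<lambda>n. f (x n)) \<longlonglongrightarrow> f u"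
  shows "(\<lambda>r. indicator {s<..t} r * f r) \<in> borel_measurable borel"
proof (cases "s < t")
  case True
  then obtain Q where Q: "fine_subdivisions s t Q" using fine_subdivisions_exist by blast
  then have sub: "subdivision s t (Q n)" for n by (auto simp: fine_subdivisions_def)
  show ?thesis
  proof (rule borel_measurable_LIMSEQ_real)
    fix n
    have "bdd_measurable s t (\<lambda>u. f (pre (Q n) u))"
      by (rule bdd_measurable_pieces[OF sub, where h = "\<lambda>s _. f s"]) (rule bdd_measurable_const)
    then show "(\<lambda>r. indicator {s<..t} r * f (pre (Q n) r)) \<in> borel_measurable borel"
      by (simp add: bdd_measurable_def)
  next
    fix r :: real
    have "(\<lambda>n. f (pre (Q n) r)) \<longlonglongrightarrow> f r" if r: "r \<in> {s<..t}"
      by (rule lim[OF r]) (use pre_props[OF sub, of r] r pre_tendsto[OF Q, of r] in \<open>auto intro: less_imp_le\<close>)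
    then show "(\<lambda>n. indicator {s<..t} r * f (pre (Q n) r)) \<longlonglongrightarrow> indicator {s<..t} r * f r"
      by (cases "r \<in> {s<..t}") auto
  qed
next
  case False
  then show ?thesis by simp
qed

text \<open>The integral of the difference vanishes for all upper limits below \<open>t\<close> and
  is continuous in the upper limit. Through this, continuity of the integrators hides a change of
  the path at time \<open>t\<close>.\<close>

lemma stieltjes_integral_cong_open:
  assumes g: "cont_bv T g" and t: "0 \<le> t" "t \<le> T"
    and f: "bdd_measurable 0 t f" "bdd_measurable 0 t f'" and eq: "\<And>x. x \<in> {0<..<t} \<Longrightarrow> f x = f' x"
  shows "stieltjes_integral 0 t f g = stieltjes_integral 0 t f' g"
proof (cases "0 < t")
  case True
  have g': "cont_bv t g"
    using g t bounded_variation_on_subset[of 0 T g 0 t] continuous_on_subset[of "{0..T}" g "{0..t}"]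
    by (auto simp: cont_bv_def)
  have "stieltjes_integral 0 t (\<lambda>x. f x - f' x) g = 0"
  proof (rule continuous_constant_on_closure[of "{0..<t}" "\<lambda>u. stieltjes_integral 0 u (\<lambda>x. f x - f' x) g"])
    show "continuous_on (closure {0..<t}) (\<lambda>u. stieltjes_integral 0 u (\<lambda>x. f x - f' x) g)"
      using True continuous_on_stieltjes_integral[OF g' bdd_measurable_diff[OF f] t(1)] by simp
    fix u assume u: "u \<in> {0..<t}"
    have "stieltjes_integral 0 u (\<lambda>x. f x - f' x) g = stieltjes_integral 0 u (\<lambda>_. 0) g"
      by (rule stieltjes_integral_cong) (use u eq in auto)
    then show "stieltjes_integral 0 u (\<lambda>x. f x - f' x) g = 0"
      using stieltjes_integral_const[OF g', of 0 u 0] u by simp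
  qed (use True in auto)
  then show ?thesis using stieltjes_integral_diff[OF g' _ _ _ f] t by simp
next
  case False
  then show ?thesis using t by (simp add: stieltjes_integral_refl)
qed

context
  fixes T :: real and m :: nat and U :: "(real ^ 'd::finite) set" and S :: "(nat \<Rightarrow> real) set"
  assumes T: "0 < T" and U: "open U"
begin

lemma boundedness_preservingD:
  assumes "boundedness_preserving T m U S F" "A \<in> CBV T m S" "compact K" "K \<subseteq> U"
  obtains C where "C \<ge> 0" "\<And>t X. t \<in> {0..T} \<Longrightarrow> X \<in> cadlag_paths T K \<Longrightarrow> \<bar>F t X A\<bar> \<le> C"
proof -
  obtain C where C: "\<forall>t\<in>{0..T}. \<forall>X\<in>cadlag_paths T K. \<bar>F t X A\<bar> \<le> C"
    using assms(1)[unfolded boundedness_preserving_def, rule_format, OF assms(2), of K] assms(3,4) by blast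
  show ?thesis
  proof (rule that[of "\<bar>C\<bar>"])
    fix t X assume "t \<in> {0..T}" "X \<in> cadlag_paths T K"
    then have "\<bar>F t X A\<bar> \<le> C" using C by blast
    then show "\<bar>F t X A\<bar> \<le> \<bar>C\<bar>" by linarith
  qed simp
qed

section \<open>Closure properties of functionals and horizontal integrands\<close>

lemma horizontal_integrandI:
  assumes na: "non_anticipative T m U S E" and bp: "boundedness_preserving T m U S E"
    and cft: "continuous_at_fixed_times T m U S E"
    and meas: "\<And>s t X A. 0 \<le> s \<Longrightarrow> s < t \<Longrightarrow> t \<le> T \<Longrightarrow> X \<in> cadlag_paths T U \<Longrightarrow> A \<in> CBV T m S \<Longrightarrow>
       (\<lambda>r. E r (stop s X) A) \<in> borel_measurable (restrict_space borel {s..t})"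
  shows "horizontal_integrand T m U S E"
  unfolding horizontal_integrand_def by (intro conjI na bp cft allI ballI impI meas) auto

lemma non_anticipative_combine:
  assumes "non_anticipative T m U S E" "non_anticipative T m U S E'"
  shows "non_anticipative T m U S (\<lambda>t X A. h t (E t X A) (E' t X A))"
  unfolding non_anticipative_def
proof (intro ballI)
  fix t X A assume "t \<in> {0..T}" "X \<in> cadlag_paths T U" "A \<in> CBV T m S"
  then have "E t X A = E t (stop t X) (stop t A)" "E' t X A = E' t (stop t X) (stop t A)"
    using assms unfolding non_anticipative_def by blast+
  then show "h t (E t X A) (E' t X A) = h t (E t (stop t X) (stop t A)) (E' t (stop t X) (stop t A))" by simp
qed

lemma boundedness_preserving_combine:
  assumes "boundedness_preserving T m U S E" "boundedness_preserving T m U S E'"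
    and h: "\<And>t x y C C'. \<bar>x\<bar> \<le> C \<Longrightarrow> \<bar>y\<bar> \<le> C' \<Longrightarrow> \<bar>h t x y\<bar> \<le> B C C'"
  shows "boundedness_preserving T m U S (\<lambda>t X A. h t (E t X A) (E' t X A))"
  unfolding boundedness_preserving_def
proof (intro ballI allI impI, elim conjE)
  fix A K assume *: "A \<in> CBV T m S" "compact K" "K \<subseteq> U"
  obtain C where C: "\<And>t X. t \<in> {0..T} \<Longrightarrow> X \<in> cadlag_paths T K \<Longrightarrow> \<bar>E t X A\<bar> \<le> C"
    using boundedness_preservingD[OF assms(1) *] by metis
  obtain C' where C': "\<And>t X. t \<in> {0..T} \<Longrightarrow> X \<in> cadlag_paths T K \<Longrightarrow> \<bar>E' t X A\<bar> \<le> C'"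
    using boundedness_preservingD[OF assms(2) *] by metis
  show "\<exists>C. \<forall>t\<in>{0..T}. \<forall>X\<in>cadlag_paths T K. \<bar>h t (E t X A) (E' t X A)\<bar> \<le> C"
    by (rule exI[of _ "B C C'"]) (use C C' h in blast)
qed

lemma continuous_at_fixed_times_combine:
  assumes "continuous_at_fixed_times T m U S E" "continuous_at_fixed_times T m U S E'"
    and h: "\<And>t x y a b. x \<longlonglongrightarrow> a \<Longrightarrow> y \<longlonglongrightarrow> b \<Longrightarrow> (\<lambda>n. h t (x n) (y n)) \<longlonglongrightarrow> h t a b"
  shows "continuous_at_fixed_times T m U S (\<lambda>t X A. h t (E t X A) (E' t X A))"
proof (rule continuous_at_fixed_timesI[OF T U])
  fix t X A Y assume *: "t \<in> {0..T}" "X \<in> cadlag_paths T U" "A \<in> CBV T m S" "\<And>n. Y n \<in> cadlag_paths T U"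
     "uniform_limit {0..T} (\<lambda>n. stop t (Y n)) (stop t X) sequentially"
  show "(\<lambda>n. h t (E t (Y n) A) (E' t (Y n) A)) \<longlonglongrightarrow> h t (E t X A) (E' t X A)"
    by (intro h continuous_at_fixed_timesD[OF T U assms(1) *(1-3) _ *(5)]
          continuous_at_fixed_timesD[OF T U assms(2) *(1-3) _ *(5)]) (use * in auto)
qed

lemma left_continuous_combine:
  assumes "left_continuous T m U S E" "left_continuous T m U S E'"
    and h: "\<And>x y a b. x \<longlonglongrightarrow> a \<Longrightarrow> y \<longlonglongrightarrow> b \<Longrightarrow> (\<lambda>n. h (x n) (y n)) \<longlonglongrightarrow> h a b"
  shows "left_continuous T m U S (\<lambda>t X A. h (E t X A) (E' t X A))"
proof (rule left_continuousI[OF T U])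
  fix t X A Y s assume *: "t \<in> {0<..T}" "X \<in> cadlag_paths T U" "A \<in> CBV T m S" "\<And>n. Y n \<in> cadlag_paths T U" "\<And>n. s n \<in> {0..t}" "s \<longlonglongrightarrow> t"
     "uniform_limit {0..T} (\<lambda>n. stop (s n) (Y n)) (stop t X) sequentially"
  show "(\<lambda>n. h (E (s n) (Y n) A) (E' (s n) (Y n) A)) \<longlonglongrightarrow> h (E t X A) (E' t X A)"
    by (intro h left_continuousD[OF T U assms(1) *(1-3) _ *(5-7)]
          left_continuousD[OF T U assms(2) *(1-3) _ *(5-7)]) (use * in auto)
qed

lemma horizontal_integrand_add:
  assumes E: "horizontal_integrand T m U S E" "horizontal_integrand T m U S E'"
  shows "horizontal_integrand T m U S (\<lambda>t X A. E t X A + E' t X A)"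
proof (rule horizontal_integrandI)
  note D = horizontal_integrandD[OF T U E(1)] horizontal_integrandD[OF T U E(2)]
  show "non_anticipative T m U S (\<lambda>t X A. E t X A + E' t X A)"
    by (rule non_anticipative_combine[OF D(1) D(5)])
  show "boundedness_preserving T m U S (\<lambda>t X A. E t X A + E' t X A)"
    by (rule boundedness_preserving_combine[OF D(2) D(6), where B = "(+)"]) linarith
  show "continuous_at_fixed_times T m U S (\<lambda>t X A. E t X A + E' t X A)"
    by (rule continuous_at_fixed_times_combine[OF D(3) D(7)]) (rule tendsto_add)
qed (intro borel_measurable_add horizontal_integrandD(4)[OF T U E(1)] horizontal_integrandD(4)[OF T U E(2)])

lemma horizontal_integrand_mult:
  assumes E: "horizontal_integrand T m U S E" "horizontal_integrand T m U S E'"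
  shows "horizontal_integrand T m U S (\<lambda>t X A. E t X A * E' t X A)"
proof (rule horizontal_integrandI)
  note D = horizontal_integrandD[OF T U E(1)] horizontal_integrandD[OF T U E(2)]
  show "non_anticipative T m U S (\<lambda>t X A. E t X A * E' t X A)"
    by (rule non_anticipative_combine[OF D(1) D(5)])
  show "boundedness_preserving T m U S (\<lambda>t X A. E t X A * E' t X A)"
    by (rule boundedness_preserving_combine[OF D(2) D(6), where B = "(*)"]) (auto simp: abs_mult intro!: mult_mono)
  show "continuous_at_fixed_times T m U S (\<lambda>t X A. E t X A * E' t X A)"
    by (rule continuous_at_fixed_times_combine[OF D(3) D(7)]) (rule tendsto_mult)
qed (intro borel_measurable_times horizontal_integrandD(4)[OF T U E(1)] horizontal_integrandD(4)[OF T U E(2)])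

lemma horizontal_integrand_const: "horizontal_integrand T m U S (\<lambda>_ _ _. c)"
proof (rule horizontal_integrandI)
  show "continuous_at_fixed_times T m U S (\<lambda>_ _ _. c)"
    by (rule continuous_at_fixed_timesI[OF T U]) (rule tendsto_const)
  show "boundedness_preserving T m U S (\<lambda>_ _ _. c)"
    unfolding boundedness_preserving_def by (intro ballI allI impI exI[of _ "\<bar>c\<bar>"]) (rule order_refl)
qed (simp_all add: non_anticipative_def)

lemma horizontal_integrand_sum:
  "(\<And>i. i \<in> I \<Longrightarrow> horizontal_integrand T m U S (E i)) \<Longrightarrow> horizontal_integrand T m U S (\<lambda>t X A. \<Sum>i\<in>I. E i t X A)"
  by (induction I rule: infinite_finite_induct) (auto intro: horizontal_integrand_const horizontal_integrand_add)

text \<open>\<open>stop (s n) (Y n)\<close> is constant after \<open>s n\<close> and uniformly close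
  to \<open>stop t X\<close>. Hence \<open>stop t X\<close> itself oscillates little after
  \<open>s n\<close>, and stopping it anywhere in \<open>[s n,t]\<close> is a small change.\<close>

lemma uniform_limit_stop_squeeze:
  fixes X :: "'d path"
  assumes Y: "uniform_limit {0..T} (\<lambda>n. stop (s n) (Y n)) (stop t X) sequentially" and t: "t \<in> {0..T}"
    and c: "\<And>n. c n \<in> {s n..t}" and s: "\<And>n. 0 \<le> s n"
  shows "uniform_limit {0..T} (\<lambda>n. stop (c n) (stop t X)) (stop t X) sequentially"
  unfolding uniform_limit_norm
proof (intro allI impI)
  fix e :: real assume "e > 0"
  then have "\<forall>\<^sub>F n in sequentially. \<forall>u\<in>{0..T}. norm (stop (s n) (Y n) u - stop t X u) < e/2"
    by (intro uniform_limit_normD[OF Y]) simp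
  then show "\<forall>\<^sub>F n in sequentially. \<forall>u\<in>{0..T}. norm (stop (c n) (stop t X) u - stop t X u) < e"
  proof eventually_elim
    case (elim n)
    show ?case
    proof
      fix u assume u: "u \<in> {0..T}"
      show "norm (stop (c n) (stop t X) u - stop t X u) < e"
      proof (cases "u \<le> c n")
        case True
        then have "stop (c n) (stop t X) u = stop t X u" using u by (simp add: stop_def[of "c n"] min_absorb2 max_absorb2)
        then show ?thesis using \<open>e > 0\<close> by simp
      next
        case False
        have cT: "c n \<in> {0..T}" using c[of n] s[of n] t by auto
        have "stop (c n) (stop t X) u = stop t X (c n)" using False cT by (simp add: stop_apply[OF u])
        moreover have "stop (s n) (Y n) (c n) = stop (s n) (Y n) u"
          using False c[of n] s[of n] by (simp add: stop_apply[OF u] stop_apply[OF cT])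
        moreover have "norm (stop (s n) (Y n) (c n) - stop t X (c n)) < e/2" "norm (stop (s n) (Y n) u - stop t X u) < e/2"
          using elim u cT by blast+
        ultimately show ?thesis
          by (metis dist_norm dist_triangle_half_r)
      qed
    qed
  qed
qed

section \<open>Limits of a functional along a cadlag path\<close>

lemma horizontal_difference:
  assumes F: "C12c_via T m U S F DF" and st: "0 \<le> s" "s \<le> t" "t \<le> T" and X: "X \<in> cadlag_paths T U" and A: "A \<in> CBV T m S"
  shows "F t (stop s X) A - F s (stop s X) A =
    (\<Sum>i\<le>m. stieltjes_integral s t (\<lambda>r. DF i r (stop s X) A) (integrator A i))"
proof (cases "s = t")
  case True
  then show ?thesis by (simp add: stieltjes_integral_refl)
next
  case False
  then show ?thesis
    using C12c_viaD(12)[OF F] st X A unfolding is_horizontal_derivative_def by auto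
qed

text \<open>Along a stopped path the functional changes only by its horizontal integrals, and these
  are continuous in the upper limit.\<close>

lemma continuous_on_horizontal:
  assumes F: "C12c_via T m U S F DF" and s: "s \<in> {0..T}" and X: "X \<in> cadlag_paths T U" and A: "A \<in> CBV T m S"
  shows "continuous_on {s..T} (\<lambda>u. F u (stop s X) A)"
proof -
  have sX: "stop s X \<in> cadlag_paths T U" using X s by (intro cadlag_paths_stop) auto
  let ?I = "\<lambda>i u. stieltjes_integral 0 u (\<lambda>r. DF i r (stop s X) A) (integrator A i)"
  have g: "cont_bv T (integrator A i)" if "i \<le> m" for i using cont_bv_integrator[OF A that] T by simp
  have m: "bdd_measurable 0 T (\<lambda>r. DF i r (stop s X) A)" if "i \<le> m" for i
    by (rule horizontal_integrand_measurable[OF T U C12c_via_horizontal_integrand[OF F that] sX A])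
  have eq: "F u (stop s X) A = F s (stop s X) A + (\<Sum>i\<le>m. ?I i u - ?I i s)" if u: "u \<in> {s..T}" for u
  proof -
    have "?I i u - ?I i s = stieltjes_integral s u (\<lambda>r. DF i r (stop s X) A) (integrator A i)" if "i \<le> m" for i
      using stieltjes_integral_combine[OF g[OF that] _ _ _ _ bdd_measurable_subset[OF m[OF that]], of 0 s u] u s by simp
    then show ?thesis using horizontal_difference[OF F _ _ _ X A, of s u] u s by simp
  qed
  have cI: "continuous_on {s..T} (?I i)" if "i \<le> m" for i
    using continuous_on_stieltjes_integral[OF g[OF that] m[OF that]] s T by (auto intro: continuous_on_subset)
  have "continuous_on {s..T} (\<lambda>u. F s (stop s X) A + (\<Sum>i\<le>m. ?I i u - ?I i s))"
    by (intro continuous_on_add continuous_on_const continuous_on_sum continuous_on_diff cI) auto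
  then show ?thesis by (rule continuous_on_eq) (rule eq[symmetric])
qed

lemma functional_right_limit:
  assumes F: "C12c_via T m U S F DF" and t: "t \<in> {0..T}" and X: "X \<in> cadlag_paths T U" and A: "A \<in> CBV T m S"
    and u: "\<And>n. u n \<in> {t..T}" "u \<longlonglongrightarrow> t"
  shows "(\<lambda>n. F (u n) X A) \<longlonglongrightarrow> F t X A"
proof -
  have uT: "u n \<in> {0..T}" for n using u(1)[of n] t by auto
  have sX: "stop t X \<in> cadlag_paths T U" using X t by (intro cadlag_paths_stop) auto
  have lim: "uniform_limit {0..T} (\<lambda>n. stop (u n) X) (stop t X) sequentially"
    unfolding uniform_limit_norm
  proof (intro allI impI)
    fix e :: real assume e: "e > 0"
    obtain \<eta> where \<eta>: "\<eta> > 0" "\<And>v. v \<in> {0..T} \<Longrightarrow> t \<le> v \<Longrightarrow> v < t + \<eta> \<Longrightarrow> dist (X v) (X t) < e"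
      using cadlag_paths_local[OF X t e] by metis
    have "\<forall>\<^sub>F n in sequentially. dist (u n) t < \<eta>" by (rule tendstoD[OF u(2) \<eta>(1)])
    then show "\<forall>\<^sub>F n in sequentially. \<forall>v\<in>{0..T}. norm (stop (u n) X v - stop t X v) < e"
    proof eventually_elim
      case (elim n)
      show ?case
      proof
        fix v assume v: "v \<in> {0..T}"
        show "norm (stop (u n) X v - stop t X v) < e"
        proof (cases "v < t")
          case True
          then show ?thesis using u(1)[of n] t e by (simp add: stop_apply[OF v])
        next
          case False
          have "stop (u n) X v = X (min (u n) v)" using v uT[of n] by (simp add: stop_def)
          moreover have "stop t X v = X t" using False t by (simp add: stop_apply[OF v])
          moreover have "dist (X (min (u n) v)) (X t) < e"
            by (rule \<eta>(2)) (use elim v uT[of n] u(1)[of n] False in \<open>auto simp: dist_real_def min_def\<close>)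
          ultimately show ?thesis by (simp add: dist_norm)
        qed
      qed
    qed
  qed
  have 1: "(\<lambda>n. F (u n) (stop (u n) X) A - F (u n) (stop t X) A) \<longlonglongrightarrow> 0"
    by (rule continuous_in_X_locally_uniformlyD[OF T U C12c_viaD(10)[OF F] sX A _ lim uT])
       (use X uT in \<open>auto intro!: always_eventually cadlag_paths_stop\<close>)
  have 2: "(\<lambda>n. F (u n) (stop t X) A) \<longlonglongrightarrow> F t (stop t X) A"
    using continuous_on_horizontal[OF F t X A] u t
    unfolding continuous_on_sequentially comp_def by auto
  have "F (u n) (stop (u n) X) A = F (u n) X A" for n
    by (rule non_anticipative_stop[OF T U C12c_viaD(2)[OF F] uT _ X A]) (use uT[of n] in auto)
  moreover have "F t (stop t X) A = F t X A"
    by (rule non_anticipative_stop[OF T U C12c_viaD(2)[OF F] t _ X A]) (use t in auto)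
  ultimately show ?thesis using tendsto_add[OF 1 2] by simp
qed

text \<open>The limit is the value at the path \<open>X\<close> stopped just before
  \<open>t\<close>, to which the paths stopped at \<open>u n < t\<close> converge uniformly;
  \<open>X\<close> itself may jump at \<open>t\<close>.\<close>

lemma functional_left_limit:
  assumes F: "left_continuous T m U S F" and t: "t \<in> {0<..T}" and X: "X \<in> cadlag_paths T U" and A: "A \<in> CBV T m S"
    and l: "(X \<longlongrightarrow> l) (at_left t)" "l \<in> U" and u: "\<And>n. u n \<in> {0..<t}" "u \<longlonglongrightarrow> t"
  shows "(\<lambda>n. F (u n) X A) \<longlonglongrightarrow> F t (\<lambda>v. if v < t then X v else l) A"
proof -
  let ?Z = "\<lambda>v. if v < t then X v else l"
  have Z: "?Z \<in> cadlag_paths T U" by (intro cadlag_paths_glue X cadlag_paths_const l)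
  have t0: "0 < t" using t by simp
  have lim: "uniform_limit {0..T} (\<lambda>n. stop (u n) X) (stop t ?Z) sequentially"
    unfolding uniform_limit_norm
  proof (intro allI impI)
    fix e :: real assume e: "e > 0"
    then have "\<forall>\<^sub>F v in at_left t. dist (X v) l < e/2" using l(1) by (intro tendstoD) auto
    then obtain b where b: "b < t" "\<And>v. b < v \<Longrightarrow> v < t \<Longrightarrow> dist (X v) l < e/2"
      unfolding eventually_at_left[OF t0] by blast
    have "\<forall>\<^sub>F n in sequentially. b < u n" using order_tendstoD(1)[OF u(2) b(1)] .
    then show "\<forall>\<^sub>F n in sequentially. \<forall>v\<in>{0..T}. norm (stop (u n) X v - stop t ?Z v) < e"
    proof eventually_elim
      case (elim n)
      show ?case
      proof
        fix v assume v: "v \<in> {0..T}"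
        have un: "0 \<le> u n" "u n < t" using u(1)[of n] by auto
        have du: "dist (X (u n)) l < e/2" using b(2)[of "u n"] elim un by auto
        consider "v < u n" | "u n \<le> v" "v < t" | "t \<le> v" by linarith
        then show "norm (stop (u n) X v - stop t ?Z v) < e"
        proof cases
          case 1
          then show ?thesis using un e by (simp add: stop_apply[OF v])
        next
          case 2
          have "dist (X v) l < e/2" using b(2)[of v] elim 2 by auto
          then have "dist (X (u n)) (X v) < e" using du by (metis dist_triangle_half_l)
          then show ?thesis using 2 un t0 by (simp add: stop_apply[OF v] dist_norm)
        next
          case 3
          then show ?thesis using un du e t0 by (simp add: stop_apply[OF v] dist_norm)
        qed
      qed
    qed
  qed
  show ?thesis
    by (rule left_continuousD[OF T U F t Z A _ _ u(2) lim]) (use X u(1) in \<open>auto intro: less_imp_le\<close>)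
qed

context
  fixes F :: "'n::finite \<Rightarrow> 'd functional" and DF :: "'n \<Rightarrow> nat \<Rightarrow> 'd functional"
  assumes F: "\<And>l. C12c_via T m U S (F l) (DF l)"
begin

text \<open>Combines the two one-sided limits componentwise. The values of \<open>F\<close> are not
  confined to any open set, so functionals to be composed with \<open>F\<close> live on paths with
  values in \<open>UNIV\<close>.\<close>

lemma functional_path_cadlag:
  assumes X: "X \<in> cadlag_paths T U" and A: "A \<in> CBV T m S"
  shows "functional_path F X A \<in> cadlag_paths T UNIV"
  unfolding cadlag_paths_def
proof (intro CollectI conjI ballI)
  fix t assume t: "t \<in> {0..<T}"
  have "((\<lambda>u. F l u X A) \<longlongrightarrow> F l t X A) (at_right t)" for l
  proof (rule tendsto_at_right_sequentially[of t T])
    fix x assume x: "\<And>n. t < x n" "\<And>n. x n < T" "x \<longlonglongrightarrow> t"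
    show "(\<lambda>n. F l (x n) X A) \<longlonglongrightarrow> F l t X A"
      by (rule functional_right_limit[OF F _ X A]) (use t x less_imp_le in auto)
  qed (use t in auto)
  then show "(functional_path F X A \<longlongrightarrow> functional_path F X A t) (at_right t)"
    unfolding functional_path_def by (intro tendsto_vec_lambda)
next
  fix t assume t: "t \<in> {0<..T}"
  obtain l where l: "l \<in> U" "(X \<longlongrightarrow> l) (at_left t)" using cadlag_pathsD(3)[OF X t] by blast
  let ?Z = "\<lambda>v. if v < t then X v else l"
  have "((\<lambda>u. F k u X A) \<longlongrightarrow> F k t ?Z A) (at_left t)" for k
  proof (rule tendsto_at_left_sequentially[of 0 t])
    fix x assume x: "\<And>n. x n < t" "\<And>n. 0 < x n" "x \<longlonglongrightarrow> t"
    show "(\<lambda>n. F k (x n) X A) \<longlonglongrightarrow> F k t ?Z A"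
      by (rule functional_left_limit[OF C12c_viaD(3)[OF F] t X A l(2,1)]) (use x less_imp_le in auto)
  qed (use t in auto)
  then have "(functional_path F X A \<longlongrightarrow> (\<chi> k. F k t ?Z A)) (at_left t)"
    unfolding functional_path_def by (intro tendsto_vec_lambda)
  then show "\<exists>l\<in>UNIV. (functional_path F X A \<longlongrightarrow> l) (at_left t)" by blast
qed auto

text \<open>Continuity in the path that is locally uniform in time, evaluated at arbitrary moving
  times, amounts to uniform convergence of the paths of values.\<close>

lemma functional_path_uniform_limit:
  assumes X: "X \<in> cadlag_paths T U" and A: "A \<in> CBV T m S" and Y: "\<forall>\<^sub>F n in sequentially. Y n \<in> cadlag_paths T U"
    and lim: "uniform_limit {0..T} Y X sequentially"
  shows "uniform_limit {0..T} (\<lambda>n. functional_path F (Y n) A) (functional_path F X A) sequentially"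
proof (rule uniform_limit_sequences)
  fix u :: "nat \<Rightarrow> real" assume u: "\<And>n. u n \<in> {0..T}"
  show "(\<lambda>n. functional_path F (Y n) A (u n) - functional_path F X A (u n)) \<longlonglongrightarrow> 0"
    by (rule vec_tendstoI)
       (simp add: functional_path_def continuous_in_X_locally_uniformlyD[OF T U C12c_viaD(10)[OF F] X A Y lim u])
qed

lemma stop_functional_path:
  assumes X: "X \<in> cadlag_paths T U" and A: "A \<in> CBV T m S" and t: "t \<in> {0..T}"
  shows "stop t (functional_path F (stop t X) A) = stop t (functional_path F X A)"
proof (rule stop_cong)
  fix u assume u: "u \<in> {0..t}"
  have "F l u (stop t X) A = F l u X A" for l
    by (rule non_anticipative_stop[OF T U C12c_viaD(2)[OF F] _ _ X A]) (use u t in auto)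
  then show "functional_path F (stop t X) A u = functional_path F X A u" by (simp add: functional_path_def)
qed (use t in auto)

text \<open>Transports the hypothesis of left-continuity from \<open>X\<close> to the path of
  values, so that a left-continuous functional of the latter is one of \<open>X\<close>. Uniformity
  is tested at moving times \<open>u n\<close>: the path is exchanged at equal times, and then the
  time is moved along the fixed path \<open>stop t X\<close>.\<close>

lemma functional_path_left_limit:
  assumes t: "t \<in> {0<..T}" and X: "X \<in> cadlag_paths T U" and A: "A \<in> CBV T m S"
    and Y: "\<forall>\<^sub>F n in sequentially. Y n \<in> cadlag_paths T U" and s: "\<And>n. s n \<in> {0..t}" "s \<longlonglongrightarrow> t"
    and lim: "uniform_limit {0..T} (\<lambda>n. stop (s n) (Y n)) (stop t X) sequentially"
  shows "uniform_limit {0..T} (\<lambda>n. stop (s n) (functional_path F (Y n) A)) (stop t (functional_path F X A)) sequentially"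
proof (rule uniform_limit_sequences)
  fix u :: "nat \<Rightarrow> real" assume u: "\<And>n. u n \<in> {0..T}"
  let ?X = "stop t X" and ?Y = "\<lambda>n. stop (s n) (Y n)"
  have tT: "t \<in> {0..T}" and sT: "s n \<in> {0..T}" for n using t s(1)[of n] by auto
  have X': "?X \<in> cadlag_paths T U" using X tT by (intro cadlag_paths_stop) auto
  have Y': "\<forall>\<^sub>F n in sequentially. ?Y n \<in> cadlag_paths T U"
    using Y by eventually_elim (use sT in \<open>auto intro: cadlag_paths_stop\<close>)
  \<comment> \<open>If \<open>u n \<le> s n\<close>, then \<open>?v n = ?w n\<close> and
    \<open>?b n = s n\<close>; otherwise \<open>?v n = s n\<close> and \<open>?w n = ?b n\<close>.
    Either way the difference between the times \<open>?v n\<close> and \<open>?w n\<close> is the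
    one between \<open>s n\<close> and \<open>?b n\<close>, and both of these lie in
    \<open>[s n,t]\<close>.\<close>
  let ?v = "\<lambda>n. min (s n) (u n)" and ?w = "\<lambda>n. min t (u n)" and ?b = "\<lambda>n. max (s n) (min t (u n))"
  have vw: "?v n \<in> {0..T}" "?w n \<in> {0..T}" "?v n \<le> s n" "?w n \<le> t" for n using u[of n] s(1)[of n] t by auto
  have "(\<lambda>n. F l (?v n) (Y n) A - F l (?w n) X A) \<longlonglongrightarrow> 0" for l
  proof -
    note na = non_anticipative_stop[OF T U C12c_viaD(2)[OF F]]
    have 1: "(\<lambda>n. F l (?v n) (?Y n) A - F l (?v n) ?X A) \<longlonglongrightarrow> 0"
      by (rule continuous_in_X_locally_uniformlyD[OF T U C12c_viaD(10)[OF F] X' A Y' lim vw(1)])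
    have 2: "(\<lambda>n. F l (c n) ?X A) \<longlonglongrightarrow> F l t ?X A" if c: "\<And>n. c n \<in> {s n..t}" for c
    proof (rule left_continuousD[OF T U C12c_viaD(3)[OF F] t X' A])
      show "c n \<in> {0..t}" for n using c[of n] s(1)[of n] by auto
      show "c \<longlonglongrightarrow> t"
        by (rule tendsto_sandwich[OF _ _ s(2) tendsto_const]) (use c in auto)
      show "uniform_limit {0..T} (\<lambda>n. stop (c n) ?X) (stop t ?X) sequentially"
        using uniform_limit_stop_squeeze[OF lim tT c] s(1) tT by (simp add: stop_stop)
    qed (use X' in auto)
    have "(\<lambda>n. F l (s n) ?X A - F l (?b n) ?X A) \<longlonglongrightarrow> F l t ?X A - F l t ?X A"
      by (intro tendsto_diff 2) (use s(1) in auto)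
    moreover have "F l (s n) ?X A - F l (?b n) ?X A = F l (?v n) ?X A - F l (?w n) ?X A" for n
      using s(1)[of n] by (auto simp: min_def max_def)
    ultimately have "(\<lambda>n. F l (?v n) ?X A - F l (?w n) ?X A) \<longlonglongrightarrow> 0" by simp
    from tendsto_add[OF 1 this] have 3: "(\<lambda>n. F l (?v n) (?Y n) A - F l (?w n) ?X A) \<longlonglongrightarrow> 0" by simp
    have 4: "F l (?w n) ?X A = F l (?w n) X A" for n
      by (rule na[OF vw(2) _ X A]) (use vw(4)[of n] tT in auto)
    have "\<forall>\<^sub>F n in sequentially. F l (?v n) (?Y n) A - F l (?w n) ?X A = F l (?v n) (Y n) A - F l (?w n) X A"
      using Y
    proof eventually_elim
      case (elim n)
      have "F l (?v n) (?Y n) A = F l (?v n) (Y n) A"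
        by (rule na[OF vw(1) _ elim A]) (use vw(3)[of n] sT[of n] in auto)
      then show ?case using 4 by simp
    qed
    then show ?thesis using 3 by (rule Lim_transform_eventually[rotated])
  qed
  then show "(\<lambda>n. stop (s n) (functional_path F (Y n) A) (u n) - stop t (functional_path F X A) (u n)) \<longlonglongrightarrow> 0"
    by (intro vec_tendstoI) (use vw in \<open>simp add: functional_path_def stop_def max_absorb2\<close>)
qed

end

end

section \<open>Vertical derivatives and integral functionals\<close>

lemma bump_bump: "bump T t w (bump T t v X) = bump T t (w + v) X"
  by (simp add: bump_def fun_eq_iff algebra_simps)

lemma bump_zero: "bump T t 0 X = X"
  by (simp add: bump_def)

lemma has_derivative_cong_ev_minus_const:
  fixes f g :: "'a::real_normed_vector \<Rightarrow> real"
  assumes ev: "\<forall>\<^sub>F v in nhds 0. g v = f v - k"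
  shows "(g has_derivative D) (at 0) \<longleftrightarrow> (f has_derivative D) (at 0)"
proof -
  have at: "\<forall>\<^sub>F v in at 0. g v = f v - k" and 0: "g 0 = f 0 - k"
    using ev by (auto simp: eventually_nhds_conv_at)
  show ?thesis
  proof
    assume "(g has_derivative D) (at 0)"
    then have "((\<lambda>v. f v - k) has_derivative D) (at 0)"
      by (rule has_derivative_transform_eventually) (use at 0 in auto)
    from has_derivative_add_const[OF this, of k] show "(f has_derivative D) (at 0)" by simp
  next
    assume "(f has_derivative D) (at 0)"
    then have "((\<lambda>v. f v - k) has_derivative D) (at 0)"
      using has_derivative_add_const[of f D "at 0" "- k"] by simp
    then show "(g has_derivative D) (at 0)"
      by (rule has_derivative_transform_eventually) (use at 0 in \<open>auto elim: eventually_mono\<close>)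
  qed
qed

text \<open>\<open>frechet_derivative\<close> chooses among the derivatives, and two germs at 0 that
  differ by a constant have the same derivatives to choose from. The equality of partial derivatives
  therefore holds even where none exists.\<close>

lemma vertical_partial_minus_const:
  fixes F :: "'d::finite functional" and F' :: "'d functional"
  assumes "\<forall>\<^sub>F v in nhds 0. F' t' (bump T t' v X') A' = F t (bump T t v X) A - k"
  shows "vertical_partial T i F' t' X' A' = vertical_partial T i F t X A"
    and "(\<lambda>v. F t (bump T t v X) A) differentiable (at 0) \<longleftrightarrow> (\<lambda>v. F' t' (bump T t' v X') A') differentiable (at 0)"
  using has_derivative_cong_ev_minus_const[OF assms]
  unfolding vertical_partial_def frechet_derivative_def differentiable_def by auto

lemmas vertical_partial_cong = vertical_partial_minus_const[where k = 0, simplified]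

definition integral_functional :: "nat \<Rightarrow> (nat \<Rightarrow> 'd::finite functional) \<Rightarrow> 'd functional" where
  "integral_functional m E t X A = (\<Sum>i\<le>m. stieltjes_integral 0 t (\<lambda>r. E i r X A) (integrator A i))"

context
  fixes T :: real and m :: nat and U :: "(real ^ 'd::finite) set" and S :: "(nat \<Rightarrow> real) set"
  assumes T: "0 < T" and U: "open U"
begin

text \<open>A bump by \<open>w\<close> is a bump by \<open>w - v\<close> of the path already bumped
  by \<open>v\<close>. Differentiability at 0 for every path thus gives differentiability at every
  admissible \<open>v\<close>.\<close>

lemma vertical_has_derivative:
  assumes F: "vertically_differentiable T m U S F" and t: "t \<in> {0..T}" and A: "A \<in> CBV T m S"
    and X: "bump T t v X \<in> cadlag_paths T U"
  shows "((\<lambda>w. F t (bump T t w X) A) has_derivative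
     (\<lambda>h. \<Sum>i\<in>UNIV. h $ i * vertical_partial T i F t (bump T t v X) A)) (at v)"
proof -
  let ?f = "\<lambda>w. F t (bump T t w (bump T t v X)) A"
  define D where "D = frechet_derivative ?f (at 0)"
  have D: "(?f has_derivative D) (at 0)"
    using F t A X unfolding vertically_differentiable_def D_def frechet_derivative_works by blast
  then have lin: "linear D" by (rule has_derivative_linear)
  have D_eq: "D h = (\<Sum>i\<in>UNIV. h $ i * vertical_partial T i F t (bump T t v X) A)" for h
  proof -
    have "h = (\<Sum>i\<in>UNIV. h $ i *\<^sub>R axis i 1)"
      using basis_expansion[of h] by (simp add: scalar_mult_eq_scaleR)
    then have "D h = D (\<Sum>i\<in>UNIV. h $ i *\<^sub>R axis i 1)" by simp
    also have "\<dots> = (\<Sum>i\<in>UNIV. h $ i * D (axis i 1))"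
      by (simp add: linear_sum[OF lin] linear_scale[OF lin])
    finally show ?thesis by (simp add: D_def vertical_partial_def)
  qed
  have "((\<lambda>w. ?f (w - v)) has_derivative (\<lambda>h. D h)) (at v)"
    by (rule has_derivative_compose[of "\<lambda>w. w - v" "\<lambda>h. h" v UNIV ?f D])
       (use D in \<open>auto intro!: derivative_eq_intros\<close>)
  then show ?thesis unfolding bump_bump D_eq by simp
qed

lemma non_anticipative_vertical_partial:
  assumes F: "non_anticipative T m U S F"
  shows "non_anticipative T m U S (vertical_partial T i F)"
  unfolding non_anticipative_def
proof (intro ballI)
  fix t X A assume t: "t \<in> {0..T}" and X: "X \<in> cadlag_paths T U" and A: "A \<in> CBV T m S"
  have t': "0 \<le> t" "t \<le> T" using t by auto
  have sX: "stop t X \<in> cadlag_paths T U" and sA: "stop t A \<in> CBV T m S"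
    using cadlag_paths_stop[OF X t'] CBV_stop[OF A t] .
  have "\<forall>\<^sub>F v in nhds 0. F t (bump T t v X) A = F t (bump T t v (stop t X)) (stop t A)"
    using cadlag_paths_bump_small[OF X U t'(1)] cadlag_paths_bump_small[OF sX U t'(1)]
  proof eventually_elim
    case (elim v)
    show ?case
    proof (rule non_anticipative_cong[OF T U F t elim _ A sA])
      fix u assume "u \<in> {0..t}"
      then show "bump T t v X u = bump T t v (stop t X) u" "A u = stop t A u"
        using t by (auto simp: bump_def stop_def)
    qed
  qed
  then show "vertical_partial T i F t X A = vertical_partial T i F t (stop t X) (stop t A)"
    by (intro vertical_partial_cong(1)) (auto elim: eventually_mono)
qed

lemma left_continuous_cong:
  assumes F: "left_continuous T m U S F"
    and eq: "\<And>t X A. t \<in> {0..T} \<Longrightarrow> X \<in> cadlag_paths T U \<Longrightarrow> A \<in> CBV T m S \<Longrightarrow> F t X A = G t X A"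
  shows "left_continuous T m U S G"
proof (rule left_continuousI[OF T U])
  fix t X A Y s assume *: "t \<in> {0<..T}" "X \<in> cadlag_paths T U" "A \<in> CBV T m S" "\<And>n. Y n \<in> cadlag_paths T U" "\<And>n. s n \<in> {0..t}" "s \<longlonglongrightarrow> t"
     "uniform_limit {0..T} (\<lambda>n. stop (s n) (Y n)) (stop t X) sequentially"
  have "(\<lambda>n. F (s n) (Y n) A) \<longlonglongrightarrow> F t X A"
    by (rule left_continuousD[OF T U F *(1-3) _ *(5-7)]) (use * in auto)
  moreover have "F t X A = G t X A" using * by (intro eq) auto
  moreover have "F (s n) (Y n) A = G (s n) (Y n) A" for n using *(1,3,4) *(5)[of n] by (intro eq) auto
  ultimately show "(\<lambda>n. G (s n) (Y n) A) \<longlonglongrightarrow> G t X A" by simp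
qed

lemma boundedness_preserving_cong:
  assumes F: "boundedness_preserving T m U S F"
    and eq: "\<And>t X A. t \<in> {0..T} \<Longrightarrow> X \<in> cadlag_paths T U \<Longrightarrow> A \<in> CBV T m S \<Longrightarrow> F t X A = G t X A"
  shows "boundedness_preserving T m U S G"
  unfolding boundedness_preserving_def
proof (intro ballI allI impI, elim conjE)
  fix A K assume *: "A \<in> CBV T m S" "compact K" "K \<subseteq> U"
  obtain C where C: "\<And>t X. t \<in> {0..T} \<Longrightarrow> X \<in> cadlag_paths T K \<Longrightarrow> \<bar>F t X A\<bar> \<le> C"
    using boundedness_preservingD[OF T U F *] by metis
  have "\<bar>G t X A\<bar> \<le> C" if "t \<in> {0..T}" "X \<in> cadlag_paths T K" for t X
    using C[OF that] eq[OF that(1) cadlag_paths_mono[OF that(2) *(3)] *(1)] by simp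
  then show "\<exists>C. \<forall>t\<in>{0..T}. \<forall>X\<in>cadlag_paths T K. \<bar>G t X A\<bar> \<le> C" by blast
qed

text \<open>Admits gradients as factors of horizontal derivatives, for which continuity at fixed
  times and measurability along stopped paths are required. Along a stopped path a left-continuous
  functional is a left-continuous function of time, hence Borel.\<close>

lemma horizontal_integrand_left:
  assumes na: "non_anticipative T m U S H" and lc: "left_continuous T m U S H" and bp: "boundedness_preserving T m U S H"
  shows "horizontal_integrand T m U S (\<lambda>t X A. if t = 0 then 0 else H t X A)"
proof (rule horizontal_integrandI[OF T U])
  let ?H = "\<lambda>t X A. if t = 0 then 0 else H t X A"
  show "non_anticipative T m U S ?H"
    using non_anticipative_combine[OF T U na na, of "\<lambda>t x y. if t = 0 then 0 else x"] .
  show "boundedness_preserving T m U S ?H"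
    by (rule boundedness_preserving_combine[OF T U bp bp, of "\<lambda>t x y. if t = 0 then 0 else x" "\<lambda>x y. \<bar>x\<bar>"]) auto
  show "continuous_at_fixed_times T m U S ?H" by (rule left_continuous_imp_fixed_times[OF T U lc])
  fix s t X A assume st: "0 \<le> s" "s < t" "t \<le> T" and X: "X \<in> cadlag_paths T U" and A: "A \<in> CBV T m S"
  let ?f = "\<lambda>r. ?H r (stop s X) A"
  have sX: "stop s X \<in> cadlag_paths T U" using cadlag_paths_stop[OF X] st by simp
  have 1: "(\<lambda>r. indicator {s<..t} r * ?f r) \<in> borel_measurable borel"
  proof (rule left_continuous_measurable)
    fix u x assume u: "u \<in> {s<..t}" and x: "\<And>n. x n \<in> {s..u}" "x \<longlonglongrightarrow> u"
    have "(\<lambda>n. H (x n) (stop s X) A) \<longlonglongrightarrow> H u (stop s X) A"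
    proof (rule left_continuousD[OF T U lc _ sX A _ _ x(2)])
      show "x n \<in> {0..u}" for n using x(1)[of n] st by auto
      have "stop (x n) (stop s X) = stop s X" "stop u (stop s X) = stop s X" for n
        using x(1)[of n] st u by (simp_all add: stop_stop min_absorb1)
      then show "uniform_limit {0..T} (\<lambda>n. stop (x n) (stop s X)) (stop u (stop s X)) sequentially"
        by (simp add: uniform_limit_norm)
    qed (use sX u st in auto)
    \<comment> \<open>The times \<open>x n\<close> eventually exceed \<open>s\<close>, hence 0, so
      the cut at time 0 is not seen even when \<open>s = 0\<close>.\<close>
    moreover have "\<forall>\<^sub>F n in sequentially. H (x n) (stop s X) A = ?f (x n)"
    proof -
      have "\<forall>\<^sub>F n in sequentially. s < x n" using order_tendstoD(1)[OF x(2), of s] u by simp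
      then show ?thesis by eventually_elim (use st in auto)
    qed
    ultimately have "(\<lambda>n. ?f (x n)) \<longlonglongrightarrow> H u (stop s X) A" by (rule Lim_transform_eventually)
    then show "(\<lambda>n. ?f (x n)) \<longlonglongrightarrow> ?f u" using u st by simp
  qed
  have "(\<lambda>x. indicator {s..t} x *\<^sub>R ?f x) = (\<lambda>x. indicator {s<..t} x * ?f x + indicator {s} x * ?f s)"
    using st by (auto simp: indicator_def)
  also have "\<dots> \<in> borel_measurable borel"
    by (rule borel_measurable_add[OF 1 borel_measurable_times]) auto
  finally show "?f \<in> borel_measurable (restrict_space borel {s..t})"
    by (subst borel_measurable_restrict_space_iff) auto
qed

context
  fixes E :: "nat \<Rightarrow> 'd functional"
  assumes E: "\<And>i. i \<le> m \<Longrightarrow> horizontal_integrand T m U S (E i)"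
begin

lemma integrator_cont_bv: "A \<in> CBV T m S \<Longrightarrow> i \<le> m \<Longrightarrow> cont_bv T (integrator A i)"
  using cont_bv_integrator T by (metis less_imp_le)

lemma integrand_measurable:
  "i \<le> m \<Longrightarrow> X \<in> cadlag_paths T U \<Longrightarrow> A \<in> CBV T m S \<Longrightarrow> 0 \<le> s \<Longrightarrow> t \<le> T \<Longrightarrow> bdd_measurable s t (\<lambda>r. E i r X A)"
  using bdd_measurable_subset[OF horizontal_integrand_measurable[OF T U E]] by blast

lemma non_anticipative_integral_functional: "non_anticipative T m U S (integral_functional m E)"
  unfolding non_anticipative_def integral_functional_def
proof (intro ballI sum.cong refl)
  fix t X A i assume t: "t \<in> {0..T}" and X: "X \<in> cadlag_paths T U" and A: "A \<in> CBV T m S" and i: "i \<in> {..m}"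
  have sX: "stop t X \<in> cadlag_paths T U" and sA: "stop t A \<in> CBV T m S"
    using cadlag_paths_stop[OF X] CBV_stop[OF A t] t by auto
  have st: "stop t X u = X u" "stop t A u = A u" if "u \<in> {0..t}" for u
    using that t by (auto simp: stop_def)
  show "stieltjes_integral 0 t (\<lambda>r. E i r X A) (integrator A i) =
      stieltjes_integral 0 t (\<lambda>r. E i r (stop t X) (stop t A)) (integrator (stop t A) i)"
  proof (rule stieltjes_integral_cong)
    fix r assume r: "r \<in> {0<..t}"
    show "E i r X A = E i r (stop t X) (stop t A)"
      by (rule non_anticipative_cong[OF T U horizontal_integrandD(1)[OF T U E] _ X sX _ A sA]) (use r t i st in auto)
  next
    fix r assume "r \<in> {0..t}"
    then show "integrator A i r = integrator (stop t A) i r"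
      using st by (auto simp: integrator_def split: nat.split)
  qed (use t in auto)
qed

lemma boundedness_preserving_integral_functional: "boundedness_preserving T m U S (integral_functional m E)"
  unfolding boundedness_preserving_def
proof (intro ballI allI impI, elim conjE)
  fix A K assume *: "A \<in> CBV T m S" "compact K" "K \<subseteq> U"
  have "\<exists>C. C \<ge> 0 \<and> (\<forall>t\<in>{0..T}. \<forall>X\<in>cadlag_paths T K. \<bar>E i t X A\<bar> \<le> C)" if "i \<le> m" for i
    using boundedness_preservingD[OF T U horizontal_integrandD(2)[OF T U E[OF that]] *] by metis
  then obtain C where C0: "\<And>i. i \<le> m \<Longrightarrow> C i \<ge> 0"
     and C: "\<And>i t X. i \<le> m \<Longrightarrow> t \<in> {0..T} \<Longrightarrow> X \<in> cadlag_paths T K \<Longrightarrow> \<bar>E i t X A\<bar> \<le> C i"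
    by metis
  have "\<bar>integral_functional m E t X A\<bar> \<le> (\<Sum>i\<le>m. 3 * C i * total_variation (integrator A i) 0 T)"
    if t: "t \<in> {0..T}" and X: "X \<in> cadlag_paths T K" for t X
    unfolding integral_functional_def
  proof (rule order_trans[OF sum_abs sum_mono])
    fix i assume i: "i \<in> {..m}"
    then have g: "cont_bv T (integrator A i)" using integrator_cont_bv * by simp
    have "\<bar>stieltjes_integral 0 t (\<lambda>r. E i r X A) (integrator A i)\<bar> \<le> 3 * C i * total_variation (integrator A i) 0 t"
      by (rule stieltjes_integral_bound[OF g])
         (use t i X * C cadlag_paths_mono[OF X] integrand_measurable in auto)
    also have "\<dots> \<le> 3 * C i * total_variation (integrator A i) 0 T"
    proof (rule mult_left_mono)
      have "total_variation (integrator A i) 0 T = total_variation (integrator A i) 0 t + total_variation (integrator A i) t T"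
        by (rule total_variation_add) (use g t in \<open>auto simp: cont_bv_def\<close>)
      moreover have "0 \<le> total_variation (integrator A i) t T" by (rule total_variation_bounds[OF g]) (use t in auto)
      ultimately show "total_variation (integrator A i) 0 t \<le> total_variation (integrator A i) 0 T" by simp
    qed (use C0 i in auto)
    finally show "\<bar>stieltjes_integral 0 t (\<lambda>r. E i r X A) (integrator A i)\<bar> \<le> 3 * C i * total_variation (integrator A i) 0 T" .
  qed
  then show "\<exists>C. \<forall>t\<in>{0..T}. \<forall>X\<in>cadlag_paths T K. \<bar>integral_functional m E t X A\<bar> \<le> C" by blast
qed

lemma integral_functional_uniform:
  assumes "X \<in> cadlag_paths T U" "A \<in> CBV T m S" "\<forall>\<^sub>F n in sequentially. Y n \<in> cadlag_paths T U"
    "uniform_limit {0..T} Y X sequentially" "\<And>n. u n \<in> {0..T}"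
  shows "(\<lambda>n. integral_functional m E (u n) (Y n) A - integral_functional m E (u n) X A) \<longlonglongrightarrow> 0"
proof -
  have "(\<lambda>n. \<Sum>i\<le>m. stieltjes_integral 0 (u n) (\<lambda>r. E i r (Y n) A) (integrator A i)
     - stieltjes_integral 0 (u n) (\<lambda>r. E i r X A) (integrator A i)) \<longlonglongrightarrow> (\<Sum>i\<le>m. 0)"
    by (intro tendsto_sum horizontal_integrand_integral_tendsto[OF T U E assms(1,2) integrator_cont_bv assms(3-5)])
       (use assms in auto)
  then show ?thesis by (simp add: integral_functional_def sum_subtractf)
qed

lemma continuous_on_integral_functional:
  assumes "X \<in> cadlag_paths T U" "A \<in> CBV T m S"
  shows "continuous_on {0..T} (\<lambda>t. integral_functional m E t X A)"
  unfolding integral_functional_def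
  by (intro continuous_on_sum continuous_on_stieltjes_integral integrator_cont_bv integrand_measurable)
     (use assms T in auto)

text \<open>Path and time are exchanged one after the other: the path uniformly in the upper limit,
  the time by continuity of the integrals along the fixed path \<open>stop t X\<close>.\<close>

lemma left_continuous_integral_functional: "left_continuous T m U S (integral_functional m E)"
proof (rule left_continuousI[OF T U])
  fix t X A Y s assume *: "t \<in> {0<..T}" "X \<in> cadlag_paths T U" "A \<in> CBV T m S" "\<And>n. Y n \<in> cadlag_paths T U" "\<And>n. s n \<in> {0..t}" "s \<longlonglongrightarrow> t"
     "uniform_limit {0..T} (\<lambda>n. stop (s n) (Y n)) (stop t X) sequentially"
  let ?I = "integral_functional m E"
  have tT: "t \<in> {0..T}" and sT: "s n \<in> {0..T}" for n using *(1) *(5)[of n] by auto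
  have sX: "stop t X \<in> cadlag_paths T U" and sY: "stop (s n) (Y n) \<in> cadlag_paths T U" for n
    using cadlag_paths_stop[OF *(2)] cadlag_paths_stop[OF *(4)] tT sT[of n] by auto
  note na = non_anticipative_stop[OF T U non_anticipative_integral_functional]
  have "(\<lambda>n. ?I (s n) (stop (s n) (Y n)) A - ?I (s n) (stop t X) A) \<longlonglongrightarrow> 0"
    by (rule integral_functional_uniform[OF sX *(3) _ *(7) sT]) (use sY in auto)
  moreover have "(\<lambda>n. ?I (s n) (stop t X) A) \<longlonglongrightarrow> ?I t (stop t X) A"
    using continuous_on_integral_functional[OF sX *(3)] *(6) tT sT
    unfolding continuous_on_sequentially comp_def by blast
  ultimately have "(\<lambda>n. ?I (s n) (stop (s n) (Y n)) A) \<longlonglongrightarrow> ?I t (stop t X) A"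
    using tendsto_add by fastforce
  moreover have "?I (s n) (stop (s n) (Y n)) A = ?I (s n) (Y n) A" for n
    by (rule na[OF sT _ *(4) *(3)]) (use sT[of n] in auto)
  moreover have "?I t (stop t X) A = ?I t X A" by (rule na[OF tT _ *(2) *(3)]) (use tT in auto)
  ultimately show "(\<lambda>n. ?I (s n) (Y n) A) \<longlonglongrightarrow> ?I t X A" by simp
qed

lemma integral_functional_bump:
  assumes X: "X \<in> cadlag_paths T U" and A: "A \<in> CBV T m S" and t: "t \<in> {0..T}" and b: "bump T t v X \<in> cadlag_paths T U"
  shows "integral_functional m E t (bump T t v X) A = integral_functional m E t X A"
  unfolding integral_functional_def
proof (rule sum.cong[OF refl])
  fix i assume i: "i \<in> {..m}"
  show "stieltjes_integral 0 t (\<lambda>r. E i r (bump T t v X) A) (integrator A i) =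
      stieltjes_integral 0 t (\<lambda>r. E i r X A) (integrator A i)"
  proof (rule stieltjes_integral_cong_open)
    fix r assume r: "r \<in> {0<..<t}"
    show "E i r (bump T t v X) A = E i r X A"
      by (rule non_anticipative_cong[OF T U horizontal_integrandD(1)[OF T U E] _ b X _ A A])
         (use r t i in \<open>auto simp: bump_def\<close>)
  qed (use i t A X b integrator_cont_bv integrand_measurable in auto)
qed

lemma horizontal_derivative_integral_functional:
  assumes st: "0 \<le> s" "s < t" "t \<le> T" and X: "X \<in> cadlag_paths T U" and A: "A \<in> CBV T m S"
  shows "integral_functional m E t X A - integral_functional m E s X A =
    (\<Sum>i\<le>m. stieltjes_integral s t (\<lambda>r. E i r X A) (integrator A i))"
  unfolding integral_functional_def sum_subtractf[symmetric]
proof (rule sum.cong[OF refl])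
  fix i assume i: "i \<in> {..m}"
  have "stieltjes_integral 0 t (\<lambda>r. E i r X A) (integrator A i) =
     stieltjes_integral 0 s (\<lambda>r. E i r X A) (integrator A i) + stieltjes_integral s t (\<lambda>r. E i r X A) (integrator A i)"
    by (rule stieltjes_integral_combine[of T]) (use i st X A integrator_cont_bv integrand_measurable in auto)
  then show "stieltjes_integral 0 t (\<lambda>r. E i r X A) (integrator A i) - stieltjes_integral 0 s (\<lambda>r. E i r X A) (integrator A i)
     = stieltjes_integral s t (\<lambda>r. E i r X A) (integrator A i)" by simp
qed

text \<open>Subtracting integrals does not affect the vertical derivatives, because the integrators
  are continuous and a bump at time \<open>t\<close> changes the integrand only at \<open>t\<close>.\<close>

context
  fixes F :: "'d functional" and DF :: "nat \<Rightarrow> 'd functional" and c :: real and G :: "'d functional"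
  assumes F: "C12c_via T m U S F DF"
    and G: "G = (\<lambda>t X A. F t X A - c - integral_functional m E t X A)"
begin

lemma subtract_integral_ev:
  assumes t: "t \<in> {0..T}" and X: "X \<in> cadlag_paths T U" and A: "A \<in> CBV T m S"
  shows "\<forall>\<^sub>F v in nhds 0. G t (bump T t v X) A = F t (bump T t v X) A - (c + integral_functional m E t X A)"
proof -
  have "\<forall>\<^sub>F v in nhds 0. bump T t v X \<in> cadlag_paths T U"
    using cadlag_paths_bump_small[OF X U, of t] t by simp
  then show ?thesis by eventually_elim (simp add: G integral_functional_bump[OF X A t])
qed

lemma vertical_partial_subtract_integral:
  assumes t: "t \<in> {0..T}" and X: "X \<in> cadlag_paths T U" and A: "A \<in> CBV T m S"
  shows "vertical_partial T i G t X A = vertical_partial T i F t X A"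
  by (rule vertical_partial_minus_const(1)[where k = "c + integral_functional m E t X A"]) (rule subtract_integral_ev[OF assms])

lemma vertical_partial2_subtract_integral_ev:
  assumes t: "t \<in> {0..T}" and X: "X \<in> cadlag_paths T U" and A: "A \<in> CBV T m S"
  shows "\<forall>\<^sub>F v in nhds 0. vertical_partial T j G t (bump T t v X) A = vertical_partial T j F t (bump T t v X) A"
proof -
  have "\<forall>\<^sub>F v in nhds 0. bump T t v X \<in> cadlag_paths T U"
    using cadlag_paths_bump_small[OF X U, of t] t by simp
  then show ?thesis by eventually_elim (rule vertical_partial_subtract_integral[OF t _ A])
qed

lemma vertical_partial2_subtract_integral:
  assumes t: "t \<in> {0..T}" and X: "X \<in> cadlag_paths T U" and A: "A \<in> CBV T m S"
  shows "vertical_partial T i (vertical_partial T j G) t X A = vertical_partial T i (vertical_partial T j F) t X A"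
  by (rule vertical_partial_cong(1)) (rule vertical_partial2_subtract_integral_ev[OF assms])

lemma C12c_via_subtract_integral: "C12c_via T m U S G (\<lambda>i t X A. DF i t X A - E i t X A)"
proof -
  note D = C12c_viaD[OF F]
  have HI: "horizontal_integrand T m U S (\<lambda>t X A. DF i t X A - E i t X A)" if i: "i \<le> m" for i
  proof -
    have "horizontal_integrand T m U S (\<lambda>t X A. DF i t X A + (- 1) * E i t X A)"
      by (intro horizontal_integrand_add horizontal_integrand_mult horizontal_integrand_const
          C12c_via_horizontal_integrand[OF F i] E i T U)
    then show ?thesis by simp
  qed
  have hd: "G t (stop s X) A - G s (stop s X) A =
      (\<Sum>i\<le>m. stieltjes_integral s t (\<lambda>r. DF i r (stop s X) A - E i r (stop s X) A) (integrator A i))"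
    if st: "0 \<le> s" "s < t" "t \<le> T" and X: "X \<in> cadlag_paths T U" and A: "A \<in> CBV T m S" for s t X A
  proof -
    have sX: "stop s X \<in> cadlag_paths T U" using cadlag_paths_stop[OF X] st by auto
    have "(\<Sum>i\<le>m. stieltjes_integral s t (\<lambda>r. DF i r (stop s X) A - E i r (stop s X) A) (integrator A i)) =
       (\<Sum>i\<le>m. stieltjes_integral s t (\<lambda>r. DF i r (stop s X) A) (integrator A i)
          - stieltjes_integral s t (\<lambda>r. E i r (stop s X) A) (integrator A i))"
    proof (rule sum.cong[OF refl])
      fix i assume "i \<in> {..m}"
      then show "stieltjes_integral s t (\<lambda>r. DF i r (stop s X) A - E i r (stop s X) A) (integrator A i) =
         stieltjes_integral s t (\<lambda>r. DF i r (stop s X) A) (integrator A i)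
          - stieltjes_integral s t (\<lambda>r. E i r (stop s X) A) (integrator A i)"
        by (intro stieltjes_integral_diff[of T])
           (use st sX A integrator_cont_bv integrand_measurable
             bdd_measurable_subset[OF horizontal_integrand_measurable[OF T U C12c_via_horizontal_integrand[OF F] sX A]] in auto)
    qed
    then show ?thesis
      using horizontal_difference[OF T U F _ _ _ X A, of s t] horizontal_derivative_integral_functional[OF _ _ _ sX A, of s t] st
      by (simp add: G sum_subtractf)
  qed
  have na: "non_anticipative T m U S G"
    unfolding G by (rule non_anticipative_combine[OF T U D(2) non_anticipative_integral_functional, of "\<lambda>t x y. x - c - y"])
  have lc: "left_continuous T m U S G"
    unfolding G by (rule left_continuous_combine[OF T U D(3) left_continuous_integral_functional, of "\<lambda>x y. x - c - y"])
      (intro tendsto_intros)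
  have bp: "boundedness_preserving T m U S G"
    unfolding G by (rule boundedness_preserving_combine[OF T U D(11) boundedness_preserving_integral_functional, of "\<lambda>t x y. x - c - y" "\<lambda>x y. x + \<bar>c\<bar> + y"]) linarith
  have lu: "continuous_in_X_locally_uniformly T m U S G"
  proof (rule continuous_in_X_locally_uniformlyI[OF T U])
    fix X A and Y :: "nat \<Rightarrow> 'd path" and u :: "nat \<Rightarrow> real"
    assume *: "X \<in> cadlag_paths T U" "A \<in> CBV T m S" "\<And>n. Y n \<in> cadlag_paths T U" "uniform_limit {0..T} Y X sequentially"
      "\<And>n. u n \<in> {0..T}"
    have Y: "\<forall>\<^sub>F n in sequentially. Y n \<in> cadlag_paths T U" using * by auto
    show "(\<lambda>n. G (u n) (Y n) A - G (u n) X A) \<longlonglongrightarrow> 0"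
      using tendsto_diff[OF continuous_in_X_locally_uniformlyD[OF T U D(10) *(1,2) Y *(4,5)]
          integral_functional_uniform[OF *(1,2) Y *(4,5)]] by (simp add: G algebra_simps)
  qed
  have vd: "vertically_differentiable T m U S G"
    unfolding vertically_differentiable_def
  proof (intro ballI)
    fix t X A assume *: "t \<in> {0..T}" "X \<in> cadlag_paths T U" "A \<in> CBV T m S"
    have "(\<lambda>v. F t (bump T t v X) A) differentiable (at 0)" using D(4) * unfolding vertically_differentiable_def by blast
    then show "(\<lambda>v. G t (bump T t v X) A) differentiable (at 0)"
      by (rule iffD1[OF vertical_partial_minus_const(2)[where k = "c + integral_functional m E t X A"], rotated])
         (rule subtract_integral_ev[OF *])
  qed
  have vd2: "vertically_differentiable T m U S (vertical_partial T j G)" for j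
    unfolding vertically_differentiable_def
  proof (intro ballI)
    fix t X A assume *: "t \<in> {0..T}" "X \<in> cadlag_paths T U" "A \<in> CBV T m S"
    have "(\<lambda>v. vertical_partial T j F t (bump T t v X) A) differentiable (at 0)"
      using D(5) * unfolding vertically_differentiable_def by blast
    then show "(\<lambda>v. vertical_partial T j G t (bump T t v X) A) differentiable (at 0)"
      by (rule iffD1[OF vertical_partial_cong(2), rotated]) (rule vertical_partial2_subtract_integral_ev[OF *])
  qed
  have vp: "left_continuous T m U S (vertical_partial T i G)" "boundedness_preserving T m U S (vertical_partial T i G)" for i
    by (rule left_continuous_cong[OF D(6)] boundedness_preserving_cong[OF D(7)]; simp add: vertical_partial_subtract_integral)+
  have vp2: "left_continuous T m U S (vertical_partial T i (vertical_partial T j G))"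
    "boundedness_preserving T m U S (vertical_partial T i (vertical_partial T j G))" for i j
    by (rule left_continuous_cong[OF D(8)] boundedness_preserving_cong[OF D(9)]; simp add: vertical_partial2_subtract_integral)+
  show ?thesis by (rule C12c_viaI[OF na lc vd vd2 vp vp2 lu bp HI hd])
qed

end

end

end

text \<open>Each component of \<open>F\<close> is bounded on paths in the compact \<open>K\<close>,
  so all paths of values lie in one closed ball, and the bound of \<open>E\<close> on that ball
  applies.\<close>

lemma boundedness_preserving_functional_path:
  fixes F :: "'n::finite \<Rightarrow> 'd::finite functional"
  assumes T: "0 < T" and U: "open U"
    and F: "\<And>l. C12c_via T m U S (F l) (DF l)" and E: "boundedness_preserving T m UNIV S E"
  shows "boundedness_preserving T m U S (\<lambda>t X A. E t (functional_path F X A) A)"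
  unfolding boundedness_preserving_def
proof (intro ballI allI impI, elim conjE)
  fix A K assume *: "A \<in> CBV T m S" "compact K" "K \<subseteq> U"
  have "\<exists>C. \<forall>t\<in>{0..T}. \<forall>X\<in>cadlag_paths T K. \<bar>F l t X A\<bar> \<le> C" for l
    using C12c_viaD(11)[OF F, of l] * unfolding boundedness_preserving_def by blast
  then obtain C where C: "\<And>l t X. t \<in> {0..T} \<Longrightarrow> X \<in> cadlag_paths T K \<Longrightarrow> \<bar>F l t X A\<bar> \<le> C l" by metis
  obtain B where B: "\<And>t Y. t \<in> {0..T} \<Longrightarrow> Y \<in> cadlag_paths T (cball 0 (\<Sum>l\<in>UNIV. C l)) \<Longrightarrow> \<bar>E t Y A\<bar> \<le> B"
    using boundedness_preservingD[OF T open_UNIV E *(1) compact_cball subset_UNIV] by metis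
  have "\<bar>E t (functional_path F X A) A\<bar> \<le> B" if t: "t \<in> {0..T}" and X: "X \<in> cadlag_paths T K" for t X
  proof (rule B[OF t cadlag_paths_closed[OF functional_path_cadlag[where F = F, OF T U F cadlag_paths_mono[OF X *(3)] *(1)] closed_cball]])
    fix u assume u: "u \<in> {0..T}"
    have "norm (functional_path F X A u) \<le> (\<Sum>l\<in>UNIV. \<bar>functional_path F X A u $ l\<bar>)" by (rule norm_le_l1_cart)
    also have "\<dots> \<le> (\<Sum>l\<in>UNIV. C l)" by (rule sum_mono) (simp add: functional_path_def C[OF u X])
    finally show "functional_path F X A u \<in> cball 0 (\<Sum>l\<in>UNIV. C l)" by simp
  qed
  then show "\<exists>C. \<forall>t\<in>{0..T}. \<forall>X\<in>cadlag_paths T K. \<bar>E t (functional_path F X A) A\<bar> \<le> C" by blast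
qed

lemma non_anticipative_functional_path:
  fixes F :: "'n::finite \<Rightarrow> 'd::finite functional"
  assumes T: "0 < T" and U: "open U"
    and F: "\<And>l. C12c_via T m U S (F l) (DF l)" and E: "non_anticipative T m UNIV S E"
  shows "non_anticipative T m U S (\<lambda>t X A. E t (functional_path F X A) A)"
  unfolding non_anticipative_def
proof (intro ballI)
  note cad = functional_path_cadlag[where F = F, OF T U F]
  fix t X A assume t: "t \<in> {0..T}" and X: "X \<in> cadlag_paths T U" and A: "A \<in> CBV T m S"
  have sX: "stop t X \<in> cadlag_paths T U" and sA: "stop t A \<in> CBV T m S"
    using cadlag_paths_stop[OF X] CBV_stop[OF A t] t by auto
  have st: "stop t X u = X u" "stop t A u = A u" if "u \<in> {0..t}" for u
    using that t by (auto simp: stop_def)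
  show "E t (functional_path F X A) A = E t (functional_path F (stop t X) (stop t A)) (stop t A)"
  proof (rule non_anticipative_cong[OF T open_UNIV E t cad[OF X A] cad[OF sX sA] _ A sA])
    fix u assume u: "u \<in> {0..t}"
    have "F l u X A = F l u (stop t X) (stop t A)" for l
      by (rule non_anticipative_cong[OF T U C12c_viaD(2)[OF F] _ X sX _ A sA]) (use u t st in auto)
    then show "functional_path F X A u = functional_path F (stop t X) (stop t A) u" by (simp add: functional_path_def)
    show "A u = stop t A u" using st u by simp
  qed
qed

text \<open>After \<open>s\<close>, the path of values along \<open>stop s X\<close> keeps moving by
  the horizontal derivative of \<open>F\<close>, so measurability of \<open>E\<close> along stopped
  paths does not apply to it. This is why measurability was extended to all cadlag paths.\<close>

lemma horizontal_integrand_compose: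
  fixes F :: "'n::finite \<Rightarrow> 'd::finite functional"
  assumes T: "0 < T" and U: "open U"
    and F: "\<And>l. C12c_via T m U S (F l) (DF l)" and E: "horizontal_integrand T m UNIV S E"
  shows "horizontal_integrand T m U S (\<lambda>t X A. E t (functional_path F X A) A)"
proof (rule horizontal_integrandI[OF T U])
  note E' = horizontal_integrandD[OF T open_UNIV E]
  note cad = functional_path_cadlag[where F = F, OF T U F]
  show "non_anticipative T m U S (\<lambda>t X A. E t (functional_path F X A) A)"
    by (rule non_anticipative_functional_path[OF T U F E'(1)])
  show "boundedness_preserving T m U S (\<lambda>t X A. E t (functional_path F X A) A)"
    by (rule boundedness_preserving_functional_path[OF T U F E'(2)])
  show "continuous_at_fixed_times T m U S (\<lambda>t X A. E t (functional_path F X A) A)"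
  proof (rule continuous_at_fixed_timesI[OF T U])
    fix t X A Y assume *: "t \<in> {0..T}" "X \<in> cadlag_paths T U" "A \<in> CBV T m S" "\<And>n. Y n \<in> cadlag_paths T U"
     "uniform_limit {0..T} (\<lambda>n. stop t (Y n)) (stop t X) sequentially"
    have s: "stop t X \<in> cadlag_paths T U" "stop t (Y n) \<in> cadlag_paths T U" for n
      using cadlag_paths_stop[OF *(2)] cadlag_paths_stop[OF *(4)] *(1) by auto
    have "uniform_limit {0..T} (\<lambda>n. functional_path F (stop t (Y n)) A) (functional_path F (stop t X) A) sequentially"
      by (rule functional_path_uniform_limit[where F = F, OF T U F s(1) *(3) _ *(5)]) (use s in auto)
    from uniform_limit_stop_const[OF this *(1)]
    have "uniform_limit {0..T} (\<lambda>n. stop t (functional_path F (Y n) A)) (stop t (functional_path F X A)) sequentially"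
      using stop_functional_path[where F = F, OF T U F *(4) *(3,1)] stop_functional_path[where F = F, OF T U F *(2,3,1)] by simp
    then show "(\<lambda>n. E t (functional_path F (Y n) A) A) \<longlonglongrightarrow> E t (functional_path F X A) A"
      by (intro continuous_at_fixed_timesD[OF T open_UNIV E'(3) *(1) _ *(3)]) (use cad * in auto)
  qed
  fix s t X A assume st: "0 \<le> s" "s < t" "t \<le> T" and X: "X \<in> cadlag_paths T U" and A: "A \<in> CBV T m S"
  have "stop s X \<in> cadlag_paths T U" using cadlag_paths_stop[OF X] st by auto
  then show "(\<lambda>r. E r (functional_path F (stop s X) A) A) \<in> borel_measurable (restrict_space borel {s..t})"
    by (intro borel_measurable_restrict_Icc[OF horizontal_integrand_measurable[OF T open_UNIV E cad A]]) (use st A in auto)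
qed

context
  fixes T :: real and U :: "(real ^ 'd::finite) set" and X :: "'d path"
  assumes T: "0 < T" and U: "open U" and X: "X \<in> cadlag_paths T U"
begin

lemma bdd_measurable_vertical:
  assumes "non_anticipative T m U S H" "left_continuous T m U S H" "boundedness_preserving T m U S H"
    and A: "A \<in> CBV T m S" and t: "t \<le> T"
  shows "bdd_measurable 0 t (\<lambda>r. H r X A)"
proof -
  have "bdd_measurable 0 T (\<lambda>r. if r = 0 then 0 else H r X A)"
    by (rule horizontal_integrand_measurable[OF T U horizontal_integrand_left[OF T U assms(1-3)] X A])
  then have "bdd_measurable 0 t (\<lambda>r. if r = 0 then 0 else H r X A)"
    by (rule bdd_measurable_subset) (use t in auto)
  moreover have "bdd_measurable 0 t (\<lambda>r. if r = 0 then 0 else H r X A) \<longleftrightarrow> bdd_measurable 0 t (\<lambda>r. H r X A)"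
    by (rule bdd_measurable_cong) auto
  ultimately show ?thesis by simp
qed

lemma bdd_measurable_vertical_partial:
  assumes F: "C12c_via T m U S F DF" and A: "A \<in> CBV T m S" and t: "t \<le> T"
  shows "bdd_measurable 0 t (\<lambda>r. vertical_partial T i F r X A)"
    and "bdd_measurable 0 t (\<lambda>r. vertical_partial T i (vertical_partial T j F) r X A)"
  by (rule bdd_measurable_vertical[OF _ _ _ A t] non_anticipative_vertical_partial[OF T U] C12c_viaD[OF F])+

end

section \<open>Weighted sums with converging distribution functions\<close>

lemma interval_measure_singleton:
  assumes F: "\<And>x y. x \<le> y \<Longrightarrow> F x \<le> F y" "continuous_on UNIV F"
  shows "emeasure (interval_measure F) {x} = 0"
proof -
  have "emeasure (interval_measure F) {x .. x} = F x - F x"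
    by (rule emeasure_interval_measure_Icc) (use F in auto)
  then show ?thesis by simp
qed

text \<open>Left-local properties hold on all cells of a suitable subdivision, up to cells of small total
  mass: the points outside the interiors of all good intervals are the right endpoints of disjoint
  intervals, hence countable, hence null for a measure without atoms.\<close>

lemma good_cells:
  fixes m :: "real \<Rightarrow> real"
  assumes t: "0 < t" and m: "continuous_on {0..t} m" "\<And>x y. 0 \<le> x \<Longrightarrow> x \<le> y \<Longrightarrow> y \<le> t \<Longrightarrow> m x \<le> m y"
    and her: "\<And>l u l' u'. good l u \<Longrightarrow> l \<le> l' \<Longrightarrow> u' \<le> u \<Longrightarrow> good l' u'"
    and loc: "\<And>r. r \<in> {0<..t} \<Longrightarrow> \<exists>l<r. good l r" and e: "e > 0"
  obtains R where "subdivision 0 t R"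
    "(\<Sum>x\<in>{x\<in>R. x < t \<and> \<not> good x (nx R x)}. m (nx R x) - m x) < e"
proof -
  have "\<exists>l. 0 \<le> l \<and> l < r \<and> good l r" if r: "r \<in> {0<..t}" for r
  proof -
    obtain l where "l < r" "good l r" using loc[OF r] by blast
    then show ?thesis using r by (intro exI[of _ "max 0 l"]) (auto intro: her[of l r])
  qed
  then obtain l where l: "\<And>r. r \<in> {0<..t} \<Longrightarrow> 0 \<le> l r \<and> l r < r \<and> good (l r) r" by metis
  let ?I = "\<lambda>r. {l r<..<r}"
  define Op where "Op = (\<Union>r\<in>{0<..t}. ?I r)"
  define B where "B = {0<..t} - Op"
  \<comment> \<open>For \<open>r < r'\<close> in \<open>B\<close> the point \<open>r\<close> is not
    in \<open>{l r'<..<r'}\<close>, so this interval starts at or after \<open>r\<close>, where the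
    interval of \<open>r\<close> has ended.\<close>
  have "countable B"
  proof -
    have disj: "?I r \<inter> ?I r' = {}" if "r \<in> B" "r' \<in> B" "r < r'" for r r'
    proof -
      have "r \<notin> ?I r'" using that unfolding B_def Op_def by blast
      then show ?thesis using that by auto
    qed
    have inj: "inj_on ?I B"
    proof (rule inj_onI)
      fix r r' assume r: "r \<in> B" "r' \<in> B" "?I r = ?I r'"
      then have "?I r \<noteq> {}" using l[of r] by (auto simp: B_def)
      then show "r = r'" using disj[of r r'] disj[of r' r] r by (metis inf.idem linorder_neqE_linordered_idom)
    qed
    have "countable (?I ` B)"
    proof (rule countable_disjoint_open_subsets)
      show "pairwise disjnt (?I ` B)"
      proof (rule pairwiseI)
        fix X Y assume XY: "X \<in> ?I ` B" "Y \<in> ?I ` B" "X \<noteq> Y"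
        then obtain r r' where r: "r \<in> B" "r' \<in> B" "X = ?I r" "Y = ?I r'" by blast
        then have "r < r' \<or> r' < r" using XY by auto
        then show "disjnt X Y" using disj[of r r'] disj[of r' r] r by (auto simp: disjnt_def)
      qed
    qed auto
    then show ?thesis using inj countable_image_inj_on by blast
  qed
  define F where "F = (\<lambda>x. m (max 0 (min t x)))"
  have Fm: "\<And>x y. x \<le> y \<Longrightarrow> F x \<le> F y" unfolding F_def using t by (intro m(2)) auto
  have Fc: "continuous_on UNIV F" unfolding F_def using t by (intro continuous_clamp m) auto
  have Fr: "continuous (at_right x) F" for x
    using Fc by (simp add: continuous_on_eq_continuous_at continuous_at_imp_continuous_at_within)
  define \<mu> where "\<mu> = interval_measure F"
  have sets_\<mu>: "sets \<mu> = sets borel" by (simp add: \<mu>_def)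
  have \<mu>_Ioc: "emeasure \<mu> {x<..y} = ennreal (m y - m x)" if "0 \<le> x" "x \<le> y" "y \<le> t" for x y
  proof -
    have "emeasure \<mu> {x<..y} = ennreal (F y - F x)"
      unfolding \<mu>_def using that by (intro emeasure_interval_measure_Ioc Fm Fr)
    then show ?thesis using that by (simp add: F_def)
  qed
  have "B \<in> null_sets \<mu>"
  proof -
    have "(\<Union>x\<in>B. {x}) \<in> null_sets \<mu>"
      by (rule null_sets_UN'[OF \<open>countable B\<close>])
         (auto simp: null_sets_def sets_\<mu> \<mu>_def interval_measure_singleton Fm Fc)
    then show ?thesis by simp
  qed
  then have nullB: "emeasure \<mu> B = 0" by auto
  obtain \<F> where \<F>: "\<F> \<subseteq> ?I ` {0<..t}" "countable \<F>" "\<Union>\<F> = Op"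
  proof -
    have "\<And>S. S \<in> ?I ` {0<..t} \<Longrightarrow> open S" by auto
    then obtain \<F> where "\<F> \<subseteq> ?I ` {0<..t}" "countable \<F>" "\<Union>\<F> = \<Union>(?I ` {0<..t})"
      by (rule Lindelof)
    then show ?thesis using that unfolding Op_def by blast
  qed
  have "Op \<noteq> {}"
  proof -
    have "(l t + t) / 2 \<in> ?I t" using l[of t] t by auto
    then show ?thesis unfolding Op_def using t by force
  qed
  then have "\<F> \<noteq> {}" using \<F> by auto
  then have rng: "range (from_nat_into \<F>) = \<F>" using \<F>(2) by (rule range_from_nat_into)
  have "\<exists>r\<in>{0<..t}. from_nat_into \<F> k = ?I r" for k :: nat
    using rng \<F>(1) by blast
  then obtain \<rho> where \<rho>: "\<And>k::nat. \<rho> k \<in> {0<..t}" "\<And>k. from_nat_into \<F> k = ?I (\<rho> k)" by metis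
  have Op_eq: "Op = (\<Union>k. ?I (\<rho> k))" using \<F>(3) rng \<rho>(2) by auto
  \<comment> \<open>What the first \<open>n\<close> of countably many intervals leave uncovered.
    These sets decrease to the null set \<open>B\<close>, so finitely many intervals suffice up to
    mass \<open>e\<close>, and their end points become the subdivision.\<close>
  define G where "G n = {0<..t} - (\<Union>k<n. ?I (\<rho> k))" for n :: nat
  have "(\<lambda>n. emeasure \<mu> (G n)) \<longlonglongrightarrow> emeasure \<mu> (\<Inter>n. G n)"
  proof (rule Lim_emeasure_decseq)
    show "range G \<subseteq> sets \<mu>" by (auto simp: sets_\<mu> G_def)
    show "decseq G" unfolding G_def decseq_def by fastforce
    fix n
    have "emeasure \<mu> (G n) \<le> emeasure \<mu> {0<..t}"
      by (rule emeasure_mono) (auto simp: G_def sets_\<mu>)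
    then show "emeasure \<mu> (G n) \<noteq> \<infinity>" using \<mu>_Ioc[of 0 t] t by (auto simp: top_unique)
  qed
  moreover have "(\<Inter>n. G n) = B" unfolding G_def B_def Op_eq by auto
  ultimately have "(\<lambda>n. emeasure \<mu> (G n)) \<longlonglongrightarrow> 0" using nullB by simp
  then have "\<forall>\<^sub>F n in sequentially. emeasure \<mu> (G n) < ennreal e" using e by (intro order_tendstoD) auto
  then obtain n where n: "emeasure \<mu> (G n) < ennreal e" using eventually_happens'[OF sequentially_bot] by blast
  define R where "R = {0, t} \<union> (\<lambda>k. l (\<rho> k)) ` {..<n} \<union> \<rho> ` {..<n}"
  have lr: "0 \<le> l (\<rho> k)" "l (\<rho> k) < \<rho> k" "\<rho> k \<le> t" "good (l (\<rho> k)) (\<rho> k)" for k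
    using l[OF \<rho>(1)[of k]] \<rho>(1)[of k] by auto
  have R: "subdivision 0 t R"
    unfolding subdivision_def
  proof (intro conjI)
    show "R \<subseteq> {0..t}"
      using t lr less_imp_le[OF lr(2)] order_trans[OF lr(1) less_imp_le[OF lr(2)]] order_trans[OF less_imp_le[OF lr(2)] lr(3)]
      by (auto simp: R_def)
  qed (auto simp: R_def)
  let ?bad = "{x\<in>R. x < t \<and> \<not> good x (nx R x)}"
  \<comment> \<open>A cell that meets one of the first \<open>n\<close> intervals lies between its
    end points, since these belong to \<open>R\<close>; by heredity such a cell is good.\<close>
  have sub: "{x<..nx R x} \<subseteq> G n" if x: "x \<in> ?bad" for x
  proof
    fix y assume y: "y \<in> {x<..nx R x}"
    have xR: "x \<in> R" "x < t" using x by auto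
    have "y \<notin> ?I (\<rho> k)" if k: "k < n" for k
    proof
      assume yk: "y \<in> ?I (\<rho> k)"
      have "nx R x \<le> \<rho> k" by (rule nx_least[OF R]) (use k yk y in \<open>auto simp: R_def\<close>)
      moreover have "l (\<rho> k) \<le> x"
      proof (rule ccontr)
        assume "\<not> l (\<rho> k) \<le> x"
        then have "nx R x \<le> l (\<rho> k)" by (intro nx_least[OF R]) (use k in \<open>auto simp: R_def\<close>)
        then show False using y yk by auto
      qed
      ultimately have "good x (nx R x)" using her[OF lr(4)[of k]] by blast
      then show False using x by blast
    qed
    moreover have "y \<in> {0<..t}" using y xR subdivision_bounds[OF R xR(1)] nx_props[OF R xR(2)] by auto
    ultimately show "y \<in> G n" unfolding G_def by blast
  qed
  have xb: "0 \<le> x" "x \<le> nx R x" "nx R x \<le> t" if "x \<in> ?bad" for x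
    using that subdivision_bounds[OF R, of x] nx_props[OF R, of x] by auto
  have fin: "finite ?bad" using subdivision_finite[OF R] by simp
  have "ennreal (\<Sum>x\<in>?bad. m (nx R x) - m x) = (\<Sum>x\<in>?bad. emeasure \<mu> {x<..nx R x})"
  proof -
    have "(\<Sum>x\<in>?bad. emeasure \<mu> {x<..nx R x}) = (\<Sum>x\<in>?bad. ennreal (m (nx R x) - m x))"
      by (rule sum.cong[OF refl]) (use xb \<mu>_Ioc in blast)
    also have "\<dots> = ennreal (\<Sum>x\<in>?bad. m (nx R x) - m x)"
      by (rule sum_ennreal) (use xb m(2) in force)
    finally show ?thesis by simp
  qed
  also have "\<dots> = emeasure \<mu> (\<Union>x\<in>?bad. {x<..nx R x})"
  proof (rule sum_emeasure)
    show "disjoint_family_on (\<lambda>x. {x<..nx R x}) ?bad"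
      unfolding disjoint_family_on_def
    proof (intro ballI impI)
      fix x y assume xy: "x \<in> ?bad" "y \<in> ?bad" "x \<noteq> y"
      then have "nx R x \<le> y \<or> nx R y \<le> x"
        using nx_least[OF R, of y x] nx_least[OF R, of x y] by (cases "x < y") auto
      then show "{x<..nx R x} \<inter> {y<..nx R y} = {}" by auto
    qed
  qed (use fin in \<open>auto simp: sets_\<mu>\<close>)
  also have "\<dots> \<le> emeasure \<mu> (G n)"
    by (rule emeasure_mono) (use sub in \<open>auto simp: sets_\<mu> G_def\<close>)
  also have "\<dots> < ennreal e" by (rule n)
  finally have "ennreal (\<Sum>x\<in>?bad. m (nx R x) - m x) < ennreal e" .
  moreover have "0 \<le> (\<Sum>x\<in>?bad. m (nx R x) - m x)"
    by (rule sum_nonneg) (use xb m(2) in force)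
  ultimately have "(\<Sum>x\<in>?bad. m (nx R x) - m x) < e" by (simp add: ennreal_less_iff)
  with R show ?thesis by (rule that)
qed

text \<open>Replacing both families of values by the constant \<open>c\<close> leaves only the
  difference of the total weights.\<close>

lemma weighted_sum_diff_bound:
  fixes w w' g g' :: "'a \<Rightarrow> real"
  assumes w: "\<And>s. s \<in> J \<Longrightarrow> 0 \<le> w s" "\<And>s. s \<in> J \<Longrightarrow> 0 \<le> w' s"
    and g: "\<And>s. s \<in> J \<Longrightarrow> \<bar>g s - c\<bar> \<le> d" "\<And>s. s \<in> J \<Longrightarrow> \<bar>g' s - c\<bar> \<le> d"
  shows "\<bar>(\<Sum>s\<in>J. g s * w s) - (\<Sum>s\<in>J. g' s * w' s)\<bar> \<le>
    d * ((\<Sum>s\<in>J. w s) + (\<Sum>s\<in>J. w' s)) + \<bar>c\<bar> * \<bar>(\<Sum>s\<in>J. w s) - (\<Sum>s\<in>J. w' s)\<bar>"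
proof -
  have b: "\<bar>\<Sum>s\<in>J. (h s - c) * v s\<bar> \<le> d * (\<Sum>s\<in>J. v s)"
    if "\<And>s. s \<in> J \<Longrightarrow> 0 \<le> v s" "\<And>s. s \<in> J \<Longrightarrow> \<bar>h s - c\<bar> \<le> d" for h v :: "'a \<Rightarrow> real"
    unfolding sum_distrib_left
  proof (rule order_trans[OF sum_abs sum_mono])
    fix s assume s: "s \<in> J"
    show "\<bar>(h s - c) * v s\<bar> \<le> d * v s"
      unfolding abs_mult using that[OF s] by (simp add: mult_right_mono)
  qed
  have "(\<Sum>s\<in>J. g s * w s) - (\<Sum>s\<in>J. g' s * w' s) =
     (\<Sum>s\<in>J. (g s - c) * w s) - (\<Sum>s\<in>J. (g' s - c) * w' s) + c * ((\<Sum>s\<in>J. w s) - (\<Sum>s\<in>J. w' s))"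
    by (simp add: algebra_simps sum_subtractf sum.distrib sum_distrib_left)
  moreover have "\<bar>c * ((\<Sum>s\<in>J. w s) - (\<Sum>s\<in>J. w' s))\<bar> = \<bar>c\<bar> * \<bar>(\<Sum>s\<in>J. w s) - (\<Sum>s\<in>J. w' s)\<bar>" by (rule abs_mult)
  moreover have "\<bar>\<Sum>s\<in>J. (g s - c) * w s\<bar> \<le> d * (\<Sum>s\<in>J. w s)" by (rule b[OF w(1) g(1)])
  moreover have "\<bar>\<Sum>s\<in>J. (g' s - c) * w' s\<bar> \<le> d * (\<Sum>s\<in>J. w' s)" by (rule b[OF w(2) g(2)])
  ultimately show ?thesis unfolding distrib_left by linarith
qed

text \<open>Two systems of nonnegative weights have the same continuous limit distribution function
  \<open>m\<close>, and both families of values approach \<open>f\<close> locally from the left. On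
  good cells the values are nearly constant, so only the masses of the cells matter, and these agree
  in the limit; the bad cells carry little mass while the values stay bounded. It will be used to
  compare squared increments of a path with increments of its quadratic variation.\<close>

lemma weighted_sums_limit:
  fixes w w' g g' :: "nat \<Rightarrow> real \<Rightarrow> real" and I :: "nat \<Rightarrow> real set" and m :: "real \<Rightarrow> real"
  assumes t: "0 < t" and I: "\<And>n. finite (I n)" "\<And>n. I n \<subseteq> {0..t}"
    and w: "\<And>n s. s \<in> I n \<Longrightarrow> 0 \<le> w n s" "\<And>n s. s \<in> I n \<Longrightarrow> 0 \<le> w' n s"
    and lim: "\<And>x. x \<in> {0..t} \<Longrightarrow> (\<lambda>n. \<Sum>s\<in>{s\<in>I n. s \<le> x}. w n s) \<longlonglongrightarrow> m x"
      "\<And>x. x \<in> {0..t} \<Longrightarrow> (\<lambda>n. \<Sum>s\<in>{s\<in>I n. s \<le> x}. w' n s) \<longlonglongrightarrow> m x"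
    and m: "continuous_on {0..t} m" "\<And>x y. 0 \<le> x \<Longrightarrow> x \<le> y \<Longrightarrow> y \<le> t \<Longrightarrow> m x \<le> m y" "m 0 = 0"
    and loc: "\<And>r \<epsilon>. r \<in> {0<..t} \<Longrightarrow> \<epsilon> > 0 \<Longrightarrow> \<exists>l<r. \<forall>\<^sub>F n in sequentially. \<forall>s\<in>I n. l < s \<and> s \<le> r \<longrightarrow>
        \<bar>g n s - f r\<bar> < \<epsilon> \<and> \<bar>g' n s - f r\<bar> < \<epsilon>"
    and bnd: "\<forall>\<^sub>F n in sequentially. \<forall>s\<in>I n. \<bar>g n s\<bar> \<le> C \<and> \<bar>g' n s\<bar> \<le> C"
  shows "(\<lambda>n. (\<Sum>s\<in>I n. g n s * w n s) - (\<Sum>s\<in>I n. g' n s * w' n s)) \<longlonglongrightarrow> 0"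
proof (rule tendstoI)
  fix e :: real assume e: "e > 0"
  define D where "D = \<bar>C\<bar>"
  have D: "0 \<le> D" and bndD: "\<forall>\<^sub>F n in sequentially. \<forall>s\<in>I n. \<bar>g n s\<bar> \<le> D \<and> \<bar>g' n s\<bar> \<le> D"
    using bnd unfolding D_def by (auto elim!: eventually_mono intro: order_trans)
  have mt: "0 \<le> m t" using m(2)[of 0 t] m(3) t by simp
  \<comment> \<open>In the limit the good cells contribute at most \<open>2 * d * m t\<close>, which
    is less than \<open>e / 2\<close>, and the bad ones at most
    \<open>2 * D * (e / (4 * (D + 1)))\<close>, which is at most \<open>e / 2\<close>.\<close>
  define d where "d = e / (4 * (m t + 1))"
  have d: "d > 0" "2 * d * m t < e / 2" using e mt by (auto simp: d_def field_simps)
  define good where "good l u \<longleftrightarrow> (\<exists>c. \<forall>\<^sub>F n in sequentially. \<forall>s\<in>I n. l < s \<and> s \<le> u \<longrightarrow>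
        \<bar>g n s - c\<bar> < d \<and> \<bar>g' n s - c\<bar> < d)" for l u
  have b0: "0 < e / (4 * (D + 1))" using e D by simp
  obtain R where R: "subdivision 0 t R"
    and bad: "(\<Sum>x\<in>{x\<in>R. x < t \<and> \<not> good x (nx R x)}. m (nx R x) - m x) < e / (4 * (D + 1))"
  proof (rule good_cells[OF t m(1,2) _ _ b0, of good])
    fix l u l' u' assume "good l u" "l \<le> l'" "u' \<le> u"
    then obtain c where "\<forall>\<^sub>F n in sequentially. \<forall>s\<in>I n. l < s \<and> s \<le> u \<longrightarrow> \<bar>g n s - c\<bar> < d \<and> \<bar>g' n s - c\<bar> < d"
      unfolding good_def by blast
    then have "\<forall>\<^sub>F n in sequentially. \<forall>s\<in>I n. l' < s \<and> s \<le> u' \<longrightarrow> \<bar>g n s - c\<bar> < d \<and> \<bar>g' n s - c\<bar> < d"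
      by eventually_elim (use \<open>l \<le> l'\<close> \<open>u' \<le> u\<close> in auto)
    then show "good l' u'" unfolding good_def by blast
  next
    fix r assume "r \<in> {0<..t}"
    from loc[OF this d(1)] show "\<exists>l<r. good l r" unfolding good_def by blast
  qed auto
  have "\<forall>x. \<exists>c. good x (nx R x) \<longrightarrow> (\<forall>\<^sub>F n in sequentially. \<forall>s\<in>I n. x < s \<and> s \<le> nx R x \<longrightarrow>
        \<bar>g n s - c\<bar> < d \<and> \<bar>g' n s - c\<bar> < d)" unfolding good_def by blast
  from choice[OF this] obtain c where c: "\<forall>x. good x (nx R x) \<longrightarrow> (\<forall>\<^sub>F n in sequentially. \<forall>s\<in>I n. x < s \<and> s \<le> nx R x \<longrightarrow>
        \<bar>g n s - c x\<bar> < d \<and> \<bar>g' n s - c x\<bar> < d)" by blast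
  let ?R = "{x\<in>R. x < t}"
  let ?M = "\<lambda>n x. \<Sum>s\<in>{s\<in>I n. s \<le> x}. w n s" and ?M' = "\<lambda>n x. \<Sum>s\<in>{s\<in>I n. s \<le> x}. w' n s"
  let ?\<Delta> = "\<lambda>n x. ?M n (nx R x) - ?M n x" and ?\<Delta>' = "\<lambda>n x. ?M' n (nx R x) - ?M' n x"
  define K where "K n x = (if good x (nx R x) then d * (?\<Delta> n x + ?\<Delta>' n x) + \<bar>c x\<bar> * \<bar>?\<Delta> n x - ?\<Delta>' n x\<bar>
     else D * (?\<Delta> n x + ?\<Delta>' n x))" for n x
  have RI: "x \<in> {0..t}" "nx R x \<in> {0..t}" "x < nx R x" if "x \<in> ?R" for x
    using that subdivision_bounds[OF R, of x] nx_props[OF R, of x] by auto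
  have ev: "\<forall>\<^sub>F n in sequentially. \<forall>x\<in>?R. good x (nx R x) \<longrightarrow> (\<forall>s\<in>I n. x < s \<and> s \<le> nx R x \<longrightarrow>
        \<bar>g n s - c x\<bar> < d \<and> \<bar>g' n s - c x\<bar> < d)"
  proof (rule eventually_ball_finite)
    show "\<forall>x\<in>?R. \<forall>\<^sub>F n in sequentially. good x (nx R x) \<longrightarrow> (\<forall>s\<in>I n. x < s \<and> s \<le> nx R x \<longrightarrow>
        \<bar>g n s - c x\<bar> < d \<and> \<bar>g' n s - c x\<bar> < d)"
      using c by simp
  qed (use subdivision_finite[OF R] in auto)
  have split: "(\<Sum>s\<in>{s\<in>I n. s \<le> nx R x}. h s) - (\<Sum>s\<in>{s\<in>I n. s \<le> x}. h s) = (\<Sum>s\<in>{s\<in>I n. x < s \<and> s \<le> nx R x}. h s)"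
    if "x \<in> ?R" for n x and h :: "real \<Rightarrow> real"
  proof -
    have "{s\<in>I n. s \<le> nx R x} = {s\<in>I n. s \<le> x} \<union> {s\<in>I n. x < s \<and> s \<le> nx R x}" using RI[OF that] by auto
    moreover have "(\<Sum>s\<in>{s\<in>I n. s \<le> x} \<union> {s\<in>I n. x < s \<and> s \<le> nx R x}. h s) =
        (\<Sum>s\<in>{s\<in>I n. s \<le> x}. h s) + (\<Sum>s\<in>{s\<in>I n. x < s \<and> s \<le> nx R x}. h s)"
      by (rule sum.union_disjoint) (use I(1) in auto)
    ultimately show ?thesis by simp
  qed
  \<comment> \<open>An index at 0 lies in no cell \<open>{x<..nx R x}\<close>; its weight appears
    separately and tends to \<open>m 0 = 0\<close>.\<close>
  have main: "\<forall>\<^sub>F n in sequentially. \<bar>(\<Sum>s\<in>I n. g n s * w n s) - (\<Sum>s\<in>I n. g' n s * w' n s)\<bar> \<le>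
     D * (?M n 0 + ?M' n 0) + (\<Sum>x\<in>?R. K n x)"
    using bndD ev
  proof eventually_elim
    case (elim n)
    let ?\<phi> = "\<lambda>x. (\<Sum>s\<in>{s\<in>I n. s \<le> x}. g n s * w n s) - (\<Sum>s\<in>{s\<in>I n. s \<le> x}. g' n s * w' n s)"
    have "{s\<in>I n. s \<le> t} = I n" using I(2) by fastforce
    then have "(\<Sum>s\<in>I n. g n s * w n s) - (\<Sum>s\<in>I n. g' n s * w' n s) = ?\<phi> 0 + (\<Sum>x\<in>?R. ?\<phi> (nx R x) - ?\<phi> x)"
      using subdivision_telescope[OF R, of ?\<phi>] by simp
    moreover have "\<bar>?\<phi> 0\<bar> \<le> D * (?M n 0 + ?M' n 0) + \<bar>0\<bar> * \<bar>?M n 0 - ?M' n 0\<bar>"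
      by (rule weighted_sum_diff_bound) (use w elim(1) in auto)
    moreover have "\<bar>\<Sum>x\<in>?R. ?\<phi> (nx R x) - ?\<phi> x\<bar> \<le> (\<Sum>x\<in>?R. K n x)"
    proof (rule order_trans[OF sum_abs sum_mono])
      fix x assume x: "x \<in> ?R"
      let ?J = "{s\<in>I n. x < s \<and> s \<le> nx R x}"
      have \<phi>: "?\<phi> (nx R x) - ?\<phi> x = (\<Sum>s\<in>?J. g n s * w n s) - (\<Sum>s\<in>?J. g' n s * w' n s)"
        using split[OF x, where n = n and h = "\<lambda>s. g n s * w n s"] split[OF x, where n = n and h = "\<lambda>s. g' n s * w' n s"] by linarith
      show "\<bar>?\<phi> (nx R x) - ?\<phi> x\<bar> \<le> K n x"
      proof (cases "good x (nx R x)")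
        case True
        show ?thesis
          unfolding \<phi> K_def split[OF x] if_P[OF True]
          by (rule weighted_sum_diff_bound) (use w elim(2) x True in \<open>auto intro: less_imp_le\<close>)
      next
        case False
        have "\<bar>(\<Sum>s\<in>?J. g n s * w n s) - (\<Sum>s\<in>?J. g' n s * w' n s)\<bar> \<le>
           D * ((\<Sum>s\<in>?J. w n s) + (\<Sum>s\<in>?J. w' n s)) + \<bar>0\<bar> * \<bar>(\<Sum>s\<in>?J. w n s) - (\<Sum>s\<in>?J. w' n s)\<bar>"
          by (rule weighted_sum_diff_bound) (use w elim(1) in auto)
        then show ?thesis unfolding \<phi> K_def split[OF x] if_not_P[OF False] by simp
      qed
    qed
    ultimately show ?case by linarith
  qed
  define L where "L x = (if good x (nx R x) then 2 * d * (m (nx R x) - m x) else 2 * D * (m (nx R x) - m x))" for x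
  have "(\<lambda>n. D * (?M n 0 + ?M' n 0) + (\<Sum>x\<in>?R. K n x)) \<longlonglongrightarrow> D * (m 0 + m 0) + (\<Sum>x\<in>?R. L x)"
  proof (intro tendsto_add tendsto_mult tendsto_const lim tendsto_sum)
    fix x assume x: "x \<in> ?R"
    have \<Delta>: "(\<lambda>n. ?\<Delta> n x) \<longlonglongrightarrow> m (nx R x) - m x" "(\<lambda>n. ?\<Delta>' n x) \<longlonglongrightarrow> m (nx R x) - m x"
      by (intro tendsto_diff lim RI[OF x])+
    show "(\<lambda>n. K n x) \<longlonglongrightarrow> L x"
    proof (cases "good x (nx R x)")
      case True
      have "(\<lambda>n. d * (?\<Delta> n x + ?\<Delta>' n x) + \<bar>c x\<bar> * \<bar>?\<Delta> n x - ?\<Delta>' n x\<bar>) \<longlonglongrightarrow>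
         d * ((m (nx R x) - m x) + (m (nx R x) - m x)) + \<bar>c x\<bar> * \<bar>(m (nx R x) - m x) - (m (nx R x) - m x)\<bar>"
        by (intro tendsto_add tendsto_mult tendsto_const tendsto_rabs tendsto_diff[OF \<Delta>] \<Delta>)
      then show ?thesis unfolding K_def L_def if_P[OF True] by (simp add: algebra_simps)
    next
      case False
      have "(\<lambda>n. D * (?\<Delta> n x + ?\<Delta>' n x)) \<longlonglongrightarrow> D * ((m (nx R x) - m x) + (m (nx R x) - m x))"
        by (intro tendsto_add tendsto_mult tendsto_const \<Delta>)
      then show ?thesis unfolding K_def L_def if_not_P[OF False] by (simp add: algebra_simps)
    qed
  qed (use t in auto)
  moreover have "D * (m 0 + m 0) + (\<Sum>x\<in>?R. L x) < e"
  proof -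
    have fin: "finite ?R" using subdivision_finite[OF R] by simp
    have pos: "0 \<le> m (nx R x) - m x" if "x \<in> ?R" for x using m(2)[of x "nx R x"] RI[OF that] by auto
    let ?b = "\<lambda>x. if good x (nx R x) then 0 else m (nx R x) - m x"
    have "(\<Sum>x\<in>?R. L x) \<le> (\<Sum>x\<in>?R. 2 * d * (m (nx R x) - m x) + 2 * D * ?b x)"
      by (rule sum_mono) (use pos d(1) D in \<open>auto simp: L_def\<close>)
    also have "\<dots> = 2 * d * (m t - m 0) + 2 * D * (\<Sum>x\<in>?R. ?b x)"
      unfolding sum.distrib sum_distrib_left[symmetric] subdivision_telescope[OF R] ..
    also have "(\<Sum>x\<in>?R. ?b x) = (\<Sum>x\<in>{x\<in>R. x < t \<and> \<not> good x (nx R x)}. m (nx R x) - m x)"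
      by (rule sum.mono_neutral_cong_right) (use fin in auto)
    also have "2 * d * (m t - m 0) + 2 * D * \<dots> \<le> 2 * d * (m t - m 0) + 2 * D * (e / (4 * (D + 1)))"
      using bad D by (intro add_left_mono mult_left_mono) auto
    also have "2 * D * (e / (4 * (D + 1))) \<le> e / 2" using D e by (simp add: field_simps)
    also have "2 * d * (m t - m 0) + e / 2 < e" using d(2) m(3) by simp
    finally show ?thesis using m(3) by simp
  qed
  ultimately have "\<forall>\<^sub>F n in sequentially. D * (?M n 0 + ?M' n 0) + (\<Sum>x\<in>?R. K n x) < e"
    by (rule order_tendstoD)
  with main show "\<forall>\<^sub>F n in sequentially. dist ((\<Sum>s\<in>I n. g n s * w n s) - (\<Sum>s\<in>I n. g' n s * w' n s)) 0 < e"
    by eventually_elim (simp add: dist_real_def)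
qed

lemma nx_close:
  assumes Q: "subdivision a b Q" and u: "a \<le> u" "u < b"
  obtains s where "s \<in> Q" "s < b" "s \<le> u" "nx Q u \<le> nx Q s"
proof (cases "u \<in> Q")
  case True
  then show ?thesis using that u by blast
next
  case False
  have au: "a < u" using False u subdivision_ends[OF Q] by (cases "u = a") auto
  note p = pre_props[OF Q au] and l = le_nx_pre[OF Q au less_imp_le[OF u(2)]]
  have "nx Q (pre Q u) \<noteq> u" using nx_props(1)[OF Q l(1)] False by metis
  then have "nx Q u \<le> nx Q (pre Q u)"
    using l nx_props(1)[OF Q l(1)] by (intro nx_least[OF Q]) auto
  then show ?thesis using that p l by (meson less_imp_le)
qed

lemma nx_tendsto:
  assumes Q: "fine_subdivisions a b Q" and u: "a \<le> u" "u < b"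
  shows "(\<lambda>n. nx (Q n) u) \<longlonglongrightarrow> u"
proof (rule tendstoI)
  fix e :: real assume "e > 0"
  note sub = fine_subdivisionsD[OF Q]
  have "\<forall>\<^sub>F n in sequentially. \<forall>s\<in>Q n. s < b \<longrightarrow> nx (Q n) s - s < e"
    using Q \<open>e > 0\<close> by (auto simp: fine_subdivisions_def)
  then show "\<forall>\<^sub>F n in sequentially. dist (nx (Q n) u) u < e"
  proof eventually_elim
    case (elim n)
    obtain s where s: "s \<in> Q n" "s < b" "s \<le> u" "nx (Q n) u \<le> nx (Q n) s" using nx_close[OF sub u] .
    then have "nx (Q n) s - s < e" using elim by blast
    then show ?case using s nx_props[OF sub u(2), of n] by (auto simp: dist_real_def)
  qed
qed

text \<open>The sum up to \<open>x < b\<close> telescopes to the value of \<open>v\<close> at the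
  first point after \<open>x\<close>, which tends to \<open>x\<close>.\<close>

lemma increment_distribution_tendsto:
  fixes v :: "real \<Rightarrow> real"
  assumes Q: "fine_subdivisions a b Q" and v: "continuous_on {a..b} v" and x: "x \<in> {a..b}"
  shows "(\<lambda>n. \<Sum>s\<in>{s\<in>{s\<in>Q n. s < b}. s \<le> x}. v (nx (Q n) s) - v s) \<longlonglongrightarrow> v x - v a"
proof (cases "x = b")
  case True
  note sub = fine_subdivisionsD[OF Q]
  have "{s\<in>{s\<in>Q n. s < b}. s \<le> x} = {s\<in>Q n. s < b}" for n using True by auto
  then show ?thesis using subdivision_telescope[OF sub, of v] True by simp
next
  case False
  note sub = fine_subdivisionsD[OF Q]
  have xb: "a \<le> x" "x < b" using x False by auto
  have "{s\<in>{s\<in>Q n. s < b}. s \<le> x} = {s\<in>Q n. s < nx (Q n) x}" for n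
    using nx_props[OF sub xb(2), of n] nx_least[OF sub, of _ n x] xb by force
  then have eq: "(\<Sum>s\<in>{s\<in>{s\<in>Q n. s < b}. s \<le> x}. v (nx (Q n) s) - v s) = v (nx (Q n) x) - v a" for n
    using subdivision_telescope_upto[OF sub nx_props(1)[OF sub xb(2)], of v n] by simp
  have "(\<lambda>n. v (nx (Q n) x)) \<longlonglongrightarrow> v x"
  proof (rule v[unfolded continuous_on_sequentially comp_def, rule_format, OF x])
    show "(\<forall>n. nx (Q n) x \<in> {a..b}) \<and> (\<lambda>n. nx (Q n) x) \<longlonglongrightarrow> x"
      using nx_tendsto[OF Q xb] nx_props[OF sub xb(2)] xb
      by (auto intro: order_trans[OF xb(1) less_imp_le])
  qed
  then show ?thesis unfolding eq by (intro tendsto_intros)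
qed

text \<open>A left-point Riemann sum is the integral of \<open>f (pre (Q n) u)\<close>, which
  converges pointwise because \<open>f\<close> is left-continuous.\<close>

lemma riemann_sums_tendsto:
  assumes g: "cont_bv T g" and t: "0 < t" "t \<le> T" and Q: "fine_subdivisions 0 t Q"
    and f: "\<And>u x. u \<in> {0<..t} \<Longrightarrow> (\<And>n. x n \<in> {0..u}) \<Longrightarrow> x \<longlonglongrightarrow> u \<Longrightarrow> (\<lambda>n. f (x n)) \<longlonglongrightarrow> f u"
    and C: "\<And>u. u \<in> {0..t} \<Longrightarrow> \<bar>f u\<bar> \<le> C"
  shows "bdd_measurable 0 t f"
    and "(\<lambda>n. \<Sum>s\<in>{s\<in>Q n. s < t}. f s * (g (nx (Q n) s) - g s)) \<longlonglongrightarrow> stieltjes_integral 0 t f g"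
proof -
  note sub = fine_subdivisionsD[OF Q]
  show fm: "bdd_measurable 0 t f"
    by (rule bdd_measurableI[OF left_continuous_measurable[OF f] C]) auto
  have "(\<Sum>s\<in>{s\<in>Q n. s < t}. f s * (g (nx (Q n) s) - g s)) = stieltjes_integral 0 t (\<lambda>u. f (pre (Q n) u)) g" for n
  proof -
    have "stieltjes_integral 0 t (\<lambda>u. f (pre (Q n) u)) g =
        (\<Sum>s\<in>{s\<in>Q n. s < t}. stieltjes_integral s (nx (Q n) s) (\<lambda>_. f s) g)"
      by (rule stieltjes_integral_pieces[OF g _ t(2) sub, where h = "\<lambda>s _. f s"]) (auto intro: bdd_measurable_const)
    also have "\<dots> = (\<Sum>s\<in>{s\<in>Q n. s < t}. f s * (g (nx (Q n) s) - g s))"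
    proof (rule sum.cong[OF refl])
      fix s assume s: "s \<in> {s\<in>Q n. s < t}"
      show "stieltjes_integral s (nx (Q n) s) (\<lambda>_. f s) g = f s * (g (nx (Q n) s) - g s)"
        by (rule stieltjes_integral_const[OF g])
           (use s t subdivision_bounds[OF sub, of s n] nx_props[OF sub, of s n] in auto)
    qed
    finally show ?thesis by simp
  qed
  moreover have "(\<lambda>n. stieltjes_integral 0 t (\<lambda>u. f (pre (Q n) u)) g) \<longlonglongrightarrow> stieltjes_integral 0 t f g"
  proof (rule stieltjes_integral_dominated_convergence[OF g _ _ t(2) _ fm, where C = C])
    show "bdd_measurable 0 t (\<lambda>u. f (pre (Q n) u))" for n
      by (rule bdd_measurable_pieces[OF sub, where h = "\<lambda>s _. f s"]) (rule bdd_measurable_const)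
    fix n u assume u: "u \<in> {0<..t}"
    show "\<bar>f (pre (Q n) u)\<bar> \<le> C" using pre_props[OF sub, of u n] u by (intro C) auto
    show "(\<lambda>n. f (pre (Q n) u)) \<longlonglongrightarrow> f u"
      by (rule f[OF u]) (use pre_props[OF sub, of u] u pre_tendsto[OF Q, of u] in \<open>auto intro: less_imp_le\<close>)
  qed (use t in auto)
  ultimately show "(\<lambda>n. \<Sum>s\<in>{s\<in>Q n. s < t}. f s * (g (nx (Q n) s) - g s)) \<longlonglongrightarrow> stieltjes_integral 0 t f g"
    by simp
qed

section \<open>Change of variables along continuous paths\<close>

text \<open>For \<open>a = 0\<close> and a partition point \<open>r\<close> this is, on
  \<open>[0,T]\<close>, the step path of the Ito sums stopped just before \<open>r\<close>: on each
  cell it already has the value of \<open>W\<close> at the end of the cell. Before \<open>a\<close>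
  the path is left alone, from \<open>r\<close> on it is frozen.\<close>

definition stair :: "real set \<Rightarrow> real \<Rightarrow> 'd::finite path \<Rightarrow> real \<Rightarrow> 'd path" where
  "stair Q a W r = (\<lambda>u. if u < a then W u else if u < r then W (nx Q u) else W r)"

text \<open>Closeness is uniform over an index set, which consists of partition points or of pairs
  of a partition point and an intermediate parameter. Mean value theorems choose such parameters in
  an uncontrolled way, so all of them are treated at once.\<close>

definition tracks ::
  "real \<Rightarrow> (nat \<Rightarrow> 'i set) \<Rightarrow> ('i \<Rightarrow> real) \<Rightarrow> 'd::finite path \<Rightarrow> (nat \<Rightarrow> 'i \<Rightarrow> 'd path) \<Rightarrow> bool" where
  "tracks T I \<tau> W Z \<longleftrightarrow> (\<forall>\<epsilon>>0. \<forall>\<^sub>F n in sequentially. \<forall>i\<in>I n. \<forall>u\<in>{0..T}. norm (Z n i u - stop (\<tau> i) W u) < \<epsilon>)"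

abbreviation stair_bump :: "real \<Rightarrow> real set \<Rightarrow> real \<Rightarrow> 'd::finite path \<Rightarrow> real \<times> real \<Rightarrow> 'd path" where
  "stair_bump T Q a W \<equiv> \<lambda>(s, x). bump T s (x *\<^sub>R (W (nx Q s) - W s)) (stair Q a W s)"

lemma nx_eq:
  assumes Q: "subdivision a b Q" and s: "s \<in> Q" "s < b" "s \<le> u" "u < nx Q s"
  shows "nx Q u = nx Q s"
proof (rule antisym)
  show "nx Q u \<le> nx Q s" by (rule nx_least[OF Q nx_props(1)[OF Q s(2)] s(4)])
  have "u < b" using s nx_props[OF Q s(2)] by auto
  then show "nx Q s \<le> nx Q u" using nx_props[OF Q, of u] s by (intro nx_least[OF Q]) auto
qed

text \<open>This is what anticipation buys: advancing from \<open>s\<close> to the next point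
  amounts to a single bump at time \<open>s\<close>, after which the path is constant over the
  cell.\<close>

lemma stair_step:
  assumes Q: "subdivision a b Q" and s: "s \<in> Q" "s < b" and u: "u \<in> {0..T}"
  shows "stair Q a W (nx Q s) u = stair_bump T Q a W (s, 1) u"
  using u s nx_eq[OF Q s, of u] nx_props[OF Q s(2)] subdivision_bounds[OF Q s(1)]
  by (auto simp: stair_def bump_apply)

text \<open>Uniform continuity of \<open>W\<close>; for \<open>u\<close> off the subdivision, the
  step to its successor is no longer than the cell in which it lies.\<close>

lemma fine_subdivisions_oscillation:
  fixes W :: "real \<Rightarrow> 'b::real_normed_vector"
  assumes Q: "fine_subdivisions a b Q" and W: "continuous_on {a..b} W" and e: "e > 0"
  shows "\<forall>\<^sub>F n in sequentially. \<forall>u. a \<le> u \<and> u < b \<longrightarrow> norm (W (nx (Q n) u) - W u) < e"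
proof -
  note sub = fine_subdivisionsD[OF Q]
  have "uniformly_continuous_on {a..b} W" by (rule compact_uniformly_continuous[OF W compact_Icc])
  then obtain d where d: "d > 0" "\<And>x y. x \<in> {a..b} \<Longrightarrow> y \<in> {a..b} \<Longrightarrow> dist y x < d \<Longrightarrow> dist (W y) (W x) < e"
    unfolding uniformly_continuous_on_def using e by metis
  have "\<forall>\<^sub>F n in sequentially. \<forall>s\<in>Q n. s < b \<longrightarrow> nx (Q n) s - s < d"
    using Q d(1) by (auto simp: fine_subdivisions_def)
  then show ?thesis
  proof eventually_elim
    case (elim n)
    show ?case
    proof (intro allI impI, elim conjE)
      fix u assume u: "a \<le> u" "u < b"
      obtain s where s: "s \<in> Q n" "s < b" "s \<le> u" "nx (Q n) u \<le> nx (Q n) s" using nx_close[OF sub u] .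
      then have "nx (Q n) s - s < d" using elim by blast
      then show "norm (W (nx (Q n) u) - W u) < e"
        using s u nx_props[OF sub u(2), of n] unfolding dist_norm[symmetric] by (intro d(2)) (auto simp: dist_real_def)
    qed
  qed
qed

lemma stair_cadlag:
  assumes Q: "subdivision a b Q" and ab: "0 \<le> a" "b \<le> T" and W: "W \<in> cadlag_paths T U" and r: "r \<in> Q"
  shows "stair Q a W r \<in> cadlag_paths T U"
proof -
  \<comment> \<open>\<open>Min B\<close> is the next point of \<open>Q\<close>. The set is empty
    only from \<open>b\<close> on, where \<open>W b\<close> serves as a default value in
    \<open>U\<close>.\<close>
  let ?\<phi> = "\<lambda>B. if B = {} then W b else W (Min B)"
  have WQ: "W x \<in> U" if "x \<in> Q" for x using cadlag_pathsD(1)[OF W, of x] subdivision_bounds[OF Q that] ab by auto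
  have V: "(\<lambda>u. ?\<phi> {x\<in>Q. u < x}) \<in> cadlag_paths T U"
  proof (rule cadlag_paths_step[OF subdivision_finite[OF Q], of T ?\<phi>])
    fix u assume "u \<in> {0..T}"
    show "?\<phi> {x\<in>Q. u < x} \<in> U"
    proof (cases "{x\<in>Q. u < x} = {}")
      case False
      have "Min {x\<in>Q. u < x} \<in> {x\<in>Q. u < x}" by (rule Min_in) (use False subdivision_finite[OF Q] in auto)
      then show ?thesis using False WQ by auto
    qed (use WQ subdivision_ends[OF Q] in auto)
  qed
  have "stair Q a W r = (\<lambda>u. if u < a then W u else (\<lambda>u. if u < r then (\<lambda>u. ?\<phi> {x\<in>Q. u < x}) u else (\<lambda>_. W r) u) u)"
    using r by (auto simp: stair_def nx_def fun_eq_iff)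
  also have "\<dots> \<in> cadlag_paths T U"
    by (intro cadlag_paths_glue W V cadlag_paths_const WQ r)
  finally show ?thesis .
qed

lemma tracks_stop: "tracks T I \<tau> W (\<lambda>n i. stop (\<tau> i) W)"
  by (simp add: tracks_def)

lemma stop_stair_close:
  assumes Q: "subdivision a b Q" and ab: "0 \<le> a" "b \<le> T" and r: "r \<in> Q" and e: "e > 0"
    and osc: "\<forall>u. a \<le> u \<and> u < b \<longrightarrow> norm (W (nx Q u) - W u) < e" and u: "u \<in> {0..T}"
  shows "norm (stair Q a W r u - stop r W u) < e"
  using u r subdivision_bounds[OF Q r] ab osc e by (auto simp: stair_def stop_apply[OF u])

lemma tracks_stair:
  assumes Q: "fine_subdivisions a b Q" and ab: "0 \<le> a" "b \<le> T" and W: "continuous_on {a..b} W"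
  shows "tracks T Q (\<lambda>s. s) W (\<lambda>n s. stair (Q n) a W s)"
  unfolding tracks_def
proof (intro allI impI)
  note sub = fine_subdivisionsD[OF Q]
  fix e :: real assume e: "e > 0"
  show "\<forall>\<^sub>F n in sequentially. \<forall>s\<in>Q n. \<forall>u\<in>{0..T}. norm (stair (Q n) a W s u - stop s W u) < e"
    using fine_subdivisions_oscillation[OF Q W e]
    by eventually_elim (use stop_stair_close[OF sub ab _ e] in blast)
qed

lemma tracks_stair_bump:
  assumes Q: "fine_subdivisions a b Q" and ab: "0 \<le> a" "b \<le> T" and W: "continuous_on {a..b} W"
  shows "tracks T (\<lambda>n. {s\<in>Q n. s < b} \<times> {0..1}) fst W (\<lambda>n. stair_bump T (Q n) a W)"
  unfolding tracks_def
proof (intro allI impI)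
  note sub = fine_subdivisionsD[OF Q]
  fix e :: real assume "e > 0"
  then have e: "e/2 > 0" by simp
  show "\<forall>\<^sub>F n in sequentially. \<forall>i\<in>{s\<in>Q n. s < b} \<times> {0..1}. \<forall>u\<in>{0..T}.
      norm (stair_bump T (Q n) a W i u - stop (fst i) W u) < e"
    using fine_subdivisions_oscillation[OF Q W e]
  proof eventually_elim
    case (elim n)
    show ?case
    proof (intro ballI)
      fix i u assume i: "i \<in> {s\<in>Q n. s < b} \<times> {0..1::real}" and u: "u \<in> {0..T}"
      obtain s x where ix: "i = (s, x)" "s \<in> Q n" "s < b" "0 \<le> x" "x \<le> 1" using i by auto
      let ?\<delta> = "W (nx (Q n) s) - W s"
      have "norm (x *\<^sub>R ?\<delta>) \<le> norm ?\<delta>" using ix by (simp add: mult_left_le_one_le)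
      moreover have "norm ?\<delta> < e/2" using elim ix subdivision_bounds[OF sub ix(2)] by auto
      moreover have "norm (stair (Q n) a W s u - stop s W u) < e/2"
        by (rule stop_stair_close[OF sub ab ix(2) e elim u])
      moreover have "norm (stair (Q n) a W s u - stop s W u + x *\<^sub>R ?\<delta>) \<le>
         norm (stair (Q n) a W s u - stop s W u) + norm (x *\<^sub>R ?\<delta>)" by (rule norm_triangle_ineq)
      moreover have "stair_bump T (Q n) a W i u - stop (fst i) W u =
        (if u < s then stair (Q n) a W s u - stop s W u else stair (Q n) a W s u - stop s W u + x *\<^sub>R ?\<delta>)"
        using u by (simp add: ix bump_apply)
      ultimately show "norm (stair_bump T (Q n) a W i u - stop (fst i) W u) < e"
        using e by (simp split: if_splits)
    qed
  qed
qed

section \<open>Functionals along families of tracking paths\<close>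

context
  fixes T :: real and m :: nat and U :: "(real ^ 'd::finite) set" and S :: "(nat \<Rightarrow> real) set"
  assumes T: "0 < T" and U: "open U"
begin

text \<open>Stopped versions of \<open>W\<close> stay in the compact set of \<open>W\<close>, and a
  closed neighbourhood of this set inside \<open>U\<close> absorbs the tracking error for all
  indices simultaneously.\<close>

lemma tracks_compact:
  assumes W: "W \<in> cadlag_paths T U" and Z: "tracks T I \<tau> W Z"
    and I: "\<And>n i. i \<in> I n \<Longrightarrow> \<tau> i \<in> {0..T}" "\<And>n i. i \<in> I n \<Longrightarrow> Z n i \<in> cadlag_paths T UNIV"
  obtains K where "compact K" "K \<subseteq> U" "\<forall>\<^sub>F n in sequentially. \<forall>i\<in>I n. Z n i \<in> cadlag_paths T K"
proof -
  obtain K where K: "compact K" "K \<subseteq> U" "W \<in> cadlag_paths T K"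
    using cadlag_paths_compact[OF W U] .
  obtain e where e: "e > 0" "(\<Union>x\<in>K. cball x e) \<subseteq> U"
    using compact_subset_open_imp_cball_epsilon_subset[OF K(1) U K(2)] by blast
  let ?K = "\<Union>x\<in>K. cball x e"
  have c: "compact ?K" using K by (intro compact_minkowski_sum_cball)
  have "\<forall>\<^sub>F n in sequentially. \<forall>i\<in>I n. \<forall>u\<in>{0..T}. norm (Z n i u - stop (\<tau> i) W u) < e"
    using Z e(1) unfolding tracks_def by blast
  then have "\<forall>\<^sub>F n in sequentially. \<forall>i\<in>I n. Z n i \<in> cadlag_paths T ?K"
  proof eventually_elim
    case (elim n)
    show ?case
    proof
      fix i assume i: "i \<in> I n"
      show "Z n i \<in> cadlag_paths T ?K"
      proof (rule cadlag_paths_closed[OF I(2)[OF i] compact_imp_closed[OF c]])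
        fix u assume u: "u \<in> {0..T}"
        have "norm (Z n i u - stop (\<tau> i) W u) < e" using elim i u by blast
        then have "Z n i u \<in> cball (stop (\<tau> i) W u) e" by (simp add: dist_norm norm_minus_commute)
        moreover have "stop (\<tau> i) W \<in> cadlag_paths T K" using cadlag_paths_stop[OF K(3)] I(1)[OF i] by auto
        then have "stop (\<tau> i) W u \<in> K" using cadlag_pathsD(1) u by blast
        ultimately show "Z n i u \<in> ?K" by blast
      qed
    qed
  qed
  then show ?thesis by (rule that[OF c e(2)])
qed

lemma tracks_paths:
  assumes "W \<in> cadlag_paths T U" "tracks T I \<tau> W Z"
    "\<And>n i. i \<in> I n \<Longrightarrow> \<tau> i \<in> {0..T}" "\<And>n i. i \<in> I n \<Longrightarrow> Z n i \<in> cadlag_paths T UNIV"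
  shows "\<forall>\<^sub>F n in sequentially. \<forall>i\<in>I n. Z n i \<in> cadlag_paths T U"
proof -
  obtain K where K: "compact K" "K \<subseteq> U" "\<forall>\<^sub>F n in sequentially. \<forall>i\<in>I n. Z n i \<in> cadlag_paths T K"
    using tracks_compact[OF assms] .
  show ?thesis using K(3) by eventually_elim (use K(2) cadlag_paths_mono in blast)
qed

lemma tracks_bounded:
  assumes H: "boundedness_preserving T m U S H" and A: "A \<in> CBV T m S"
    and "W \<in> cadlag_paths T U" "tracks T I \<tau> W Z"
    "\<And>n i. i \<in> I n \<Longrightarrow> \<tau> i \<in> {0..T}" "\<And>n i. i \<in> I n \<Longrightarrow> Z n i \<in> cadlag_paths T UNIV"
  obtains C where "\<forall>\<^sub>F n in sequentially. \<forall>i\<in>I n. \<forall>r\<in>{0..T}. \<bar>H r (Z n i) A\<bar> \<le> C"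
proof -
  obtain K where K: "compact K" "K \<subseteq> U" "\<forall>\<^sub>F n in sequentially. \<forall>i\<in>I n. Z n i \<in> cadlag_paths T K"
    using tracks_compact[OF assms(3-6)] .
  obtain C where C: "\<And>t X. t \<in> {0..T} \<Longrightarrow> X \<in> cadlag_paths T K \<Longrightarrow> \<bar>H t X A\<bar> \<le> C"
    using boundedness_preservingD[OF T U H A K(1,2)] by metis
  have "\<forall>\<^sub>F n in sequentially. \<forall>i\<in>I n. \<forall>r\<in>{0..T}. \<bar>H r (Z n i) A\<bar> \<le> C"
    using K(3) by eventually_elim (use C in blast)
  then show ?thesis by (rule that)
qed

text \<open>Between times near \<open>r\<close> the path \<open>W\<close> varies by at most
  \<eta>/4, and the tracking error is at most \<eta>/8. The stopped paths are thus within \<eta>/2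
  of each other, and the one \<eta> of left-continuity at \<open>(r, W)\<close> serves all
  indices.\<close>

lemma left_continuous_tracks:
  assumes H: "left_continuous T m U S H" and A: "A \<in> CBV T m S" and W: "W \<in> cadlag_paths T U"
    and Z: "tracks T I \<tau> W Z" and I: "\<And>n i. i \<in> I n \<Longrightarrow> \<tau> i \<in> {0..T}"
    and ZU: "\<forall>\<^sub>F n in sequentially. \<forall>i\<in>I n. Z n i \<in> cadlag_paths T U"
    and cont: "continuous_on {a..b} W" and ab: "0 \<le> a" "b \<le> T" and r: "r \<in> {a<..b}" and e: "e > 0"
  obtains l where "l < r" "\<forall>\<^sub>F n in sequentially. \<forall>i\<in>I n. l < \<tau> i \<and> \<tau> i \<le> r \<longrightarrow> \<bar>H (\<tau> i) (Z n i) A - H r W A\<bar> < e"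
proof -
  have rT: "r \<in> {0<..T}" using r ab by auto
  obtain \<eta> where \<eta>: "\<eta> > 0" "\<And>h Y. h \<in> {0..<\<eta>} \<Longrightarrow> h \<le> r \<Longrightarrow> Y \<in> cadlag_paths T U \<Longrightarrow>
      sup_norm T (\<lambda>u. stop r W u - stop (r - h) Y u) < \<eta> \<Longrightarrow> \<bar>H r W A - H (r - h) Y A\<bar> < e"
    using H rT e W A unfolding left_continuous_def by meson
  have \<eta>8: "\<eta> / 8 > 0" using \<eta>(1) by simp
  obtain d where d: "d > 0" "\<And>v. v \<in> {a..b} \<Longrightarrow> dist v r < d \<Longrightarrow> dist (W v) (W r) < \<eta> / 8"
    using cont[unfolded continuous_on_iff, rule_format, of r "\<eta> / 8"] r \<eta>8 by auto
  \<comment> \<open>The three bounds keep the times in \<open>[a,b]\<close>, within the continuity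
    modulus of \<open>W\<close> at \<open>r\<close>, and within the time window \<eta> of
    left-continuity.\<close>
  define l where "l = max a (max (r - d) (r - \<eta>))"
  have l: "l < r" using r d(1) \<eta>(1) by (auto simp: l_def)
  have "\<forall>\<^sub>F n in sequentially. \<forall>i\<in>I n. \<forall>u\<in>{0..T}. norm (Z n i u - stop (\<tau> i) W u) < \<eta> / 8"
    using Z \<eta>8 unfolding tracks_def by blast
  then have "\<forall>\<^sub>F n in sequentially. \<forall>i\<in>I n. l < \<tau> i \<and> \<tau> i \<le> r \<longrightarrow> \<bar>H (\<tau> i) (Z n i) A - H r W A\<bar> < e"
    using ZU
  proof eventually_elim
    case (elim n)
    show ?case
    proof (intro ballI impI, elim conjE)
      fix i assume i: "i \<in> I n" "l < \<tau> i" "\<tau> i \<le> r"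
      let ?s = "\<tau> i"
      have s: "0 \<le> ?s" "a \<le> ?s" "r - d < ?s" "r - \<eta> < ?s" using i I[OF i(1)] by (auto simp: l_def)
      have near: "norm (W v - W r) < \<eta> / 8" if "?s \<le> v" "v \<le> r" for v
        using d(2)[of v] that s r by (auto simp: dist_real_def dist_norm)
      have "norm (stop r W u - stop (r - (r - ?s)) (Z n i) u) \<le> \<eta> / 2" if u: "u \<in> {0..T}" for u
      proof -
        let ?v = "min ?s u"
        have v: "?v \<in> {0..T}" using u s by auto
        have 1: "norm (Z n i ?v - stop ?s W ?v) < \<eta> / 8" using elim(1) i(1) v by blast
        have 2: "stop ?s W ?v = W ?v" "stop ?s (Z n i) u = Z n i ?v" "stop r W u = W (min r u)"
          using u s rT by (auto simp: stop_def)
        have 3: "norm (W (min r u) - W ?v) \<le> \<eta> / 4"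
        proof (cases "u \<le> ?s")
          case True
          then have "min r u = u" "?v = u" using i by auto
          then show ?thesis using \<eta>(1) by simp
        next
          case False
          have "norm (W (min r u) - W r) < \<eta> / 8" using False i by (intro near) auto
          moreover have "norm (W ?v - W r) < \<eta> / 8" using False i by (intro near) auto
          moreover have "norm (W (min r u) - W ?v) \<le> norm (W (min r u) - W r) + norm (W ?v - W r)"
            using norm_triangle_ineq4[of "W (min r u) - W r" "W ?v - W r"] by simp
          ultimately show ?thesis by linarith
        qed
        have "norm (stop r W u - stop ?s (Z n i) u) \<le> norm (W (min r u) - W ?v) + norm (Z n i ?v - W ?v)"
          unfolding 2 using norm_triangle_ineq4[of "W (min r u) - W ?v" "Z n i ?v - W ?v"] by simp
        then have "norm (stop r W u - stop ?s (Z n i) u) \<le> \<eta> / 2" using 1 3 \<eta>(1) unfolding 2(1) by linarith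
        then show ?thesis by simp
      qed
      then have "sup_norm T (\<lambda>u. stop r W u - stop (r - (r - ?s)) (Z n i) u) \<le> \<eta> / 2"
        using T by (intro sup_norm_le) auto
      then have "\<bar>H r W A - H (r - (r - ?s)) (Z n i) A\<bar> < e"
        using elim i s \<eta>(1) by (intro \<eta>(2)) auto
      then show "\<bar>H ?s (Z n i) A - H r W A\<bar> < e" by (simp add: abs_minus_commute)
    qed
  qed
  with l show ?thesis by (rule that)
qed

text \<open>The stopped versions of \<open>W\<close> track it without error, and non-anticipativity
  removes the stopping again.\<close>

lemma left_limit_continuous_path:
  assumes H: "left_continuous T m U S H" "non_anticipative T m U S H" and A: "A \<in> CBV T m S" and W: "W \<in> cadlag_paths T U"
    and cont: "continuous_on {a..b} W" and ab: "0 \<le> a" "b \<le> T" and r: "r \<in> {a<..b}"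
    and x: "\<And>n. x n \<in> {a..r}" "x \<longlonglongrightarrow> r"
  shows "(\<lambda>n. H (x n) W A) \<longlonglongrightarrow> H r W A"
proof (rule tendstoI)
  fix e :: real assume e: "e > 0"
  obtain l where l: "l < r" "\<forall>\<^sub>F n in sequentially. \<forall>s\<in>{0..T}. l < s \<and> s \<le> r \<longrightarrow> \<bar>H s (stop s W) A - H r W A\<bar> < e"
  proof (rule left_continuous_tracks[OF H(1) A W tracks_stop[of T "\<lambda>_. {0..T}" "\<lambda>s. s"] _ _ cont ab r e])
    show "\<forall>\<^sub>F n in sequentially. \<forall>s\<in>{0..T}. stop s W \<in> cadlag_paths T U"
      using cadlag_paths_stop[OF W] by auto
  qed (use that in auto)
  have "\<forall>\<^sub>F n in sequentially. l < x n" using order_tendstoD(1)[OF x(2) l(1)] .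
  with l(2) show "\<forall>\<^sub>F n in sequentially. dist (H (x n) W A) (H r W A) < e"
  proof eventually_elim
    case (elim n)
    have xn: "x n \<in> {0..T}" "x n \<le> r" using x(1)[of n] r ab by auto
    then have "\<bar>H (x n) (stop (x n) W) A - H r W A\<bar> < e" using elim by blast
    moreover have "H (x n) (stop (x n) W) A = H (x n) W A"
      by (rule non_anticipative_stop[OF T U H(2) xn(1) _ W A]) (use xn in auto)
    ultimately show ?case by (simp add: dist_real_def)
  qed
qed

text \<open>Times are split into \<open>max (u n) t\<close>, covered by the right limit, and
  \<open>min (u n) t\<close>, covered by left-continuity since \<open>X\<close> does not jump. One
  of the two equals \<open>u n\<close> and the other \<open>t\<close>, so their values sum up as
  needed.\<close>

lemma continuous_on_functional:
  assumes F: "C12c_via T m U S F DF" and ab: "0 \<le> a" "b \<le> T" and X: "X \<in> cadlag_paths T U" and A: "A \<in> CBV T m S"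
    and cont: "continuous_on {a..b} X"
  shows "continuous_on {a..b} (\<lambda>t. F t X A)"
  unfolding continuous_on_sequentially comp_def
proof (intro allI ballI impI, elim conjE)
  fix u t assume t: "t \<in> {a..b}" and u: "\<forall>n. u n \<in> {a..b}" "u \<longlonglongrightarrow> t"
  have tT: "t \<in> {0..T}" using t ab by auto
  have "(\<lambda>n. F (max (u n) t) X A) \<longlonglongrightarrow> F t X A"
  proof (rule functional_right_limit[OF T U F tT X A])
    show "(\<lambda>n. max (u n) t) \<longlonglongrightarrow> t" using tendsto_max[OF u(2) tendsto_const, of t] by simp
  qed (use u(1) t ab in \<open>auto simp: max_def intro: order_trans\<close>)
  moreover have "(\<lambda>n. F (min (u n) t) X A) \<longlonglongrightarrow> F t X A"
  proof (cases "t = a")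
    case True
    then have "min (u n) t = t" for n using u(1) by simp
    then show ?thesis by simp
  next
    case False
    have "(\<lambda>n. min (u n) t) \<longlonglongrightarrow> t" using tendsto_min[OF u(2) tendsto_const, of t] by simp
    then show ?thesis
      by (intro left_limit_continuous_path[OF C12c_viaD(3,2)[OF F] A X cont ab]) (use t u(1) False in auto)
  qed
  ultimately have "(\<lambda>n. F (max (u n) t) X A + F (min (u n) t) X A - F t X A) \<longlonglongrightarrow> F t X A + F t X A - F t X A"
    by (intro tendsto_intros)
  moreover have "F (max (u n) t) X A + F (min (u n) t) X A - F t X A = F (u n) X A" for n
    by (auto simp: max_def min_def)
  ultimately show "(\<lambda>n. F (u n) X A) \<longlonglongrightarrow> F t X A" by simp
qed

text \<open>Along the anticipating stair paths, each step splits into a horizontal move and a bump.\<close>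

lemma discrete_change_of_variables:
  assumes F: "C12c_via T m U S F DF" and A: "A \<in> CBV T m S" and W: "W \<in> cadlag_paths T U"
    and ab: "0 \<le> a" "b \<le> T" and cont: "continuous_on {a..b} W" and Q: "fine_subdivisions a b Q"
  shows "(\<lambda>n. \<Sum>s\<in>{s\<in>Q n. s < b}. F s (stair_bump T (Q n) a W (s, 1)) A - F s (stair (Q n) a W s) A)
     \<longlonglongrightarrow> F b W A - F a W A - (\<Sum>i\<le>m. stieltjes_integral a b (\<lambda>r. DF i r W A) (integrator A i))"
proof -
  note sub = fine_subdivisionsD[OF Q]
  have ab': "a \<le> b" using subdivision_ends(3)[OF sub] .
  note na = C12c_viaD(2)[OF F] and HI = C12c_via_horizontal_integrand[OF F]
  note hna = horizontal_integrandD(1)[OF T U HI]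
  have g: "cont_bv T (integrator A i)" if "i \<le> m" for i using cont_bv_integrator[OF A that] T by simp
  let ?Z = "\<lambda>n r. stair (Q n) a W r"
  have QT: "s \<in> {0..T}" if "s \<in> Q n" for s n using subdivision_bounds[OF sub that] ab by auto
  have Z: "?Z n r \<in> cadlag_paths T U" if "r \<in> Q n" for n r by (rule stair_cadlag[OF sub ab W that])
  have meas: "bdd_measurable 0 T (\<lambda>r. DF i r X A)" if "X \<in> cadlag_paths T U" "i \<le> m" for X i
    by (rule horizontal_integrand_measurable[OF T U HI[OF that(2)] that(1) A])
  let ?h = "\<lambda>i n u. DF i u (?Z n (nx (Q n) (pre (Q n) u))) A"
  have pieces: "bdd_measurable s (nx (Q n) s) (\<lambda>r. DF i r (?Z n (nx (Q n) s)) A)" if "s \<in> Q n" "s < b" "i \<le> m" for s n i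
    by (rule bdd_measurable_subset[OF meas[OF Z[OF nx_props(1)[OF sub that(2)]] that(3)]])
       (use QT[OF that(1)] QT[OF nx_props(1)[OF sub that(2)]] in auto)
  have step: "F (nx (Q n) s) (?Z n (nx (Q n) s)) A - F s (?Z n s) A =
      (\<Sum>i\<le>m. stieltjes_integral s (nx (Q n) s) (\<lambda>r. DF i r (?Z n (nx (Q n) s)) A) (integrator A i))
      + (F s (stair_bump T (Q n) a W (s, 1)) A - F s (?Z n s) A)" if s: "s \<in> Q n" "s < b" for n s
  proof -
    let ?s' = "nx (Q n) s"
    note n = nx_props[OF sub s(2), of n]
    have Z': "?Z n ?s' \<in> cadlag_paths T U" by (rule Z[OF n(1)])
    have sZ: "stop s (?Z n ?s') \<in> cadlag_paths T U" using cadlag_paths_stop[OF Z'] QT[OF s(1)] by auto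
    \<comment> \<open>The staircase ending at \<open>?s'\<close> has the value \<open>W ?s'\<close>
      on all of \<open>{s..?s'}\<close>, so up to \<open>?s'\<close> it equals its version stopped
      at \<open>s\<close>: the move from \<open>s\<close> to \<open>?s'\<close> is purely
      horizontal.\<close>
    have eq: "stop s (?Z n ?s') u = ?Z n ?s' u" if u: "u \<in> {0..?s'}" for u
    proof -
      have uT: "u \<in> {0..T}" using u QT[OF n(1)] by auto
      have sa: "a \<le> s" "0 \<le> s" using subdivision_bounds[OF sub s(1)] ab by auto
      show ?thesis
      proof (cases "u < s")
        case True
        then show ?thesis using sa by (simp add: stop_apply[OF uT])
      next
        case False
        have 1: "stop s (?Z n ?s') u = ?Z n ?s' s" using False sa by (simp add: stop_apply[OF uT])
        have 2: "?Z n ?s' s = W ?s'" using sa n(2) by (simp add: stair_def)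
        have 3: "?Z n ?s' u = W ?s'"
        proof (cases "u < ?s'")
          case True
          then have "nx (Q n) u = ?s'" using False by (intro nx_eq[OF sub s]) auto
          then show ?thesis using True False sa by (simp add: stair_def)
        next
          case False
          then have "u = ?s'" using u by auto
          then show ?thesis using sa n(2) by (simp add: stair_def)
        qed
        show ?thesis unfolding 1 2 3 ..
      qed
    qed
    have 1: "F ?s' (?Z n ?s') A = F ?s' (stop s (?Z n ?s')) A"
      by (rule non_anticipative_cong[OF T U na QT[OF n(1)] Z' sZ _ A A]) (use eq in auto)
    \<comment> \<open>Seen up to time \<open>s\<close>, the next staircase is the current one with
      the full bump.\<close>
    have 2: "F s (stop s (?Z n ?s')) A = F s (stair_bump T (Q n) a W (s, 1)) A"
    proof -
      have b: "stair_bump T (Q n) a W (s, 1) \<in> cadlag_paths T U"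
        by (rule cadlag_paths_cong[OF Z' stair_step[OF sub s]])
      show ?thesis
      proof (rule non_anticipative_cong[OF T U na QT[OF s(1)] sZ b _ A A])
        fix u assume u: "u \<in> {0..s}"
        then have "u \<in> {0..T}" using QT[OF s(1)] by auto
        then show "stop s (?Z n ?s') u = stair_bump T (Q n) a W (s, 1) u"
          using stair_step[OF sub s, of u T W] eq[of u] u n by auto
      qed auto
    qed
    have 3: "stieltjes_integral s ?s' (\<lambda>r. DF i r (stop s (?Z n ?s')) A) (integrator A i) =
        stieltjes_integral s ?s' (\<lambda>r. DF i r (?Z n ?s') A) (integrator A i)" if i: "i \<le> m" for i
    proof (rule stieltjes_integral_cong)
      fix r assume r: "r \<in> {s<..?s'}"
      show "DF i r (stop s (?Z n ?s')) A = DF i r (?Z n ?s') A"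
        by (rule non_anticipative_cong[OF T U hna[OF i] _ sZ Z' _ A A])
           (use r eq QT[OF s(1)] QT[OF n(1)] in auto)
    qed (use n in auto)
    have "F ?s' (stop s (?Z n ?s')) A - F s (stop s (?Z n ?s')) A =
       (\<Sum>i\<le>m. stieltjes_integral s ?s' (\<lambda>r. DF i r (stop s (?Z n ?s')) A) (integrator A i))"
      by (rule horizontal_difference[OF T U F _ _ _ Z' A]) (use n QT[OF s(1)] QT[OF n(1)] in auto)
    also have "\<dots> = (\<Sum>i\<le>m. stieltjes_integral s ?s' (\<lambda>r. DF i r (?Z n ?s') A) (integrator A i))"
      by (rule sum.cong[OF refl]) (use 3 in auto)
    finally show ?thesis using 1 2 by simp
  qed
  have sum_eq: "(\<Sum>s\<in>{s\<in>Q n. s < b}. F s (stair_bump T (Q n) a W (s, 1)) A - F s (?Z n s) A) =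
     F b (?Z n b) A - F a W A - (\<Sum>i\<le>m. stieltjes_integral a b (?h i n) (integrator A i))" for n
  proof -
    have Za: "F a (?Z n a) A = F a W A"
      by (rule non_anticipative_cong[OF T U na QT[OF subdivision_ends(1)[OF sub]] Z[OF subdivision_ends(1)[OF sub]] W _ A A])
         (auto simp: stair_def)
    have "F b (?Z n b) A - F a (?Z n a) A = (\<Sum>s\<in>{s\<in>Q n. s < b}. F (nx (Q n) s) (?Z n (nx (Q n) s)) A - F s (?Z n s) A)"
      using subdivision_telescope[OF sub, of "\<lambda>r. F r (?Z n r) A"] by simp
    also have "\<dots> = (\<Sum>s\<in>{s\<in>Q n. s < b}. (\<Sum>i\<le>m. stieltjes_integral s (nx (Q n) s) (\<lambda>r. DF i r (?Z n (nx (Q n) s)) A) (integrator A i)))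
       + (\<Sum>s\<in>{s\<in>Q n. s < b}. F s (stair_bump T (Q n) a W (s, 1)) A - F s (?Z n s) A)"
      unfolding sum.distrib[symmetric] by (rule sum.cong[OF refl], rule step) auto
    also have "(\<Sum>s\<in>{s\<in>Q n. s < b}. (\<Sum>i\<le>m. stieltjes_integral s (nx (Q n) s) (\<lambda>r. DF i r (?Z n (nx (Q n) s)) A) (integrator A i)))
       = (\<Sum>i\<le>m. \<Sum>s\<in>{s\<in>Q n. s < b}. stieltjes_integral s (nx (Q n) s) (\<lambda>r. DF i r (?Z n (nx (Q n) s)) A) (integrator A i))"
      by (rule sum.swap)
    also have "\<dots> = (\<Sum>i\<le>m. stieltjes_integral a b (?h i n) (integrator A i))"
    proof (rule sum.cong[OF refl])
      fix i assume "i \<in> {..m}"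
      then show "(\<Sum>s\<in>{s\<in>Q n. s < b}. stieltjes_integral s (nx (Q n) s) (\<lambda>r. DF i r (?Z n (nx (Q n) s)) A) (integrator A i)) =
          stieltjes_integral a b (?h i n) (integrator A i)"
        by (intro stieltjes_integral_pieces[OF g ab sub, where h = "\<lambda>s r. DF i r (?Z n (nx (Q n) s)) A", symmetric])
           (use pieces in auto)
    qed
    finally show ?thesis using Za by simp
  qed
  have tr: "tracks T Q (\<lambda>s. s) W (\<lambda>n s. ?Z n s)" by (rule tracks_stair[OF Q ab cont])
  have bT: "b \<in> {0..T}" using ab ab' by auto
  have sW: "stop r W \<in> cadlag_paths T U" if "r \<in> {0..T}" for r using cadlag_paths_stop[OF W] that by auto
  have Fb: "(\<lambda>n. F b (?Z n b) A) \<longlonglongrightarrow> F b W A"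
  proof -
    have "uniform_limit {0..T} (\<lambda>n. ?Z n b) (stop b W) sequentially"
      using tr subdivision_ends(2)[OF sub] unfolding tracks_def uniform_limit_norm by (auto elim!: eventually_mono)
    then have "(\<lambda>n. F b (?Z n b) A - F b (stop b W) A) \<longlonglongrightarrow> 0"
      by (intro continuous_in_X_locally_uniformlyD[OF T U C12c_viaD(10)[OF F] sW[OF bT] A])
         (use Z subdivision_ends(2)[OF sub] bT in auto)
    moreover have "F b (stop b W) A = F b W A"
      by (rule non_anticipative_stop[OF T U na bT _ W A]) (use bT in auto)
    ultimately show ?thesis by (simp add: Lim_null[symmetric])
  qed
  \<comment> \<open>For fixed \<open>u\<close> the staircases belonging to the cell of
    \<open>u\<close> converge to \<open>W\<close> uniformly up to \<open>u\<close>; continuity at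
    fixed times gives the pointwise limit and tracking the common bound.\<close>
  have int: "(\<lambda>n. stieltjes_integral a b (?h i n) (integrator A i)) \<longlonglongrightarrow>
     stieltjes_integral a b (\<lambda>r. DF i r W A) (integrator A i)" if i: "i \<le> m" for i
  proof -
    obtain C where C: "\<forall>\<^sub>F n in sequentially. \<forall>s\<in>Q n. \<forall>r\<in>{0..T}. \<bar>DF i r (?Z n s) A\<bar> \<le> C"
    proof (rule tracks_bounded[OF horizontal_integrandD(2)[OF T U HI[OF i]] A W tr])
      fix C assume "\<forall>\<^sub>F n in sequentially. \<forall>s\<in>Q n. \<forall>r\<in>{0..T}. \<bar>DF i r (?Z n s) A\<bar> \<le> C"
      then show thesis by (rule that)
    qed (use QT cadlag_paths_mono[OF Z subset_UNIV] in auto)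
    have loc: "nx (Q n) (pre (Q n) u) \<in> Q n" "u \<le> nx (Q n) (pre (Q n) u)" if u: "u \<in> {a<..b}" for u n
      using le_nx_pre[OF sub, of u n] nx_props(1)[OF sub] u by auto
    show ?thesis
    proof (rule stieltjes_integral_dominated_convergence'[OF g[OF i] ab(1) ab' ab(2), where C = C])
      show "\<forall>\<^sub>F n in sequentially. bdd_measurable a b (?h i n) \<and> (\<forall>x\<in>{a<..b}. \<bar>?h i n x\<bar> \<le> C)"
        using C
      proof eventually_elim
        case (elim n)
        have "bdd_measurable a b (?h i n)"
          by (rule bdd_measurable_pieces[OF sub, where h = "\<lambda>s r. DF i r (?Z n (nx (Q n) s)) A"]) (use pieces i in auto)
        moreover have "\<bar>?h i n x\<bar> \<le> C" if x: "x \<in> {a<..b}" for x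
          using elim loc(1)[OF x, of n] x ab by auto
        ultimately show ?case by blast
      qed
      show "bdd_measurable a b (\<lambda>r. DF i r W A)" by (rule bdd_measurable_subset[OF meas[OF W i]]) (use ab in auto)
      fix u assume u: "u \<in> {a<..b}"
      have uT: "u \<in> {0..T}" using u ab by auto
      show "(\<lambda>n. ?h i n u) \<longlonglongrightarrow> DF i u W A"
      proof (rule continuous_at_fixed_timesD[OF T U horizontal_integrandD(3)[OF T U HI[OF i]] uT W A])
        show "\<forall>\<^sub>F n in sequentially. ?Z n (nx (Q n) (pre (Q n) u)) \<in> cadlag_paths T U" using Z loc(1)[OF u] by auto
        show "uniform_limit {0..T} (\<lambda>n. stop u (?Z n (nx (Q n) (pre (Q n) u)))) (stop u W) sequentially"
          unfolding uniform_limit_norm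
        proof (intro allI impI)
          fix e :: real assume e: "e > 0"
          have "\<forall>\<^sub>F n in sequentially. \<forall>s\<in>Q n. \<forall>v\<in>{0..T}. norm (?Z n s v - stop s W v) < e"
            using tr e unfolding tracks_def by blast
          then show "\<forall>\<^sub>F n in sequentially. \<forall>v\<in>{0..T}. norm (stop u (?Z n (nx (Q n) (pre (Q n) u))) v - stop u W v) < e"
          proof eventually_elim
            case (elim n)
            show ?case
            proof
              fix v assume v: "v \<in> {0..T}"
              let ?w = "min u v" and ?r = "nx (Q n) (pre (Q n) u)"
              have w: "?w \<in> {0..T}" "?w \<le> ?r" using v uT loc(2)[OF u, of n] by auto
              have "norm (?Z n ?r ?w - stop ?r W ?w) < e" using elim loc(1)[OF u] w by blast
              moreover have "stop ?r W ?w = W ?w" using w by (simp add: stop_def)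
              moreover have "stop u (?Z n ?r) v = ?Z n ?r ?w" "stop u W v = W ?w" using v uT by (simp_all add: stop_def)
              ultimately show "norm (stop u (?Z n ?r) v - stop u W v) < e" by simp
            qed
          qed
        qed
      qed
    qed
  qed
  show ?thesis
    unfolding sum_eq by (intro tendsto_diff Fb tendsto_const tendsto_sum int) auto
qed

section \<open>Mean value and Taylor expansions in the direction of a bump\<close>

lemma vertical_line_derivative:
  assumes F: "vertically_differentiable T m U S F" and t: "t \<in> {0..T}" and A: "A \<in> CBV T m S"
    and X: "bump T t (x *\<^sub>R \<delta>) X \<in> cadlag_paths T U"
  shows "((\<lambda>x. F t (bump T t (x *\<^sub>R \<delta>) X) A) has_real_derivative
     (\<Sum>i\<in>UNIV. \<delta> $ i * vertical_partial T i F t (bump T t (x *\<^sub>R \<delta>) X) A)) (at x)"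
proof -
  have "((\<lambda>x. F t (bump T t (x *\<^sub>R \<delta>) X) A) has_derivative
     (\<lambda>h. \<Sum>i\<in>UNIV. (h *\<^sub>R \<delta>) $ i * vertical_partial T i F t (bump T t (x *\<^sub>R \<delta>) X) A)) (at x)"
    by (rule has_derivative_compose[where f = "\<lambda>x. x *\<^sub>R \<delta>" and g = "\<lambda>w. F t (bump T t w X) A"])
       (auto intro!: derivative_eq_intros vertical_has_derivative[OF T U F t A X])
  then show ?thesis
    unfolding has_field_derivative_def
    by (rule has_derivative_eq_rhs) (simp add: fun_eq_iff sum_distrib_left algebra_simps)
qed

lemma vertical_mean_value:
  assumes F: "vertically_differentiable T m U S F" and t: "t \<in> {0..T}" and A: "A \<in> CBV T m S"
    and X: "\<And>x. x \<in> {0..1} \<Longrightarrow> bump T t (x *\<^sub>R \<delta>) X \<in> cadlag_paths T U"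
  shows "\<exists>x\<in>{0..1}. F t (bump T t (1 *\<^sub>R \<delta>) X) A - F t X A =
     (\<Sum>i\<in>UNIV. \<delta> $ i * vertical_partial T i F t (bump T t (x *\<^sub>R \<delta>) X) A)"
proof -
  let ?\<phi> = "\<lambda>x. F t (bump T t (x *\<^sub>R \<delta>) X) A"
  have "\<exists>z>0. z < 1 \<and> ?\<phi> 1 - ?\<phi> 0 = (1 - 0) * (\<Sum>i\<in>UNIV. \<delta> $ i * vertical_partial T i F t (bump T t (z *\<^sub>R \<delta>) X) A)"
    by (rule MVT2) (auto intro!: vertical_line_derivative[OF F t A] X)
  then show ?thesis by (auto simp: bump_zero intro: less_imp_le)
qed

text \<open>Taylor's theorem on the line through the bump. The order of the iterated partial
  derivatives is kept, since no symmetry is assumed.\<close>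

lemma vertical_taylor:
  assumes F: "vertically_differentiable T m U S F" "\<And>j. vertically_differentiable T m U S (vertical_partial T j F)"
    and t: "t \<in> {0..T}" and A: "A \<in> CBV T m S"
    and X: "\<And>x. x \<in> {0..1} \<Longrightarrow> bump T t (x *\<^sub>R \<delta>) X \<in> cadlag_paths T U"
  shows "\<exists>x\<in>{0..1}. F t (bump T t (1 *\<^sub>R \<delta>) X) A - F t X A =
     (\<Sum>j\<in>UNIV. \<delta> $ j * vertical_partial T j F t X A) +
     (\<Sum>j\<in>UNIV. \<Sum>i\<in>UNIV. vertical_partial T i (vertical_partial T j F) t (bump T t (x *\<^sub>R \<delta>) X) A * (\<delta> $ i * \<delta> $ j)) / 2"
proof -
  let ?b = "\<lambda>x. bump T t (x *\<^sub>R \<delta>) X"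
  let ?d = "\<lambda>k x. if k = 0 then F t (?b x) A else if k = Suc 0 then (\<Sum>j\<in>UNIV. \<delta> $ j * vertical_partial T j F t (?b x) A)
     else (\<Sum>j\<in>UNIV. \<delta> $ j * (\<Sum>i\<in>UNIV. \<delta> $ i * vertical_partial T i (vertical_partial T j F) t (?b x) A))"
  have d0: "(?d 0 has_real_derivative ?d (Suc 0) x) (at x)" if "x \<in> {0..1}" for x
    using vertical_line_derivative[OF F(1) t A X[OF that]] by simp
  have d1: "(?d (Suc 0) has_real_derivative ?d (Suc (Suc 0)) x) (at x)" if "x \<in> {0..1}" for x
  proof -
    have "((\<lambda>x. \<Sum>j\<in>UNIV. \<delta> $ j * vertical_partial T j F t (?b x) A) has_real_derivative
       (\<Sum>j\<in>UNIV. \<delta> $ j * (\<Sum>i\<in>UNIV. \<delta> $ i * vertical_partial T i (vertical_partial T j F) t (?b x) A))) (at x)"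
      by (intro DERIV_sum DERIV_cmult vertical_line_derivative[OF F(2) t A X[OF that]])
    then show ?thesis by simp
  qed
  have "\<exists>x>0. x < 1 \<and> F t (?b 1) A = (\<Sum>k<2. ?d k 0 / fact k * (1 - 0) ^ k) + ?d 2 x / fact 2 * (1 - 0) ^ 2"
  proof (rule Taylor_up[of 2 ?d "\<lambda>x. F t (?b x) A" 0 1 0])
    show "\<forall>k x. k < 2 \<and> 0 \<le> x \<and> x \<le> 1 \<longrightarrow> (?d k has_real_derivative ?d (Suc k) x) (at x)"
    proof (intro allI impI, elim conjE)
      fix k :: nat and x :: real assume "k < 2" and x: "0 \<le> x" "x \<le> 1"
      then consider "k = 0" | "k = Suc 0" by linarith
      then show "(?d k has_real_derivative ?d (Suc k) x) (at x)"
        using d0[of x] d1[of x] x by cases auto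
    qed
  qed auto
  then obtain x where x: "0 < x" "x < 1"
    and eq: "F t (?b 1) A = (\<Sum>k<2. ?d k 0 / fact k * (1 - 0) ^ k) + ?d 2 x / fact 2 * (1 - 0) ^ 2" by blast
  have "(\<Sum>k<2. ?d k 0 / fact k * (1 - 0) ^ k) = F t X A + (\<Sum>j\<in>UNIV. \<delta> $ j * vertical_partial T j F t X A)"
    by (simp add: numeral_2_eq_2 bump_zero)
  moreover have "?d 2 x / fact 2 * (1 - 0) ^ 2 =
     (\<Sum>j\<in>UNIV. \<Sum>i\<in>UNIV. vertical_partial T i (vertical_partial T j F) t (?b x) A * (\<delta> $ i * \<delta> $ j)) / 2"
    by (simp add: sum_distrib_left algebra_simps)
  ultimately have "F t (?b 1) A - F t X A = (\<Sum>j\<in>UNIV. \<delta> $ j * vertical_partial T j F t X A) +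
     (\<Sum>j\<in>UNIV. \<Sum>i\<in>UNIV. vertical_partial T i (vertical_partial T j F) t (?b x) A * (\<delta> $ i * \<delta> $ j)) / 2"
    using eq by linarith
  then show ?thesis using x by (intro bexI[of _ x]) auto
qed

end

context
  fixes T :: real and m :: nat and U :: "(real ^ 'd::finite) set" and S :: "(nat \<Rightarrow> real) set"
  assumes T: "0 < T" and U: "open U"
begin

lemma left_continuous_sum:
  "finite I \<Longrightarrow> (\<And>i. i \<in> I \<Longrightarrow> left_continuous T m U S (H i)) \<Longrightarrow> left_continuous T m U S (\<lambda>t X A. \<Sum>i\<in>I. H i t X A)"
proof (induction I rule: finite_induct)
  case empty
  show ?case by (rule left_continuousI[OF T U]) simp
next
  case (insert x I)
  have "left_continuous T m U S (\<lambda>t X A. H x t X A + (\<Sum>i\<in>I. H i t X A))"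
    by (rule left_continuous_combine[OF T U, of _ _ _ _ "\<lambda>x y. x + y"]) (use insert in \<open>auto intro: tendsto_add\<close>)
  then show ?case using insert by simp
qed

lemma left_continuous_mult:
  "left_continuous T m U S H \<Longrightarrow> left_continuous T m U S H' \<Longrightarrow> left_continuous T m U S (\<lambda>t X A. H t X A * H' t X A)"
  by (rule left_continuous_combine[OF T U, of _ _ _ _ "\<lambda>x y. x * y"]) (auto intro: tendsto_mult)

lemma boundedness_preserving_sum:
  "finite I \<Longrightarrow> (\<And>i. i \<in> I \<Longrightarrow> boundedness_preserving T m U S (H i)) \<Longrightarrow>
    boundedness_preserving T m U S (\<lambda>t X A. \<Sum>i\<in>I. H i t X A)"
proof (induction I rule: finite_induct)
  case empty
  show ?case unfolding boundedness_preserving_def by (auto intro!: exI[of _ 0])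
next
  case (insert x I)
  have "boundedness_preserving T m U S (\<lambda>t X A. H x t X A + (\<Sum>i\<in>I. H i t X A))"
    by (rule boundedness_preserving_combine[OF T U, of _ _ _ _ "\<lambda>t x y. x + y" "(+)"]) (use insert in auto)
  then show ?case using insert by simp
qed

lemma boundedness_preserving_mult:
  "boundedness_preserving T m U S H \<Longrightarrow> boundedness_preserving T m U S H' \<Longrightarrow>
    boundedness_preserving T m U S (\<lambda>t X A. H t X A * H' t X A)"
  by (rule boundedness_preserving_combine[OF T U, of _ _ _ _ "\<lambda>t x y. x * y" "(*)"])
     (auto simp: abs_mult intro!: mult_mono)

context
  fixes W :: "'d path" and A :: "real \<Rightarrow> nat \<Rightarrow> real" and a b :: real and Q :: "nat \<Rightarrow> real set"
  assumes A: "A \<in> CBV T m S" and W: "W \<in> cadlag_paths T U" and ab: "0 \<le> a" "b \<le> T"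
    and cont: "continuous_on {a..b} W" and Q: "fine_subdivisions a b Q"
begin

lemma stair_bump_family:
  shows "\<And>n i. i \<in> {s\<in>Q n. s < b} \<times> {0..1::real} \<Longrightarrow> fst i \<in> {0..T}"
    and "\<And>n i. i \<in> {s\<in>Q n. s < b} \<times> {0..1::real} \<Longrightarrow> stair_bump T (Q n) a W i \<in> cadlag_paths T UNIV"
    and "\<forall>\<^sub>F n in sequentially. \<forall>i\<in>{s\<in>Q n. s < b} \<times> {0..1::real}. stair_bump T (Q n) a W i \<in> cadlag_paths T U"
proof -
  note sub = fine_subdivisionsD[OF Q]
  show 1: "\<And>n i. i \<in> {s\<in>Q n. s < b} \<times> {0..1::real} \<Longrightarrow> fst i \<in> {0..T}"
    using subdivision_bounds[OF sub] ab by force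
  show 2: "\<And>n i. i \<in> {s\<in>Q n. s < b} \<times> {0..1::real} \<Longrightarrow> stair_bump T (Q n) a W i \<in> cadlag_paths T UNIV"
  proof -
    fix n i assume i: "i \<in> {s\<in>Q n. s < b} \<times> {0..1::real}"
    obtain s x where ix: "i = (s, x)" "s \<in> Q n" using i by auto
    have "stair (Q n) a W s \<in> cadlag_paths T U" by (rule stair_cadlag[OF sub ab W ix(2)])
    then show "stair_bump T (Q n) a W i \<in> cadlag_paths T UNIV"
      using cadlag_paths_bump 1[OF i] unfolding ix(1) by auto
  qed
  show "\<forall>\<^sub>F n in sequentially. \<forall>i\<in>{s\<in>Q n. s < b} \<times> {0..1::real}. stair_bump T (Q n) a W i \<in> cadlag_paths T U"
    by (rule tracks_paths[OF T U W tracks_stair_bump[OF Q ab cont]]) (fact 1, fact 2)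
qed

lemma stair_bump_bounded:
  assumes H: "boundedness_preserving T m U S H"
  obtains C where "\<forall>\<^sub>F n in sequentially. \<forall>s\<in>{s\<in>Q n. s < b}. \<forall>x\<in>{0..1}. \<bar>H s (stair_bump T (Q n) a W (s, x)) A\<bar> \<le> C"
proof -
  obtain C where "\<forall>\<^sub>F n in sequentially. \<forall>i\<in>{s\<in>Q n. s < b} \<times> {0..1::real}. \<forall>r\<in>{0..T}. \<bar>H r (stair_bump T (Q n) a W i) A\<bar> \<le> C"
    by (rule tracks_bounded[OF T U H A W tracks_stair_bump[OF Q ab cont] stair_bump_family(1,2)])
  then have "\<forall>\<^sub>F n in sequentially. \<forall>s\<in>{s\<in>Q n. s < b}. \<forall>x\<in>{0..1}. \<bar>H s (stair_bump T (Q n) a W (s, x)) A\<bar> \<le> C"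
  proof eventually_elim
    case (elim n)
    show ?case
    proof (intro ballI)
      fix s x :: real assume "s \<in> {s\<in>Q n. s < b}" "x \<in> {0..1}"
      then have *: "(s, x) \<in> {s\<in>Q n. s < b} \<times> {0..1::real}" by blast
      then have "s \<in> {0..T}" using stair_bump_family(1)[OF *] by simp
      with elim * show "\<bar>H s (stair_bump T (Q n) a W (s, x)) A\<bar> \<le> C" by blast
    qed
  qed
  then show ?thesis by (rule that)
qed

text \<open>The bound is uniform in \<open>x\<close>, so it holds for whatever intermediate point
  the mean value theorem selects.\<close>

lemma stair_bump_local:
  assumes H: "left_continuous T m U S H" and r: "r \<in> {a<..b}" and e: "e > 0"
  obtains l where "l < r" "\<forall>\<^sub>F n in sequentially. \<forall>s\<in>{s\<in>Q n. s < b}. \<forall>x\<in>{0..1}. l < s \<and> s \<le> r \<longrightarrow>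
      \<bar>H s (stair_bump T (Q n) a W (s, x)) A - H r W A\<bar> < e"
proof -
  obtain l where l: "l < r" "\<forall>\<^sub>F n in sequentially. \<forall>i\<in>{s\<in>Q n. s < b} \<times> {0..1::real}. l < fst i \<and> fst i \<le> r \<longrightarrow>
      \<bar>H (fst i) (stair_bump T (Q n) a W i) A - H r W A\<bar> < e"
    by (rule left_continuous_tracks[OF T U H A W tracks_stair_bump[OF Q ab cont] stair_bump_family(1,3) cont ab r e])
  from l(2) have "\<forall>\<^sub>F n in sequentially. \<forall>s\<in>{s\<in>Q n. s < b}. \<forall>x\<in>{0..1}. l < s \<and> s \<le> r \<longrightarrow>
      \<bar>H s (stair_bump T (Q n) a W (s, x)) A - H r W A\<bar> < e"
  proof eventually_elim
    case (elim n)
    show ?case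
    proof (intro ballI impI)
      fix s x :: real assume "s \<in> {s\<in>Q n. s < b}" "x \<in> {0..1}" "l < s \<and> s \<le> r"
      then have "(s, x) \<in> {s\<in>Q n. s < b} \<times> {0..1::real}" "l < fst (s, x) \<and> fst (s, x) \<le> r" by auto
      with elim have "\<bar>H (fst (s, x)) (stair_bump T (Q n) a W (s, x)) A - H r W A\<bar> < e" by blast
      then show "\<bar>H s (stair_bump T (Q n) a W (s, x)) A - H r W A\<bar> < e" unfolding fst_conv .
    qed
  qed
  with l(1) show ?thesis by (rule that)
qed

end

end

text \<open>The mean value theorem turns each bump into a gradient times an increment of
  \<open>W\<close>. As these increments are integrals of the densities \<open>d\<close>, the sum
  over all cells becomes one integral with the gradient attached to the left end of the cell, and
  left-continuity of the gradient gives its limit.\<close>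

lemma change_of_variables_bounded_variation:
  fixes G :: "'n::finite functional" and W :: "'n path" and d :: "nat \<Rightarrow> 'n \<Rightarrow> real \<Rightarrow> real"
  assumes T: "0 < T" and G: "C12c_via T m UNIV S G DG" and A: "A \<in> CBV T m S" and W: "W \<in> cadlag_paths T UNIV"
    and ab: "0 \<le> a" "b \<le> T" "a < b" and cont: "continuous_on {a..b} W"
    and d: "\<And>i l. i \<le> m \<Longrightarrow> bdd_measurable a b (d i l)"
    and W_d: "\<And>x y l. a \<le> x \<Longrightarrow> x \<le> y \<Longrightarrow> y \<le> b \<Longrightarrow>
       W y $ l - W x $ l = (\<Sum>i\<le>m. stieltjes_integral x y (d i l) (integrator A i))"
  shows "G b W A - G a W A = (\<Sum>i\<le>m. stieltjes_integral a b (\<lambda>r. DG i r W A) (integrator A i)) +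
     (\<Sum>i\<le>m. stieltjes_integral a b (\<lambda>r. \<Sum>l\<in>UNIV. vertical_partial T l G r W A * d i l r) (integrator A i))"
proof -
  obtain Q where Q: "fine_subdivisions a b Q" using fine_subdivisions_exist[OF ab(3)] .
  note sub = fine_subdivisionsD[OF Q]
  have g: "cont_bv T (integrator A i)" if "i \<le> m" for i using cont_bv_integrator[OF A that] T by simp
  note D = C12c_viaD[OF G]
  note fam = stair_bump_family[OF T open_UNIV A W ab(1,2) cont Q]
  let ?Z = "\<lambda>n. stair_bump T (Q n) a W" and ?\<delta> = "\<lambda>n s. W (nx (Q n) s) - W s"
  have QT: "s \<in> {0..T}" if "s \<in> Q n" for s n using subdivision_bounds[OF sub that] ab by auto
  let ?R = "\<lambda>n s x. G s (?Z n (s, 1)) A - G s (stair (Q n) a W s) A =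
     (\<Sum>l\<in>UNIV. ?\<delta> n s $ l * vertical_partial T l G s (?Z n (s, x)) A)"
  \<comment> \<open>Stated as an implication under the quantifier, so that intermediate points can
    be chosen for all \<open>n\<close> and \<open>s\<close> together.\<close>
  have "\<exists>x\<in>{0..1}. s \<in> Q n \<and> s < b \<longrightarrow> ?R n s x" for n s
  proof (cases "s \<in> Q n \<and> s < b")
    case True
    have "\<exists>x\<in>{0..1}. G s (bump T s (1 *\<^sub>R ?\<delta> n s) (stair (Q n) a W s)) A - G s (stair (Q n) a W s) A =
       (\<Sum>l\<in>UNIV. ?\<delta> n s $ l * vertical_partial T l G s (bump T s (x *\<^sub>R ?\<delta> n s) (stair (Q n) a W s)) A)"
    proof (rule vertical_mean_value[OF T open_UNIV D(4) QT A])
      fix x :: real assume "x \<in> {0..1}"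
      then show "bump T s (x *\<^sub>R ?\<delta> n s) (stair (Q n) a W s) \<in> cadlag_paths T UNIV"
        using fam(2)[of "(s, x)" n] True by simp
    qed (use True in auto)
    then show ?thesis unfolding prod.case by blast
  qed (auto intro: bexI[of _ 0])
  then have "\<forall>n s. \<exists>x. x \<in> {0..1} \<and> (s \<in> Q n \<and> s < b \<longrightarrow> ?R n s x)" by blast
  then obtain \<theta> where \<theta>': "\<forall>n s. \<theta> n s \<in> {0..1} \<and> (s \<in> Q n \<and> s < b \<longrightarrow> ?R n s (\<theta> n s))"
    unfolding choice_iff by blast
  then have \<theta>: "\<And>n s. \<theta> n s \<in> {0..1}"
    and mv: "\<And>n s. s \<in> Q n \<Longrightarrow> s < b \<Longrightarrow> ?R n s (\<theta> n s)" by blast+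
  let ?g = "\<lambda>n s l. vertical_partial T l G s (?Z n (s, \<theta> n s)) A"
  let ?h = "\<lambda>i n u. \<Sum>l\<in>UNIV. ?g n (pre (Q n) u) l * d i l u"
  have dm: "bdd_measurable x y (d i l)" if "a \<le> x" "y \<le> b" "i \<le> m" for x y i l
    by (rule bdd_measurable_subset[OF d[OF that(3)] that(1,2)])
  have hm: "bdd_measurable x y (\<lambda>u. \<Sum>l\<in>UNIV. c l * d i l u)" if "a \<le> x" "y \<le> b" "i \<le> m" for x y i c
    by (intro bdd_measurable_sum bdd_measurable_cmult dm that)
  have sum_eq: "(\<Sum>s\<in>{s\<in>Q n. s < b}. G s (?Z n (s, 1)) A - G s (stair (Q n) a W s) A) =
      (\<Sum>i\<le>m. stieltjes_integral a b (?h i n) (integrator A i))" for n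
  proof -
    have "(\<Sum>s\<in>{s\<in>Q n. s < b}. G s (?Z n (s, 1)) A - G s (stair (Q n) a W s) A) =
       (\<Sum>s\<in>{s\<in>Q n. s < b}. \<Sum>i\<le>m. stieltjes_integral s (nx (Q n) s) (\<lambda>u. \<Sum>l\<in>UNIV. ?g n s l * d i l u) (integrator A i))"
    proof (rule sum.cong[OF refl])
      fix s assume "s \<in> {s\<in>Q n. s < b}"
      then have s: "s \<in> Q n" "s < b" by auto
      let ?s' = "nx (Q n) s"
      note n = nx_props[OF sub s(2), of n] and sb = subdivision_bounds[OF sub s(1)]
      have "(\<Sum>l\<in>UNIV. ?\<delta> n s $ l * ?g n s l) =
          (\<Sum>l\<in>UNIV. \<Sum>i\<le>m. ?g n s l * stieltjes_integral s ?s' (d i l) (integrator A i))"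
        using W_d[of s ?s'] n sb by (intro sum.cong refl) (simp add: sum_distrib_left sum_distrib_right mult.commute)
      also have "\<dots> = (\<Sum>i\<le>m. \<Sum>l\<in>UNIV. ?g n s l * stieltjes_integral s ?s' (d i l) (integrator A i))"
        by (rule sum.swap)
      also have "\<dots> = (\<Sum>i\<le>m. stieltjes_integral s ?s' (\<lambda>u. \<Sum>l\<in>UNIV. ?g n s l * d i l u) (integrator A i))"
      proof (rule sum.cong[OF refl])
        fix i assume i: "i \<in> {..m}"
        have st: "0 \<le> s" "s \<le> ?s'" "?s' \<le> T" using n sb ab by auto
        have i': "i \<le> m" and dms: "bdd_measurable s ?s' (d i l)" for l using i dm n sb by auto
        show "(\<Sum>l\<in>UNIV. ?g n s l * stieltjes_integral s ?s' (d i l) (integrator A i)) =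
           stieltjes_integral s ?s' (\<lambda>u. \<Sum>l\<in>UNIV. ?g n s l * d i l u) (integrator A i)"
          by (simp add: stieltjes_integral_sum[OF g[OF i'] st bdd_measurable_cmult[OF dms]]
              stieltjes_integral_cmult[OF g[OF i'] st dms])
      qed
      finally show "G s (?Z n (s, 1)) A - G s (stair (Q n) a W s) A =
         (\<Sum>i\<le>m. stieltjes_integral s ?s' (\<lambda>u. \<Sum>l\<in>UNIV. ?g n s l * d i l u) (integrator A i))"
        using mv[OF s] by simp
    qed
    also have "\<dots> = (\<Sum>i\<le>m. \<Sum>s\<in>{s\<in>Q n. s < b}. stieltjes_integral s (nx (Q n) s) (\<lambda>u. \<Sum>l\<in>UNIV. ?g n s l * d i l u) (integrator A i))"
      by (rule sum.swap)
    also have "\<dots> = (\<Sum>i\<le>m. stieltjes_integral a b (?h i n) (integrator A i))"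
    proof (rule sum.cong[OF refl])
      fix i assume i: "i \<in> {..m}"
      show "(\<Sum>s\<in>{s\<in>Q n. s < b}. stieltjes_integral s (nx (Q n) s) (\<lambda>u. \<Sum>l\<in>UNIV. ?g n s l * d i l u) (integrator A i)) =
         stieltjes_integral a b (?h i n) (integrator A i)"
        by (rule stieltjes_integral_pieces[OF g ab(1,2) sub, where h = "\<lambda>s u. \<Sum>l\<in>UNIV. ?g n s l * d i l u", symmetric])
           (use i hm nx_props[OF sub] subdivision_bounds[OF sub] in auto)
    qed
    finally show ?thesis .
  qed
  have lim: "(\<lambda>n. stieltjes_integral a b (?h i n) (integrator A i)) \<longlonglongrightarrow>
      stieltjes_integral a b (\<lambda>r. \<Sum>l\<in>UNIV. vertical_partial T l G r W A * d i l r) (integrator A i)" if i: "i \<le> m" for i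
  proof -
    have "\<exists>C. \<forall>\<^sub>F n in sequentially. \<forall>s\<in>{s\<in>Q n. s < b}. \<bar>?g n s l\<bar> \<le> C" for l
    proof -
      obtain C where "\<forall>\<^sub>F n in sequentially. \<forall>s\<in>{s\<in>Q n. s < b}. \<forall>x\<in>{0..1}. \<bar>vertical_partial T l G s (?Z n (s, x)) A\<bar> \<le> C"
        by (rule stair_bump_bounded[OF T open_UNIV A W ab(1,2) cont Q D(7)[of l]])
      then have "\<forall>\<^sub>F n in sequentially. \<forall>s\<in>{s\<in>Q n. s < b}. \<bar>?g n s l\<bar> \<le> C"
        by eventually_elim (use \<theta> in blast)
      then show ?thesis by (rule exI[where x = C])
    qed
    then have "\<forall>l. \<exists>C. \<forall>\<^sub>F n in sequentially. \<forall>s\<in>{s\<in>Q n. s < b}. \<bar>?g n s l\<bar> \<le> C" by (rule allI)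
    from choice[OF this] obtain C where C: "\<forall>l. \<forall>\<^sub>F n in sequentially. \<forall>s\<in>{s\<in>Q n. s < b}. \<bar>?g n s l\<bar> \<le> C l" ..
    have "\<exists>B. \<forall>u\<in>{a<..b}. \<bar>d i l u\<bar> \<le> B" for l using d[OF i] unfolding bdd_measurable_def by blast
    then obtain B where B: "\<And>l u. u \<in> {a<..b} \<Longrightarrow> \<bar>d i l u\<bar> \<le> B l" by metis
    have "\<forall>\<^sub>F n in sequentially. \<forall>l\<in>UNIV. \<forall>s\<in>{s\<in>Q n. s < b}. \<bar>?g n s l\<bar> \<le> C l"
      by (rule eventually_ball_finite[OF finite]) (use C in blast)
    then have bnd: "\<forall>\<^sub>F n in sequentially. bdd_measurable a b (?h i n) \<and> (\<forall>u\<in>{a<..b}. \<bar>?h i n u\<bar> \<le> (\<Sum>l\<in>UNIV. C l * B l))"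
    proof eventually_elim
      case (elim n)
      have "bdd_measurable a b (?h i n)"
        by (rule bdd_measurable_pieces[OF sub, where h = "\<lambda>s u. \<Sum>l\<in>UNIV. ?g n s l * d i l u"])
           (use i hm nx_props[OF sub] subdivision_bounds[OF sub] in auto)
      moreover have "\<bar>?h i n u\<bar> \<le> (\<Sum>l\<in>UNIV. C l * B l)" if u: "u \<in> {a<..b}" for u
      proof (rule order_trans[OF sum_abs sum_mono])
        fix l
        have "pre (Q n) u \<in> {s\<in>Q n. s < b}" using pre_props[OF sub, of u] le_nx_pre[OF sub, of u] u by auto
        then have "\<bar>?g n (pre (Q n) u) l\<bar> \<le> C l" using elim by blast
        then show "\<bar>?g n (pre (Q n) u) l * d i l u\<bar> \<le> C l * B l"
          using B[OF u, of l] unfolding abs_mult by (intro mult_mono) auto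
      qed
      ultimately show ?case by blast
    qed
    have pw: "(\<lambda>n. ?g n (pre (Q n) u) l) \<longlonglongrightarrow> vertical_partial T l G u W A" if u: "u \<in> {a<..b}" for u l
    proof (rule tendstoI)
      fix e :: real assume e: "e > 0"
      obtain l0 where l0: "l0 < u" "\<forall>\<^sub>F n in sequentially. \<forall>s\<in>{s\<in>Q n. s < b}. \<forall>x\<in>{0..1}. l0 < s \<and> s \<le> u \<longrightarrow>
        \<bar>vertical_partial T l G s (?Z n (s, x)) A - vertical_partial T l G u W A\<bar> < e"
        by (rule stair_bump_local[OF T open_UNIV A W ab(1,2) cont Q D(6)[of l] u e])
      have "\<forall>\<^sub>F n in sequentially. l0 < pre (Q n) u"
        by (rule order_tendstoD(1)[OF pre_tendsto[OF Q] l0(1)]) (use u in auto)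
      with l0(2) show "\<forall>\<^sub>F n in sequentially. dist (?g n (pre (Q n) u) l) (vertical_partial T l G u W A) < e"
      proof eventually_elim
        case (elim n)
        have "pre (Q n) u \<in> {s\<in>Q n. s < b}" "pre (Q n) u \<le> u"
          using pre_props[OF sub, of u n] le_nx_pre[OF sub, of u n] u by auto
        then show ?case using elim \<theta> unfolding dist_real_def by blast
      qed
    qed
    have vm: "bdd_measurable a b (\<lambda>r. vertical_partial T l G r W A)" for l
      by (rule bdd_measurable_subset[OF bdd_measurable_vertical_partial(1)[OF T open_UNIV W G A ab(2)] ab(1) order_refl])
    show ?thesis
    proof (rule stieltjes_integral_dominated_convergence'[OF g[OF i] ab(1) _ ab(2) bnd])
      show "bdd_measurable a b (\<lambda>r. \<Sum>l\<in>UNIV. vertical_partial T l G r W A * d i l r)"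
        by (intro bdd_measurable_sum bdd_measurable_mult vm d i)
      fix u assume "u \<in> {a<..b}"
      then show "(\<lambda>n. ?h i n u) \<longlonglongrightarrow> (\<Sum>l\<in>UNIV. vertical_partial T l G u W A * d i l u)"
        by (intro tendsto_sum tendsto_mult pw tendsto_const)
    qed (use ab in auto)
  qed
  have "(\<lambda>n. \<Sum>i\<le>m. stieltjes_integral a b (?h i n) (integrator A i)) \<longlonglongrightarrow>
      (\<Sum>i\<le>m. stieltjes_integral a b (\<lambda>r. \<Sum>l\<in>UNIV. vertical_partial T l G r W A * d i l r) (integrator A i))"
    by (intro tendsto_sum lim) auto
  moreover have "(\<lambda>n. \<Sum>i\<le>m. stieltjes_integral a b (?h i n) (integrator A i)) \<longlonglongrightarrow>
      G b W A - G a W A - (\<Sum>i\<le>m. stieltjes_integral a b (\<lambda>r. DG i r W A) (integrator A i))"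
    using discrete_change_of_variables[OF T open_UNIV G A W ab(1,2) cont Q] unfolding sum_eq .
  ultimately show ?thesis using LIMSEQ_unique by fastforce
qed

section \<open>The functional Ito formula\<close>

text \<open>Each bump of the staircase is expanded to second order. The bumps add up to a convergent
  sum by the discrete change of variables, and the second-order terms converge by the comparison of
  weighted sums; so what remains, the sum of gradients times increments, converges as well.
  \<open>v i j\<close> stands for the quadratic variation of \<open>X_i + X_j\<close>; in particular
  \<open>v i i\<close> belongs to \<open>2 * X_i\<close>, whence the quarters in the covariation
  \<open>c i j\<close>.\<close>

theorem functional_ito_formula:
  fixes F :: "'d::finite functional" and X :: "'d path" and v :: "'d \<Rightarrow> 'd \<Rightarrow> real \<Rightarrow> real"
  assumes T: "0 < T" and U: "open U" and F: "C12c_via T m U S F DF" and A: "A \<in> CBV T m S"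
    and X: "X \<in> cadlag_paths T U" and t: "0 < t" "t \<le> T" and cont: "continuous_on {0..t} X" and Q: "fine_subdivisions 0 t Q"
    and v: "\<And>i j x. x \<in> {0..t} \<Longrightarrow> (\<lambda>n. \<Sum>s\<in>{s\<in>{s\<in>Q n. s < t}. s \<le> x}.
         ((X (nx (Q n) s) - X s) $ i + (X (nx (Q n) s) - X s) $ j)\<^sup>2) \<longlonglongrightarrow> v i j x"
    and v_cont: "\<And>i j. continuous_on {0..t} (v i j)" and v_mono: "\<And>i j x y. 0 \<le> x \<Longrightarrow> x \<le> y \<Longrightarrow> y \<le> t \<Longrightarrow> v i j x \<le> v i j y"
    and v0: "\<And>i j. v i j 0 = 0"
    and c: "\<And>i j. cont_bv T (c i j)" "\<And>i j x. x \<in> {0..t} \<Longrightarrow> c i j x = (v i j x - v i i x / 4 - v j j x / 4) / 2"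
  shows "(\<lambda>n. \<Sum>s\<in>{s\<in>Q n. s < t}. vertical_gradient T F s (stair (Q n) 0 X s) A \<bullet> (X (nx (Q n) s) - X s)) \<longlonglongrightarrow>
      F t X A - F 0 X A - (\<Sum>i\<le>m. stieltjes_integral 0 t (\<lambda>r. DF i r X A) (integrator A i))
      - (\<Sum>j\<in>UNIV. \<Sum>i\<in>UNIV. stieltjes_integral 0 t (\<lambda>r. vertical_partial T i (vertical_partial T j F) r X A) (c i j)) / 2"
proof -
  note sub = fine_subdivisionsD[OF Q]
  note D = C12c_viaD[OF F]
  note fam = stair_bump_family[OF T U A X order_refl t(2) cont Q]
  let ?Z = "\<lambda>n. stair_bump T (Q n) 0 X" and ?\<delta> = "\<lambda>n s. X (nx (Q n) s) - X s"
  let ?I = "\<lambda>n. {s\<in>Q n. s < t}"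
  let ?H = "\<lambda>i j. vertical_partial T i (vertical_partial T j F)"
  have QT: "s \<in> {0..T}" if "s \<in> Q n" for s n using subdivision_bounds[OF sub that] t by auto
  have I: "finite (?I n)" "?I n \<subseteq> {0..t}" for n using subdivision_finite[OF sub] subdivision_bounds[OF sub] by auto
  \<comment> \<open>The bumped paths lie in \<open>U\<close> only for large \<open>n\<close>, and
    Taylor's theorem is invoked only for those.\<close>
  let ?ok = "\<lambda>n. \<forall>i\<in>?I n \<times> {0..1::real}. ?Z n i \<in> cadlag_paths T U"
  let ?R = "\<lambda>n s x. F s (?Z n (s, 1)) A - F s (stair (Q n) 0 X s) A =
     (\<Sum>j\<in>UNIV. ?\<delta> n s $ j * vertical_partial T j F s (stair (Q n) 0 X s) A) +
     (\<Sum>j\<in>UNIV. \<Sum>i\<in>UNIV. ?H i j s (?Z n (s, x)) A * (?\<delta> n s $ i * ?\<delta> n s $ j)) / 2"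
  have "\<exists>x\<in>{0..1}. ?ok n \<and> s \<in> Q n \<and> s < t \<longrightarrow> ?R n s x" for n s
  proof (cases "?ok n \<and> s \<in> Q n \<and> s < t")
    case True
    have "\<exists>x\<in>{0..1}. F s (bump T s (1 *\<^sub>R ?\<delta> n s) (stair (Q n) 0 X s)) A - F s (stair (Q n) 0 X s) A =
       (\<Sum>j\<in>UNIV. ?\<delta> n s $ j * vertical_partial T j F s (stair (Q n) 0 X s) A) +
       (\<Sum>j\<in>UNIV. \<Sum>i\<in>UNIV. ?H i j s (bump T s (x *\<^sub>R ?\<delta> n s) (stair (Q n) 0 X s)) A * (?\<delta> n s $ i * ?\<delta> n s $ j)) / 2"
    proof (rule vertical_taylor[OF T U D(4,5) QT A])
      fix x :: real assume "x \<in> {0..1}"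
      then have "(s, x) \<in> ?I n \<times> {0..1::real}" using True by blast
      with True have "?Z n (s, x) \<in> cadlag_paths T U" by blast
      then show "bump T s (x *\<^sub>R ?\<delta> n s) (stair (Q n) 0 X s) \<in> cadlag_paths T U" by simp
    qed (use True in auto)
    then show ?thesis unfolding prod.case by blast
  qed (auto intro: bexI[of _ 0])
  then have "\<forall>n s. \<exists>x. x\<in>{0..1} \<and> (?ok n \<and> s \<in> Q n \<and> s < t \<longrightarrow> ?R n s x)" by blast
  then obtain \<theta> where \<theta>': "\<forall>n s. \<theta> n s \<in> {0..1} \<and> (?ok n \<and> s \<in> Q n \<and> s < t \<longrightarrow> ?R n s (\<theta> n s))"
    unfolding choice_iff by blast
  then have \<theta>: "\<theta> n s \<in> {0..1}" for n s by blast
  let ?g = "\<lambda>i j n s. ?H i j s (?Z n (s, \<theta> n s)) A"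
  have quad: "(\<lambda>n. \<Sum>s\<in>?I n. ?g i j n s * (?\<delta> n s $ i * ?\<delta> n s $ j)) \<longlonglongrightarrow>
      stieltjes_integral 0 t (\<lambda>r. ?H i j r X A) (c i j)" for i j
  proof -
    have Hna: "non_anticipative T m U S (?H i j)"
      by (intro non_anticipative_vertical_partial[OF T U] D(2))
    obtain C1 where C1: "\<forall>\<^sub>F n in sequentially. \<forall>s\<in>?I n. \<forall>x\<in>{0..1}. \<bar>?H i j s (?Z n (s, x)) A\<bar> \<le> C1"
      by (rule stair_bump_bounded[OF T U A X order_refl t(2) cont Q D(9)[of i j]])
    obtain K where K: "compact K" "K \<subseteq> U" "X \<in> cadlag_paths T K" using cadlag_paths_compact[OF X U] .
    obtain C2 where C2: "\<And>r. r \<in> {0..T} \<Longrightarrow> \<bar>?H i j r X A\<bar> \<le> C2"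
      using boundedness_preservingD[OF T U D(9)[of i j] A K(1,2)] K(3) by metis
    have lc: "(\<lambda>n. ?H i j (x n) X A) \<longlonglongrightarrow> ?H i j u X A" if "u \<in> {0<..t}" "\<And>n. x n \<in> {0..u}" "x \<longlonglongrightarrow> u" for x u
      by (rule left_limit_continuous_path[OF T U D(8) Hna A X cont order_refl t(2) that])
    \<comment> \<open>Squares of increments of \<open>X_k + X_l\<close> are nonnegative weights,
      unlike products of different components, and so are the increments of the nondecreasing
      \<open>v k l\<close>; both have the limit distribution function \<open>v k l\<close>.\<close>
    have key: "(\<lambda>n. (\<Sum>s\<in>?I n. ?g i j n s * (?\<delta> n s $ k + ?\<delta> n s $ l)\<^sup>2) -
        (\<Sum>s\<in>?I n. ?H i j s X A * (v k l (nx (Q n) s) - v k l s))) \<longlonglongrightarrow> 0" for k l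
    proof (rule weighted_sums_limit[OF t(1) I, where f = "\<lambda>r. ?H i j r X A" and m = "v k l" and C = "max C1 C2"])
      show "0 \<le> v k l (nx (Q n) s) - v k l s" if "s \<in> ?I n" for n s
        using v_mono[of s "nx (Q n) s" k l] that nx_props[OF sub, of s n] subdivision_bounds[OF sub, of s n] by auto
      show "(\<lambda>n. \<Sum>s\<in>{s\<in>?I n. s \<le> x}. v k l (nx (Q n) s) - v k l s) \<longlonglongrightarrow> v k l x" if "x \<in> {0..t}" for x
        using increment_distribution_tendsto[OF Q v_cont that, of k l] v0 by simp
      fix r e :: real assume r: "r \<in> {0<..t}" and e: "e > 0"
      obtain l1 where l1: "l1 < r" "\<forall>\<^sub>F n in sequentially. \<forall>s\<in>?I n. \<forall>x\<in>{0..1}. l1 < s \<and> s \<le> r \<longrightarrow>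
        \<bar>?H i j s (?Z n (s, x)) A - ?H i j r X A\<bar> < e"
        by (rule stair_bump_local[OF T U A X order_refl t(2) cont Q D(8)[of i j] r e])
      obtain l2 where l2: "l2 < r" "\<forall>\<^sub>F n in sequentially. \<forall>s\<in>?I n. l2 < s \<and> s \<le> r \<longrightarrow> \<bar>?H i j s (stop s X) A - ?H i j r X A\<bar> < e"
      proof (rule left_continuous_tracks[OF T U D(8)[of i j] A X tracks_stop[of T ?I "\<lambda>s. s"] _ _ cont order_refl t(2) r e])
        show "\<forall>\<^sub>F n in sequentially. \<forall>s\<in>?I n. stop s X \<in> cadlag_paths T U"
          by (intro always_eventually allI ballI cadlag_paths_stop[OF X]) (use QT in auto)
        fix l assume "l < r" "\<forall>\<^sub>F n in sequentially. \<forall>s\<in>?I n. l < s \<and> s \<le> r \<longrightarrow> \<bar>?H i j s (stop s X) A - ?H i j r X A\<bar> < e"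
        then show thesis by (rule that)
      qed (use QT in auto)
      have "\<forall>\<^sub>F n in sequentially. \<forall>s\<in>?I n. max l1 l2 < s \<and> s \<le> r \<longrightarrow>
          \<bar>?g i j n s - ?H i j r X A\<bar> < e \<and> \<bar>?H i j s X A - ?H i j r X A\<bar> < e"
        using l1(2) l2(2)
      proof eventually_elim
        case (elim n)
        show ?case
        proof (intro ballI impI)
          fix s assume s: "s \<in> ?I n" "max l1 l2 < s \<and> s \<le> r"
          have "s \<in> Q n" using s by simp
          then have "?H i j s (stop s X) A = ?H i j s X A"
            by (intro non_anticipative_stop[OF T U Hna QT _ X A]) (use QT in auto)
          moreover have "\<bar>?H i j s (stop s X) A - ?H i j r X A\<bar> < e" using elim(2) s by auto
          moreover have "l1 < s \<and> s \<le> r" using s by simp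
          then have "\<bar>?g i j n s - ?H i j r X A\<bar> < e" using elim(1) s(1) \<theta> by blast
          ultimately show "\<bar>?g i j n s - ?H i j r X A\<bar> < e \<and> \<bar>?H i j s X A - ?H i j r X A\<bar> < e" by simp
        qed
      qed
      then show "\<exists>l<r. \<forall>\<^sub>F n in sequentially. \<forall>s\<in>?I n. l < s \<and> s \<le> r \<longrightarrow>
          \<bar>?g i j n s - ?H i j r X A\<bar> < e \<and> \<bar>?H i j s X A - ?H i j r X A\<bar> < e"
        using l1(1) l2(1) by (intro exI[of _ "max l1 l2"]) auto
    next
      show "\<forall>\<^sub>F n in sequentially. \<forall>s\<in>?I n. \<bar>?g i j n s\<bar> \<le> max C1 C2 \<and> \<bar>?H i j s X A\<bar> \<le> max C1 C2"
        using C1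
      proof eventually_elim
        case (elim n)
        show ?case
        proof
          fix s assume s: "s \<in> ?I n"
          have "\<bar>?g i j n s\<bar> \<le> C1" using elim s \<theta> by blast
          moreover have "\<bar>?H i j s X A\<bar> \<le> C2" using s QT by (intro C2) auto
          ultimately show "\<bar>?g i j n s\<bar> \<le> max C1 C2 \<and> \<bar>?H i j s X A\<bar> \<le> max C1 C2" by linarith
        qed
      qed
    qed (use v v_cont v_mono v0 in auto)
    \<comment> \<open>Polarization in the form
      \<open>x * y = ((x + y)^2 - (x + x)^2 / 4 - (y + y)^2 / 4) / 2\<close>, all of whose squares
      are covered by \<open>key\<close>.\<close>
    have 1: "(\<Sum>s\<in>?I n. ?g i j n s * (?\<delta> n s $ i * ?\<delta> n s $ j)) =
       ((\<Sum>s\<in>?I n. ?g i j n s * (?\<delta> n s $ i + ?\<delta> n s $ j)\<^sup>2) - (\<Sum>s\<in>?I n. ?g i j n s * (?\<delta> n s $ i + ?\<delta> n s $ i)\<^sup>2) / 4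
         - (\<Sum>s\<in>?I n. ?g i j n s * (?\<delta> n s $ j + ?\<delta> n s $ j)\<^sup>2) / 4) / 2" for n
      unfolding sum_divide_distrib sum_subtractf[symmetric]
      by (rule sum.cong[OF refl]) (simp add: power2_eq_square field_simps)
    have 2: "(\<Sum>s\<in>?I n. ?H i j s X A * (c i j (nx (Q n) s) - c i j s)) =
       ((\<Sum>s\<in>?I n. ?H i j s X A * (v i j (nx (Q n) s) - v i j s)) - (\<Sum>s\<in>?I n. ?H i j s X A * (v i i (nx (Q n) s) - v i i s)) / 4
         - (\<Sum>s\<in>?I n. ?H i j s X A * (v j j (nx (Q n) s) - v j j s)) / 4) / 2" for n
      unfolding sum_divide_distrib sum_subtractf[symmetric]
    proof (rule sum.cong[OF refl])
      fix s assume s: "s \<in> ?I n"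
      have "s \<in> {0..t}" "nx (Q n) s \<in> {0..t}" using s nx_props[OF sub, of s n] subdivision_bounds[OF sub, of s n] by auto
      note cs = c(2)[OF this(1), of i j] c(2)[OF this(2), of i j]
      show "?H i j s X A * (c i j (nx (Q n) s) - c i j s) =
         (?H i j s X A * (v i j (nx (Q n) s) - v i j s) - ?H i j s X A * (v i i (nx (Q n) s) - v i i s) / 4
         - ?H i j s X A * (v j j (nx (Q n) s) - v j j s) / 4) / 2"
        unfolding cs by (simp add: field_simps)
    qed
    have alg: "((a - b) - (c - d) / 4 - (e - f) / 4) / 2 = (a - c / 4 - e / 4) / 2 - (b - d / 4 - f / 4) / 2" for a b c d e f :: real
      by (simp add: field_simps)
    have lim1: "(\<lambda>n. (\<Sum>s\<in>?I n. ?g i j n s * (?\<delta> n s $ i * ?\<delta> n s $ j)) - (\<Sum>s\<in>?I n. ?H i j s X A * (c i j (nx (Q n) s) - c i j s)))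
       \<longlonglongrightarrow> (0 - 0 / 4 - 0 / 4) / 2"
    proof (rule Lim_transform_eventually[OF tendsto_divide[OF tendsto_diff[OF tendsto_diff[OF key[of i j] tendsto_divide[OF key[of i i] tendsto_const[of 4]]]
          tendsto_divide[OF key[of j j] tendsto_const[of 4]]] tendsto_const[of 2]]])
    qed (simp, simp, simp, unfold 1 2, rule always_eventually, rule allI, rule alg)
    have lim2: "(\<lambda>n. \<Sum>s\<in>?I n. ?H i j s X A * (c i j (nx (Q n) s) - c i j s)) \<longlonglongrightarrow> stieltjes_integral 0 t (\<lambda>r. ?H i j r X A) (c i j)"
      by (rule riemann_sums_tendsto(2)[OF c(1) t Q lc, where C = C2]) (use C2 t in auto)
    from tendsto_add[OF lim1 lim2] show ?thesis by (simp only: diff_add_cancel div_0 diff_0_right add_0_left)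
  qed
  let ?L = "F t X A - F 0 X A - (\<Sum>i\<le>m. stieltjes_integral 0 t (\<lambda>r. DF i r X A) (integrator A i))"
  let ?q = "\<lambda>n. (\<Sum>j\<in>UNIV. \<Sum>i\<in>UNIV. \<Sum>s\<in>?I n. ?g i j n s * (?\<delta> n s $ i * ?\<delta> n s $ j)) / 2"
  have "(\<lambda>n. (\<Sum>s\<in>?I n. F s (?Z n (s, 1)) A - F s (stair (Q n) 0 X s) A) - ?q n) \<longlonglongrightarrow>
     ?L - (\<Sum>j\<in>UNIV. \<Sum>i\<in>UNIV. stieltjes_integral 0 t (\<lambda>r. ?H i j r X A) (c i j)) / 2"
    by (intro tendsto_diff tendsto_divide tendsto_sum quad tendsto_const discrete_change_of_variables[OF T U F A X order_refl t(2) cont Q]) auto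
  then show ?thesis
  proof (rule Lim_transform_eventually)
    show "\<forall>\<^sub>F n in sequentially. (\<Sum>s\<in>?I n. F s (?Z n (s, 1)) A - F s (stair (Q n) 0 X s) A) - ?q n =
       (\<Sum>s\<in>?I n. vertical_gradient T F s (stair (Q n) 0 X s) A \<bullet> ?\<delta> n s)"
      using fam(3)
    proof eventually_elim
      case (elim n)
      have "(\<Sum>s\<in>?I n. F s (?Z n (s, 1)) A - F s (stair (Q n) 0 X s) A) =
         (\<Sum>s\<in>?I n. vertical_gradient T F s (stair (Q n) 0 X s) A \<bullet> ?\<delta> n s +
            (\<Sum>j\<in>UNIV. \<Sum>i\<in>UNIV. ?g i j n s * (?\<delta> n s $ i * ?\<delta> n s $ j)) / 2)"
      proof (rule sum.cong[OF refl])
        fix s assume "s \<in> ?I n"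
        then have "F s (?Z n (s, 1)) A - F s (stair (Q n) 0 X s) A =
           (\<Sum>j\<in>UNIV. ?\<delta> n s $ j * vertical_partial T j F s (stair (Q n) 0 X s) A) +
           (\<Sum>j\<in>UNIV. \<Sum>i\<in>UNIV. ?g i j n s * (?\<delta> n s $ i * ?\<delta> n s $ j)) / 2"
          using \<theta>' elim by blast
        then show "F s (?Z n (s, 1)) A - F s (stair (Q n) 0 X s) A = vertical_gradient T F s (stair (Q n) 0 X s) A \<bullet> ?\<delta> n s +
            (\<Sum>j\<in>UNIV. \<Sum>i\<in>UNIV. ?g i j n s * (?\<delta> n s $ i * ?\<delta> n s $ j)) / 2"
          by (simp add: inner_vec_def vertical_gradient_def mult.commute)
      qed
      also have "\<dots> = (\<Sum>s\<in>?I n. vertical_gradient T F s (stair (Q n) 0 X s) A \<bullet> ?\<delta> n s) +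
            (\<Sum>s\<in>?I n. \<Sum>j\<in>UNIV. \<Sum>i\<in>UNIV. ?g i j n s * (?\<delta> n s $ i * ?\<delta> n s $ j)) / 2"
        by (simp add: sum.distrib sum_divide_distrib)
      also have "(\<Sum>s\<in>?I n. \<Sum>j\<in>UNIV. \<Sum>i\<in>UNIV. ?g i j n s * (?\<delta> n s $ i * ?\<delta> n s $ j)) =
         (\<Sum>j\<in>UNIV. \<Sum>i\<in>UNIV. \<Sum>s\<in>?I n. ?g i j n s * (?\<delta> n s $ i * ?\<delta> n s $ j))"
        by (subst sum.swap) (intro sum.cong refl sum.swap)
      finally show ?case by simp
    qed
  qed
qed

section \<open>Composition of functionals\<close>

lemma vertical_partial_eqI:
  assumes "((\<lambda>v. K t (bump T t v X) A) has_derivative D) (at 0)"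
  shows "vertical_partial T i K t X A = D (axis i 1)"
  using frechet_derivative_at[OF assms] unfolding vertical_partial_def by simp

lemma sum_axis: "(\<Sum>j\<in>UNIV. axis i 1 $ j * c j) = (c (i :: 'a :: finite) :: real)"
proof -
  have "(\<Sum>j\<in>UNIV. axis i 1 $ j * c j) = (\<Sum>j\<in>UNIV. if j = i then c j else 0)"
    by (rule sum.cong) (auto simp: axis_def)
  then show ?thesis by simp
qed

context
  fixes T :: real and m :: nat and U :: "(real ^ 'd::finite) set" and S :: "(nat \<Rightarrow> real) set"
    and F :: "'n::finite \<Rightarrow> 'd functional" and DF :: "'n \<Rightarrow> nat \<Rightarrow> 'd functional"
  assumes T: "0 < T" and U: "open U" and F: "\<And>l. C12c_via T m U S (F l) (DF l)"
begin

text \<open>\<open>H\<close> sees its path only up to \<open>t\<close>, and up to \<open>t\<close> a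
  bump of \<open>X\<close> at \<open>t\<close> changes the path of values only at \<open>t\<close>
  itself.\<close>

lemma functional_path_bump:
  assumes H: "non_anticipative T m UNIV S H" and t: "t \<in> {0..T}" and X: "X \<in> cadlag_paths T U" and A: "A \<in> CBV T m S"
    and b: "bump T t v X \<in> cadlag_paths T U"
  shows "H t (functional_path F (bump T t v X) A) A =
    H t (bump T t (functional_path F (bump T t v X) A t - functional_path F X A t) (functional_path F X A)) A"
proof (rule non_anticipative_cong[OF T open_UNIV H t _ _ _ A A])
  note cad = functional_path_cadlag[where F = F, OF T U F]
  show "functional_path F (bump T t v X) A \<in> cadlag_paths T UNIV" by (rule cad[OF b A])
  show "bump T t (functional_path F (bump T t v X) A t - functional_path F X A t) (functional_path F X A) \<in> cadlag_paths T UNIV"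
    by (rule cadlag_paths_bump[OF cad[OF X A]]) (use t in auto)
  fix u assume u: "u \<in> {0..t}"
  show "functional_path F (bump T t v X) A u =
     bump T t (functional_path F (bump T t v X) A t - functional_path F X A t) (functional_path F X A) u"
  proof (cases "u = t")
    case True
    then show ?thesis using t by (simp add: bump_def)
  next
    case False
    have "F l u (bump T t v X) A = F l u X A" for l
      by (rule non_anticipative_cong[OF T U C12c_viaD(2)[OF F] _ b X _ A A]) (use u t False in \<open>auto simp: bump_def\<close>)
    then show ?thesis using u False by (simp add: bump_def functional_path_def)
  qed
qed auto

text \<open>Because only the value at time \<open>t\<close> moves, the inner map reduces to the
  finite-dimensional displacement \<open>w v\<close> of that value, and the ordinary chain rule
  applies.\<close>

lemma functional_path_has_derivative:
  assumes H: "non_anticipative T m UNIV S H" "vertically_differentiable T m UNIV S H"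
    and t: "t \<in> {0..T}" and X: "X \<in> cadlag_paths T U" and A: "A \<in> CBV T m S"
  shows "((\<lambda>v. H t (functional_path F (bump T t v X) A) A) has_derivative
    (\<lambda>h. \<Sum>l\<in>UNIV. (\<Sum>j\<in>UNIV. h $ j * vertical_partial T j (F l) t X A) * vertical_partial T l H t (functional_path F X A) A)) (at 0)"
proof -
  note cad = functional_path_cadlag[where F = F, OF T U F]
  define w where "w v = functional_path F (bump T t v X) A t - functional_path F X A t" for v
  define D where "D h = (\<chi> l. \<Sum>j\<in>UNIV. h $ j * vertical_partial T j (F l) t X A)" for h
  have "((\<lambda>v. F l t (bump T t v X) A - F l t X A) has_derivative (\<lambda>h. \<Sum>j\<in>UNIV. h $ j * vertical_partial T j (F l) t X A)) (at 0)" for l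
    using has_derivative_add_const[OF vertical_has_derivative[OF T U C12c_viaD(4)[OF F] t A, of 0 X l], of "- F l t X A"] X
    by (simp add: bump_zero)
  then have w: "(w has_derivative D) (at 0)"
    unfolding has_derivative_componentwise_within[of w] Basis_vec_def
    by (auto simp: inner_axis w_def D_def functional_path_def)
  have w0: "w 0 = 0" by (simp add: w_def bump_zero)
  have "((\<lambda>y. H t (bump T t y (functional_path F X A)) A) has_derivative
      (\<lambda>h. \<Sum>l\<in>UNIV. h $ l * vertical_partial T l H t (functional_path F X A) A)) (at (w 0))"
    using vertical_has_derivative[OF T open_UNIV H(2) t A, of 0 "functional_path F X A"] cad[OF X A]
    by (simp add: bump_zero w0)
  from has_derivative_compose[OF w this]
  have "((\<lambda>v. H t (bump T t (w v) (functional_path F X A)) A) has_derivative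
     (\<lambda>h. \<Sum>l\<in>UNIV. D h $ l * vertical_partial T l H t (functional_path F X A) A)) (at 0)" .
  then have "((\<lambda>v. H t (functional_path F (bump T t v X) A) A) has_derivative
     (\<lambda>h. \<Sum>l\<in>UNIV. D h $ l * vertical_partial T l H t (functional_path F X A) A)) (at 0)"
  proof (rule has_derivative_transform_eventually)
    have eq: "H t (bump T t (w v) (functional_path F X A)) A = H t (functional_path F (bump T t v X) A) A"
      if "bump T t v X \<in> cadlag_paths T U" for v
      unfolding w_def by (rule functional_path_bump[OF H(1) t X A that, symmetric])
    have "\<forall>\<^sub>F v in nhds 0. bump T t v X \<in> cadlag_paths T U" using cadlag_paths_bump_small[OF X U] t by auto
    then have "\<forall>\<^sub>F v in at 0. bump T t v X \<in> cadlag_paths T U" by (simp add: eventually_nhds_conv_at)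
    then show "\<forall>\<^sub>F v in at 0. H t (bump T t (w v) (functional_path F X A)) A = H t (functional_path F (bump T t v X) A) A"
      by eventually_elim (rule eq)
    show "H t (bump T t (w 0) (functional_path F X A)) A = H t (functional_path F (bump T t 0 X) A) A"
      by (rule eq) (simp add: bump_zero X)
  qed simp
  then show ?thesis by (simp add: D_def)
qed

lemma left_continuous_functional_path:
  assumes H: "left_continuous T m UNIV S H"
  shows "left_continuous T m U S (\<lambda>t X A. H t (functional_path F X A) A)"
proof (rule left_continuousI[OF T U])
  fix t X A s and Y :: "nat \<Rightarrow> 'd path"
  assume *: "t \<in> {0<..T}" "X \<in> cadlag_paths T U" "A \<in> CBV T m S" "\<And>n. Y n \<in> cadlag_paths T U" "\<And>n. s n \<in> {0..t}" "s \<longlonglongrightarrow> t"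
     "uniform_limit {0..T} (\<lambda>n. stop (s n) (Y n)) (stop t X) sequentially"
  note cad = functional_path_cadlag[where F = F, OF T U F]
  have "uniform_limit {0..T} (\<lambda>n. stop (s n) (functional_path F (Y n) A)) (stop t (functional_path F X A)) sequentially"
    by (rule functional_path_left_limit[where F = F, OF T U F *(1-3) _ *(5-7)]) (use * in auto)
  then show "(\<lambda>n. H (s n) (functional_path F (Y n) A) A) \<longlonglongrightarrow> H t (functional_path F X A) A"
    by (intro left_continuousD[OF T open_UNIV H *(1) cad[OF *(2,3)] *(3) _ *(5,6)]) (use cad[OF *(4,3)] in auto)
qed

context
  fixes G :: "'n functional" and DG :: "nat \<Rightarrow> 'n functional"
  assumes G: "C12c_via T m UNIV S G DG"
begin

lemma vertical_partial_compose:
  assumes t: "t \<in> {0..T}" and X: "X \<in> cadlag_paths T U" and A: "A \<in> CBV T m S"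
  shows "vertical_partial T j (\<lambda>t X A. G t (functional_path F X A) A) t X A =
    (\<Sum>l\<in>UNIV. vertical_partial T j (F l) t X A * vertical_partial T l G t (functional_path F X A) A)"
  using vertical_partial_eqI[where K = "\<lambda>t X A. G t (functional_path F X A) A", OF functional_path_has_derivative[OF C12c_viaD(2,4)[OF G] t X A], of j]
  by (simp add: sum_axis)

lemma vertical_partial_compose_has_derivative:
  assumes t: "t \<in> {0..T}" and X: "X \<in> cadlag_paths T U" and A: "A \<in> CBV T m S"
  shows "((\<lambda>v. vertical_partial T j (\<lambda>t X A. G t (functional_path F X A) A) t (bump T t v X) A) has_derivative
    (\<lambda>h. \<Sum>l\<in>UNIV. vertical_partial T j (F l) t X A * (\<Sum>k\<in>UNIV. (\<Sum>i\<in>UNIV. h $ i * vertical_partial T i (F k) t X A)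
         * vertical_partial T k (vertical_partial T l G) t (functional_path F X A) A)
       + (\<Sum>i\<in>UNIV. h $ i * vertical_partial T i (vertical_partial T j (F l)) t X A) * vertical_partial T l G t (functional_path F X A) A)) (at 0)"
proof -
  have "((\<lambda>v. \<Sum>l\<in>UNIV. vertical_partial T j (F l) t (bump T t v X) A * vertical_partial T l G t (functional_path F (bump T t v X) A) A)
    has_derivative
    (\<lambda>h. \<Sum>l\<in>UNIV. vertical_partial T j (F l) t X A * (\<Sum>k\<in>UNIV. (\<Sum>i\<in>UNIV. h $ i * vertical_partial T i (F k) t X A)
         * vertical_partial T k (vertical_partial T l G) t (functional_path F X A) A)
       + (\<Sum>i\<in>UNIV. h $ i * vertical_partial T i (vertical_partial T j (F l)) t X A) * vertical_partial T l G t (functional_path F X A) A)) (at 0)"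
  proof (rule has_derivative_sum)
    fix l
    have 1: "((\<lambda>v. vertical_partial T j (F l) t (bump T t v X) A) has_derivative
       (\<lambda>h. \<Sum>i\<in>UNIV. h $ i * vertical_partial T i (vertical_partial T j (F l)) t X A)) (at 0)"
      using vertical_has_derivative[OF T U C12c_viaD(5)[OF F] t A, of 0 X j l] X by (simp add: bump_zero)
    have 2: "((\<lambda>v. vertical_partial T l G t (functional_path F (bump T t v X) A) A) has_derivative
       (\<lambda>h. \<Sum>k\<in>UNIV. (\<Sum>i\<in>UNIV. h $ i * vertical_partial T i (F k) t X A)
         * vertical_partial T k (vertical_partial T l G) t (functional_path F X A) A)) (at 0)"
      by (rule functional_path_has_derivative[OF non_anticipative_vertical_partial[OF T open_UNIV C12c_viaD(2)[OF G]] C12c_viaD(5)[OF G] t X A])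
    show "((\<lambda>v. vertical_partial T j (F l) t (bump T t v X) A * vertical_partial T l G t (functional_path F (bump T t v X) A) A) has_derivative
       (\<lambda>h. vertical_partial T j (F l) t X A * (\<Sum>k\<in>UNIV. (\<Sum>i\<in>UNIV. h $ i * vertical_partial T i (F k) t X A)
         * vertical_partial T k (vertical_partial T l G) t (functional_path F X A) A)
       + (\<Sum>i\<in>UNIV. h $ i * vertical_partial T i (vertical_partial T j (F l)) t X A) * vertical_partial T l G t (functional_path F X A) A)) (at 0)"
      using has_derivative_mult[OF 1 2] by (simp only: bump_zero)
  qed
  then show ?thesis
  proof (rule has_derivative_transform_eventually)
    have eq: "(\<Sum>l\<in>UNIV. vertical_partial T j (F l) t (bump T t v X) A * vertical_partial T l G t (functional_path F (bump T t v X) A) A)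
      = vertical_partial T j (\<lambda>t X A. G t (functional_path F X A) A) t (bump T t v X) A"
      if "bump T t v X \<in> cadlag_paths T U" for v by (rule vertical_partial_compose[OF t that A, symmetric])
    have "\<forall>\<^sub>F v in nhds 0. bump T t v X \<in> cadlag_paths T U" using cadlag_paths_bump_small[OF X U] t by auto
    then have "\<forall>\<^sub>F v in at 0. bump T t v X \<in> cadlag_paths T U" by (simp add: eventually_nhds_conv_at)
    then show "\<forall>\<^sub>F v in at 0. (\<Sum>l\<in>UNIV. vertical_partial T j (F l) t (bump T t v X) A * vertical_partial T l G t (functional_path F (bump T t v X) A) A)
      = vertical_partial T j (\<lambda>t X A. G t (functional_path F X A) A) t (bump T t v X) A"
      by eventually_elim (rule eq)
    show "(\<Sum>l\<in>UNIV. vertical_partial T j (F l) t (bump T t 0 X) A * vertical_partial T l G t (functional_path F (bump T t 0 X) A) A)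
      = vertical_partial T j (\<lambda>t X A. G t (functional_path F X A) A) t (bump T t 0 X) A"
      by (rule eq) (simp add: bump_zero X)
  qed simp
qed

lemma vertical_partial2_compose:
  assumes t: "t \<in> {0..T}" and X: "X \<in> cadlag_paths T U" and A: "A \<in> CBV T m S"
  shows "vertical_partial T i (vertical_partial T j (\<lambda>t X A. G t (functional_path F X A) A)) t X A =
    (\<Sum>l\<in>UNIV. vertical_partial T j (F l) t X A * (\<Sum>k\<in>UNIV. vertical_partial T i (F k) t X A
         * vertical_partial T k (vertical_partial T l G) t (functional_path F X A) A)
       + vertical_partial T i (vertical_partial T j (F l)) t X A * vertical_partial T l G t (functional_path F X A) A)"
  using vertical_partial_eqI[where K = "vertical_partial T j (\<lambda>t X A. G t (functional_path F X A) A)",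
      OF vertical_partial_compose_has_derivative[OF t X A, of j], of i]
  by (simp add: sum_axis)

text \<open>The gradient of \<open>G\<close> is a factor here, so it must be turned into a
  horizontal integrand by cutting it off at time 0.\<close>

lemma horizontal_integrand_compose_derivative:
  assumes i: "i \<le> m"
  shows "horizontal_integrand T m U S (\<lambda>t X A. DG i t (functional_path F X A) A +
     (\<Sum>l\<in>UNIV. (if t = 0 then 0 else vertical_partial T l G t (functional_path F X A) A) * DF l i t X A))"
proof -
  have HI: "horizontal_integrand T m UNIV S (\<lambda>t X A. if t = 0 then 0 else vertical_partial T l G t X A)" for l
    by (rule horizontal_integrand_left[OF T open_UNIV non_anticipative_vertical_partial[OF T open_UNIV C12c_viaD(2)[OF G]] C12c_viaD(6,7)[OF G]])
  have 1: "horizontal_integrand T m U S (\<lambda>t X A. DG i t (functional_path F X A) A)"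
    by (rule horizontal_integrand_compose[OF T U F C12c_via_horizontal_integrand[OF G i]])
  have 2: "horizontal_integrand T m U S (\<lambda>t X A. if t = 0 then 0 else vertical_partial T l G t (functional_path F X A) A)" for l
    by (rule horizontal_integrand_compose[OF T U F HI[of l]])
  have 3: "horizontal_integrand T m U S (\<lambda>t X A. \<Sum>l\<in>UNIV. (if t = 0 then 0 else vertical_partial T l G t (functional_path F X A) A) * DF l i t X A)"
    by (rule horizontal_integrand_sum[OF T U], rule horizontal_integrand_mult[OF T U 2 C12c_via_horizontal_integrand[OF F i]])
  show ?thesis by (rule horizontal_integrand_add[OF T U 1 3])
qed

text \<open>Along \<open>stop s X\<close> the components of the path of values are integrals of
  \<open>DF\<close> against the controls, so the change of variables for such paths applies. The cut
  at \<open>r = 0\<close> is invisible because the integrals extend over \<open>{s<..t}\<close> with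
  \<open>0 \<le> s\<close>.\<close>

lemma horizontal_derivative_compose:
  assumes st: "0 \<le> s" "s < t" "t \<le> T" and X: "X \<in> cadlag_paths T U" and A: "A \<in> CBV T m S"
  shows "G t (functional_path F (stop s X) A) A - G s (functional_path F (stop s X) A) A =
    (\<Sum>i\<le>m. stieltjes_integral s t (\<lambda>r. DG i r (functional_path F (stop s X) A) A +
     (\<Sum>l\<in>UNIV. (if r = 0 then 0 else vertical_partial T l G r (functional_path F (stop s X) A) A) * DF l i r (stop s X) A)) (integrator A i))"
proof -
  let ?X = "stop s X" let ?W = "functional_path F ?X A"
  have sX: "?X \<in> cadlag_paths T U" using cadlag_paths_stop[OF X] st by auto
  have W: "?W \<in> cadlag_paths T UNIV" by (rule functional_path_cadlag[where F = F, OF T U F sX A])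
  have g: "cont_bv T (integrator A i)" if "i \<le> m" for i using cont_bv_integrator[OF A that] T by simp
  have meas: "bdd_measurable x y (\<lambda>r. DF l i r ?X A)" if "i \<le> m" "0 \<le> x" "y \<le> T" for i l x y
    by (rule bdd_measurable_subset[OF horizontal_integrand_measurable[OF T U C12c_via_horizontal_integrand[OF F that(1)] sX A] that(2,3)])
  have "G t ?W A - G s ?W A = (\<Sum>i\<le>m. stieltjes_integral s t (\<lambda>r. DG i r ?W A) (integrator A i)) +
     (\<Sum>i\<le>m. stieltjes_integral s t (\<lambda>r. \<Sum>l\<in>UNIV. vertical_partial T l G r ?W A * DF l i r ?X A) (integrator A i))"
  proof (rule change_of_variables_bounded_variation[OF T G A W st(1,3,2)])
    have "continuous_on {s..t} (\<lambda>u. F l u ?X A)" for l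
      by (rule continuous_on_subset[OF continuous_on_horizontal[OF T U F _ X A]]) (use st in auto)
    then show "continuous_on {s..t} ?W" unfolding functional_path_def by (rule continuous_on_vec_lambda)
    fix x y l assume xy: "s \<le> x" "x \<le> y" "y \<le> t"
    have "stop x ?X = ?X" using st xy by (simp add: stop_stop min_absorb1)
    then show "?W y $ l - ?W x $ l = (\<Sum>i\<le>m. stieltjes_integral x y (\<lambda>r. DF l i r ?X A) (integrator A i))"
      using horizontal_difference[OF T U F _ xy(2) _ sX A, of l] st xy by (simp add: functional_path_def)
  qed (use meas st in auto)
  also have "\<dots> = (\<Sum>i\<le>m. stieltjes_integral s t (\<lambda>r. DG i r ?W A) (integrator A i) +
     stieltjes_integral s t (\<lambda>r. \<Sum>l\<in>UNIV. vertical_partial T l G r ?W A * DF l i r ?X A) (integrator A i))"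
    by (simp add: sum.distrib)
  also have "\<dots> = (\<Sum>i\<le>m. stieltjes_integral s t (\<lambda>r. DG i r ?W A +
     (\<Sum>l\<in>UNIV. (if r = 0 then 0 else vertical_partial T l G r ?W A) * DF l i r ?X A)) (integrator A i))"
  proof (rule sum.cong[OF refl])
    fix i assume "i \<in> {..m}"
    then have i: "i \<le> m" by simp
    have m1: "bdd_measurable s t (\<lambda>r. DG i r ?W A)"
      by (rule bdd_measurable_subset[OF horizontal_integrand_measurable[OF T open_UNIV C12c_via_horizontal_integrand[OF G i] W A]])
         (use st in auto)
    have m2: "bdd_measurable s t (\<lambda>r. \<Sum>l\<in>UNIV. vertical_partial T l G r ?W A * DF l i r ?X A)"
      by (intro bdd_measurable_sum bdd_measurable_mult meas i
          bdd_measurable_subset[OF bdd_measurable_vertical_partial(1)[OF T open_UNIV W G A st(3)]]) (use st in auto)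
    have "stieltjes_integral s t (\<lambda>r. DG i r ?W A + (\<Sum>l\<in>UNIV. vertical_partial T l G r ?W A * DF l i r ?X A)) (integrator A i) =
      stieltjes_integral s t (\<lambda>r. DG i r ?W A + (\<Sum>l\<in>UNIV. (if r = 0 then 0 else vertical_partial T l G r ?W A) * DF l i r ?X A)) (integrator A i)"
      by (rule stieltjes_integral_cong) (use st in auto)
    then show "stieltjes_integral s t (\<lambda>r. DG i r ?W A) (integrator A i) +
     stieltjes_integral s t (\<lambda>r. \<Sum>l\<in>UNIV. vertical_partial T l G r ?W A * DF l i r ?X A) (integrator A i) =
      stieltjes_integral s t (\<lambda>r. DG i r ?W A +
     (\<Sum>l\<in>UNIV. (if r = 0 then 0 else vertical_partial T l G r ?W A) * DF l i r ?X A)) (integrator A i)"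
      using stieltjes_integral_add[OF g[OF i] _ _ _ m1 m2] st by simp
  qed
  finally show ?thesis .
qed

theorem C12c_via_compose:
  "C12c_via T m U S (\<lambda>t X A. G t (functional_path F X A) A)
    (\<lambda>i t X A. DG i t (functional_path F X A) A +
     (\<Sum>l\<in>UNIV. (if t = 0 then 0 else vertical_partial T l G t (functional_path F X A) A) * DF l i t X A))"
proof -
  let ?K = "\<lambda>t X A. G t (functional_path F X A) A"
  let ?V = "\<lambda>i j t X A. \<Sum>l\<in>UNIV. vertical_partial T j (F l) t X A * (\<Sum>k\<in>UNIV. vertical_partial T i (F k) t X A
         * vertical_partial T k (vertical_partial T l G) t (functional_path F X A) A)
       + vertical_partial T i (vertical_partial T j (F l)) t X A * vertical_partial T l G t (functional_path F X A) A"
  note D = C12c_viaD[OF G] and DFs = C12c_viaD[OF F]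
  have na: "non_anticipative T m U S ?K" by (rule non_anticipative_functional_path[OF T U F D(2)])
  have lc: "left_continuous T m U S ?K" by (rule left_continuous_functional_path[OF D(3)])
  have bp: "boundedness_preserving T m U S ?K" by (rule boundedness_preserving_functional_path[OF T U F D(11)])
  have lu: "continuous_in_X_locally_uniformly T m U S ?K"
  proof (rule continuous_in_X_locally_uniformlyI[OF T U])
    fix X A and Y :: "nat \<Rightarrow> 'd path" and u :: "nat \<Rightarrow> real"
    assume *: "X \<in> cadlag_paths T U" "A \<in> CBV T m S" "\<And>n. Y n \<in> cadlag_paths T U" "uniform_limit {0..T} Y X sequentially"
      "\<And>n. u n \<in> {0..T}"
    note cad = functional_path_cadlag[where F = F, OF T U F]
    have "uniform_limit {0..T} (\<lambda>n. functional_path F (Y n) A) (functional_path F X A) sequentially"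
      by (rule functional_path_uniform_limit[where F = F, OF T U F *(1,2) _ *(4)]) (use * in auto)
    then show "(\<lambda>n. ?K (u n) (Y n) A - ?K (u n) X A) \<longlonglongrightarrow> 0"
      by (intro continuous_in_X_locally_uniformlyD[OF T open_UNIV D(10) cad[OF *(1,2)] *(2) _ _ *(5)]) (use cad[OF *(3,2)] in auto)
  qed
  have vd: "vertically_differentiable T m U S ?K"
    unfolding vertically_differentiable_def differentiable_def
    using functional_path_has_derivative[OF D(2,4)] by blast
  have vd2: "vertically_differentiable T m U S (vertical_partial T j ?K)" for j
    unfolding vertically_differentiable_def differentiable_def
    using vertical_partial_compose_has_derivative by blast
  have vpl: "left_continuous T m U S (vertical_partial T j ?K)" for j
    by (rule left_continuous_cong[OF T U left_continuous_sum[OF T U finite left_continuous_mult[OF T U DFs(6) left_continuous_functional_path[OF D(6)]]]])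
       (rule vertical_partial_compose[symmetric])
  have vpb: "boundedness_preserving T m U S (vertical_partial T j ?K)" for j
    by (rule boundedness_preserving_cong[OF T U boundedness_preserving_sum[OF T U finite boundedness_preserving_mult[OF T U DFs(7)
          boundedness_preserving_functional_path[OF T U F D(7)]]]])
       (rule vertical_partial_compose[symmetric])
  have vp2l: "left_continuous T m U S (vertical_partial T i (vertical_partial T j ?K))" for i j
  proof (rule left_continuous_cong[OF T U _ vertical_partial2_compose[symmetric]])
    have add: "left_continuous T m U S (\<lambda>t X A. H t X A + H' t X A)" if "left_continuous T m U S H" "left_continuous T m U S H'" for H H'
      by (rule left_continuous_combine[OF T U that, of "\<lambda>x y. x + y"]) (rule tendsto_add)
    show "left_continuous T m U S (\<lambda>t X A. ?V i j t X A)"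
      by (intro left_continuous_sum[OF T U finite] add left_continuous_mult[OF T U] DFs(6,8)
          left_continuous_functional_path[OF D(6)] left_continuous_functional_path[OF D(8)])
  qed
  have vp2b: "boundedness_preserving T m U S (vertical_partial T i (vertical_partial T j ?K))" for i j
  proof (rule boundedness_preserving_cong[OF T U _ vertical_partial2_compose[symmetric]])
    have add: "boundedness_preserving T m U S (\<lambda>t X A. H t X A + H' t X A)"
      if "boundedness_preserving T m U S H" "boundedness_preserving T m U S H'" for H H'
      by (rule boundedness_preserving_combine[OF T U that, of "\<lambda>t x y. x + y" "(+)"]) linarith
    show "boundedness_preserving T m U S (\<lambda>t X A. ?V i j t X A)"
      by (intro boundedness_preserving_sum[OF T U finite] add boundedness_preserving_mult[OF T U] DFs(7,9)
          boundedness_preserving_functional_path[OF T U F D(7)] boundedness_preserving_functional_path[OF T U F D(9)])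
  qed
  show ?thesis
    by (rule C12c_viaI[OF na lc vd vd2 vpl vpb vp2l vp2b lu bp horizontal_integrand_compose_derivative horizontal_derivative_compose])
qed

end

end

section \<open>Enlarging the space of controls\<close>

text \<open>\<sigma> lists the positions of the old components among the new ones; the zeros beyond
  \<open>m\<close> place the result in \<open>Euclidean_space m\<close>.\<close>

definition project :: "(nat \<Rightarrow> nat) \<Rightarrow> nat \<Rightarrow> (nat \<Rightarrow> real) \<Rightarrow> nat \<Rightarrow> real" where
  "project \<sigma> m x = (\<lambda>j. if j < m then x (\<sigma> j) else 0)"

lemma vertical_partial_project:
  "vertical_partial T j (\<lambda>t X A. F t X (\<lambda>t. project \<sigma> m (A t))) = (\<lambda>t X A. vertical_partial T j F t X (\<lambda>t. project \<sigma> m (A t)))"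
  by (simp add: vertical_partial_def)

lemma project_CBV:
  assumes A: "A \<in> CBV T q S'" and S: "\<And>x. x \<in> S' \<Longrightarrow> project \<sigma> m x \<in> S" and \<sigma>: "\<And>j. j < m \<Longrightarrow> \<sigma> j < q"
  shows "(\<lambda>t. project \<sigma> m (A t)) \<in> CBV T m S"
  using assms unfolding CBV_def project_def by auto

lemma openin_project:
  assumes S: "openin (Euclidean_space m) S" and \<sigma>: "\<And>j. j < m \<Longrightarrow> \<sigma> j < q"
  shows "openin (Euclidean_space q) {x \<in> topspace (Euclidean_space q). project \<sigma> m x \<in> S}"
proof (rule openin_continuous_map_preimage[OF _ S])
  show "continuous_map (Euclidean_space q) (Euclidean_space m) (project \<sigma> m)"
    unfolding project_def[abs_def] continuous_map_componentwise_Euclidean_space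
    by (auto simp: Euclidean_space_def intro!: continuous_map_from_subtopology continuous_map_product_projection)
qed

text \<open>Integrator 0 is time for every control, so only the indices from 1 on are moved by
  \<sigma>.\<close>

definition project_index :: "(nat \<Rightarrow> nat) \<Rightarrow> nat \<Rightarrow> nat" where
  "project_index \<sigma> i = (case i of 0 \<Rightarrow> 0 | Suc j \<Rightarrow> Suc (\<sigma> j))"

lemma integrator_project: "i \<le> m \<Longrightarrow> integrator (\<lambda>t. project \<sigma> m (A t)) i = integrator A (project_index \<sigma> i)"
  by (auto simp: integrator_def fun_eq_iff project_def project_index_def split: nat.split)

text \<open>\<iota> may send several \<open>j\<close> to the same index; integrands that share an
  integrator are then added up.\<close>

lemma sum_stieltjes_integral_reindex:
  fixes q :: nat
  assumes g: "\<And>i. i \<le> q \<Longrightarrow> cont_bv T (g i)" and st: "0 \<le> s" "s \<le> t" "t \<le> T"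
    and J: "finite J" and f: "\<And>i. i \<in> J \<Longrightarrow> bdd_measurable s t (f i)" and \<iota>: "\<And>i. i \<in> J \<Longrightarrow> \<iota> i \<le> q"
  shows "(\<Sum>i\<le>q. stieltjes_integral s t (\<lambda>r. \<Sum>j\<in>J. if i = \<iota> j then f j r else 0) (g i)) =
    (\<Sum>j\<in>J. stieltjes_integral s t (f j) (g (\<iota> j)))"
proof -
  have "(\<Sum>i\<le>q. stieltjes_integral s t (\<lambda>r. \<Sum>j\<in>J. if i = \<iota> j then f j r else 0) (g i)) =
     (\<Sum>i\<le>q. \<Sum>j\<in>J. if i = \<iota> j then stieltjes_integral s t (f j) (g (\<iota> j)) else 0)"
  proof (rule sum.cong[OF refl])
    fix i assume i: "i \<in> {..q}"
    have "stieltjes_integral s t (\<lambda>r. \<Sum>j\<in>J. if i = \<iota> j then f j r else 0) (g i) =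
       (\<Sum>j\<in>J. stieltjes_integral s t (\<lambda>r. if i = \<iota> j then f j r else 0) (g i))"
    proof (rule stieltjes_integral_sum[OF g st])
      fix j assume "j \<in> J"
      then show "bdd_measurable s t (\<lambda>r. if i = \<iota> j then f j r else 0)"
        using f bdd_measurable_const by (cases "i = \<iota> j") auto
    qed (use i in auto)
    also have "\<dots> = (\<Sum>j\<in>J. if i = \<iota> j then stieltjes_integral s t (f j) (g (\<iota> j)) else 0)"
    proof (rule sum.cong[OF refl])
      fix j assume "j \<in> J"
      show "stieltjes_integral s t (\<lambda>r. if i = \<iota> j then f j r else 0) (g i) =
         (if i = \<iota> j then stieltjes_integral s t (f j) (g (\<iota> j)) else 0)"
        using stieltjes_integral_const[OF g st, of i 0] i by (cases "i = \<iota> j") auto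
    qed
    finally show "stieltjes_integral s t (\<lambda>r. \<Sum>j\<in>J. if i = \<iota> j then f j r else 0) (g i) =
       (\<Sum>j\<in>J. if i = \<iota> j then stieltjes_integral s t (f j) (g (\<iota> j)) else 0)" .
  qed
  also have "\<dots> = (\<Sum>j\<in>J. \<Sum>i\<le>q. if i = \<iota> j then stieltjes_integral s t (f j) (g (\<iota> j)) else 0)" by (rule sum.swap)
  also have "\<dots> = (\<Sum>j\<in>J. stieltjes_integral s t (f j) (g (\<iota> j)))"
  proof (rule sum.cong[OF refl])
    fix j assume "j \<in> J"
    then have "\<iota> j \<in> {..q}" using \<iota> by simp
    then show "(\<Sum>i\<le>q. if i = \<iota> j then stieltjes_integral s t (f j) (g (\<iota> j)) else 0) = stieltjes_integral s t (f j) (g (\<iota> j))"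
      by (subst sum.delta) auto
  qed
  finally show ?thesis .
qed

context
  fixes T :: real and m q :: nat and U :: "(real ^ 'd::finite) set" and S S' :: "(nat \<Rightarrow> real) set" and \<sigma> :: "nat \<Rightarrow> nat"
  assumes T: "0 < T" and U: "open U"
    and S': "\<And>x. x \<in> S' \<Longrightarrow> project \<sigma> m x \<in> S" and \<sigma>: "\<And>j. j < m \<Longrightarrow> \<sigma> j < q"
begin

private lemma pr_CBV: "A \<in> CBV T q S' \<Longrightarrow> (\<lambda>t. project \<sigma> m (A t)) \<in> CBV T m S"
  by (rule project_CBV[OF _ S' \<sigma>])

lemma project_transfer:
  shows "non_anticipative T m U S H \<Longrightarrow> non_anticipative T q U S' (\<lambda>t X A. H t X (\<lambda>t. project \<sigma> m (A t)))"
    and "left_continuous T m U S H \<Longrightarrow> left_continuous T q U S' (\<lambda>t X A. H t X (\<lambda>t. project \<sigma> m (A t)))"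
    and "boundedness_preserving T m U S H \<Longrightarrow> boundedness_preserving T q U S' (\<lambda>t X A. H t X (\<lambda>t. project \<sigma> m (A t)))"
    and "continuous_at_fixed_times T m U S H \<Longrightarrow> continuous_at_fixed_times T q U S' (\<lambda>t X A. H t X (\<lambda>t. project \<sigma> m (A t)))"
    and "continuous_in_X_locally_uniformly T m U S H \<Longrightarrow> continuous_in_X_locally_uniformly T q U S' (\<lambda>t X A. H t X (\<lambda>t. project \<sigma> m (A t)))"
    and "vertically_differentiable T m U S H \<Longrightarrow> vertically_differentiable T q U S' (\<lambda>t X A. H t X (\<lambda>t. project \<sigma> m (A t)))"
proof -
  assume H: "non_anticipative T m U S H"
  show "non_anticipative T q U S' (\<lambda>t X A. H t X (\<lambda>t. project \<sigma> m (A t)))"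
    unfolding non_anticipative_def
  proof (intro ballI)
    fix t X A assume "t \<in> {0..T}" "X \<in> cadlag_paths T U" "A \<in> CBV T q S'"
    then have "H t X (\<lambda>t. project \<sigma> m (A t)) = H t (stop t X) (stop t (\<lambda>t. project \<sigma> m (A t)))"
      using H pr_CBV unfolding non_anticipative_def by blast
    then show "H t X (\<lambda>t. project \<sigma> m (A t)) = H t (stop t X) (\<lambda>s. project \<sigma> m (stop t A s))"
      by (simp add: stop_def)
  qed
next
  assume H: "left_continuous T m U S H"
  show "left_continuous T q U S' (\<lambda>t X A. H t X (\<lambda>t. project \<sigma> m (A t)))"
    unfolding left_continuous_def
    by (intro ballI allI impI H[unfolded left_continuous_def, rule_format] pr_CBV)
next
  assume H: "boundedness_preserving T m U S H"
  show "boundedness_preserving T q U S' (\<lambda>t X A. H t X (\<lambda>t. project \<sigma> m (A t)))"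
    unfolding boundedness_preserving_def
    by (intro ballI allI impI H[unfolded boundedness_preserving_def, rule_format] pr_CBV)
next
  assume H: "continuous_at_fixed_times T m U S H"
  show "continuous_at_fixed_times T q U S' (\<lambda>t X A. H t X (\<lambda>t. project \<sigma> m (A t)))"
    unfolding continuous_at_fixed_times_def
    by (intro ballI allI impI H[unfolded continuous_at_fixed_times_def, rule_format] pr_CBV)
next
  assume H: "continuous_in_X_locally_uniformly T m U S H"
  show "continuous_in_X_locally_uniformly T q U S' (\<lambda>t X A. H t X (\<lambda>t. project \<sigma> m (A t)))"
    unfolding continuous_in_X_locally_uniformly_def
    by (intro ballI allI impI H[unfolded continuous_in_X_locally_uniformly_def, rule_format] pr_CBV)
next
  assume H: "vertically_differentiable T m U S H"
  show "vertically_differentiable T q U S' (\<lambda>t X A. H t X (\<lambda>t. project \<sigma> m (A t)))"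
    unfolding vertically_differentiable_def
    by (intro ballI allI impI H[unfolded vertically_differentiable_def, rule_format] pr_CBV)
qed

lemma horizontal_integrand_project:
  assumes E: "horizontal_integrand T m U S E"
  shows "horizontal_integrand T q U S' (\<lambda>t X A. E t X (\<lambda>t. project \<sigma> m (A t)))"
proof (rule horizontal_integrandI[OF T U])
  note D = horizontal_integrandD[OF T U E]
  show "non_anticipative T q U S' (\<lambda>t X A. E t X (\<lambda>t. project \<sigma> m (A t)))" by (rule project_transfer(1)[OF D(1)])
  show "boundedness_preserving T q U S' (\<lambda>t X A. E t X (\<lambda>t. project \<sigma> m (A t)))" by (rule project_transfer(3)[OF D(2)])
  show "continuous_at_fixed_times T q U S' (\<lambda>t X A. E t X (\<lambda>t. project \<sigma> m (A t)))" by (rule project_transfer(4)[OF D(3)])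
qed (intro horizontal_integrandD(4)[OF T U E] pr_CBV)

text \<open>A component of the new horizontal derivative collects all old ones whose index is sent
  to it; at an index outside the range of \<open>project_index \<sigma>\<close> it is a sum of
  zeros.\<close>

theorem C12c_via_project:
  assumes F: "C12c_via T m U S F DF"
  shows "C12c_via T q U S' (\<lambda>t X A. F t X (\<lambda>t. project \<sigma> m (A t)))
    (\<lambda>i t X A. \<Sum>j\<le>m. if i = project_index \<sigma> j then DF j t X (\<lambda>t. project \<sigma> m (A t)) else 0)"
proof -
  note D = C12c_viaD[OF F]
  let ?F = "\<lambda>t X A. F t X (\<lambda>t. project \<sigma> m (A t))"
  let ?D = "\<lambda>i t X A. \<Sum>j\<le>m. if i = project_index \<sigma> j then DF j t X (\<lambda>t. project \<sigma> m (A t)) else 0"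
  have HI: "horizontal_integrand T q U S' (?D i)" for i
  proof (rule horizontal_integrand_sum[OF T U])
    fix j assume "j \<in> {..m}"
    then show "horizontal_integrand T q U S' (\<lambda>t X A. if i = project_index \<sigma> j then DF j t X (\<lambda>t. project \<sigma> m (A t)) else 0)"
      using horizontal_integrand_project[OF C12c_via_horizontal_integrand[OF F, of j]] horizontal_integrand_const[OF T U]
      by (cases "i = project_index \<sigma> j") auto
  qed
  have idx: "project_index \<sigma> j \<le> q" if "j \<le> m" for j
    using that \<sigma> by (auto simp: project_index_def Suc_le_eq split: nat.split)
  have hd: "?F t (stop s X) A - ?F s (stop s X) A = (\<Sum>i\<le>q. stieltjes_integral s t (\<lambda>r. ?D i r (stop s X) A) (integrator A i))"
    if st: "0 \<le> s" "s < t" "t \<le> T" and X: "X \<in> cadlag_paths T U" and A: "A \<in> CBV T q S'" for s t X A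
  proof -
    have sX: "stop s X \<in> cadlag_paths T U" using cadlag_paths_stop[OF X] st by auto
    have "?F t (stop s X) A - ?F s (stop s X) A =
       (\<Sum>j\<le>m. stieltjes_integral s t (\<lambda>r. DF j r (stop s X) (\<lambda>t. project \<sigma> m (A t))) (integrator A (project_index \<sigma> j)))"
      using horizontal_difference[OF T U F _ _ _ X pr_CBV[OF A], of s t] st by (simp add: integrator_project)
    also have "\<dots> = (\<Sum>i\<le>q. stieltjes_integral s t (\<lambda>r. ?D i r (stop s X) A) (integrator A i))"
    proof (rule sum_stieltjes_integral_reindex[symmetric, where T = T])
      show "cont_bv T (integrator A i)" if "i \<le> q" for i using cont_bv_integrator[OF A that] T by simp
      fix j assume "j \<in> {..m}"
      then show "bdd_measurable s t (\<lambda>r. DF j r (stop s X) (\<lambda>t. project \<sigma> m (A t)))"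
        by (intro bdd_measurable_subset[OF horizontal_integrand_measurable[OF T U C12c_via_horizontal_integrand[OF F] sX pr_CBV[OF A]]])
           (use st in auto)
    qed (use st idx in auto)
    finally show ?thesis .
  qed
  have eq: "vertical_partial T j ?F = (\<lambda>t X A. vertical_partial T j F t X (\<lambda>t. project \<sigma> m (A t)))"
    and eq2: "vertical_partial T i (\<lambda>t X A. vertical_partial T j F t X (\<lambda>t. project \<sigma> m (A t))) =
      (\<lambda>t X A. vertical_partial T i (vertical_partial T j F) t X (\<lambda>t. project \<sigma> m (A t)))" for i j
    by (rule vertical_partial_project)+
  show ?thesis
  proof (rule C12c_viaI[OF project_transfer(1)[OF D(2)] project_transfer(2)[OF D(3)] project_transfer(6)[OF D(4)] _ _ _ _ _
        project_transfer(5)[OF D(10)] project_transfer(3)[OF D(11)] HI hd])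
    show "vertically_differentiable T q U S' (vertical_partial T j ?F)" for j
      unfolding eq by (rule project_transfer(6)[OF D(5)])
    show "left_continuous T q U S' (vertical_partial T i ?F)" "boundedness_preserving T q U S' (vertical_partial T i ?F)" for i
      unfolding eq by (rule project_transfer(2)[OF D(6)] project_transfer(3)[OF D(7)])+
    show "left_continuous T q U S' (vertical_partial T i (vertical_partial T j ?F))"
      "boundedness_preserving T q U S' (vertical_partial T i (vertical_partial T j ?F))" for i j
      unfolding eq eq2 by (rule project_transfer(2)[OF D(8)] project_transfer(3)[OF D(9)])+
  qed
qed

end

section \<open>The pathwise Ito integral\<close>

lemma refining_partitions_fine:
  assumes P: "refining_partitions T P"
  shows "fine_subdivisions 0 T P"
    and "\<And>n t. t < T \<Longrightarrow> successor T (P n) t = nx (P n) t" "\<And>n. successor T (P n) T = T"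
proof -
  show succ: "successor T (P n) t = nx (P n) t" if "t < T" for n t
    using that by (simp add: successor_def nx_def)
  show "successor T (P n) T = T" for n by (simp add: successor_def)
  have sub: "subdivision 0 T (P n)" for n
    using P by (auto simp: refining_partitions_def subdivision_def)
  show "fine_subdivisions 0 T P"
    unfolding fine_subdivisions_def
  proof (intro conjI allI impI sub)
    fix d :: real assume "d > 0"
    let ?M = "\<lambda>n. Max ((\<lambda>t. successor T (P n) t - t) ` P n)"
    have "?M \<longlonglongrightarrow> 0" using P by (simp add: refining_partitions_def)
    then have "\<forall>\<^sub>F n in sequentially. ?M n < d" using \<open>d > 0\<close> by (rule order_tendstoD)
    then show "\<forall>\<^sub>F n in sequentially. \<forall>s\<in>P n. s < T \<longrightarrow> nx (P n) s - s < d"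
    proof eventually_elim
      case (elim n)
      show ?case
      proof (intro ballI impI)
        fix s assume s: "s \<in> P n" "s < T"
        have "successor T (P n) s - s \<le> ?M n"
          by (rule Max_ge) (use s subdivision_finite[OF sub] in auto)
        then show "nx (P n) s - s < d" using elim succ[OF s(2)] by simp
      qed
    qed
  qed
qed

lemma bounded_variation_onI:
  assumes "\<And>x y. a \<le> x \<Longrightarrow> x \<le> y \<Longrightarrow> y \<le> b \<Longrightarrow> \<bar>g y - g x\<bar> \<le> \<phi> y - \<phi> x"
  shows "bounded_variation_on a b g"
  unfolding bounded_variation_on_def
proof (rule bdd_aboveI[where M = "\<phi> b - \<phi> a"])
  fix z assume "z \<in> variation_sums g a b"
  then obtain n p where z: "z = (\<Sum>i<n. \<bar>g (p (Suc i)) - g (p i)\<bar>)" and p: "mono_on {..n} p" "p ` {..n} \<subseteq> {a..b}"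
    unfolding variation_sums_def by blast
  have pi: "a \<le> p i" "p i \<le> b" if "i \<le> n" for i using p(2) that by auto
  have "z \<le> (\<Sum>i<n. \<phi> (p (Suc i)) - \<phi> (p i))"
    unfolding z by (rule sum_mono, rule assms) (use pi p(1) in \<open>auto intro: mono_onD\<close>)
  also have "\<dots> = \<phi> (p n) - \<phi> (p 0)" by (rule sum_lessThan_telescope)
  also have "\<dots> \<le> \<phi> b - \<phi> a"
    using assms[of a "p 0"] assms[of "p n" b] pi[of 0] pi[of n] by fastforce
  finally show "z \<le> \<phi> b - \<phi> a" .
qed

text \<open>Sums over \<open>s \<le> t\<close> include the increment over the cell of
  \<open>t\<close> up to its end beyond \<open>t\<close>. When such a sum is compared with the one
  cut at \<open>t\<close>, all other terms vanish, and at most one point of \<open>Q\<close>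
  satisfies \<open>s \<le> t < nx Q s\<close>. The last point \<open>b\<close> starts no cell and is
  treated apart.\<close>

lemma sum_straddling_cell:
  fixes h :: "real \<Rightarrow> real"
  assumes Q: "subdivision a b Q" and t: "a \<le> t" "t \<le> b" and x: "x \<le> t"
    and h: "\<And>s. s \<in> Q \<Longrightarrow> s < b \<Longrightarrow> nx Q s \<le> t \<Longrightarrow> h s = 0" "b \<le> x \<Longrightarrow> h b = 0"
    and B: "0 \<le> B" "\<And>s. s \<in> Q \<Longrightarrow> s \<le> t \<Longrightarrow> s < b \<Longrightarrow> t < nx Q s \<Longrightarrow> \<bar>h s\<bar> \<le> B"
  shows "\<bar>\<Sum>s\<in>{s\<in>Q. s \<le> x}. h s\<bar> \<le> B"
proof -
  let ?J = "{s\<in>Q. s \<le> x \<and> s < b \<and> t < nx Q s}"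
  have "(\<Sum>s\<in>{s\<in>Q. s \<le> x}. h s) = (\<Sum>s\<in>?J. h s)"
  proof (rule sum.mono_neutral_right)
    show "\<forall>s\<in>{s\<in>Q. s \<le> x} - ?J. h s = 0"
    proof
      fix s assume s: "s \<in> {s\<in>Q. s \<le> x} - ?J"
      then have "s = b \<or> (s < b \<and> nx Q s \<le> t)" using subdivision_bounds[OF Q, of s] by fastforce
      then show "h s = 0" using h s by auto
    qed
  qed (use subdivision_finite[OF Q] in auto)
  moreover have "\<exists>s. ?J \<subseteq> {s}"
  proof -
    have "s = r" if "s \<in> ?J" "r \<in> ?J" for s r
    proof (rule ccontr)
      assume "s \<noteq> r"
      then consider "s < r" | "r < s" by linarith
      then show False
      proof cases
        case 1
        then show False using nx_least[OF Q, of r s] that x by auto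
      next
        case 2
        then show False using nx_least[OF Q, of s r] that x by auto
      qed
    qed
    then show ?thesis by (cases "?J = {}") blast+
  qed
  then obtain s where "?J \<subseteq> {s}" by blast
  then consider "?J = {}" | "?J = {s}" by blast
  then have "\<bar>\<Sum>s\<in>?J. h s\<bar> \<le> B"
  proof cases
    case 1
    show ?thesis unfolding 1 using B(1) by simp
  next
    case 2
    then have "s \<in> ?J" by blast
    then have "\<bar>h s\<bar> \<le> B" using B(2) x by auto
    then show ?thesis unfolding 2 by simp
  qed
  ultimately show ?thesis by simp
qed

text \<open>The Riemann sums of \<open>g\<close> against \<open>H\<close> are at the same time
  integrals of \<open>g (pre (Q n) u) * h i u\<close> against the \<open>c i\<close>; the two
  descriptions converge to the two sides.\<close>

lemma stieltjes_integral_assoc: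
  fixes c :: "'i \<Rightarrow> real \<Rightarrow> real"
  assumes T: "0 < T" and I: "finite I" and c: "\<And>i. i \<in> I \<Longrightarrow> cont_bv T (c i)" and H: "cont_bv T H"
    and h: "\<And>i. i \<in> I \<Longrightarrow> bdd_measurable 0 T (h i)"
    and H_eq: "\<And>t. t \<in> {0..T} \<Longrightarrow> H t = (\<Sum>i\<in>I. stieltjes_integral 0 t (h i) (c i))"
    and g: "\<And>u x. u \<in> {0<..T} \<Longrightarrow> (\<And>n. x n \<in> {0..u}) \<Longrightarrow> x \<longlonglongrightarrow> u \<Longrightarrow> (\<lambda>n. g (x n)) \<longlonglongrightarrow> g u"
    and C: "\<And>u. u \<in> {0..T} \<Longrightarrow> \<bar>g u\<bar> \<le> C"
  shows "stieltjes_integral 0 T g H = (\<Sum>i\<in>I. stieltjes_integral 0 T (\<lambda>r. g r * h i r) (c i))"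
proof -
  obtain Q where Q: "fine_subdivisions 0 T Q" using fine_subdivisions_exist[OF T] .
  note sub = fine_subdivisionsD[OF Q]
  note R = riemann_sums_tendsto[where f = g, OF H T order_refl Q g C]
  have gm: "bdd_measurable 0 T g" by (rule R(1))
  have hs: "bdd_measurable s t (h i)" if "i \<in> I" "0 \<le> s" "t \<le> T" for i s t
    by (rule bdd_measurable_subset[OF h[OF that(1)] that(2,3)])
  have eq: "(\<Sum>s\<in>{s\<in>Q n. s < T}. g s * (H (nx (Q n) s) - H s)) =
      (\<Sum>i\<in>I. stieltjes_integral 0 T (\<lambda>u. g (pre (Q n) u) * h i u) (c i))" for n
  proof -
    have "(\<Sum>s\<in>{s\<in>Q n. s < T}. g s * (H (nx (Q n) s) - H s)) =
       (\<Sum>s\<in>{s\<in>Q n. s < T}. \<Sum>i\<in>I. stieltjes_integral s (nx (Q n) s) (\<lambda>u. g s * h i u) (c i))"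
    proof (rule sum.cong[OF refl])
      fix s assume "s \<in> {s\<in>Q n. s < T}"
      then have s: "s \<in> Q n" "s < T" by auto
      let ?s' = "nx (Q n) s"
      note n = nx_props[OF sub s(2), of n] and sb = subdivision_bounds[OF sub s(1)]
      have "H ?s' - H s = (\<Sum>i\<in>I. stieltjes_integral 0 ?s' (h i) (c i) - stieltjes_integral 0 s (h i) (c i))"
        using H_eq[of ?s'] H_eq[of s] n sb by (simp add: sum_subtractf)
      also have "\<dots> = (\<Sum>i\<in>I. stieltjes_integral s ?s' (h i) (c i))"
        by (rule sum.cong[OF refl]) (use stieltjes_integral_combine[OF c, of _ 0 s ?s'] hs n sb in auto)
      finally have "g s * (H ?s' - H s) = (\<Sum>i\<in>I. g s * stieltjes_integral s ?s' (h i) (c i))"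
        by (simp add: sum_distrib_left)
      also have "\<dots> = (\<Sum>i\<in>I. stieltjes_integral s ?s' (\<lambda>u. g s * h i u) (c i))"
        by (rule sum.cong[OF refl], rule stieltjes_integral_cmult[symmetric, OF c]) (use hs n sb in auto)
      finally show "g s * (H ?s' - H s) = (\<Sum>i\<in>I. stieltjes_integral s ?s' (\<lambda>u. g s * h i u) (c i))" .
    qed
    also have "\<dots> = (\<Sum>i\<in>I. \<Sum>s\<in>{s\<in>Q n. s < T}. stieltjes_integral s (nx (Q n) s) (\<lambda>u. g s * h i u) (c i))" by (rule sum.swap)
    also have "\<dots> = (\<Sum>i\<in>I. stieltjes_integral 0 T (\<lambda>u. g (pre (Q n) u) * h i u) (c i))"
    proof (rule sum.cong[OF refl])
      fix i assume i: "i \<in> I"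
      show "(\<Sum>s\<in>{s\<in>Q n. s < T}. stieltjes_integral s (nx (Q n) s) (\<lambda>u. g s * h i u) (c i)) =
          stieltjes_integral 0 T (\<lambda>u. g (pre (Q n) u) * h i u) (c i)"
        by (rule stieltjes_integral_pieces[OF c[OF i] order_refl order_refl sub, where h = "\<lambda>s u. g s * h i u", symmetric])
           (use hs[OF i] nx_props[OF sub] subdivision_bounds[OF sub] in \<open>auto intro: bdd_measurable_cmult\<close>)
    qed
    finally show ?thesis .
  qed
  have "(\<lambda>n. stieltjes_integral 0 T (\<lambda>u. g (pre (Q n) u) * h i u) (c i)) \<longlonglongrightarrow> stieltjes_integral 0 T (\<lambda>r. g r * h i r) (c i)"
    if i: "i \<in> I" for i
  proof -
    obtain B where B: "\<And>u. u \<in> {0<..T} \<Longrightarrow> \<bar>h i u\<bar> \<le> B" using h[OF i] unfolding bdd_measurable_def by blast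
    show ?thesis
    proof (rule stieltjes_integral_dominated_convergence[OF c[OF i] order_refl less_imp_le[OF T] order_refl, where C = "C * B"])
      show "bdd_measurable 0 T (\<lambda>u. g (pre (Q n) u) * h i u)" for n
        by (intro bdd_measurable_mult h[OF i] bdd_measurable_pieces[OF sub, where h = "\<lambda>s _. g s"] bdd_measurable_const)
      show "bdd_measurable 0 T (\<lambda>r. g r * h i r)" by (intro bdd_measurable_mult gm h[OF i])
      fix n u assume u: "u \<in> {0<..T}"
      have p: "pre (Q n) u \<in> {0..u}" "pre (Q n) u \<in> {0..T}" for n using pre_props[OF sub, of u n] u by auto
      show "\<bar>g (pre (Q n) u) * h i u\<bar> \<le> C * B"
        unfolding abs_mult using C[OF p(2)] B[OF u] order_trans[OF abs_ge_zero C[OF p(2)]] by (intro mult_mono) auto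
      show "(\<lambda>n. g (pre (Q n) u) * h i u) \<longlonglongrightarrow> g u * h i u"
        by (intro tendsto_mult tendsto_const g[OF u p(1)] pre_tendsto[OF Q]) (use u in auto)
    qed
  qed
  then have "(\<lambda>n. \<Sum>s\<in>{s\<in>Q n. s < T}. g s * (H (nx (Q n) s) - H s)) \<longlonglongrightarrow>
     (\<Sum>i\<in>I. stieltjes_integral 0 T (\<lambda>r. g r * h i r) (c i))"
    unfolding eq by (rule tendsto_sum)
  then show ?thesis using LIMSEQ_unique[OF R(2)] by blast
qed

section \<open>Step paths and sums along the partitions\<close>

context
  fixes T :: real and P :: "nat \<Rightarrow> real set"
  assumes T: "0 < T" and P: "refining_partitions T P"
begin

private lemma sub: "subdivision 0 T (P n)" and fine: "fine_subdivisions 0 T P"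
  using refining_partitions_fine(1)[OF P] by (auto simp: fine_subdivisions_def)

lemma partition_bounds: "s \<in> P n \<Longrightarrow> 0 \<le> s \<and> s \<le> T"
  using subdivision_bounds[OF sub] by auto

lemma step_path_eq:
  assumes u: "0 \<le> u" "u < T"
  shows "step_path T (P n) X u = X (nx (P n) u)"
proof -
  obtain r where r: "r \<in> P n" "r < T" "r \<le> u" "nx (P n) u \<le> nx (P n) r" using nx_close[OF sub u] .
  have un: "u < nx (P n) u" using nx_props[OF sub u(2)] by simp
  have rn: "nx (P n) r = nx (P n) u" by (rule nx_eq[OF sub r(1,2,3), symmetric]) (use r un in simp)
  have "(\<Sum>s\<in>P n. indicator {s..<successor T (P n) s} u *\<^sub>R X (successor T (P n) s)) =
     (\<Sum>s\<in>P n. if s = r then X (nx (P n) u) else 0)"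
  proof (rule sum.cong[OF refl])
    fix s assume s: "s \<in> P n"
    show "indicator {s..<successor T (P n) s} u *\<^sub>R X (successor T (P n) s) = (if s = r then X (nx (P n) u) else 0)"
    proof (cases "s = r")
      case True
      then show ?thesis using r rn un refining_partitions_fine(2)[OF P, of r n] by simp
    next
      case False
      have "u \<notin> {s..<successor T (P n) s}"
      proof
        assume us: "u \<in> {s..<successor T (P n) s}"
        have sT: "s < T" using us u by auto
        have us': "s \<le> u" "u < nx (P n) s" using us refining_partitions_fine(2)[OF P sT, of n] by auto
        consider "s < r" | "r < s" using False by linarith
        then show False
        proof cases
          case 1
          then show False using nx_least[OF sub r(1)] us' r by force
        next
          case 2
          then show False using nx_least[OF sub s] us' r un rn by force
        qed
      qed
      then show ?thesis using False by simp
    qed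
  qed
  also have "\<dots> = X (nx (P n) u)" using r subdivision_finite[OF sub] by simp
  finally show ?thesis using u by (simp add: step_path_def)
qed

text \<open>Just before a partition point \<open>s > 0\<close> the step path already has the value
  at the end of the preceding cell, so its left limit at \<open>s\<close> is
  \<open>X s\<close>.\<close>

lemma step_path_before_eq:
  fixes X :: "'d::finite path"
  assumes s: "s \<in> P n" and u: "u \<in> {0..T}"
  shows "step_path_before T (P n) X s u = stair (P n) 0 X s u"
proof (cases "s = 0")
  case True
  then show ?thesis using u by (simp add: step_path_before_def stair_def)
next
  case False
  then have s0: "0 < s" "s \<le> T" using partition_bounds[OF s] by auto
  note p = pre_props[OF sub s0(1), of n]
  have "\<forall>\<^sub>F v in at_left s. X s = step_path T (P n) X v"
  proof -
    have "step_path T (P n) X v = X s" if v: "v \<in> {pre (P n) s<..<s}" for v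
    proof -
      have "nx (P n) (pre (P n) s) = s" by (rule nx_pre[OF sub s s0(1)])
      then have "nx (P n) v = s" using nx_eq[OF sub p(1), of v] v p s0 by simp
      then show ?thesis using step_path_eq[of v n X] v p s0 by simp
    qed
    then show ?thesis using eventually_at_left_real[OF p(2)] by (auto elim!: eventually_mono)
  qed
  then have "(step_path T (P n) X \<longlongrightarrow> X s) (at_left s)"
    by (rule Lim_transform_eventually[OF tendsto_const])
  then have "Lim (at_left s) (step_path T (P n) X) = X s"
    by (rule tendsto_Lim[rotated]) simp
  then show ?thesis using False u s0 step_path_eq[of u n X] by (simp add: step_path_before_def stop_left_def stair_def)
qed

lemma nx_truncate:
  assumes s: "s \<in> P n" "s \<le> t" and u: "0 \<le> u" "u < s" and t: "t \<le> T"
  shows "nx (insert t (P n \<inter> {0..t})) u = nx (P n) u"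
proof -
  let ?Q = "insert t (P n \<inter> {0..t})"
  have t0: "0 \<le> t" using s u by auto
  have subQ: "subdivision 0 t ?Q" using sub[of n] t0 t by (auto simp: subdivision_def)
  have uT: "u < T" "u < t" using u s t by auto
  have nP: "nx (P n) u \<in> P n" "u < nx (P n) u" "nx (P n) u \<le> s" using nx_props[OF sub uT(1), of n] nx_least[OF sub s(1) u(2)] by auto
  have sQ: "s \<in> ?Q" using s u by auto
  have nQ: "nx ?Q u \<in> ?Q" "u < nx ?Q u" "nx ?Q u \<le> s" using nx_props[OF subQ uT(2)] nx_least[OF subQ sQ u(2)] by auto
  show ?thesis
  proof (rule antisym)
    show "nx ?Q u \<le> nx (P n) u" by (rule nx_least[OF subQ]) (use nP s u in auto)
    have "nx ?Q u \<in> P n" using nQ s by (cases "nx ?Q u = t") auto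
    then show "nx (P n) u \<le> nx ?Q u" using nQ by (intro nx_least[OF sub]) auto
  qed
qed

lemma oscillation_straddling:
  fixes x :: "real \<Rightarrow> 'b::real_normed_vector"
  assumes osc: "\<forall>u. 0 \<le> u \<and> u < T \<longrightarrow> norm (x (nx (P n) u) - x u) < e"
    and s: "s \<in> P n" "s \<le> t" "s < T" "t < nx (P n) s"
  shows "norm (x (nx (P n) s) - x s) < e" "norm (x (nx (P n) s) - x t) < e"
proof -
  have tT: "t < T" using nx_props[OF sub s(3), of n] s by auto
  show "norm (x (nx (P n) s) - x s) < e" using osc s partition_bounds[OF s(1)] by auto
  have "nx (P n) t = nx (P n) s" by (rule nx_eq[OF sub s(1,3,2,4)])
  then show "norm (x (nx (P n) s) - x t) < e" using osc tT s partition_bounds[OF s(1)] by (metis order_trans)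
qed

text \<open>The two sums differ only in the cell that reaches across \<open>t\<close>, whose
  contribution vanishes by uniform continuity.\<close>

lemma qv_sum_truncated:
  assumes x: "continuous_on {0..T} x" and t: "t \<in> {0..T}" and a: "a \<in> {0..t}"
  shows "(\<lambda>n. qv_sum T P x a n - (\<Sum>s\<in>{s\<in>P n. s \<le> a}. (x (min t (successor T (P n) s)) - x s)\<^sup>2)) \<longlonglongrightarrow> 0"
proof (rule tendstoI)
  fix e :: real assume e: "e > 0"
  \<comment> \<open>The cell across \<open>t\<close> contributes at most
    \<open>d^2 + (2 * d)^2\<close>, and \<open>d \<le> 1\<close> bounds this by
    \<open>5 * d < e\<close>.\<close>
  define d where "d = min 1 (e / 10)"
  have d: "0 < d" "d \<le> 1" "5 * d < e" using e by (auto simp: d_def)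
  show "\<forall>\<^sub>F n in sequentially. dist (qv_sum T P x a n - (\<Sum>s\<in>{s\<in>P n. s \<le> a}. (x (min t (successor T (P n) s)) - x s)\<^sup>2)) 0 < e"
    using fine_subdivisions_oscillation[OF fine x d(1)]
  proof eventually_elim
    case (elim n)
    let ?h = "\<lambda>s. (x (successor T (P n) s) - x s)\<^sup>2 - (x (min t (successor T (P n) s)) - x s)\<^sup>2"
    have "\<bar>\<Sum>s\<in>{s\<in>P n. s \<le> a}. ?h s\<bar> \<le> 5 * d"
    proof (rule sum_straddling_cell[OF sub, of t])
      fix s assume s: "s \<in> P n" "s < T" "nx (P n) s \<le> t"
      then show "?h s = 0" using refining_partitions_fine(2)[OF P s(2)] by (simp add: min_absorb2)
    next
      fix s assume s: "s \<in> P n" "s \<le> t" "s < T" "t < nx (P n) s"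
      let ?y = "x (nx (P n) s)"
      have 1: "\<bar>?y - x s\<bar> < d" "\<bar>?y - x t\<bar> < d" using oscillation_straddling[OF elim s] by simp_all
      then have "\<bar>x t - x s\<bar> \<le> 2 * d" by linarith
      then have "(x t - x s)\<^sup>2 \<le> (2 * d)\<^sup>2" by (meson abs_le_square_iff abs_ge_self order_trans d(1) less_imp_le abs_of_nonneg mult_nonneg_nonneg zero_le_numeral)
      moreover have "(?y - x s)\<^sup>2 \<le> d\<^sup>2" using 1(1) d(1) by (metis abs_le_square_iff abs_of_pos less_imp_le)
      moreover have "d\<^sup>2 \<le> d" using d by (simp add: power2_eq_square mult_left_le)
      moreover have "(2 * d)\<^sup>2 = 4 * d\<^sup>2" by (simp add: power2_eq_square)
      moreover have "0 \<le> (?y - x s)\<^sup>2" "0 \<le> (x t - x s)\<^sup>2" by simp_all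
      ultimately have "\<bar>(?y - x s)\<^sup>2 - (x t - x s)\<^sup>2\<bar> \<le> 5 * d" by linarith
      then show "\<bar>?h s\<bar> \<le> 5 * d" using refining_partitions_fine(2)[OF P s(3)] s(4) by simp
    next
      show "?h T = 0" if "T \<le> a" using refining_partitions_fine(3)[OF P] t a that by (cases "t = T") auto
    qed (use t a d in auto)
    then show ?case using d by (simp add: qv_sum_def sum_subtractf)
  qed
qed

text \<open>At \<open>a = 0\<close> the quadratic variation is 0 by definition, while the sum is the
  square of the first increment, which tends to 0 by continuity of \<open>x\<close>.\<close>

lemma qv_sum_tendsto:
  assumes x: "admits_qv_real T P x" and a: "a \<in> {0..T}"
  shows "qv_sum T P x a \<longlonglongrightarrow> quadratic_variation T P x a"
proof (cases "a = 0")
  case True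
  have cont: "continuous_on {0..T} x" using x by (simp add: admits_qv_real_def)
  have "(\<lambda>n. qv_sum T P x 0 n - (\<Sum>s\<in>{s\<in>P n. s \<le> 0}. (x (min 0 (successor T (P n) s)) - x s)\<^sup>2)) \<longlonglongrightarrow> 0"
    by (rule qv_sum_truncated[OF cont]) (use T in auto)
  moreover have "(\<Sum>s\<in>{s\<in>P n. s \<le> 0}. (x (min 0 (successor T (P n) s)) - x s)\<^sup>2) = 0" for n
  proof (rule sum.neutral, rule ballI)
    fix s assume s: "s \<in> {s\<in>P n. s \<le> 0}"
    then have s0: "s = 0" using partition_bounds by force
    have "0 < successor T (P n) 0" using nx_props[OF sub T] refining_partitions_fine(2)[OF P T] by simp
    then show "(x (min 0 (successor T (P n) s)) - x s)\<^sup>2 = 0" using s0 by simp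
  qed
  ultimately show ?thesis using True by (simp add: quadratic_variation_def)
next
  case False
  then show ?thesis using x a unfolding admits_qv_real_def quadratic_variation_def
    by (auto simp: convergent_LIMSEQ_iff)
qed

lemma quadratic_variation_mono:
  assumes x: "admits_qv_real T P x" and ab: "0 \<le> a" "a \<le> b" "b \<le> T"
  shows "quadratic_variation T P x a \<le> quadratic_variation T P x b"
proof (rule LIMSEQ_le[OF qv_sum_tendsto[OF x] qv_sum_tendsto[OF x]])
  have "qv_sum T P x a n \<le> qv_sum T P x b n" for n
    unfolding qv_sum_def by (rule sum_mono2) (use ab subdivision_finite[OF sub] in auto)
  then show "\<exists>N. \<forall>n\<ge>N. qv_sum T P x a n \<le> qv_sum T P x b n" by blast
qed (use ab in auto)

text \<open>Supplies the input of the Ito formula on \<open>[0,t]\<close>. The squared increments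
  cut at \<open>t\<close> are those of the truncated partition, and a partition point at
  \<open>t\<close> itself contributes 0.\<close>

lemma quadratic_variation_truncated:
  assumes x: "admits_qv_real T P x" and t: "0 < t" "t \<le> T" and a: "a \<in> {0..t}" and Q: "Q = (\<lambda>n. insert t (P n \<inter> {0..t}))"
  shows "(\<lambda>n. \<Sum>s\<in>{s\<in>{s\<in>Q n. s < t}. s \<le> a}. (x (nx (Q n) s) - x s)\<^sup>2) \<longlonglongrightarrow> quadratic_variation T P x a"
proof -
  have cont: "continuous_on {0..T} x" using x by (simp add: admits_qv_real_def)
  have tT: "t \<in> {0..T}" and aT: "a \<in> {0..T}" using t a by auto
  have eq: "(\<Sum>s\<in>{s\<in>P n. s \<le> a}. (x (min t (successor T (P n) s)) - x s)\<^sup>2) =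
     (\<Sum>s\<in>{s\<in>{s\<in>Q n. s < t}. s \<le> a}. (x (nx (Q n) s) - x s)\<^sup>2)" for n
  proof (rule sum.mono_neutral_cong_right)
    show "finite {s\<in>P n. s \<le> a}" using subdivision_finite[OF sub] by simp
    show "{s\<in>{s\<in>Q n. s < t}. s \<le> a} \<subseteq> {s\<in>P n. s \<le> a}" unfolding Q by auto
    show "\<forall>s\<in>{s\<in>P n. s \<le> a} - {s\<in>{s\<in>Q n. s < t}. s \<le> a}. (x (min t (successor T (P n) s)) - x s)\<^sup>2 = 0"
    proof
      fix s assume s: "s \<in> {s\<in>P n. s \<le> a} - {s\<in>{s\<in>Q n. s < t}. s \<le> a}"
      then have st: "s = t" using a partition_bounds[of s n] unfolding Q by auto
      have "t \<le> successor T (P n) t"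
        using nx_props[OF sub, of t n] refining_partitions_fine(2,3)[OF P] t by (cases "t < T") auto
      then show "(x (min t (successor T (P n) s)) - x s)\<^sup>2 = 0" using st by (simp add: min_absorb1)
    qed
    fix s assume s: "s \<in> {s\<in>{s\<in>Q n. s < t}. s \<le> a}"
    then have "s \<in> P n" "s < t" unfolding Q by auto
    then show "(x (min t (successor T (P n) s)) - x s)\<^sup>2 = (x (nx (Q n) s) - x s)\<^sup>2"
      using fine_subdivisions_truncate(2)[OF fine _ t(2) Q] refining_partitions_fine(2)[OF P, of s n] t by simp
  qed
  show ?thesis
    using tendsto_diff[OF qv_sum_tendsto[OF x aT] qv_sum_truncated[OF cont tT a]] unfolding eq by simp
qed

section \<open>Covariations and the limit of Ito sums\<close>

context
  fixes X :: "'d::finite path"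
  assumes qv: "admits_qv T P X"
begin

lemma admits_qv_sum: "admits_qv_real T P (\<lambda>s. X s $ i + X s $ j)"
  using qv by (simp add: admits_qv_def)

text \<open>\<open>admits_qv\<close> speaks only of the sums \<open>X_i + X_j\<close>, so the
  quadratic variation of \<open>X_i\<close> is recovered from that of \<open>2 * X_i\<close> through
  the factor 4.\<close>

lemma covariation_eq:
  assumes x: "x \<in> {0..T}"
  shows "covariation T P X i j x = (quadratic_variation T P (\<lambda>s. X s $ i + X s $ j) x
     - quadratic_variation T P (\<lambda>s. X s $ i + X s $ i) x / 4 - quadratic_variation T P (\<lambda>s. X s $ j + X s $ j) x / 4) / 2"
proof -
  have *: "quadratic_variation T P (\<lambda>s. X s $ k) x = quadratic_variation T P (\<lambda>s. X s $ k + X s $ k) x / 4" for k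
  proof (cases "x = 0")
    case False
    have "qv_sum T P (\<lambda>s. X s $ k + X s $ k) x = (\<lambda>n. 4 * qv_sum T P (\<lambda>s. X s $ k) x n)"
      by (simp add: qv_sum_def sum_distrib_left fun_eq_iff power2_eq_square algebra_simps)
    then have "(\<lambda>n. 4 * qv_sum T P (\<lambda>s. X s $ k) x n / 4) \<longlonglongrightarrow> quadratic_variation T P (\<lambda>s. X s $ k + X s $ k) x / 4"
      using tendsto_divide[OF qv_sum_tendsto[OF admits_qv_sum x] tendsto_const[of 4], of k k] by simp
    then have "lim (qv_sum T P (\<lambda>s. X s $ k) x) = quadratic_variation T P (\<lambda>s. X s $ k + X s $ k) x / 4"
      by (intro limI) simp
    then show ?thesis using False by (simp add: quadratic_variation_def)
  qed (simp add: quadratic_variation_def)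
  show ?thesis unfolding covariation_def *[of i] *[of j] ..
qed

text \<open>A combination of three nondecreasing functions with coefficients of modulus at most 1
  has increments dominated by those of their sum.\<close>

lemma cont_bv_covariation: "cont_bv T (covariation T P X i j)"
proof -
  let ?v = "\<lambda>i j. quadratic_variation T P (\<lambda>s. X s $ i + X s $ j)"
  have c: "continuous_on {0..T} (?v i j)" for i j using admits_qv_sum by (simp add: admits_qv_real_def)
  have "continuous_on {0..T} (\<lambda>x. (?v i j x - ?v i i x / 4 - ?v j j x / 4) / 2)"
    by (intro continuous_intros c) auto
  then have "continuous_on {0..T} (covariation T P X i j)"
    by (rule continuous_on_eq) (rule covariation_eq[symmetric])
  moreover have "bounded_variation_on 0 T (covariation T P X i j)"
  proof (rule bounded_variation_onI[where \<phi> = "\<lambda>x. ?v i j x + ?v i i x + ?v j j x"])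
    have *: "\<bar>(a' - b' / 4 - c' / 4) / 2 - (a - b / 4 - c / 4) / 2\<bar> \<le> a' + b' + c' - (a + b + c)"
      if "a \<le> a'" "b \<le> b'" "c \<le> c'" for a b c a' b' c' :: real
      unfolding abs_le_iff using that by (intro conjI) (simp add: field_simps)+
    fix x y :: real assume xy: "0 \<le> x" "x \<le> y" "y \<le> T"
    have m: "?v i j x \<le> ?v i j y" "?v i i x \<le> ?v i i y" "?v j j x \<le> ?v j j y"
      by (rule quadratic_variation_mono[OF admits_qv_sum xy])+
    have x: "x \<in> {0..T}" and y: "y \<in> {0..T}" using xy by auto
    show "\<bar>covariation T P X i j y - covariation T P X i j x\<bar> \<le>
       ?v i j y + ?v i i y + ?v j j y - (?v i j x + ?v i i x + ?v j j x)"
      unfolding covariation_eq[OF x] covariation_eq[OF y] by (rule *[OF m])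
  qed
  ultimately show ?thesis by (simp add: cont_bv_def)
qed

text \<open>For \<open>t\<close> inside a cell the last increment of the Ito sum reaches beyond
  \<open>t\<close>; cutting it at \<open>t\<close> costs at most a bound of the gradient times the
  oscillation of \<open>X\<close> over a cell. The cut sum is the Ito sum of the truncated
  partition, to which the functional Ito formula applies.\<close>

theorem ito_sum_tendsto:
  assumes U: "open U" and F: "C12c_via T m U S F DF" and A: "A \<in> CBV T m S"
    and X: "continuous_on {0..T} X" "X ` {0..T} \<subseteq> U"
    and \<xi>: "\<And>t Z. t \<in> {0..T} \<Longrightarrow> Z \<in> cadlag_paths T U \<Longrightarrow> \<xi> t Z = vertical_gradient T F t Z A"
    and t: "t \<in> {0..T}"
  shows "ito_sum T P \<xi> X t \<longlonglongrightarrow>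
      F t X A - F 0 X A - (\<Sum>i\<le>m. stieltjes_integral 0 t (\<lambda>r. DF i r X A) (integrator A i))
      - (\<Sum>j\<in>UNIV. \<Sum>i\<in>UNIV. stieltjes_integral 0 t (\<lambda>r. vertical_partial T i (vertical_partial T j F) r X A) (covariation T P X i j)) / 2"
    (is "_ \<longlonglongrightarrow> ?L")
proof -
  note D = C12c_viaD[OF F]
  have XU: "X \<in> cadlag_paths T U" by (rule cadlag_paths_continuous[OF X])
  define Q where "Q = (\<lambda>n. insert t (P n \<inter> {0..t}))"
  let ?w = "\<lambda>n s. vertical_gradient T F s (stair (P n) 0 X s) A"
  have stP: "stair (P n) 0 X s \<in> cadlag_paths T U" if "s \<in> P n" for s n
    by (rule stair_cadlag[OF sub order_refl order_refl XU that])
  have sT: "s \<in> {0..T}" if "s \<in> P n" for s n using partition_bounds[OF that] by simp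
  have \<xi>w: "\<xi> s (step_path_before T (P n) X s) = ?w n s" if s: "s \<in> P n" for s n
  proof -
    \<comment> \<open>The two paths are known to agree only on \<open>[0,T]\<close>, so the
      gradients are identified through non-anticipativity.\<close>
    have b: "step_path_before T (P n) X s \<in> cadlag_paths T U"
      by (rule cadlag_paths_cong[OF stP[OF s]]) (rule step_path_before_eq[OF s, symmetric])
    have "vertical_partial T i F s (step_path_before T (P n) X s) A = vertical_partial T i F s (stair (P n) 0 X s) A" for i
      by (rule non_anticipative_cong[OF T U non_anticipative_vertical_partial[OF T U D(2)] sT[OF s] b stP[OF s] _ A A])
         (rule step_path_before_eq[OF s], use sT[OF s] in auto)
    then show ?thesis using \<xi>[OF sT[OF s] b] by (simp add: vertical_gradient_def)
  qed
  obtain K where K: "compact K" "K \<subseteq> U" "X \<in> cadlag_paths T K" using cadlag_paths_compact[OF XU U] .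
  have "\<exists>C. \<forall>s\<in>{0..T}. \<forall>Z\<in>cadlag_paths T K. \<bar>vertical_partial T i F s Z A\<bar> \<le> C" for i
    using boundedness_preservingD[OF T U D(7)[of i] A K(1,2)] by metis
  then obtain C where C: "\<And>i s Z. s \<in> {0..T} \<Longrightarrow> Z \<in> cadlag_paths T K \<Longrightarrow> \<bar>vertical_partial T i F s Z A\<bar> \<le> C i" by metis
  \<comment> \<open>The added 1 makes \<open>B\<close> positive, since \<open>e\<close> is divided
    by it below.\<close>
  define B where "B = \<bar>\<Sum>i\<in>UNIV. C i\<bar> + 1"
  have wB: "norm (?w n s) \<le> B" if "s \<in> P n" for s n
  proof -
    have "norm (?w n s) \<le> (\<Sum>i\<in>UNIV. \<bar>?w n s $ i\<bar>)" by (rule norm_le_l1_cart)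
    also have "\<dots> \<le> (\<Sum>i\<in>UNIV. C i)"
      by (rule sum_mono) (simp add: vertical_gradient_def C[OF sT[OF that] stair_cadlag[OF sub order_refl order_refl K(3) that]])
    finally show ?thesis unfolding B_def by linarith
  qed
  have B0: "B > 0" by (simp add: B_def)
  let ?tr = "\<lambda>n. \<Sum>s\<in>{s\<in>P n. s \<le> t}. ?w n s \<bullet> (X (min t (successor T (P n) s)) - X s)"
  have diff: "(\<lambda>n. ito_sum T P \<xi> X t n - ?tr n) \<longlonglongrightarrow> 0"
  proof (rule tendstoI)
    fix e :: real assume e: "e > 0"
    define d where "d = e / (2 * B)"
    have d: "d > 0" "B * d < e" using e B0 by (auto simp: d_def field_simps)
    show "\<forall>\<^sub>F n in sequentially. dist (ito_sum T P \<xi> X t n - ?tr n) 0 < e"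
      using fine_subdivisions_oscillation[OF fine X(1) d(1)]
    proof eventually_elim
      case (elim n)
      let ?h = "\<lambda>s. ?w n s \<bullet> (X (successor T (P n) s) - X (min t (successor T (P n) s)))"
      have "\<bar>\<Sum>s\<in>{s\<in>P n. s \<le> t}. ?h s\<bar> \<le> B * d"
      proof (rule sum_straddling_cell[OF sub, of t])
        fix s assume s: "s \<in> P n" "s < T" "nx (P n) s \<le> t"
        then show "?h s = 0" using refining_partitions_fine(2)[OF P s(2)] by (simp add: min_absorb2)
      next
        fix s assume s: "s \<in> P n" "s \<le> t" "s < T" "t < nx (P n) s"
        have "norm (X (nx (P n) s) - X t) < d" using oscillation_straddling(2)[OF elim s] .
        then have "norm (?w n s) * norm (X (nx (P n) s) - X t) \<le> B * d"
          using wB[OF s(1)] B0 by (intro mult_mono) auto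
        then have "\<bar>?w n s \<bullet> (X (nx (P n) s) - X t)\<bar> \<le> B * d" using Cauchy_Schwarz_ineq2 order_trans by blast
        then show "\<bar>?h s\<bar> \<le> B * d" using refining_partitions_fine(2)[OF P s(3)] s(4) by simp
      next
        show "?h T = 0" if "T \<le> t" using refining_partitions_fine(3)[OF P] t that by (simp add: min_def)
      qed (use t d B0 in auto)
      moreover have "ito_sum T P \<xi> X t n - ?tr n = (\<Sum>s\<in>{s\<in>P n. s \<le> t}. ?h s)"
        unfolding ito_sum_def sum_subtractf[symmetric]
        by (rule sum.cong[OF refl]) (simp add: \<xi>w inner_diff_right)
      ultimately show ?case using d by simp
    qed
  qed
  have st: "t \<le> successor T (P n) t" for n
    using nx_props[OF sub, of t n] refining_partitions_fine(2,3)[OF P] t by (cases "t < T") auto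
  have "?tr \<longlonglongrightarrow> ?L"
  proof (cases "t = 0")
    case True
    have "?tr n = 0" for n
    proof (rule sum.neutral, rule ballI)
      fix s assume "s \<in> {s\<in>P n. s \<le> t}"
      then have "s = t" using True partition_bounds by force
      then show "?w n s \<bullet> (X (min t (successor T (P n) s)) - X s) = 0" using st[of n] by (simp add: min_absorb1)
    qed
    moreover have "?L = 0" using True by (simp add: stieltjes_integral_refl)
    ultimately show ?thesis by (simp only: tendsto_const)
  next
    case False
    then have t': "0 < t" "t \<le> T" using t by auto
    have Qf: "fine_subdivisions 0 t Q" by (rule fine_subdivisions_truncate(1)[OF fine _ t'(2) Q_def]) (use t' in simp)
    have nxQ: "nx (Q n) s = min t (nx (P n) s)" if "s \<in> P n" "s < t" for n s
      by (rule fine_subdivisions_truncate(2)[OF fine _ t'(2) Q_def that]) (use t' in simp)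
    let ?v = "\<lambda>i j. quadratic_variation T P (\<lambda>s. X s $ i + X s $ j)"
    have lim: "(\<lambda>n. \<Sum>s\<in>{s\<in>Q n. s < t}. vertical_gradient T F s (stair (Q n) 0 X s) A \<bullet> (X (nx (Q n) s) - X s)) \<longlonglongrightarrow> ?L"
    proof (rule functional_ito_formula[OF T U F A XU t' _ Qf, where v = ?v])
      show "continuous_on {0..t} X" by (rule continuous_on_subset[OF X(1)]) (use t' in auto)
      fix i j
      show "(\<lambda>n. \<Sum>s\<in>{s\<in>{s\<in>Q n. s < t}. s \<le> x}. ((X (nx (Q n) s) - X s) $ i + (X (nx (Q n) s) - X s) $ j)\<^sup>2) \<longlonglongrightarrow> ?v i j x"
        if "x \<in> {0..t}" for x
        using quadratic_variation_truncated[OF admits_qv_sum t' that Q_def, of i j] by (simp add: algebra_simps)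
      have "continuous_on {0..T} (?v i j)" using admits_qv_sum by (simp add: admits_qv_real_def)
      then show "continuous_on {0..t} (?v i j)" by (rule continuous_on_subset) (use t' in auto)
      show "?v i j x \<le> ?v i j y" if "0 \<le> x" "x \<le> y" "y \<le> t" for x y
        by (rule quadratic_variation_mono[OF admits_qv_sum]) (use that t' in auto)
      show "?v i j 0 = 0" by (simp add: quadratic_variation_def)
      show "cont_bv T (covariation T P X i j)" by (rule cont_bv_covariation)
      show "covariation T P X i j x = (?v i j x - ?v i i x / 4 - ?v j j x / 4) / 2" if "x \<in> {0..t}" for x
        by (rule covariation_eq) (use that t' in auto)
    qed
    moreover have "(\<Sum>s\<in>{s\<in>Q n. s < t}. vertical_gradient T F s (stair (Q n) 0 X s) A \<bullet> (X (nx (Q n) s) - X s)) = ?tr n" for n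
    proof (rule sum.mono_neutral_cong_left)
      show "finite {s\<in>P n. s \<le> t}" using subdivision_finite[OF sub] by simp
      show "{s\<in>Q n. s < t} \<subseteq> {s\<in>P n. s \<le> t}" unfolding Q_def by auto
      show "\<forall>s\<in>{s\<in>P n. s \<le> t} - {s\<in>Q n. s < t}. ?w n s \<bullet> (X (min t (successor T (P n) s)) - X s) = 0"
      proof
        fix s assume "s \<in> {s\<in>P n. s \<le> t} - {s\<in>Q n. s < t}"
        then have "s = t" using partition_bounds[of s n] unfolding Q_def by auto
        then show "?w n s \<bullet> (X (min t (successor T (P n) s)) - X s) = 0" using st[of n] by (simp add: min_absorb1)
      qed
      fix s assume "s \<in> {s\<in>Q n. s < t}"
      then have s: "s \<in> P n" "s < t" unfolding Q_def by auto
      have "stair (Q n) 0 X s = stair (P n) 0 X s"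
        using nx_truncate[OF s(1) less_imp_le[OF s(2)] _ _ t'(2)] by (auto simp: stair_def Q_def fun_eq_iff)
      moreover have "successor T (P n) s = nx (P n) s" by (rule refining_partitions_fine(2)[OF P]) (use s t' in auto)
      ultimately show "vertical_gradient T F s (stair (Q n) 0 X s) A \<bullet> (X (nx (Q n) s) - X s) =
         ?w n s \<bullet> (X (min t (successor T (P n) s)) - X s)" using nxQ[OF s] by simp
    qed
    ultimately show ?thesis by simp
  qed
  from tendsto_add[OF diff this] show ?thesis by simp
qed

end

end

section \<open>Associativity\<close>

text \<open>The components of all controls are numbered through by a bijection \<open>h\<close> from
  the disjoint union of their index sets. Openness of \<open>S'\<close> uses that only finitely many
  preimages are intersected.\<close>

lemma joint_control:
  fixes m :: "'k::finite \<Rightarrow> nat"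
  assumes m: "\<And>k. m k \<ge> 1" and S: "\<And>k. openin (Euclidean_space (m k)) (S k)" and A: "\<And>k. A k \<in> CBV T (m k) (S k)"
  obtains q S' A' \<sigma> where "q \<ge> 1" "openin (Euclidean_space q) S'" "A' \<in> CBV T q S'"
    "\<And>k j. j < m k \<Longrightarrow> \<sigma> k j < q" "\<And>k x. x \<in> S' \<Longrightarrow> project (\<sigma> k) (m k) x \<in> S k"
    "\<And>k t. t \<in> {0..T} \<Longrightarrow> project (\<sigma> k) (m k) (A' t) = A k t"
proof -
  define I where "I = (SIGMA k : UNIV. {..<m k})"
  define q where "q = card I"
  have fin: "finite I" by (simp add: I_def)
  obtain h where h: "bij_betw h I {0..<q}" using ex_bij_betw_finite_nat[OF fin] unfolding q_def by blast
  define \<sigma> where "\<sigma> = (\<lambda>k j. h (k, j))"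
  have \<sigma>: "\<sigma> k j < q" if "j < m k" for k j
    using bij_betwE[OF h, rule_format, of "(k, j)"] that by (auto simp: \<sigma>_def I_def)
  define A' where "A' = (\<lambda>t x. if x < q then A (fst (inv_into I h x)) t (snd (inv_into I h x)) else 0)"
  have AS: "A k t \<in> S k" if "t \<in> {0..T}" for k t using A[of k] that by (simp add: CBV_def)
  have A0: "A k t j = 0" if "t \<in> {0..T}" "j \<ge> m k" for k t j
    using AS[OF that(1), of k] openin_subset[OF S[of k]] that(2) by (auto simp: topspace_Euclidean_space)
  have pA: "project (\<sigma> k) (m k) (A' t) = A k t" if t: "t \<in> {0..T}" for k t
  proof
    fix j
    show "project (\<sigma> k) (m k) (A' t) j = A k t j"
    proof (cases "j < m k")
      case True
      then have "(k, j) \<in> I" by (simp add: I_def)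
      then have "inv_into I h (\<sigma> k j) = (k, j)" using h by (simp add: \<sigma>_def bij_betw_def)
      then show ?thesis using True \<sigma>[OF True] by (simp add: project_def A'_def)
    next
      case False
      then show ?thesis using A0[OF t, of k j] by (simp add: project_def)
    qed
  qed
  define S' where "S' = (\<Inter>k. {x \<in> topspace (Euclidean_space q). project (\<sigma> k) (m k) x \<in> S k})"
  show thesis
  proof
    \<comment> \<open>Any one of the controls has a component, because
      \<open>m k \<ge> 1\<close>.\<close>
    have "(undefined, 0) \<in> I" using m[of undefined] by (simp add: I_def)
    then show "q \<ge> 1" using fin by (auto simp: q_def Suc_le_eq card_gt_0_iff)
    show "openin (Euclidean_space q) S'" unfolding S'_def
      by (rule openin_INT2) (auto intro!: openin_project[OF S \<sigma>])
    have top: "A' t \<in> topspace (Euclidean_space q)" for t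
      by (simp add: topspace_Euclidean_space A'_def)
    show "A' \<in> CBV T q S'"
      unfolding CBV_def
    proof (intro CollectI conjI ballI allI impI)
      show "A' t \<in> S'" if "t \<in> {0..T}" for t using top[of t] pA[OF that] AS[OF that] by (simp add: S'_def)
      fix x assume x: "x < q"
      have "inv_into I h x \<in> I" using x h by (metis atLeast0LessThan bij_betw_def inv_into_into lessThan_iff)
      then have "snd (inv_into I h x) < m (fst (inv_into I h x))" by (auto simp: I_def)
      then show "continuous_on {0..T} (\<lambda>t. A' t x)" "bounded_variation_on 0 T (\<lambda>t. A' t x)"
        using A[of "fst (inv_into I h x)"] x by (auto simp: A'_def CBV_def)
    qed
  qed (use \<sigma> pA S'_def in auto)
qed

text \<open>Each covariation \<open>[X_i, X_j]\<close> is, through \<open>\<epsilon>\<close>, one of the integrators; a functional without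
  drift is one whose horizontal derivative cancels the second order term of the Ito formula.\<close>

definition carries_covariation ::
    "real \<Rightarrow> (nat \<Rightarrow> real set) \<Rightarrow> nat \<Rightarrow> ('d \<times> 'd \<Rightarrow> nat) \<Rightarrow> 'd::finite path \<Rightarrow> (real \<Rightarrow> nat \<Rightarrow> real) \<Rightarrow> bool" where
  "carries_covariation T P q \<epsilon> X A \<longleftrightarrow>
     (\<forall>p. \<epsilon> p \<le> q \<and> (\<forall>t\<in>{0..T}. integrator A (\<epsilon> p) t = covariation T P X (snd p) (fst p) t))"

definition driftless ::
    "real \<Rightarrow> nat \<Rightarrow> ('d \<times> 'd \<Rightarrow> nat) \<Rightarrow> 'd::finite path \<Rightarrow> (real \<Rightarrow> nat \<Rightarrow> real) \<Rightarrow> 'd functional \<Rightarrow> (nat \<Rightarrow> 'd functional) \<Rightarrow> bool" where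
  "driftless T q \<epsilon> X A F DF \<longleftrightarrow> (\<forall>r\<in>{0<..T}. \<forall>i\<le>q. DF i r X A =
     - (\<Sum>p\<in>UNIV. if i = \<epsilon> p then vertical_partial T (snd p) (vertical_partial T (fst p) F) r X A / 2 else 0))"

text \<open>Passes from the integrators of a control to the covariations that they carry. In the
  applications the pair \<open>(j, i)\<close> stands for the derivative taken in direction
  \<open>j\<close> and then in direction \<open>i\<close>.\<close>

lemma sum_covariation_integral:
  fixes X :: "'d::finite path"
  assumes A: "A \<in> CBV T q S" and c: "carries_covariation T P q \<epsilon> X A" and t: "t \<in> {0..T}"
    and f: "\<And>p. bdd_measurable 0 t (f p)"
    and D: "\<And>i r. i \<le> q \<Longrightarrow> r \<in> {0<..t} \<Longrightarrow> D i r = (\<Sum>p\<in>UNIV. if i = \<epsilon> p then f p r else 0)"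
  shows "(\<Sum>i\<le>q. stieltjes_integral 0 t (D i) (integrator A i)) =
    (\<Sum>j\<in>UNIV. \<Sum>i\<in>UNIV. stieltjes_integral 0 t (f (j, i)) (covariation T P X i j))"
proof -
  have "(\<Sum>i\<le>q. stieltjes_integral 0 t (D i) (integrator A i)) =
     (\<Sum>i\<le>q. stieltjes_integral 0 t (\<lambda>r. \<Sum>p\<in>UNIV. if i = \<epsilon> p then f p r else 0) (integrator A i))"
    by (rule sum.cong[OF refl], rule stieltjes_integral_cong) (use D t in auto)
  also have "\<dots> = (\<Sum>p\<in>UNIV. stieltjes_integral 0 t (f p) (integrator A (\<epsilon> p)))"
  proof (rule sum_stieltjes_integral_reindex[where T = T])
    show "cont_bv T (integrator A i)" if "i \<le> q" for i using cont_bv_integrator[OF A that] t by simp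
  qed (use t f c in \<open>auto simp: carries_covariation_def\<close>)
  also have "\<dots> = (\<Sum>p\<in>UNIV. stieltjes_integral 0 t (f p) (covariation T P X (snd p) (fst p)))"
    by (rule sum.cong[OF refl], rule stieltjes_integral_cong) (use c t in \<open>auto simp: carries_covariation_def\<close>)
  also have "\<dots> = (\<Sum>(j, i)\<in>UNIV \<times> UNIV. stieltjes_integral 0 t (f (j, i)) (covariation T P X i j))"
    by (rule sum.cong) auto
  finally show ?thesis by (simp only: sum.cartesian_product)
qed

context
  fixes T :: real and m q :: nat and U :: "(real ^ 'd::finite) set" and S S' :: "(nat \<Rightarrow> real) set" and \<sigma> :: "nat \<Rightarrow> nat"
    and F :: "'d functional" and DF :: "nat \<Rightarrow> 'd functional" and A A' :: "real \<Rightarrow> nat \<Rightarrow> real"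
  assumes T: "0 < T" and U: "open U"
    and S': "\<And>x. x \<in> S' \<Longrightarrow> project \<sigma> m x \<in> S" and \<sigma>: "\<And>j. j < m \<Longrightarrow> \<sigma> j < q"
    and F: "C12c_via T m U S F DF" and A: "A \<in> CBV T m S" and A': "A' \<in> CBV T q S'"
    and eq: "\<And>t. t \<in> {0..T} \<Longrightarrow> project \<sigma> m (A' t) = A t"
begin

lemma project_control:
  assumes H: "non_anticipative T m U S H" and t: "t \<in> {0..T}" and Z: "Z \<in> cadlag_paths T U"
  shows "H t Z (\<lambda>t. project \<sigma> m (A' t)) = H t Z A"
  by (rule non_anticipative_cong[OF T U H t Z Z refl project_CBV[OF A' S' \<sigma>] A]) (use t eq in auto)

lemma vertical_gradient_project:
  assumes t: "t \<in> {0..T}" and Z: "Z \<in> cadlag_paths T U"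
  shows "vertical_gradient T (\<lambda>t X A. F t X (\<lambda>t. project \<sigma> m (A t))) t Z A' = vertical_gradient T F t Z A"
proof -
  have "vertical_partial T i (\<lambda>t X A. F t X (\<lambda>t. project \<sigma> m (A t))) t Z A' = vertical_partial T i F t Z A" for i
    unfolding vertical_partial_project[of T _ F]
    by (rule project_control[OF non_anticipative_vertical_partial[OF T U C12c_viaD(2)[OF F]] t Z])
  then show ?thesis by (simp add: vertical_gradient_def)
qed

text \<open>Enlarging the control moves the components of \<open>DF\<close> and the integrators that
  carry covariations to new indices in the same way, and leaves the second derivatives along
  \<open>X\<close> unchanged. The cancellation thus survives when the control of \<eta> is
  added.\<close>

lemma driftless_project:
  assumes d: "driftless T m \<epsilon> X A F DF" and \<epsilon>: "\<And>p. \<epsilon> p \<le> m" and X: "X \<in> cadlag_paths T U"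
  shows "driftless T q (\<lambda>p. project_index \<sigma> (\<epsilon> p)) X A' (\<lambda>t X A. F t X (\<lambda>t. project \<sigma> m (A t)))
    (\<lambda>i t X A. \<Sum>j\<le>m. if i = project_index \<sigma> j then DF j t X (\<lambda>t. project \<sigma> m (A t)) else 0)"
  unfolding driftless_def
proof (intro ballI allI impI)
  fix r i assume r: "r \<in> {0<..T}" and i: "i \<le> q"
  let ?H = "\<lambda>p. vertical_partial T (snd p) (vertical_partial T (fst p) F) r X A / 2"
  have r': "r \<in> {0..T}" using r by simp
  note na = C12c_viaD(2)[OF F]
  have DF: "DF j r X (\<lambda>t. project \<sigma> m (A' t)) = - (\<Sum>p\<in>UNIV. if j = \<epsilon> p then ?H p else 0)" if j: "j \<le> m" for j
  proof -
    have "DF j r X (\<lambda>t. project \<sigma> m (A' t)) = DF j r X A"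
      by (rule project_control[OF horizontal_integrandD(1)[OF T U C12c_via_horizontal_integrand[OF F j]] r' X])
    then show ?thesis using d r j by (simp add: driftless_def)
  qed
  have "(\<Sum>j\<le>m. if i = project_index \<sigma> j then DF j r X (\<lambda>t. project \<sigma> m (A' t)) else 0) =
     (\<Sum>j\<le>m. \<Sum>p\<in>UNIV. if j = \<epsilon> p then (if i = project_index \<sigma> (\<epsilon> p) then - ?H p else 0) else 0)"
    by (rule sum.cong[OF refl]) (auto simp: DF sum_negf[symmetric] intro!: sum.cong sum.neutral)
  also have "\<dots> = (\<Sum>p\<in>UNIV. \<Sum>j\<le>m. if j = \<epsilon> p then (if i = project_index \<sigma> (\<epsilon> p) then - ?H p else 0) else 0)"
    by (rule sum.swap)
  also have "\<dots> = (\<Sum>p\<in>UNIV. if i = project_index \<sigma> (\<epsilon> p) then - ?H p else 0)"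
    using \<epsilon> by (intro sum.cong refl) (simp add: sum.delta)
  also have "\<dots> = - (\<Sum>p\<in>UNIV. if i = project_index \<sigma> (\<epsilon> p) then ?H p else 0)"
    unfolding sum_negf[symmetric] by (rule sum.cong) auto
  finally show "(\<Sum>j\<le>m. if i = project_index \<sigma> j then DF j r X (\<lambda>t. project \<sigma> m (A' t)) else 0) =
    - (\<Sum>p\<in>UNIV. if i = project_index \<sigma> (\<epsilon> p) then vertical_partial T (snd p)
       (vertical_partial T (fst p) (\<lambda>t X A. F t X (\<lambda>t. project \<sigma> m (A t)))) r X A' / 2 else 0)"
    unfolding vertical_partial_project[of T _ F]
      vertical_partial_project[of T _ "vertical_partial T j F" for j]
      project_control[OF non_anticipative_vertical_partial[OF T U non_anticipative_vertical_partial[OF T U na]] r' X] .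
qed

lemma carries_covariation_project:
  assumes c: "carries_covariation T P m \<epsilon> X A"
  shows "carries_covariation T P q (\<lambda>p. project_index \<sigma> (\<epsilon> p)) X A'"
  unfolding carries_covariation_def
proof (intro allI conjI ballI)
  fix p
  have p: "\<epsilon> p \<le> m" using c unfolding carries_covariation_def by blast
  then show "project_index \<sigma> (\<epsilon> p) \<le> q" using \<sigma> by (auto simp: project_index_def Suc_le_eq split: nat.split)
  fix t assume t: "t \<in> {0..T}"
  have "integrator A' (project_index \<sigma> (\<epsilon> p)) t = integrator A (\<epsilon> p) t"
    using integrator_project[OF p, of \<sigma> A', symmetric] eq[OF t] by (simp add: integrator_def split: nat.splits)
  then show "integrator A' (project_index \<sigma> (\<epsilon> p)) t = covariation T P X (snd p) (fst p) t"
    using c t unfolding carries_covariation_def by metis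
qed

end

lemma sum_swap_pairs:
  "(\<Sum>j\<in>J. \<Sum>i\<in>I. \<Sum>l\<in>L. \<Sum>k\<in>M. a i j k l) = (\<Sum>l\<in>L. \<Sum>k\<in>M. \<Sum>j\<in>J. \<Sum>i\<in>I. a i j k l)"
proof -
  have "(\<Sum>j\<in>J. \<Sum>i\<in>I. \<Sum>l\<in>L. \<Sum>k\<in>M. a i j k l) = (\<Sum>j\<in>J. \<Sum>l\<in>L. \<Sum>k\<in>M. \<Sum>i\<in>I. a i j k l)"
    by (rule sum.cong[OF refl], subst sum.swap, rule sum.cong[OF refl], rule sum.swap)
  also have "\<dots> = (\<Sum>l\<in>L. \<Sum>k\<in>M. \<Sum>j\<in>J. \<Sum>i\<in>I. a i j k l)"
    by (subst sum.swap, rule sum.cong[OF refl], rule sum.swap)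
  finally show ?thesis .
qed

context
  fixes T :: real and P :: "nat \<Rightarrow> real set" and U :: "(real ^ 'd::finite) set" and X :: "'d path"
    and q :: nat and S :: "(nat \<Rightarrow> real) set" and A :: "real \<Rightarrow> nat \<Rightarrow> real" and \<epsilon> :: "'d \<times> 'd \<Rightarrow> nat"
  assumes T: "0 < T" and P: "refining_partitions T P" and U: "open U"
    and X: "continuous_on {0..T} X" "X ` {0..T} \<subseteq> U" and qv: "admits_qv T P X"
    and A: "A \<in> CBV T q S" and c: "carries_covariation T P q \<epsilon> X A"
begin

private lemma XU: "X \<in> cadlag_paths T U" by (rule cadlag_paths_continuous[OF X])

text \<open>The horizontal integrals are minus half the integrals of the second derivatives against
  the covariations, so these two terms of the Ito formula cancel and only values of \<open>F\<close>
  remain.\<close>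

lemma ito_sum_driftless:
  assumes F: "C12c_via T q U S F DF" and d: "driftless T q \<epsilon> X A F DF"
    and \<xi>: "\<And>t Z. t \<in> {0..T} \<Longrightarrow> Z \<in> cadlag_paths T U \<Longrightarrow> \<xi> t Z = vertical_gradient T F t Z A"
    and t: "t \<in> {0..T}"
  shows "ito_sum T P \<xi> X t \<longlonglongrightarrow> F t X A - F 0 X A"
proof -
  let ?H = "\<lambda>p r. vertical_partial T (snd p) (vertical_partial T (fst p) F) r X A"
  have tT: "t \<le> T" and t0: "0 \<le> t" using t by auto
  have Hm: "bdd_measurable 0 t (?H p)" for p
    by (rule bdd_measurable_vertical_partial(2)[OF T U XU F A tT])
  have "(\<Sum>i\<le>q. stieltjes_integral 0 t (\<lambda>r. DF i r X A) (integrator A i)) =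
     (\<Sum>j\<in>UNIV. \<Sum>i\<in>UNIV. stieltjes_integral 0 t (\<lambda>r. - (1 / 2) * ?H (j, i) r) (covariation T P X i j))"
  proof (rule sum_covariation_integral[OF A c t])
    show "bdd_measurable 0 t (\<lambda>r. - (1 / 2) * ?H p r)" for p by (rule bdd_measurable_cmult[OF Hm])
    fix i r assume "i \<le> q" "r \<in> {0<..t}"
    then have "DF i r X A = - (\<Sum>p\<in>UNIV. if i = \<epsilon> p then ?H p r / 2 else 0)"
      using d t by (auto simp: driftless_def)
    then show "DF i r X A = (\<Sum>p\<in>UNIV. if i = \<epsilon> p then - (1 / 2) * ?H p r else 0)"
      unfolding sum_negf[symmetric] by (auto intro!: sum.cong)
  qed
  also have "\<dots> = (\<Sum>j\<in>UNIV. \<Sum>i\<in>UNIV. - (1 / 2) * stieltjes_integral 0 t (?H (j, i)) (covariation T P X i j))"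
    by (intro sum.cong refl stieltjes_integral_cmult[OF cont_bv_covariation[OF T P qv] _ t0 tT Hm]) simp
  also have "\<dots> = - (\<Sum>j\<in>UNIV. \<Sum>i\<in>UNIV. stieltjes_integral 0 t (?H (j, i)) (covariation T P X i j)) / 2"
    by (simp add: sum_distrib_left[symmetric] sum_divide_distrib[symmetric] sum_negf)
  finally show ?thesis using ito_sum_tendsto[where F = F, OF T P qv U F A X \<xi> t] by simp
qed

lemma ito_sum_composed:
  fixes F :: "'n::finite \<Rightarrow> 'd functional"
  assumes F: "\<And>l. C12c_via T q U S (F l) (DF l)" and d: "\<And>l. driftless T q \<epsilon> X A (F l) (DF l)"
    and G: "C12c_via T q UNIV S G DG"
    and Y: "\<And>t. t \<in> {0..T} \<Longrightarrow> Y t = functional_path F X A t" and Yqv: "admits_qv T P Y"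
    and cov: "\<And>k l t. t \<in> {0..T} \<Longrightarrow> covariation T P Y k l t = (\<Sum>i\<in>UNIV. \<Sum>j\<in>UNIV.
       stieltjes_integral 0 t (\<lambda>s. vertical_partial T i (F k) s X A * vertical_partial T j (F l) s X A) (covariation T P X i j))"
    and \<zeta>: "\<And>t Z. t \<in> {0..T} \<Longrightarrow> Z \<in> cadlag_paths T U \<Longrightarrow>
      \<zeta> t Z = vertical_gradient T (\<lambda>t X A. G t (functional_path F X A) A) t Z A"
    and \<eta>: "\<And>t Z. t \<in> {0..T} \<Longrightarrow> Z \<in> cadlag_paths T UNIV \<Longrightarrow> \<eta> t Z = vertical_gradient T G t Z A"
  shows "\<exists>L. ito_sum T P \<zeta> X T \<longlonglongrightarrow> L \<and> ito_sum T P \<eta> Y T \<longlonglongrightarrow> L"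
proof -
  let ?W = "functional_path F X A" and ?K = "\<lambda>t X A. G t (functional_path F X A) A"
  let ?DK = "\<lambda>i t X A. DG i t (functional_path F X A) A +
     (\<Sum>l\<in>UNIV. (if t = 0 then 0 else vertical_partial T l G t (functional_path F X A) A) * DF l i t X A)"
  let ?c = "covariation T P X" and ?I = "stieltjes_integral 0 T"
  define g where "g = (\<lambda>l r. vertical_partial T l G r ?W A)"
  define gg where "gg = (\<lambda>k l r. vertical_partial T k (vertical_partial T l G) r ?W A)"
  define f where "f = (\<lambda>i k r. vertical_partial T i (F k) r X A)"
  define h where "h = (\<lambda>j i l r. vertical_partial T i (vertical_partial T j (F l)) r X A)"
  note DG = C12c_viaD[OF G]
  have K: "C12c_via T q U S ?K ?DK" by (rule C12c_via_compose[where F = F, OF T U F G])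
  have WC: "?W \<in> cadlag_paths T UNIV" by (rule functional_path_cadlag[where F = F, OF T U F XU A])
  have Wcont: "continuous_on {0..T} ?W"
    unfolding functional_path_def
    by (intro continuous_intros) (rule continuous_on_functional[OF T U F order_refl order_refl XU A X(1)])
  have Ycont: "continuous_on {0..T} Y" by (rule continuous_on_eq[OF Wcont]) (simp add: Y)
  have YC: "Y \<in> cadlag_paths T UNIV" by (rule cadlag_paths_continuous[OF Ycont]) simp
  \<comment> \<open>\<open>Y\<close> and the path of values agree only on \<open>[0,T]\<close>,
    which non-anticipative functionals cannot distinguish.\<close>
  have YW: "H t Y A = H t ?W A" if "non_anticipative T q UNIV S H" "t \<in> {0..T}" for H t
    by (rule non_anticipative_cong[OF T open_UNIV that YC WC _ A A refl]) (use Y that in auto)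
  have TT: "T \<in> {0..T}" "0 \<in> {0..T}" and T0: "0 \<le> T" using T by auto
  note na = DG(2) and na1 = non_anticipative_vertical_partial[OF T open_UNIV DG(2)]
  note na2 = non_anticipative_vertical_partial[OF T open_UNIV na1]
  have m [intro]: "bdd_measurable 0 T (g l)" "bdd_measurable 0 T (gg k l)" "bdd_measurable 0 T (f i k)" "bdd_measurable 0 T (h j i l)" for i j k l
    unfolding g_def gg_def f_def h_def
    using bdd_measurable_vertical_partial[OF T open_UNIV WC G A order_refl]
      bdd_measurable_vertical_partial[OF T U XU F A order_refl] by auto
  have c: "cont_bv T (?c i j)" for i j by (rule cont_bv_covariation[OF T P qv])
  have K2: "vertical_partial T i (vertical_partial T j ?K) r X A =
      (\<Sum>l\<in>UNIV. \<Sum>k\<in>UNIV. gg k l r * (f i k r * f j l r)) + (\<Sum>l\<in>UNIV. h j i l r * g l r)" if "r \<in> {0..T}" for i j r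
    unfolding vertical_partial2_compose[where F = F, OF T U F G that XU A] f_def g_def h_def gg_def sum.distrib
    by (simp add: sum_distrib_left mult_ac)
  have second: "?I (\<lambda>r. vertical_partial T i (vertical_partial T j ?K) r X A) (?c i j) =
      (\<Sum>l\<in>UNIV. \<Sum>k\<in>UNIV. ?I (\<lambda>r. gg k l r * (f i k r * f j l r)) (?c i j)) + ?I (\<lambda>r. \<Sum>l\<in>UNIV. h j i l r * g l r) (?c i j)" for i j
  proof -
    have "?I (\<lambda>r. vertical_partial T i (vertical_partial T j ?K) r X A) (?c i j) =
       ?I (\<lambda>r. (\<Sum>l\<in>UNIV. \<Sum>k\<in>UNIV. gg k l r * (f i k r * f j l r)) + (\<Sum>l\<in>UNIV. h j i l r * g l r)) (?c i j)"
      by (rule stieltjes_integral_cong) (use K2 T in auto)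
    also have "\<dots> = ?I (\<lambda>r. \<Sum>l\<in>UNIV. \<Sum>k\<in>UNIV. gg k l r * (f i k r * f j l r)) (?c i j) + ?I (\<lambda>r. \<Sum>l\<in>UNIV. h j i l r * g l r) (?c i j)"
      by (rule stieltjes_integral_add[OF c order_refl T0 order_refl]) (intro bdd_measurable_sum bdd_measurable_mult m)+
    also have "?I (\<lambda>r. \<Sum>l\<in>UNIV. \<Sum>k\<in>UNIV. gg k l r * (f i k r * f j l r)) (?c i j) =
       (\<Sum>l\<in>UNIV. ?I (\<lambda>r. \<Sum>k\<in>UNIV. gg k l r * (f i k r * f j l r)) (?c i j))"
      by (rule stieltjes_integral_sum[OF c order_refl T0 order_refl]) (intro bdd_measurable_sum bdd_measurable_mult m)
    also have "\<dots> = (\<Sum>l\<in>UNIV. \<Sum>k\<in>UNIV. ?I (\<lambda>r. gg k l r * (f i k r * f j l r)) (?c i j))"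
      by (rule sum.cong[OF refl], rule stieltjes_integral_sum[OF c order_refl T0 order_refl]) (intro bdd_measurable_mult m)
    finally show ?thesis .
  qed
  \<comment> \<open>The covariation of \<open>Y\<close> is itself an integral against the
    covariations of \<open>X\<close>; integrating against it inserts the products of gradients as a
    factor.\<close>
  have assoc: "(\<Sum>j\<in>UNIV. \<Sum>i\<in>UNIV. ?I (\<lambda>r. gg k l r * (f i k r * f j l r)) (?c i j)) = ?I (gg k l) (covariation T P Y k l)" for k l
  proof -
    obtain B where B: "compact B" "B \<subseteq> UNIV" "?W \<in> cadlag_paths T B" using cadlag_paths_compact[OF WC open_UNIV] .
    obtain C where C: "\<And>t Z. t \<in> {0..T} \<Longrightarrow> Z \<in> cadlag_paths T B \<Longrightarrow> \<bar>vertical_partial T k (vertical_partial T l G) t Z A\<bar> \<le> C"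
      using boundedness_preservingD[OF T open_UNIV DG(9)[of k l] A B(1,2)] by blast
    have "?I (gg k l) (covariation T P Y k l) = (\<Sum>p\<in>UNIV. ?I (\<lambda>r. gg k l r * (f (snd p) k r * f (fst p) l r)) (?c (snd p) (fst p)))"
    proof (rule stieltjes_integral_assoc[OF T finite _ cont_bv_covariation[OF T P Yqv]])
      show "bdd_measurable 0 T (\<lambda>r. f (snd p) k r * f (fst p) l r)" for p by (intro bdd_measurable_mult m)
      fix t assume t: "t \<in> {0..T}"
      have "covariation T P Y k l t = (\<Sum>j\<in>UNIV. \<Sum>i\<in>UNIV. stieltjes_integral 0 t (\<lambda>r. f i k r * f j l r) (?c i j))"
        unfolding cov[OF t] f_def by (rule sum.swap)
      also have "\<dots> = (\<Sum>p\<in>UNIV. stieltjes_integral 0 t (\<lambda>r. f (snd p) k r * f (fst p) l r) (?c (snd p) (fst p)))"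
        by (simp only: sum.cartesian_product case_prod_unfold UNIV_Times_UNIV)
      finally show "covariation T P Y k l t = (\<Sum>p\<in>UNIV. stieltjes_integral 0 t (\<lambda>r. f (snd p) k r * f (fst p) l r) (?c (snd p) (fst p)))" .
    next
      fix u x assume "u \<in> {0<..T}" "\<And>n. x n \<in> {0..u}" "x \<longlonglongrightarrow> u"
      then show "(\<lambda>n. gg k l (x n)) \<longlonglongrightarrow> gg k l u"
        unfolding gg_def by (rule left_limit_continuous_path[OF T open_UNIV DG(8) na2 A WC Wcont order_refl order_refl])
    next
      show "\<bar>gg k l u\<bar> \<le> C" if "u \<in> {0..T}" for u unfolding gg_def by (rule C[OF that B(3)])
    qed (rule c)
    then show ?thesis by (simp only: sum.cartesian_product case_prod_unfold UNIV_Times_UNIV)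
  qed
  \<comment> \<open>The difference of the two horizontal derivatives is the gradient of
    \<open>G\<close> times \<open>DF\<close>, and \<open>DF\<close> along \<open>X\<close> is minus
    half the second derivatives of \<open>F\<close>, placed on the integrators that carry the
    covariations.\<close>
  have first: "(\<Sum>i\<le>q. ?I (\<lambda>r. ?DK i r X A) (integrator A i)) = (\<Sum>i\<le>q. ?I (\<lambda>r. DG i r ?W A) (integrator A i))
      - (\<Sum>j\<in>UNIV. \<Sum>i\<in>UNIV. ?I (\<lambda>r. \<Sum>l\<in>UNIV. h j i l r * g l r) (?c i j)) / 2"
  proof -
    have im: "cont_bv T (integrator A i)" if "i \<le> q" for i by (rule cont_bv_integrator[OF A that T0])
    have DKm: "bdd_measurable 0 T (\<lambda>r. ?DK i r X A)" if "i \<le> q" for i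
      by (rule horizontal_integrand_measurable[OF T U C12c_via_horizontal_integrand[OF K that] XU A])
    have DGm: "bdd_measurable 0 T (\<lambda>r. DG i r ?W A)" if "i \<le> q" for i
      by (rule horizontal_integrand_measurable[OF T open_UNIV C12c_via_horizontal_integrand[OF G that] WC A])
    have "(\<Sum>i\<le>q. ?I (\<lambda>r. ?DK i r X A) (integrator A i)) - (\<Sum>i\<le>q. ?I (\<lambda>r. DG i r ?W A) (integrator A i)) =
       (\<Sum>i\<le>q. ?I (\<lambda>r. ?DK i r X A - DG i r ?W A) (integrator A i))"
      unfolding sum_subtractf[symmetric]
      by (rule sum.cong[OF refl], rule stieltjes_integral_diff[symmetric, OF _ order_refl T0 order_refl]) (use im DKm DGm in auto)
    also have "\<dots> = (\<Sum>j\<in>UNIV. \<Sum>i\<in>UNIV. ?I (\<lambda>r. - (1 / 2) * (\<Sum>l\<in>UNIV. h j i l r * g l r)) (?c i j))"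
    proof (rule sum_covariation_integral[OF A \<open>carries_covariation T P q \<epsilon> X A\<close> TT(1),
          where f = "\<lambda>p r. - (1 / 2) * (\<Sum>l\<in>UNIV. h (fst p) (snd p) l r * g l r)", simplified fst_conv snd_conv])
      show "bdd_measurable 0 T (\<lambda>r. - (1 / 2) * (\<Sum>l\<in>UNIV. h (fst p) (snd p) l r * g l r))" for p
        by (intro bdd_measurable_cmult bdd_measurable_sum bdd_measurable_mult m)
      fix i r assume i: "i \<le> q" and r: "r \<in> {0<..T}"
      have DF: "DF l i r X A = - (\<Sum>p\<in>UNIV. if i = \<epsilon> p then h (fst p) (snd p) l r / 2 else 0)" for l
        using d[of l] i r unfolding driftless_def h_def by blast
      have "?DK i r X A - DG i r ?W A = (\<Sum>l\<in>UNIV. g l r * DF l i r X A)" using r by (simp add: g_def)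
      also have "\<dots> = (\<Sum>l\<in>UNIV. \<Sum>p\<in>UNIV. if i = \<epsilon> p then - (1 / 2) * (h (fst p) (snd p) l r * g l r) else 0)"
        unfolding DF by (auto simp: sum_distrib_left sum_negf[symmetric] intro!: sum.cong)
      also have "\<dots> = (\<Sum>p\<in>UNIV. \<Sum>l\<in>UNIV. if i = \<epsilon> p then - (1 / 2) * (h (fst p) (snd p) l r * g l r) else 0)"
        by (rule sum.swap)
      also have "\<dots> = (\<Sum>p\<in>UNIV. if i = \<epsilon> p then - (1 / 2) * (\<Sum>l\<in>UNIV. h (fst p) (snd p) l r * g l r) else 0)"
        by (rule sum.cong[OF refl]) (simp add: sum_distrib_left)
      finally show "?DK i r X A - DG i r ?W A =
        (\<Sum>p\<in>UNIV. if i = \<epsilon> p then - (1 / 2) * (\<Sum>l\<in>UNIV. h (fst p) (snd p) l r * g l r) else 0)" .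
    qed
    also have "\<dots> = (\<Sum>j\<in>UNIV. \<Sum>i\<in>UNIV. - (1 / 2) * ?I (\<lambda>r. \<Sum>l\<in>UNIV. h j i l r * g l r) (?c i j))"
      by (intro sum.cong refl stieltjes_integral_cmult[OF c order_refl T0 order_refl] bdd_measurable_sum bdd_measurable_mult m)
    also have "\<dots> = - (\<Sum>j\<in>UNIV. \<Sum>i\<in>UNIV. ?I (\<lambda>r. \<Sum>l\<in>UNIV. h j i l r * g l r) (?c i j)) / 2"
      by (simp add: sum_distrib_left[symmetric] sum_divide_distrib[symmetric] sum_negf)
    finally show ?thesis by simp
  qed
  have "(\<Sum>j\<in>UNIV. \<Sum>i\<in>UNIV. ?I (\<lambda>r. vertical_partial T i (vertical_partial T j ?K) r X A) (?c i j)) =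
     (\<Sum>l\<in>UNIV. \<Sum>k\<in>UNIV. ?I (gg k l) (covariation T P Y k l)) +
     (\<Sum>j\<in>UNIV. \<Sum>i\<in>UNIV. ?I (\<lambda>r. \<Sum>l\<in>UNIV. h j i l r * g l r) (?c i j))"
    unfolding second sum.distrib sum_swap_pairs assoc ..
  with first have lim_eq: "?K T X A - ?K 0 X A - (\<Sum>i\<le>q. ?I (\<lambda>r. ?DK i r X A) (integrator A i))
      - (\<Sum>j\<in>UNIV. \<Sum>i\<in>UNIV. ?I (\<lambda>r. vertical_partial T i (vertical_partial T j ?K) r X A) (?c i j)) / 2 =
    G T ?W A - G 0 ?W A - (\<Sum>i\<le>q. ?I (\<lambda>r. DG i r ?W A) (integrator A i))
      - (\<Sum>l\<in>UNIV. \<Sum>k\<in>UNIV. ?I (gg k l) (covariation T P Y k l)) / 2"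
    by argo
  have "G T Y A = G T ?W A" "G 0 Y A = G 0 ?W A" using YW[OF na] TT by auto
  moreover have "?I (\<lambda>r. DG i r Y A) (integrator A i) = ?I (\<lambda>r. DG i r ?W A) (integrator A i)" if "i \<in> {..q}" for i
    by (rule stieltjes_integral_cong) (use that YW[OF horizontal_integrandD(1)[OF T open_UNIV C12c_via_horizontal_integrand[OF G]]] T in auto)
  then have "(\<Sum>i\<le>q. ?I (\<lambda>r. DG i r Y A) (integrator A i)) = (\<Sum>i\<le>q. ?I (\<lambda>r. DG i r ?W A) (integrator A i))" by (rule sum.cong[OF refl])
  moreover have "?I (\<lambda>r. vertical_partial T k (vertical_partial T l G) r Y A) (covariation T P Y k l) = ?I (gg k l) (covariation T P Y k l)" for k l
    unfolding gg_def by (rule stieltjes_integral_cong) (use YW[OF na2] T in auto)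
  moreover note ito_sum_tendsto[where F = G, OF T P Yqv open_UNIV G A Ycont subset_UNIV \<eta> TT(1)]
  ultimately have "ito_sum T P \<eta> Y T \<longlonglongrightarrow> G T ?W A - G 0 ?W A - (\<Sum>i\<le>q. ?I (\<lambda>r. DG i r ?W A) (integrator A i))
      - (\<Sum>l\<in>UNIV. \<Sum>k\<in>UNIV. ?I (gg k l) (covariation T P Y k l)) / 2"
    by simp
  with ito_sum_tendsto[where F = ?K, OF T P qv U K A X \<zeta> TT(1), unfolded lim_eq] show ?thesis by blast
qed

end

text \<open>Merges two controls indexed by a truth value, \<open>True\<close> for the one of
  \<open>F\<close> and \<open>False\<close> for the one of \<eta>. Everything is then evaluated at
  the single control \<open>A'\<close>, as the chain rule for \<open>G\<close> and \<open>F'\<close>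
  requires.\<close>

lemma common_control:
  fixes F :: "'n::finite \<Rightarrow> 'd::finite functional" and \<eta> :: "'n integrand"
  assumes T: "0 < T" and U: "open U" and X: "X \<in> cadlag_paths T U"
    and q: "q \<ge> 1" and S: "openin (Euclidean_space q) S" and A: "A \<in> CBV T q S" and c: "carries_covariation T P q \<epsilon> X A"
    and F: "\<And>l. C12c_via T q U S (F l) (DF l)" and d: "\<And>l. driftless T q \<epsilon> X A (F l) (DF l)"
    and \<eta>: "admissible_integrand T UNIV \<eta>"
  obtains q' S' A' \<epsilon>' F' DF' G DG where "q' \<ge> 1" "openin (Euclidean_space q') S'" "A' \<in> CBV T q' S'"
    "carries_covariation T P q' \<epsilon>' X A'" "\<And>l. C12c_via T q' U S' (F' l) (DF' l)" "\<And>l. driftless T q' \<epsilon>' X A' (F' l) (DF' l)"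
    "C12c_via T q' UNIV S' G DG"
    "\<And>l t Z. t \<in> {0..T} \<Longrightarrow> Z \<in> cadlag_paths T U \<Longrightarrow> F' l t Z A' = F l t Z A"
    "\<And>l t Z. t \<in> {0..T} \<Longrightarrow> Z \<in> cadlag_paths T U \<Longrightarrow> vertical_gradient T (F' l) t Z A' = vertical_gradient T (F l) t Z A"
    "\<And>t Z. t \<in> {0..T} \<Longrightarrow> Z \<in> cadlag_paths T UNIV \<Longrightarrow> \<eta> t Z = vertical_gradient T G t Z A'"
proof -
  obtain m R B G0 where m: "m \<ge> 1" and R: "openin (Euclidean_space m) R" and B: "B \<in> CBV T m R" and "G0 \<in> C12c T m UNIV R"
    and \<eta>: "\<forall>t\<in>{0..T}. \<forall>Z\<in>cadlag_paths T UNIV. \<eta> t Z = vertical_gradient T G0 t Z B"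
    using \<eta> unfolding admissible_integrand_def by blast
  then obtain DG0 where G0: "C12c_via T m UNIV R G0 DG0" by (elim C12c_viaE)
  have "(if k then q else m) \<ge> 1" "openin (Euclidean_space (if k then q else m)) (if k then S else R)"
    "(if k then A else B) \<in> CBV T (if k then q else m) (if k then S else R)" for k
    using q m S R A B by auto
  note joint = joint_control[where m = "\<lambda>k. if k then q else m" and S = "\<lambda>k. if k then S else R" and A = "\<lambda>k. if k then A else B", OF this]
  obtain q' S' A' \<sigma> where q': "q' \<ge> 1" "openin (Euclidean_space q') S'" "A' \<in> CBV T q' S'"
    and \<sigma>: "\<And>k j. j < (if k then q else m) \<Longrightarrow> \<sigma> k j < q'"
    and S': "\<And>k x. x \<in> S' \<Longrightarrow> project (\<sigma> k) (if k then q else m) x \<in> (if k then S else R)"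
    and eq: "\<And>k t. t \<in> {0..T} \<Longrightarrow> project (\<sigma> k) (if k then q else m) (A' t) = (if k then A else B) t"
    by (rule joint) (rule that; assumption)
  note 1 = S'[of _ True, unfolded if_True] \<sigma>[of _ True, unfolded if_True] and 0 = S'[of _ False, unfolded if_False] \<sigma>[of _ False, unfolded if_False]
  note eq1 = eq[of _ True, unfolded if_True] and eq0 = eq[of _ False, unfolded if_False]
  have \<epsilon>: "\<epsilon> p \<le> q" for p using c unfolding carries_covariation_def by blast
  show thesis
  proof (rule that[OF q'])
    show "carries_covariation T P q' (\<lambda>p. project_index (\<sigma> True) (\<epsilon> p)) X A'"
      by (rule carries_covariation_project[OF T U 1 F A q'(3) eq1 c])
    fix l
    show "C12c_via T q' U S' (\<lambda>t X A. F l t X (\<lambda>t. project (\<sigma> True) q (A t)))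
      (\<lambda>i t X A. \<Sum>j\<le>q. if i = project_index (\<sigma> True) j then DF l j t X (\<lambda>t. project (\<sigma> True) q (A t)) else 0)"
      by (rule C12c_via_project[OF T U 1 F])
    show "driftless T q' (\<lambda>p. project_index (\<sigma> True) (\<epsilon> p)) X A' (\<lambda>t X A. F l t X (\<lambda>t. project (\<sigma> True) q (A t)))
      (\<lambda>i t X A. \<Sum>j\<le>q. if i = project_index (\<sigma> True) j then DF l j t X (\<lambda>t. project (\<sigma> True) q (A t)) else 0)"
      by (rule driftless_project[OF T U 1 F A q'(3) eq1 d \<epsilon> X])
    fix t Z assume tZ: "t \<in> {0..T}" "Z \<in> cadlag_paths T U"
    show "F l t Z (\<lambda>t. project (\<sigma> True) q (A' t)) = F l t Z A"
      by (rule project_control[OF T U 1 F A q'(3) eq1 C12c_viaD(2)[OF F] tZ])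
    show "vertical_gradient T (\<lambda>t X A. F l t X (\<lambda>t. project (\<sigma> True) q (A t))) t Z A' = vertical_gradient T (F l) t Z A"
      by (rule vertical_gradient_project[OF T U 1 F A q'(3) eq1 tZ])
  next
    show "C12c_via T q' UNIV S' (\<lambda>t X A. G0 t X (\<lambda>t. project (\<sigma> False) m (A t)))
      (\<lambda>i t X A. \<Sum>j\<le>m. if i = project_index (\<sigma> False) j then DG0 j t X (\<lambda>t. project (\<sigma> False) m (A t)) else 0)"
      by (rule C12c_via_project[OF T open_UNIV 0 G0])
    fix t and Z :: "'n path" assume tZ: "t \<in> {0..T}" "Z \<in> cadlag_paths T UNIV"
    show "\<eta> t Z = vertical_gradient T (\<lambda>t X A. G0 t X (\<lambda>t. project (\<sigma> False) m (A t))) t Z A'"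
      using vertical_gradient_project[OF T open_UNIV 0 G0 B q'(3) eq0 tZ] \<eta> tZ by simp
  qed
qed

text \<open>Controls are merged over a sum type: \<open>Inl\<close> for those of the \<xi>_l,
  \<open>Inr\<close> for one-dimensional controls, each a covariation of \<open>X\<close>. With
  these adjoined, the Stieltjes terms of the Ito formula form an integral functional of the
  control.\<close>

lemma ito_representation:
  fixes \<xi> :: "'n::finite \<Rightarrow> 'd::finite integrand"
  assumes T: "0 < T" and P: "refining_partitions T P" and U: "open U" and \<xi>: "\<And>l. admissible_integrand T U (\<xi> l)"
    and X: "X \<in> cadlag_paths T U" and qv: "admits_qv T P X"
  obtains q S A F DF \<epsilon> where "q \<ge> 1" "openin (Euclidean_space q) S" "A \<in> CBV T q S" "carries_covariation T P q \<epsilon> X A"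
    "\<And>l. C12c_via T q U S (F l) (DF l)" "\<And>l. driftless T q \<epsilon> X A (F l) (DF l)" "\<And>l. F l 0 X A = 0"
    "\<And>l t Z. t \<in> {0..T} \<Longrightarrow> Z \<in> cadlag_paths T U \<Longrightarrow> \<xi> l t Z = vertical_gradient T (F l) t Z A"
proof -
  let ?Q = "\<lambda>l m S A F DF. m \<ge> 1 \<and> openin (Euclidean_space m) S \<and> A \<in> CBV T m S \<and> C12c_via T m U S F DF \<and>
    (\<forall>t\<in>{0..T}. \<forall>Z\<in>cadlag_paths T U. \<xi> l t Z = vertical_gradient T F t Z A)"
  have "\<exists>m S A F DF. ?Q l m S A F DF" for l
  proof -
    obtain m S A F where *: "m \<ge> 1" "openin (Euclidean_space m) S" "A \<in> CBV T m S" "F \<in> C12c T m U S"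
      "\<forall>t\<in>{0..T}. \<forall>Z\<in>cadlag_paths T U. \<xi> l t Z = vertical_gradient T F t Z A"
      using \<xi>[of l] unfolding admissible_integrand_def by blast
    obtain DF where "C12c_via T m U S F DF" using *(4) by (elim C12c_viaE)
    then show ?thesis using * by blast
  qed
  then have "\<forall>l. \<exists>m S A F DF. ?Q l m S A F DF" ..
  from choice[OF this] obtain m where "\<forall>l. \<exists>S A F DF. ?Q l (m l) S A F DF" ..
  from choice[OF this] obtain S where "\<forall>l. \<exists>A F DF. ?Q l (m l) (S l) A F DF" ..
  from choice[OF this] obtain A where "\<forall>l. \<exists>F DF. ?Q l (m l) (S l) (A l) F DF" ..
  from choice[OF this] obtain F where "\<forall>l. \<exists>DF. ?Q l (m l) (S l) (A l) (F l) DF" ..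
  from choice[OF this] obtain DF where "\<forall>l. ?Q l (m l) (S l) (A l) (F l) (DF l)" ..
  then have m: "m l \<ge> 1" and S: "openin (Euclidean_space (m l)) (S l)" and A: "A l \<in> CBV T (m l) (S l)"
    and F: "C12c_via T (m l) U (S l) (F l) (DF l)"
    and \<xi>F: "t \<in> {0..T} \<Longrightarrow> Z \<in> cadlag_paths T U \<Longrightarrow> \<xi> l t Z = vertical_gradient T (F l) t Z (A l)" for l t Z by blast+
  let ?m = "case_sum m (\<lambda>_. 1)" and ?S = "case_sum S (\<lambda>_. topspace (Euclidean_space 1))"
  let ?A = "case_sum A (\<lambda>p t j. if j = 0 then covariation T P X (snd p) (fst p) t else 0)"
  have "?m k \<ge> 1" "openin (Euclidean_space (?m k)) (?S k)" for k :: "'n + 'd \<times> 'd"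
    using m S by (auto split: sum.split)
  moreover have "?A k \<in> CBV T (?m k) (?S k)" for k
  proof (cases k)
    case (Inr p)
    then show ?thesis using cont_bv_covariation[OF T P qv]
      by (auto simp: CBV_def cont_bv_def topspace_Euclidean_space)
  qed (use A in auto)
  ultimately obtain q S' A' \<sigma> where q: "q \<ge> 1" "openin (Euclidean_space q) S'" "A' \<in> CBV T q S'"
    and \<sigma>: "\<And>k j. j < ?m k \<Longrightarrow> \<sigma> k j < q" and S': "\<And>k x. x \<in> S' \<Longrightarrow> project (\<sigma> k) (?m k) x \<in> ?S k"
    and eq: "\<And>k t. t \<in> {0..T} \<Longrightarrow> project (\<sigma> k) (?m k) (A' t) = ?A k t"
    by (rule joint_control[where m = ?m and S = ?S and A = ?A]) (rule that; assumption)
  define \<epsilon> where "\<epsilon> = (\<lambda>p. Suc (\<sigma> (Inr p) 0))"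
  have \<epsilon>q: "\<epsilon> p \<le> q" for p using \<sigma>[of 0 "Inr p"] by (simp add: \<epsilon>_def)
  have c: "carries_covariation T P q \<epsilon> X A'"
    unfolding carries_covariation_def
  proof (intro allI conjI ballI \<epsilon>q)
    fix p t assume "t \<in> {0..T}"
    from fun_cong[OF eq[OF this, of "Inr p"], of 0]
    show "integrator A' (\<epsilon> p) t = covariation T P X (snd p) (fst p) t"
      by (simp add: integrator_def \<epsilon>_def project_def)
  qed
  have Sl: "\<And>x. x \<in> S' \<Longrightarrow> project (\<sigma> (Inl l)) (m l) x \<in> S l" and \<sigma>l: "\<And>j. j < m l \<Longrightarrow> \<sigma> (Inl l) j < q"
    and eql: "\<And>t. t \<in> {0..T} \<Longrightarrow> project (\<sigma> (Inl l)) (m l) (A' t) = A l t" for l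
    using S'[of _ "Inl l"] \<sigma>[of _ "Inl l"] eq[of _ "Inl l"] by simp_all
  define F1 where "F1 = (\<lambda>l t X A. F l t X (\<lambda>t. project (\<sigma> (Inl l)) (m l) (A t)))"
  define DF1 where "DF1 = (\<lambda>l i t X A. \<Sum>j\<le>m l. if i = project_index (\<sigma> (Inl l)) j
    then DF l j t X (\<lambda>t. project (\<sigma> (Inl l)) (m l) (A t)) else 0)"
  have F1: "C12c_via T q U S' (F1 l) (DF1 l)" for l
    unfolding F1_def DF1_def by (rule C12c_via_project[OF T U Sl \<sigma>l F])
  let ?H = "\<lambda>l p. vertical_partial T (snd p) (vertical_partial T (fst p) (F1 l))"
  \<comment> \<open>Subtracted are the whole horizontal derivative and, on the integrators that
    carry covariations, half of the second derivatives. What is left as horizontal derivative is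
    minus this half, which need not vanish but balances the second-order term.\<close>
  define E where "E = (\<lambda>l i t X A. DF1 l i t X A + (\<Sum>p\<in>UNIV. if i = \<epsilon> p then (1 / 2) * (if t = 0 then 0 else ?H l p t X A) else 0))"
  have E: "horizontal_integrand T q U S' (E l i)" if i: "i \<le> q" for l i
    unfolding E_def
  proof (intro horizontal_integrand_add horizontal_integrand_sum C12c_via_horizontal_integrand[OF F1 i] T U)
    fix p
    have "horizontal_integrand T q U S' (\<lambda>t X A. (1 / 2) * (if t = 0 then 0 else ?H l p t X A))"
      by (intro horizontal_integrand_mult horizontal_integrand_const T U horizontal_integrand_left[OF T U]
          non_anticipative_vertical_partial[OF T U] C12c_viaD[OF F1])
    then show "horizontal_integrand T q U S' (\<lambda>t X A. if i = \<epsilon> p then (1 / 2) * (if t = 0 then 0 else ?H l p t X A) else 0)"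
      using horizontal_integrand_const[OF T U] by (cases "i = \<epsilon> p") auto
  qed
  \<comment> \<open>The value \<open>F1 l 0 X A'\<close> is taken at the given path and control, so
    it is a constant: it leaves all derivatives alone and makes the functional start from 0 along
    \<open>X\<close>.\<close>
  let ?F = "\<lambda>l t X' A. F1 l t X' A - F1 l 0 X A' - integral_functional q (E l) t X' A"
  let ?DF = "\<lambda>l i t X A. DF1 l i t X A - E l i t X A"
  show thesis
  proof (rule that[OF q c, of ?F ?DF])
    fix l
    have El: "horizontal_integrand T q U S' (E l i)" if "i \<le> q" for i by (rule E[OF that])
    note sub = T U El F1[of l] refl[of "?F l"]
    show "C12c_via T q U S' (?F l) (?DF l)" by (rule C12c_via_subtract_integral[OF sub])
    show "driftless T q \<epsilon> X A' (?F l) (?DF l)"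
      unfolding driftless_def
    proof (intro ballI allI impI)
      fix r i assume r: "r \<in> {0<..T}"
      then have r': "r \<in> {0..T}" by simp
      have *: "vertical_partial T i (vertical_partial T j (?F l)) r X A' = vertical_partial T i (vertical_partial T j (F1 l)) r X A'" for i j
        by (rule vertical_partial2_subtract_integral[OF sub r' X q(3)])
      have "?DF l i r X A' = - (\<Sum>p\<in>UNIV. if i = \<epsilon> p then ?H l p r X A' / 2 else 0)"
        unfolding E_def using r by (simp cong: if_cong)
      then show "?DF l i r X A' = - (\<Sum>p\<in>UNIV. if i = \<epsilon> p then vertical_partial T (snd p) (vertical_partial T (fst p) (?F l)) r X A' / 2 else 0)"
        unfolding * .
    qed
    show "?F l 0 X A' = 0" by (simp add: integral_functional_def stieltjes_integral_refl)
    fix t Z assume t: "t \<in> {0..T}" and Z: "Z \<in> cadlag_paths T U"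
    have "vertical_partial T i (?F l) t Z A' = vertical_partial T i (F1 l) t Z A'" for i
      by (rule vertical_partial_subtract_integral[OF sub t Z q(3)])
    then have "vertical_gradient T (?F l) t Z A' = vertical_gradient T (F1 l) t Z A'" by (simp add: vertical_gradient_def)
    also have "\<dots> = vertical_gradient T (F l) t Z (A l)"
      unfolding F1_def by (rule vertical_gradient_project[OF T U Sl \<sigma>l F A q(3) eql t Z])
    finally show "\<xi> l t Z = vertical_gradient T (?F l) t Z A'" using \<xi>F[OF t Z] by simp
  qed
qed

text \<open>\<open>F\<close> with \<open>A\<close> and \<open>F'\<close> with \<open>A'\<close>
  produce paths of values that agree on \<open>[0,T]\<close>. After this exchange, the first-order
  chain rule is literally the definition of the composed integrand.\<close>

lemma composed_integrand_eq:
  fixes F F' :: "'n::finite \<Rightarrow> 'd::finite functional"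
  assumes T: "0 < T" and U: "open U" and F: "\<And>l. C12c_via T m U S (F l) (DF l)" and A: "A \<in> CBV T m S"
    and F': "\<And>l. C12c_via T q U S' (F' l) (DF' l)" and G: "C12c_via T q UNIV S' G DG" and A': "A' \<in> CBV T q S'"
    and eq: "\<And>l t Z. t \<in> {0..T} \<Longrightarrow> Z \<in> cadlag_paths T U \<Longrightarrow> F' l t Z A' = F l t Z A"
    and \<xi>: "\<And>l t Z. t \<in> {0..T} \<Longrightarrow> Z \<in> cadlag_paths T U \<Longrightarrow> \<xi> l t Z = vertical_gradient T (F' l) t Z A'"
    and \<eta>: "\<And>t Z. t \<in> {0..T} \<Longrightarrow> Z \<in> cadlag_paths T UNIV \<Longrightarrow> \<eta> t Z = vertical_gradient T G t Z A'"
    and t: "t \<in> {0..T}" and Z: "Z \<in> cadlag_paths T U"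
  shows "composed_integrand F A \<eta> \<xi> t Z = vertical_gradient T (\<lambda>t X A. G t (functional_path F' X A) A) t Z A'"
proof -
  have W: "functional_path F Z A \<in> cadlag_paths T UNIV" by (rule functional_path_cadlag[where F = F, OF T U F Z A])
  have W': "functional_path F' Z A' \<in> cadlag_paths T UNIV" by (rule functional_path_cadlag[where F = F', OF T U F' Z A'])
  have "vertical_partial T i G t (functional_path F Z A) A' = vertical_partial T i G t (functional_path F' Z A') A'" for i
    by (rule non_anticipative_cong[OF T open_UNIV non_anticipative_vertical_partial[OF T open_UNIV C12c_viaD(2)[OF G]] t W W' _ A' A' refl])
       (use eq t Z in \<open>auto simp: functional_path_def\<close>)
  then show ?thesis
    using vertical_partial_compose[where F = F', OF T U F' G t Z A']
    by (simp add: vec_eq_iff composed_integrand_def \<eta>[OF t W] \<xi>[OF t Z] vertical_gradient_def mult.commute)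
qed

text \<open>\<open>F\<close> and \<open>A\<close> precede \<eta> in the quantifiers, so they are
  built from the \<xi>_l and \<open>X\<close> alone. The control of \<eta> enters only afterwards,
  through a lifted \<open>F'\<close> that has the same values and gradients at \<open>A'\<close> as
  \<open>F\<close> has at \<open>A\<close>.\<close>

theorem theorem2p2:
  fixes T :: real
    and P :: "nat \<Rightarrow> real set"
    and U :: "(real ^ 'd::finite) set"
    and \<xi> :: "'n::finite \<Rightarrow> 'd integrand"
    and X :: "'d path"
    and Y :: "'n path"
  assumes T_pos: "0 < T"
    and P: "refining_partitions T P"
    and U: "open U"
    and \<xi>: "\<And>l. admissible_integrand T U (\<xi> l)"
    and X_cont: "continuous_on {0..T} X"
    and X_in: "X ` {0..T} \<subseteq> U"
    and X_qv: "admits_qv T P X"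
    and Y_def: "Y = (\<lambda>t. \<chi> l. ito_integral T P (\<xi> l) X t)"
  shows "(\<forall>l. \<forall>t\<in>{0..T}. ito_integrable T P (\<xi> l) X t) \<and> continuous_on {0..T} Y \<and>
    (\<exists>q\<ge>1. \<exists>S A (F :: 'n \<Rightarrow> 'd functional).
       openin (Euclidean_space q) S \<and> A \<in> CBV T q S \<and> (\<forall>l. F l \<in> C12c T q U S) \<and>
       (\<forall>t\<in>{0..T}. Y t = functional_path F X A t) \<and>
       (\<forall>Z\<in>cadlag_paths T U. functional_path F Z A \<in> cadlag_paths T UNIV) \<and>
       (\<forall>\<eta> :: 'n integrand. admissible_integrand T UNIV \<eta> \<longrightarrow>
          admissible_integrand T U (composed_integrand F A \<eta> \<xi>)) \<and>
       (admits_qv T P Y \<and>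
        (\<forall>k l. \<forall>t\<in>{0..T}. covariation T P Y k l t =
           (\<Sum>i\<in>UNIV. \<Sum>j\<in>UNIV.
              stieltjes_integral 0 t (\<lambda>s. \<xi> k s X $ i * \<xi> l s X $ j) (covariation T P X i j))) \<longrightarrow>
        (\<forall>\<eta> :: 'n integrand. admissible_integrand T UNIV \<eta> \<longrightarrow>
           ito_integrable T P \<eta> Y T \<and>
           ito_integrable T P (composed_integrand F A \<eta> \<xi>) X T \<and>
           ito_integral T P \<eta> Y T = ito_integral T P (composed_integrand F A \<eta> \<xi>) X T \<and>
           (\<forall>s\<in>{0..T}. composed_integrand F A \<eta> \<xi> s X = (\<Sum>l\<in>UNIV. (\<eta> s Y $ l) *\<^sub>R \<xi> l s X)))))"
proof -
  have XU: "X \<in> cadlag_paths T U" by (rule cadlag_paths_continuous[OF X_cont X_in])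
  obtain q S A and F :: "'n \<Rightarrow> 'd functional" and DF \<epsilon>
    where q: "q \<ge> 1" and S: "openin (Euclidean_space q) S" and A: "A \<in> CBV T q S" and c: "carries_covariation T P q \<epsilon> X A"
    and F: "\<And>l. C12c_via T q U S (F l) (DF l)" and d: "\<And>l. driftless T q \<epsilon> X A (F l) (DF l)" and F0: "\<And>l. F l 0 X A = 0"
    and \<xi>F: "\<And>l t Z. t \<in> {0..T} \<Longrightarrow> Z \<in> cadlag_paths T U \<Longrightarrow> \<xi> l t Z = vertical_gradient T (F l) t Z A"
    by (rule ito_representation[OF T_pos P U \<xi> XU X_qv]) (rule that; assumption)
  have lim: "ito_sum T P (\<xi> l) X t \<longlonglongrightarrow> F l t X A" if t: "t \<in> {0..T}" for l t
    using ito_sum_driftless[OF T_pos P U X_cont X_in X_qv A c F d \<xi>F t] F0 by simp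
  have YF: "Y t = functional_path F X A t" if "t \<in> {0..T}" for t
    using limI[OF lim[OF that]] by (simp add: Y_def functional_path_def ito_integral_def)
  have Fcont: "continuous_on {0..T} (functional_path F X A)"
    unfolding functional_path_def
    by (intro continuous_intros) (rule continuous_on_functional[OF T_pos U F order_refl order_refl XU A X_cont])
  have Y_cont: "continuous_on {0..T} Y" by (rule continuous_on_eq[OF Fcont]) (simp add: YF)
  have Y_cadlag: "Y \<in> cadlag_paths T UNIV" by (rule cadlag_paths_continuous[OF Y_cont]) simp
  have F_cadlag: "functional_path F Z A \<in> cadlag_paths T UNIV" if "Z \<in> cadlag_paths T U" for Z
    by (rule functional_path_cadlag[where F = F, OF T_pos U F that A])
  have comp: "admissible_integrand T U (composed_integrand F A \<eta> \<xi>) \<and>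
      (\<forall>s\<in>{0..T}. composed_integrand F A \<eta> \<xi> s X = (\<Sum>l\<in>UNIV. (\<eta> s Y $ l) *\<^sub>R \<xi> l s X)) \<and>
      (admits_qv T P Y \<and> (\<forall>k l. \<forall>t\<in>{0..T}. covariation T P Y k l t = (\<Sum>i\<in>UNIV. \<Sum>j\<in>UNIV.
         stieltjes_integral 0 t (\<lambda>s. \<xi> k s X $ i * \<xi> l s X $ j) (covariation T P X i j))) \<longrightarrow>
       (\<exists>L. ito_sum T P (composed_integrand F A \<eta> \<xi>) X T \<longlonglongrightarrow> L \<and> ito_sum T P \<eta> Y T \<longlonglongrightarrow> L))"
    if \<eta>: "admissible_integrand T UNIV \<eta>" for \<eta> :: "'n integrand"
  proof -
    obtain q' S' A' \<epsilon>' and F' :: "'n \<Rightarrow> 'd functional" and DF' and G :: "'n functional" and DG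
      where q': "q' \<ge> 1" "openin (Euclidean_space q') S'" and A': "A' \<in> CBV T q' S'" and c': "carries_covariation T P q' \<epsilon>' X A'"
      and F': "\<And>l. C12c_via T q' U S' (F' l) (DF' l)" and d': "\<And>l. driftless T q' \<epsilon>' X A' (F' l) (DF' l)"
      and G: "C12c_via T q' UNIV S' G DG"
      and eq: "\<And>l t Z. t \<in> {0..T} \<Longrightarrow> Z \<in> cadlag_paths T U \<Longrightarrow> F' l t Z A' = F l t Z A"
      and grad: "\<And>l t Z. t \<in> {0..T} \<Longrightarrow> Z \<in> cadlag_paths T U \<Longrightarrow> vertical_gradient T (F' l) t Z A' = vertical_gradient T (F l) t Z A"
      and \<eta>G: "\<And>t Z. t \<in> {0..T} \<Longrightarrow> Z \<in> cadlag_paths T UNIV \<Longrightarrow> \<eta> t Z = vertical_gradient T G t Z A'"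
      by (rule common_control[OF T_pos U XU q S A c F d \<eta>]) (rule that; assumption)
    let ?K = "\<lambda>t X A. G t (functional_path F' X A) A"
    have \<xi>': "\<xi> l t Z = vertical_gradient T (F' l) t Z A'" if "t \<in> {0..T}" "Z \<in> cadlag_paths T U" for l t Z
      using \<xi>F[OF that] grad[OF that] by simp
    have K: "composed_integrand F A \<eta> \<xi> t Z = vertical_gradient T ?K t Z A'" if "t \<in> {0..T}" "Z \<in> cadlag_paths T U" for t Z
      by (rule composed_integrand_eq[where F = F and F' = F', OF T_pos U F A F' G A' eq \<xi>' \<eta>G that])
    have "?K \<in> C12c T q' U S'" by (rule C12c_viaD(1)[OF C12c_via_compose[where F = F', OF T_pos U F' G]])
    then have adm: "admissible_integrand T U (composed_integrand F A \<eta> \<xi>)"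
      unfolding admissible_integrand_def using q' A' K by blast
    have YF': "Y t = functional_path F' X A' t" if "t \<in> {0..T}" for t
      using YF[OF that] eq[OF that XU] by (simp add: functional_path_def)
    \<comment> \<open>On cadlag paths \<eta> is a vertical gradient and hence non-anticipative; the
      path of values and \<open>Y\<close> agree on \<open>[0,T]\<close>.\<close>
    have "\<eta> s (functional_path F X A) = \<eta> s Y" if s: "s \<in> {0..T}" for s
    proof -
      have "vertical_partial T i G s (functional_path F X A) A' = vertical_partial T i G s Y A'" for i
        by (rule non_anticipative_cong[OF T_pos open_UNIV non_anticipative_vertical_partial[OF T_pos open_UNIV C12c_viaD(2)[OF G]]
              s F_cadlag[OF XU] Y_cadlag _ A' A' refl]) (use YF s in auto)
      then show ?thesis using \<eta>G[OF s] F_cadlag[OF XU] Y_cadlag by (simp add: vertical_gradient_def)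
    qed
    then have int: "\<forall>s\<in>{0..T}. composed_integrand F A \<eta> \<xi> s X = (\<Sum>l\<in>UNIV. (\<eta> s Y $ l) *\<^sub>R \<xi> l s X)"
      by (simp add: composed_integrand_def)
    have "\<exists>L. ito_sum T P (composed_integrand F A \<eta> \<xi>) X T \<longlonglongrightarrow> L \<and> ito_sum T P \<eta> Y T \<longlonglongrightarrow> L"
      if Yqv: "admits_qv T P Y" and cov: "\<forall>k l. \<forall>t\<in>{0..T}. covariation T P Y k l t = (\<Sum>i\<in>UNIV. \<Sum>j\<in>UNIV.
         stieltjes_integral 0 t (\<lambda>s. \<xi> k s X $ i * \<xi> l s X $ j) (covariation T P X i j))"
    proof (rule ito_sum_composed[where F = F', OF T_pos P U X_cont X_in X_qv A' c' F' d' G YF' Yqv _ K \<eta>G])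
      fix k l t assume t: "t \<in> {0..T}"
      have "\<xi> k s X $ i = vertical_partial T i (F' k) s X A'" if "s \<in> {0<..t}" for k s i
        using \<xi>'[of s X k] that t XU by (simp add: vertical_gradient_def)
      then have "stieltjes_integral 0 t (\<lambda>s. \<xi> k s X $ i * \<xi> l s X $ j) (covariation T P X i j) =
         stieltjes_integral 0 t (\<lambda>s. vertical_partial T i (F' k) s X A' * vertical_partial T j (F' l) s X A') (covariation T P X i j)" for i j
        by (intro stieltjes_integral_cong) (use t in auto)
      then show "covariation T P Y k l t = (\<Sum>i\<in>UNIV. \<Sum>j\<in>UNIV.
         stieltjes_integral 0 t (\<lambda>s. vertical_partial T i (F' k) s X A' * vertical_partial T j (F' l) s X A') (covariation T P X i j))"
        using cov t by simp
    qed
    with adm int show ?thesis by blast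
  qed
  show ?thesis
  proof (intro conjI exI[of _ q] exI[of _ S] exI[of _ A] exI[of _ F] allI impI ballI q S A Y_cont)
    show "ito_integrable T P (\<xi> l) X t" if "t \<in> {0..T}" for l t
      unfolding ito_integrable_def convergent_def using lim[OF that] by blast
    show "F l \<in> C12c T q U S" for l by (rule C12c_viaD(1)[OF F])
    fix \<eta> :: "'n integrand" assume "admissible_integrand T UNIV \<eta>"
    note * = comp[OF this]
    show "admissible_integrand T U (composed_integrand F A \<eta> \<xi>)" using * by blast
    show "composed_integrand F A \<eta> \<xi> s X = (\<Sum>l\<in>UNIV. (\<eta> s Y $ l) *\<^sub>R \<xi> l s X)" if "s \<in> {0..T}" for s using * that by blast
    assume "admits_qv T P Y \<and> (\<forall>k l. \<forall>t\<in>{0..T}. covariation T P Y k l t = (\<Sum>i\<in>UNIV. \<Sum>j\<in>UNIV.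
       stieltjes_integral 0 t (\<lambda>s. \<xi> k s X $ i * \<xi> l s X $ j) (covariation T P X i j)))"
    then obtain L where L: "ito_sum T P (composed_integrand F A \<eta> \<xi>) X T \<longlonglongrightarrow> L" "ito_sum T P \<eta> Y T \<longlonglongrightarrow> L"
      using * by blast
    then show "ito_integrable T P \<eta> Y T" "ito_integrable T P (composed_integrand F A \<eta> \<xi>) X T"
      "ito_integral T P \<eta> Y T = ito_integral T P (composed_integrand F A \<eta> \<xi>) X T"
      by (auto simp: ito_integrable_def convergent_def ito_integral_def dest: limI)
  qed (use YF F_cadlag in auto)
qed

end
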